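(* Assume the setting and notation of the context, let $\delta\in(0,1]$, and suppose: (i) $\sup_{s\in\mathcal X}G(s,s)=:\gamma^2<\infty$ and $\sup_{m\in\mathcal P}K(m,m)=:\kappa^2<\infty$; (ii) for some $\alpha\in(0,1]$, $L>0$: $\|K_{m_1}-K_{m_2}\|_{\mathcal H_K}\le L\|m_1-m_2\|_{\mathcal H_G}^{\alpha}$ for all $m_1,m_2\in\mathcal P$; (iii) $f_\rho=L_K^r h_\rho$ with $\|h_\rho\|_{L^2}\le R<\infty$, where $r\ge\frac12$; (iv) for some $\nu\in(0,1]$, $c_\nu<\infty$: $\mathcal N(\lambda)\le c_\nu\lambda^{-\nu}$ for $\lambda>0$; (v) $0<\eta_n<1/\kappa^2$, and with $\lambda=(\eta_nT_n)^{-1}$: $n\ge \frac{32\kappa^2\log(4/\delta)}{\lambda}\log\big(e\,\mathcal N(\lambda)(1+\frac{\lambda}{\|T_K\|})\big)$ and $n\ge64e\kappa^2\log^2(24/\delta)\,(\eta_nT_n)^{1+\nu}$. Let $\eta_nT_n=\big(\frac{R^2}{M^2}n\big)^{\frac1{2r+\nu}}$ and let the second-stage sample size satisfy $N=N_n\ge\log^{2/\alpha}(n)\big(\frac{R^2n}{M^2}\big)^{\frac{2r+1}{\alpha(2r+\nu)}}$. Then second-stage tail-averaged gradient descent with step size $\eta_n$ and $T_n$ iterations satisfies, with probability not less than $1-\delta$ with respect to $D$, $$\mathbb E_{\hat D|D}[\|S_K\bar{\hat f}_{T_n}-f_\rho\|_{L^2}]\le C\log(24/\delta)\,R\Big(\frac{M^2}{R^2n}\Big)^{\frac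 r{2r+\nu}}$$ for some $C<\infty$, provided $n$ is sufficiently large.
   Context: Setting. $\mathcal X$ is a compact topological space, $\mathcal M^+(\mathcal X)$ the Borel probability measures on $\mathcal X$ (weak topology), $\mathcal Y\subseteq[-M,M]$ with $M>0$. $G$ is a Mercer kernel on $\mathcal X$ (symmetric, continuous, positive semidefinite) with RKHS $\mathcal H_G$; the mean embedding of $x\in\mathcal M^+(\mathcal X)$ is $\mu_x=\int_{\mathcal X}G(s,\cdot)\,dx(s)\in\mathcal H_G$; $\mathcal P:=\{\mu_x:x\in\mathcal M^+(\mathcal X)\}\subset\mathcal H_G$. $K$ is a reproducing kernel on $\mathcal P$ with RKHS $\mathcal H_K$; $K_m:=K(m,\cdot)$. $\rho$ is a probability measure on $\mathcal P\times\mathcal Y$ with marginal $\rho_\mu$ on $\mathcal P$; $L^2=L^2(\mathcal P,\rho_\mu)$; $f_\rho(m)=\int_{\mathcal Y}y\,d\rho(y|m)$ is the regression function. $S_K:\mathcal H_K\to L^2$ is the inclusion, $T_K=S_K^*S_K$, $L_K=S_KS_K^*$ (powers via spectral calculus), $\mathcal N(\lambda)=\mathrm{trace}(L_K(L_K+\lambda)^{-1})$. Data. First stage: $(x_j,y_j)$, $j=1,\dots,n$, i.i.d. on $\mathcal M^+(\mathcal X)\times\mathcal Y$ such that $(\mu_{x_j},y_j)\sim\rho$; $D=\{(\mu_{x_j},y_j)\}_{j=1}^n$. Second stage: for each $j$, $x_{j,1},\dots,x_{j,N}$ are i.i.d. from $x_j$; $\mu_{\hat x_j}=\frac1N\sum_{i=1}^NG(x_{j,i},\cdot)$;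 $\hat D=\{(\mu_{\hat x_j},y_j)\}_{j=1}^n$. $\mathbb E_{\hat D|D}$ is conditional expectation over $\hat D$ given $D$. Algorithm (second-stage tail-averaged gradient descent). $\hat f_0=0$, $\hat f_{t+1}=\hat f_t-\eta\frac1n\sum_{j=1}^n(\hat f_t(\mu_{\hat x_j})-y_j)K_{\mu_{\hat x_j}}$, $\ \bar{\hat f}_T=\frac2T\sum_{t=\lfloor T/2\rfloor+1}^T\hat f_t$. Constants do not depend on $n,N,\delta$; "$n$ sufficiently large" may depend on $\delta$ and the problem parameters.
   Formalization: For r > 1 the number of iterations T_n is required to be even: for odd T_n the weights 2/T of the tail average sum to 1+1/T, and the claimed rate then fails (e.g. one-point space, G=K=1, y=1, r=2, step size about 1/2). *)

theory Defs
  imports "HOL-Probability.Probability" "HOL-Computational_Algebra.Polynomial"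
begin

section \<open>Kernels and reproducing kernel Hilbert spaces\<close>

definition psd_kernel_on :: "'a set \<Rightarrow> ('a \<Rightarrow> 'a \<Rightarrow> real) \<Rightarrow> bool" where
  "psd_kernel_on A k \<longleftrightarrow>
     (\<forall>a\<in>A. \<forall>b\<in>A. k a b = k b a) \<and>
     (\<forall>F c. finite F \<longrightarrow> F \<subseteq> A \<longrightarrow> 0 \<le> (\<Sum>a\<in>F. \<Sum>b\<in>F. c a * c b * k a b))"

definition mercer_kernel :: "('x::topological_space \<Rightarrow> 'x \<Rightarrow> real) \<Rightarrow> bool" where
  "mercer_kernel k \<longleftrightarrow> psd_kernel_on UNIV k \<and> continuous_on UNIV (\<lambda>(s, t). k s t)"

text \<open>A Hilbert space of functions on \<open>A\<close> is a Hilbert space type together with a linear map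
  \<open>val\<close> sending each element to a function, of which only the values on \<open>A\<close> matter and which is
  injective in that sense.  It is the RKHS of \<open>k\<close> if it contains every function \<open>k a\<close> and these
  reproduce point evaluation.\<close>

definition is_rkhs ::
  "'a set \<Rightarrow> ('a \<Rightarrow> 'a \<Rightarrow> real) \<Rightarrow> ('h::{real_inner,complete_space} \<Rightarrow> 'a \<Rightarrow> real) \<Rightarrow> bool" where
  "is_rkhs A k val \<longleftrightarrow>
     (\<forall>a\<in>A. linear (\<lambda>f. val f a)) \<and>
     (\<forall>f g. (\<forall>a\<in>A. val f a = val g a) \<longrightarrow> f = g) \<and>
     (\<forall>a\<in>A. \<exists>h. (\<forall>b\<in>A. val h b = k a b) \<and> (\<forall>f. val f a = f \<bullet> h))"

definition kernel_section ::
  "'a set \<Rightarrow> ('a \<Rightarrow> 'a \<Rightarrow> real) \<Rightarrow> ('h::{real_inner,complete_space} \<Rightarrow> 'a \<Rightarrow> real) \<Rightarrow> 'a \<Rightarrow> 'h" where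
  "kernel_section A k val a = (THE h. \<forall>b\<in>A. val h b = k a b)"

section \<open>Probability measures and mean embeddings\<close>

definition borel_probs :: "'x::topological_space measure set" where
  "borel_probs = {x. sets x = sets borel \<and> prob_space x}"

definition weak_topology :: "'x::topological_space measure topology" where
  "weak_topology = topology_generated_by
     {{x \<in> borel_probs. (\<integral>s. f s \<partial>x) \<in> U} | f U.
        continuous_on UNIV f \<and> bounded (range f) \<and> open (U :: real set)}"

definition weak_borel :: "'x::topological_space measure measure" where
  "weak_borel = sigma borel_probs {U. openin weak_topology U}"

text \<open>The sort constraint \<open>second_countable_topology\<close> is what the Bochner integral of the library
  requires.  It does not exclude anything: the RKHS of a continuous kernel on a compact space is
  separable, being the closed span of a continuous image of that space.\<close>

definition mean_embedding ::
  "('x::topological_space \<Rightarrow> 'x \<Rightarrow> real) \<Rightarrow>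
   ('h::{real_inner,complete_space,second_countable_topology} \<Rightarrow> 'x \<Rightarrow> real) \<Rightarrow> 'x measure \<Rightarrow> 'h" where
  "mean_embedding G evG x = (\<integral>s. kernel_section UNIV G evG s \<partial>x)"

definition mean_embeddings ::
  "('x::topological_space \<Rightarrow> 'x \<Rightarrow> real) \<Rightarrow>
   ('h::{real_inner,complete_space,second_countable_topology} \<Rightarrow> 'x \<Rightarrow> real) \<Rightarrow> 'h set" where
  "mean_embeddings G evG = mean_embedding G evG ` borel_probs"

definition empirical_embedding ::
  "('x::topological_space \<Rightarrow> 'x \<Rightarrow> real) \<Rightarrow>
   ('h::{real_inner,complete_space,second_countable_topology} \<Rightarrow> 'x \<Rightarrow> real) \<Rightarrow>
   nat \<Rightarrow> (nat \<Rightarrow> 'x) \<Rightarrow> 'h" where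
  "empirical_embedding G evG N s =
     (1 / real N) *\<^sub>R (\<Sum>i<N. kernel_section UNIV G evG (s i))"

section \<open>The space of square integrable functions\<close>

definition square_integrable :: "'a measure \<Rightarrow> ('a \<Rightarrow> real) \<Rightarrow> bool" where
  "square_integrable Q f \<longleftrightarrow> f \<in> borel_measurable Q \<and> integrable Q (\<lambda>a. (f a)\<^sup>2)"

text \<open>The type \<open>'l\<close> is the space \<open>L\<^sup>2(Q)\<close>, where \<open>cls f\<close> is the class of \<open>f\<close> modulo equality almost
  everywhere.  The value of \<open>cls\<close> at functions that are not square integrable is irrelevant.\<close>

definition is_L2 :: "'a measure \<Rightarrow> (('a \<Rightarrow> real) \<Rightarrow> 'l::{real_inner,complete_space}) \<Rightarrow> bool" where
  "is_L2 Q cls \<longleftrightarrow>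
     (\<forall>f g. square_integrable Q f \<longrightarrow> square_integrable Q g \<longrightarrow>
        cls (\<lambda>a. f a + g a) = cls f + cls g \<and> cls f \<bullet> cls g = (\<integral>a. f a * g a \<partial>Q)) \<and>
     (\<forall>f c. square_integrable Q f \<longrightarrow> cls (\<lambda>a. c * f a) = c *\<^sub>R cls f) \<and>
     (\<forall>h. \<exists>f. square_integrable Q f \<and> cls f = h)"

section \<open>Spectral calculus and trace\<close>

definition poly_op :: "real poly \<Rightarrow> ('l::real_inner \<Rightarrow> 'l) \<Rightarrow> 'l \<Rightarrow> 'l" where
  "poly_op p A h = (\<Sum>i\<le>degree p. coeff p i *\<^sub>R (A ^^ i) h)"

text \<open>Continuous functional calculus of a bounded positive self-adjoint operator \<open>A\<close>, whose
  spectrum lies in \<open>[0, \<parallel>A\<parallel>]\<close>: the limit in operator norm of \<open>p\<^sub>n(A)\<close> for polynomials \<open>p\<^sub>n\<close>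
  that converge to \<open>f\<close> uniformly on this interval.\<close>

definition spectral_fun :: "(real \<Rightarrow> real) \<Rightarrow> ('l::real_inner \<Rightarrow> 'l) \<Rightarrow> 'l \<Rightarrow> 'l" where
  "spectral_fun f A = (THE B. bounded_linear B \<and>
     (\<forall>p. uniform_limit {0..onorm A} (\<lambda>n. poly (p n)) f sequentially \<longrightarrow>
        (\<lambda>n. onorm (\<lambda>h. poly_op (p n) A h - B h)) \<longlonglongrightarrow> 0))"

definition op_powr :: "('l::real_inner \<Rightarrow> 'l) \<Rightarrow> real \<Rightarrow> 'l \<Rightarrow> 'l" where
  "op_powr A r = spectral_fun (\<lambda>\<sigma>. \<sigma> powr r) A"

definition orthonormal_basis :: "'l::real_inner set \<Rightarrow> bool" where
  "orthonormal_basis B \<longleftrightarrow>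
     pairwise orthogonal B \<and> (\<forall>e\<in>B. norm e = 1) \<and> closure (span B) = UNIV"

text \<open>For positive operators of trace class, where the choice of the basis does not matter.\<close>

definition op_trace :: "('l::real_inner \<Rightarrow> 'l) \<Rightarrow> real" where
  "op_trace A = (\<Sum>\<^sub>\<infinity>e\<in>(SOME B. orthonormal_basis B). A e \<bullet> e)"

text \<open>The operator \<open>A (A + \<lambda>)\<^sup>-\<^sup>1\<close> is of trace class as soon as \<open>A\<close> is, which holds for the
  integral operator of a bounded kernel.\<close>

definition effective_dim :: "('l::real_inner \<Rightarrow> 'l) \<Rightarrow> real \<Rightarrow> real" where
  "effective_dim A lam = op_trace (A \<circ> inv (\<lambda>h. A h + lam *\<^sub>R h))"

section \<open>The regression problem\<close>

definition conditional_law ::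
  "'a measure \<Rightarrow> 'b measure \<Rightarrow> ('a \<times> 'b) measure \<Rightarrow> ('a \<Rightarrow> 'b measure) \<Rightarrow> bool" where
  "conditional_law A B \<rho> cond \<longleftrightarrow>
     cond \<in> A \<rightarrow>\<^sub>M prob_algebra B \<and>
     (\<forall>S\<in>sets A. \<forall>V\<in>sets B.
        emeasure \<rho> (S \<times> V) = (\<integral>\<^sup>+m\<in>S. emeasure (cond m) V \<partial>distr \<rho> A fst))"

definition generated_by :: "'w measure \<Rightarrow> ('w \<Rightarrow> 'a) \<Rightarrow> 'a measure \<Rightarrow> 'w measure" where
  "generated_by \<Omega> Z A = vimage_algebra (space \<Omega>) Z A"

definition first_stage ::
  "nat \<Rightarrow> (nat \<Rightarrow> 'w \<Rightarrow> 'a) \<Rightarrow> (nat \<Rightarrow> 'w \<Rightarrow> real) \<Rightarrow> 'w \<Rightarrow> nat \<Rightarrow> 'a \<times> real" where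
  "first_stage n z y \<omega> = (\<lambda>j\<in>{..<n}. (z j \<omega>, y j \<omega>))"

text \<open>The last clause says that, given the first stage sample, the points \<open>s j i\<close> are independent
  with law \<open>x j\<close>.\<close>

definition two_stage_sample ::
  "('x::topological_space \<Rightarrow> 'x \<Rightarrow> real) \<Rightarrow>
   ('h::{real_inner,complete_space,second_countable_topology} \<Rightarrow> 'x \<Rightarrow> real) \<Rightarrow>
   real set \<Rightarrow> ('h \<times> real) measure \<Rightarrow> nat \<Rightarrow> nat \<Rightarrow> 'w measure \<Rightarrow>
   (nat \<Rightarrow> 'w \<Rightarrow> 'x measure) \<Rightarrow> (nat \<Rightarrow> 'w \<Rightarrow> real) \<Rightarrow> (nat \<Rightarrow> nat \<Rightarrow> 'w \<Rightarrow> 'x) \<Rightarrow> bool" where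
  "two_stage_sample G evG Y \<rho> n N \<Omega> x y s \<longleftrightarrow>
     (let YM = restrict_space borel Y;
          PM = restrict_space borel (mean_embeddings G evG);
          XY = weak_borel \<Otimes>\<^sub>M YM
      in prob_space \<Omega> \<and>
         prob_space.indep_vars \<Omega> (\<lambda>_. XY) (\<lambda>j \<omega>. (x j \<omega>, y j \<omega>)) {..<n} \<and>
         (\<forall>j<n. \<forall>k<n. distr \<Omega> XY (\<lambda>\<omega>. (x j \<omega>, y j \<omega>)) = distr \<Omega> XY (\<lambda>\<omega>. (x k \<omega>, y k \<omega>))) \<and>
         (\<forall>j<n. distr \<Omega> (PM \<Otimes>\<^sub>M YM) (\<lambda>\<omega>. (mean_embedding G evG (x j \<omega>), y j \<omega>)) = \<rho>) \<and>
         (\<forall>j<n. \<forall>i<N. s j i \<in> \<Omega> \<rightarrow>\<^sub>M borel) \<and>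
         (\<forall>A. (\<forall>j<n. \<forall>i<N. A j i \<in> sets borel) \<longrightarrow>
            (AE \<omega> in \<Omega>.
               real_cond_exp \<Omega> (generated_by \<Omega> (first_stage n x y) (PiM {..<n} (\<lambda>_. XY)))
                 (indicator {\<omega> \<in> space \<Omega>. \<forall>j<n. \<forall>i<N. s j i \<omega> \<in> A j i}) \<omega>
               = (\<Prod>j<n. \<Prod>i<N. measure (x j \<omega>) (A j i)))))"

section \<open>Tail-averaged gradient descent\<close>

text \<open>Gradient descent on the sample \<open>(m j, y j)\<close>, \<open>j < n\<close>, where \<open>Ks m\<close> is the kernel section
  at \<open>m\<close>.\<close>

primrec grad_descent ::
  "('k::{real_inner,complete_space} \<Rightarrow> 'h \<Rightarrow> real) \<Rightarrow> ('h \<Rightarrow> 'k) \<Rightarrow> real \<Rightarrow> nat \<Rightarrow>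
   (nat \<Rightarrow> 'h) \<Rightarrow> (nat \<Rightarrow> real) \<Rightarrow> nat \<Rightarrow> 'k" where
  "grad_descent val Ks \<eta> n m y 0 = 0"
| "grad_descent val Ks \<eta> n m y (Suc t) =
     grad_descent val Ks \<eta> n m y t
     - (\<eta> / real n) *\<^sub>R (\<Sum>j<n. (val (grad_descent val Ks \<eta> n m y t) (m j) - y j) *\<^sub>R Ks (m j))"

text \<open>For odd \<open>T\<close> there are \<open>(T + 1) / 2\<close> summands, so the weights add up to \<open>1 + 1 / T\<close>.  This
  rescaling costs an additional error of order \<open>1 / T\<close>.  It is harmless for source conditions with
  exponent at most \<open>1\<close>, but it can exceed the fast rates claimed for larger exponents.\<close>

definition tail_average :: "(nat \<Rightarrow> 'k::real_vector) \<Rightarrow> nat \<Rightarrow> 'k" where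
  "tail_average f T = (2 / real T) *\<^sub>R (\<Sum>t = T div 2 + 1..T. f t)"

end

theory Submission
  imports Defs "HOL-Computational_Algebra.Fundamental_Theorem_Algebra"
begin

text \<open>In the first stage, gradient descent on the exact embeddings is a spectral filter of the empirical
  covariance operator.  With probability at least \<open>1 - \<delta>\<close> the regularised population covariance is
  dominated, as a quadratic form, by the regularised empirical one, and the noise is controlled in the
  norm of that form; so bias and variance of the filter, compared with the population iterate, are both
  of order \<open>\<lambda>\<^sup>r\<close>.  In the second stage the iterates are compared with those of the first stage, on
  the same event.  The difference is controlled by the average of \<open>\<parallel>\<mu>' - \<mu>\<parallel>\<^sup>\<alpha>\<close>, where \<open>\<mu>'\<close> and \<open>\<mu>\<close> are the
  empirical and the exact embeddings of the same measure; given the first stage, its conditional mean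
  and that of its square are of order \<open>N\<^sup>-\<^sup>\<alpha>\<^sup>/\<^sup>2\<close> and \<open>N\<^sup>-\<^sup>\<alpha>\<close>, because a mean of \<open>N\<close> independent
  Hilbert space valued variables has variance of order \<open>1 / N\<close>.\<close>

section \<open>Functional calculus of positive operators\<close>

text \<open>Only the noise needs an exponential tail; it produces the factor ln(24/\<delta>). The
  covariance operators are controlled by second moments in Hilbert-Schmidt norm. Those bounds are
  polynomial in \<delta>, which is harmless because n may be chosen after \<delta>. The exception is
  r = 1/2, where n \<lambda>^(1+\<nu>) stays constant: there the lower bound on n that contains
  ln(24/\<delta>)^2 keeps \<delta> away from 0, and the quadratic forms are compared at A \<lambda>
  with a fixed A.

  A comparison of forms yields a bias of order \<lambda> at best, so it serves for r \<le> 1 only.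
  For r > 1 the empirical residual is compared with the population residual by a telescoping sum;
  this costs the operator norm deviation, of order n^(-1/2), which is below \<lambda>^r for large n.

  In the second stage a crude bound keeps the perturbed iterates bounded, and a second pass uses
  smoothing to gain a factor sqrt \<lambda>. The term quadratic in the perturbation stems from this
  bootstrap. Sample points are independent given the measures, while the risk is conditioned on the
  embeddings alone, which generate a smaller \<sigma>-algebra.\<close>

lemma poly_op_sum:
  assumes "degree p \<le> n"
  shows "poly_op p A h = (\<Sum>i\<le>n. coeff p i *\<^sub>R (A ^^ i) h)"
  unfolding poly_op_def
  by (rule sum.mono_neutral_left) (use assms in \<open>auto simp: coeff_eq_0\<close>)

lemma poly_op_0 [simp]: "poly_op 0 A h = 0"
  by (simp add: poly_op_def)

lemma poly_op_add: "poly_op (p + q) A h = poly_op p A h + poly_op q A h"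
proof -
  define n where "n = max (degree p) (degree q)"
  have "degree (p + q) \<le> n" "degree p \<le> n" "degree q \<le> n"
    by (auto simp: n_def degree_add_le_max)
  then show ?thesis
    by (simp add: poly_op_sum[of _ n] scaleR_left.add sum.distrib)
qed

lemma poly_op_smult: "poly_op (smult c p) A h = c *\<^sub>R poly_op p A h"
  using degree_smult_le[of c p]
  by (simp add: poly_op_sum[of "smult c p" "degree p"] poly_op_sum[of p "degree p"] scaleR_sum_right)

lemma poly_op_minus: "poly_op (- p) A h = - poly_op p A h"
  using poly_op_smult[of "-1" p A h] by simp

lemma poly_op_diff: "poly_op (p - q) A h = poly_op p A h - poly_op q A h"
  using poly_op_add[of p "- q" A h] by (simp add: poly_op_minus)

lemma poly_op_pCons: "poly_op (pCons c p) A h = c *\<^sub>R h + poly_op p A (A h)"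
proof -
  have "poly_op (pCons c p) A h = (\<Sum>i\<le>Suc (degree p). coeff (pCons c p) i *\<^sub>R (A ^^ i) h)"
    by (rule poly_op_sum) (simp add: degree_pCons_le)
  also have "\<dots> = c *\<^sub>R h + (\<Sum>i\<le>degree p. coeff p i *\<^sub>R (A ^^ i) (A h))"
    by (subst sum.atMost_Suc_shift) (simp add: funpow_swap1)
  finally show ?thesis
    by (simp add: poly_op_def)
qed

lemma poly_op_1 [simp]: "poly_op 1 A h = h"
  by (simp add: poly_op_def)

lemma poly_op_const [simp]: "poly_op [:c:] A h = c *\<^sub>R h"
  by (simp add: poly_op_pCons)

lemma poly_op_linear [simp]: "poly_op [:c, d:] A h = c *\<^sub>R h + d *\<^sub>R A h"
  by (simp add: poly_op_pCons)

lemma poly_op_X [simp]: "poly_op (pCons 0 p) A h = poly_op p A (A h)"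
  by (simp add: poly_op_pCons)

lemma bounded_linear_poly_op:
  assumes "bounded_linear A"
  shows "bounded_linear (poly_op p A)"
proof (induction p)
  case 0
  have "poly_op 0 A = (\<lambda>_. 0)"
    by (simp add: fun_eq_iff)
  then show ?case by simp
next
  case (pCons c p)
  have "bounded_linear (\<lambda>h. c *\<^sub>R h + poly_op p A (A h))"
    by (intro bounded_linear_add bounded_linear_scaleR_right bounded_linear_compose[OF pCons(2) assms])
  then show ?case
    by (simp add: poly_op_pCons[abs_def])
qed

lemma poly_op_commute:
  assumes "linear A"
  shows "poly_op p A (A h) = A (poly_op p A h)"
  by (induction p arbitrary: h)
     (auto simp: poly_op_pCons linear_0[OF assms] linear_add[OF assms] linear_scale[OF assms])

lemma poly_op_mult:
  assumes "bounded_linear A"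
  shows "poly_op (p * q) A h = poly_op p A (poly_op q A h)"
proof (induction p arbitrary: h)
  case (pCons c p)
  have lin: "linear A"
    using assms by (simp add: bounded_linear.linear)
  show ?case
    by (simp add: poly_op_add poly_op_smult pCons poly_op_pCons[of c p] poly_op_pCons[of 0]
        poly_op_commute[OF lin])
qed simp

text \<open>Used with \<open>S\<close> the inclusion into L2: a filter of the covariance operator on
  the RKHS becomes the same filter of the integral operator, on the space where the source condition
  lives.\<close>

lemma poly_op_intertwine:
  assumes S: "linear S" and AB: "\<And>h. S (A h) = B (S h)"
  shows "S (poly_op p A h) = poly_op p B (S h)"
  by (induction p arbitrary: h)
     (auto simp: poly_op_pCons linear_0[OF S] linear_add[OF S] linear_scale[OF S] AB)

lemma complex_poly_add:
  "map_poly complex_of_real (p + q) = map_poly complex_of_real p + map_poly complex_of_real q"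
  by (rule poly_eqI) (simp add: coeff_map_poly)

lemma complex_poly_mult:
  "map_poly complex_of_real (p * q) = map_poly complex_of_real p * map_poly complex_of_real q"
  by (rule poly_eqI) (simp add: coeff_map_poly coeff_mult)

lemma complex_poly_of_real:
  "poly (map_poly complex_of_real p) (complex_of_real x) = complex_of_real (poly p x)"
  by (induction p) (simp_all add: map_poly_pCons)

section \<open>Polynomials of a positive operator\<close>

text \<open>The bound \<open>a\<close> is kept apart from the operator norm. Population, empirical
  and perturbed covariance operators then share one interval [0, a], with a = \<kappa>^2 in the end,
  and one step size condition.\<close>

locale positive_operator =
  fixes A :: "'a::real_inner \<Rightarrow> 'a" and a :: real
  assumes bounded_linear_A: "bounded_linear A"
    and sym: "A x \<bullet> y = x \<bullet> A y"
    and pos: "0 \<le> A x \<bullet> x"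
    and bound: "norm (A x) \<le> a * norm x"
    and bound_nonneg: "0 \<le> a"
begin

lemma linear_A: "linear A"
  using bounded_linear_A by (simp add: bounded_linear.linear)

lemma poly_op_sym: "poly_op p A x \<bullet> y = x \<bullet> poly_op p A y"
  by (induction p arbitrary: x y)
     (auto simp: poly_op_pCons inner_add sym poly_op_commute[OF linear_A])

text \<open>The form of A is a semi-inner product, so the discriminant argument applies. Where the
  form vanishes at y the quadratic in t degenerates to a linear function that is bounded below,
  hence constant.\<close>

lemma cauchy_schwarz: "(A x \<bullet> y)\<^sup>2 \<le> (A x \<bullet> x) * (A y \<bullet> y)"
proof -
  have *: "0 \<le> A x \<bullet> x + 2 * t * (A x \<bullet> y) + t\<^sup>2 * (A y \<bullet> y)" for t
    using pos[of "x + t *\<^sub>R y"]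
    by (simp add: linear_add[OF linear_A] linear_scale[OF linear_A] inner_add power2_eq_square
        sym[of y x] inner_commute[of y "A x"] algebra_simps)
  show ?thesis
  proof (cases "A y \<bullet> y = 0")
    case True
    have "A x \<bullet> y = 0"
    proof (rule ccontr)
      assume "A x \<bullet> y \<noteq> 0"
      \<comment> \<open>This t makes the linear function take the value -1.\<close>
      then show False
        using *[of "- (A x \<bullet> x + 1) / (2 * (A x \<bullet> y))"] True by (simp add: field_simps)
    qed
    then show ?thesis
      using pos by simp
  next
    case False
    then have "0 < A y \<bullet> y"
      using pos[of y] by simp
    then show ?thesis
      using *[of "- (A x \<bullet> y) / (A y \<bullet> y)"] by (simp add: field_simps power2_eq_square)
  qed
qed

text \<open>Cauchy-Schwarz for the form of A, taken at y = A x. It later turns a lower bound on the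
  norm of an operator into coercivity of its form.\<close>

lemma norm_square_le: "(norm (A x))\<^sup>2 \<le> a * (A x \<bullet> x)"
proof (cases "A x = 0")
  case False
  have "((norm (A x))\<^sup>2)\<^sup>2 = (A x \<bullet> A x)\<^sup>2"
    by (simp add: power2_norm_eq_inner)
  also have "\<dots> \<le> (A x \<bullet> x) * (A (A x) \<bullet> A x)"
    by (rule cauchy_schwarz)
  also have "\<dots> \<le> (A x \<bullet> x) * (a * (norm (A x))\<^sup>2)"
  proof (intro mult_left_mono pos)
    have "A (A x) \<bullet> A x \<le> norm (A (A x)) * norm (A x)"
      by (rule norm_cauchy_schwarz)
    also have "\<dots> \<le> a * norm (A x) * norm (A x)"
      by (intro mult_right_mono bound) simp
    finally show "A (A x) \<bullet> A x \<le> a * (norm (A x))\<^sup>2"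
      by (simp add: power2_eq_square)
  qed
  finally show ?thesis
    using False by (simp add: power2_eq_square mult.assoc mult.commute mult.left_commute)
qed (use pos[of x] bound_nonneg in simp)

lemma linear_factor_bounded_below:
  assumes "u \<notin> {0..a}"
  shows "\<exists>c>0. \<forall>v. c * norm v \<le> norm (poly_op [:- u, 1:] A v)"
proof -
  \<comment> \<open>The distance from u to [0, a]; the form of A takes values in that interval on
    unit vectors.\<close>
  define c where "c = (if u < 0 then - u else u - a)"
  have "c * (norm v)\<^sup>2 \<le> norm (poly_op [:- u, 1:] A v) * norm v" for v
  proof (cases "u < 0")
    case True
    have "c * (norm v)\<^sup>2 \<le> poly_op [:- u, 1:] A v \<bullet> v"
      using pos[of v] True by (simp add: c_def inner_diff inner_add power2_norm_eq_inner)
    also have "\<dots> \<le> norm (poly_op [:- u, 1:] A v) * norm v"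
      by (rule norm_cauchy_schwarz)
    finally show ?thesis .
  next
    case False
    have "A v \<bullet> v \<le> norm (A v) * norm v"
      by (rule norm_cauchy_schwarz)
    also have "\<dots> \<le> a * norm v * norm v"
      by (intro mult_right_mono bound) simp
    finally have "A v \<bullet> v \<le> a * (v \<bullet> v)"
      by (simp add: power2_norm_eq_inner mult.assoc flip: power2_eq_square)
    then have "c * (norm v)\<^sup>2 \<le> - (poly_op [:- u, 1:] A v \<bullet> v)"
      using False by (simp add: c_def inner_diff inner_add power2_norm_eq_inner algebra_simps)
    also have "\<dots> \<le> norm (poly_op [:- u, 1:] A v) * norm v"
      using norm_cauchy_schwarz[of "- poly_op [:- u, 1:] A v" v]
      by (simp only: inner_minus_left norm_minus_cancel)
    finally show ?thesis .
  qed
  then have "c * norm v \<le> norm (poly_op [:- u, 1:] A v)" for v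
    by (cases "v = 0")
       (simp_all add: power2_eq_square mult.assoc[symmetric] mult_le_cancel_right del: poly_op_linear)
  moreover have "c > 0"
    using assms by (auto simp: c_def)
  ultimately show ?thesis by blast
qed

text \<open>The polynomial is (A - u)^2 + w^2, the real factor belonging to the conjugate roots u +
  iw and u - iw. Its form at v is |A v - u v|^2 + w^2 |v|^2.\<close>

lemma quadratic_factor_bounded_below:
  assumes "w \<noteq> 0"
  shows "w\<^sup>2 * norm v \<le> norm (poly_op [:u\<^sup>2 + w\<^sup>2, - 2 * u, 1:] A v)"
proof -
  have "w\<^sup>2 * (norm v)\<^sup>2 \<le> (norm (A v - u *\<^sub>R v))\<^sup>2 + w\<^sup>2 * (norm v)\<^sup>2"
    by simp
  also have "\<dots> = poly_op [:u\<^sup>2 + w\<^sup>2, - 2 * u, 1:] A v \<bullet> v"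
    unfolding power2_norm_eq_inner
    by (simp add: poly_op_pCons inner_add inner_diff sym[of "A v" v] algebra_simps power2_eq_square
        inner_commute[of v "A v"])
  also have "\<dots> \<le> norm (poly_op [:u\<^sup>2 + w\<^sup>2, - 2 * u, 1:] A v) * norm v"
    by (rule norm_cauchy_schwarz)
  finally show ?thesis
    by (cases "v = 0") (auto simp: power2_eq_square mult.assoc[symmetric])
qed

text \<open>One half of the spectral mapping theorem, obtained by factoring over the reals: a real
  root lies outside [0, a] and splits off a linear factor, a non-real root splits off a quadratic
  one. Each factor is bounded below, and lower bounds multiply under composition.\<close>

lemma bounded_below_if_no_root:
  assumes "\<And>u. u \<in> {0..a} \<Longrightarrow> poly p u \<noteq> 0"
  shows "\<exists>c>0. \<forall>v. c * norm v \<le> norm (poly_op p A v)"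
  using assms
proof (induction "degree p" arbitrary: p rule: less_induct)
  case less
  have p0: "p \<noteq> 0"
    using less(2)[of 0] bound_nonneg by auto
  have step: ?case if p: "p = g * q" and g: "degree g > 0"
    and c: "c > 0" "\<And>v. c * norm v \<le> norm (poly_op g A v)" for g q c
  proof -
    have "degree q < degree p"
      using p p0 g by (auto simp: degree_mult_eq)
    moreover have "poly q u \<noteq> 0" if "u \<in> {0..a}" for u
      using less(2)[OF that] p by auto
    ultimately obtain d where d: "d > 0" "\<And>v. d * norm v \<le> norm (poly_op q A v)"
      using less(1)[of q] by blast
    have "c * d * norm v \<le> norm (poly_op p A v)" for v
    proof -
      have "c * (d * norm v) \<le> c * norm (poly_op q A v)"
        using d(2) c(1) by (intro mult_left_mono) auto
      also have "\<dots> \<le> norm (poly_op p A v)"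
        using c(2) by (simp add: p poly_op_mult[OF bounded_linear_A])
      finally show ?thesis
        by (simp add: mult.assoc)
    qed
    then show ?thesis
      using c(1) d(1) by (intro exI[of _ "c * d"]) simp
  qed
  show ?case
  proof (cases "degree p = 0")
    case True
    then obtain c where p: "p = [:c:]"
      by (metis degree_eq_zeroE)
    then show ?thesis
      using p0 by (intro exI[of _ "\<bar>c\<bar>"]) auto
  next
    case False
    then have "\<not> constant (poly (map_poly complex_of_real p))"
      by (simp add: constant_degree degree_map_poly)
    then obtain z where z: "poly (map_poly complex_of_real p) z = 0"
      using fundamental_theorem_of_algebra by blast
    show ?thesis
    proof (cases "Im z = 0")
      case True
      then have "z = complex_of_real (Re z)"
        by (simp add: complex_eq_iff)
      then have root: "poly p (Re z) = 0"
        using z complex_poly_of_real[of p "Re z"] by simp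
      then obtain q where q: "p = [:- Re z, 1:] * q"
        unfolding poly_eq_0_iff_dvd dvd_def by blast
      have "Re z \<notin> {0..a}"
        using less(2) root by blast
      then obtain c where "c > 0" "\<And>v. c * norm v \<le> norm (poly_op [:- Re z, 1:] A v)"
        using linear_factor_bounded_below by blast
      then show ?thesis
        using step[OF q] by simp
    next
      case False
      define g where "g = [:(Re z)\<^sup>2 + (Im z)\<^sup>2, - 2 * Re z, 1:]"
      have g: "degree g = 2" "g \<noteq> 0"
        by (auto simp: g_def)
      have gz: "poly (map_poly complex_of_real g) z = 0"
        by (simp add: g_def complex_eq_iff power2_eq_square algebra_simps map_poly_pCons)
      \<comment> \<open>The remainder is a real polynomial of degree at most 1 vanishing at the
        non-real z, so it is zero and g divides p.\<close>
      define m where "m = p mod g"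
      have "poly (map_poly complex_of_real m) z = 0"
      proof -
        have "map_poly complex_of_real p
          = map_poly complex_of_real (p div g) * map_poly complex_of_real g + map_poly complex_of_real m"
          by (simp add: m_def flip: complex_poly_mult complex_poly_add)
        then show ?thesis
          using z gz by simp
      qed
      moreover have "degree m < 2"
        using degree_mod_less[of g p] g by (auto simp: m_def)
      then have "\<exists>c0 c1. m = [:c0, c1:]"
        by (intro exI[of _ "coeff m 0"] exI[of _ "coeff m 1"])
           (simp add: poly_eq_iff coeff_pCons coeff_eq_0 split: nat.split)
      then obtain c0 c1 where m: "m = [:c0, c1:]"
        by blast
      ultimately have "c1 = 0 \<and> c0 = 0"
        using False by (auto simp: complex_eq_iff map_poly_pCons)
      with m have "m = 0"
        by simp
      then obtain q where "p = g * q"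
        unfolding m_def mod_eq_0_iff_dvd dvd_def by blast
      then show ?thesis
        using step[of g q "(Im z)\<^sup>2"] False quadratic_factor_bounded_below[OF False, of _ "Re z"] g
        by (simp add: g_def)
    qed
  qed
qed

text \<open>Suppose the norm N of p(A) exceeded D. Then N^2 - p^2 has no root in [0, a], so N^2 -
  p(A)^2 is bounded below. As it is also positive, its form is coercive, and |p(A) v|^2 \<le> (N^2 -
  c') |v|^2 with c' > 0 contradicts the definition of N.\<close>

lemma poly_op_norm_le:
  assumes D: "\<And>u. u \<in> {0..a} \<Longrightarrow> \<bar>poly p u\<bar> \<le> D"
  shows "norm (poly_op p A v) \<le> D * norm v"
proof -
  define B where "B = poly_op p A"
  have bl: "bounded_linear B"
    unfolding B_def by (rule bounded_linear_poly_op[OF bounded_linear_A])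
  define N where "N = onorm B"
  have N: "norm (B v) \<le> N * norm v" for v
    unfolding N_def by (rule onorm[OF bl])
  have "N \<le> D"
  proof (rule ccontr)
    assume "\<not> N \<le> D"
    have "0 \<le> D"
      using D[of 0] bound_nonneg by auto
    have "N > 0"
      using \<open>\<not> N \<le> D\<close> \<open>0 \<le> D\<close> by simp
    define z where "z = [:N\<^sup>2:] - p\<^sup>2"
    have "poly z u \<noteq> 0" if "u \<in> {0..a}" for u
    proof -
      have "(poly p u)\<^sup>2 \<le> D\<^sup>2"
        using D[OF that] by (metis abs_ge_zero power2_abs power_mono)
      also have "\<dots> < N\<^sup>2"
        using \<open>\<not> N \<le> D\<close> \<open>0 \<le> D\<close> by (intro power_strict_mono) auto
      finally show ?thesis
        by (simp add: z_def)
    qed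
    then obtain c where c: "c > 0" "\<And>v. c * norm v \<le> norm (poly_op z A v)"
      using bounded_below_if_no_root by blast
    have Z: "poly_op z A v = N\<^sup>2 *\<^sub>R v - B (B v)" for v
      by (simp add: z_def poly_op_diff power2_eq_square poly_op_mult[OF bounded_linear_A] B_def)
    have BB: "B (B v) \<bullet> v = (norm (B v))\<^sup>2" for v
      by (simp add: B_def poly_op_sym power2_norm_eq_inner)
    define M where "M = onorm (poly_op z A)"
    interpret Z: positive_operator "poly_op z A" M
    proof (rule positive_operator.intro)
      show "bounded_linear (poly_op z A)"
        by (rule bounded_linear_poly_op[OF bounded_linear_A])
      then show "norm (poly_op z A x) \<le> M * norm x" for x
        unfolding M_def by (rule onorm)
      show "0 \<le> M"
        unfolding M_def using \<open>bounded_linear (poly_op z A)\<close> by (rule onorm_pos_le)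
      show "poly_op z A x \<bullet> y = x \<bullet> poly_op z A y" for x y
        by (rule poly_op_sym)
      show "0 \<le> poly_op z A x \<bullet> x" for x
        using power_mono[OF N[of x], of 2]
        by (simp add: Z inner_diff BB power_mult_distrib dot_square_norm)
    qed
    \<comment> \<open>The denominator M + 1 avoids a case distinction for M = 0.\<close>
    define c' where "c' = c\<^sup>2 / (M + 1)"
    have "c' > 0"
      using c(1) Z.bound_nonneg by (simp add: c'_def)
    have *: "(norm (B v))\<^sup>2 \<le> (N\<^sup>2 - c') * (norm v)\<^sup>2" for v
    proof -
      have "c\<^sup>2 * (norm v)\<^sup>2 \<le> (norm (poly_op z A v))\<^sup>2"
        using power_mono[OF c(2)[of v], of 2] c(1) by (simp add: power_mult_distrib)
      also have "\<dots> \<le> M * (poly_op z A v \<bullet> v)"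
        by (rule Z.norm_square_le)
      also have "\<dots> \<le> (M + 1) * (poly_op z A v \<bullet> v)"
        by (intro mult_right_mono Z.pos) simp
      finally have "c' * (norm v)\<^sup>2 \<le> poly_op z A v \<bullet> v"
        using Z.bound_nonneg by (simp add: c'_def field_simps)
      then show ?thesis
        by (simp add: Z inner_diff BB dot_square_norm algebra_simps)
    qed
    define s where "s = sqrt (max 0 (N\<^sup>2 - c'))"
    have "norm (B v) \<le> s * norm v" for v
    proof (rule power2_le_imp_le)
      show "(norm (B v))\<^sup>2 \<le> (s * norm v)\<^sup>2"
        using *[of v] mult_right_mono[of "N\<^sup>2 - c'" "max 0 (N\<^sup>2 - c')" "(norm v)\<^sup>2"]
        by (simp add: s_def power_mult_distrib)
    qed (simp add: s_def)
    then have "N \<le> s"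
      unfolding N_def by (intro onorm_bound) (auto simp: s_def)
    then have "N\<^sup>2 \<le> s\<^sup>2"
      using \<open>N > 0\<close> by (intro power_mono) auto
    moreover have "s\<^sup>2 < N\<^sup>2"
      using \<open>c' > 0\<close> \<open>N > 0\<close> by (simp add: s_def)
    ultimately show False by simp
  qed
  then have "N * norm v \<le> D * norm v"
    by (intro mult_right_mono) auto
  with N[of v] show ?thesis
    unfolding B_def by (rule order_trans)
qed

text \<open>If 0 \<le> p \<le> D on the interval, then p - D/2 has modulus at most D/2 there. The
  norm bound keeps the form of p(A) - D/2 above -D/2, and adding D/2 back gives positivity.\<close>

lemma poly_op_nonneg:
  assumes "\<And>u. u \<in> {0..a} \<Longrightarrow> 0 \<le> poly p u"
  shows "0 \<le> poly_op p A v \<bullet> v"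
proof -
  have "compact (poly p ` {0..a})"
    by (intro compact_continuous_image continuous_intros) simp
  then have "bounded (poly p ` {0..a})"
    by (rule compact_imp_bounded)
  then obtain D where "\<forall>x\<in>poly p ` {0..a}. norm x \<le> D"
    unfolding bounded_iff by blast
  then have D: "\<And>u. u \<in> {0..a} \<Longrightarrow> \<bar>poly p u\<bar> \<le> D"
    by auto
  have "norm (poly_op (p - [:D / 2:]) A v) \<le> D / 2 * norm v"
  proof (rule poly_op_norm_le)
    show "\<bar>poly (p - [:D / 2:]) u\<bar> \<le> D / 2" if "u \<in> {0..a}" for u
      using D[OF that] assms[OF that] unfolding abs_le_iff by simp
  qed
  then have "- (poly_op (p - [:D / 2:]) A v \<bullet> v) \<le> D / 2 * norm v * norm v"
    using norm_cauchy_schwarz[of "- poly_op (p - [:D / 2:]) A v" v]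
      mult_right_mono[of "norm (poly_op (p - [:D / 2:]) A v)" "D / 2 * norm v" "norm v"] by simp
  then show ?thesis
    by (simp add: poly_op_diff inner_diff dot_square_norm power2_eq_square)
qed

lemma poly_op_mono:
  assumes "\<And>u. u \<in> {0..a} \<Longrightarrow> poly p u \<le> poly q u"
  shows "poly_op p A v \<bullet> v \<le> poly_op q A v \<bullet> v"
  using poly_op_nonneg[of "q - p" v] assms by (simp add: poly_op_diff inner_diff)

end

section \<open>Continuous functions of an operator\<close>

lemma poly_approximation:
  fixes f :: "real \<Rightarrow> real"
  assumes "continuous_on {0..a} f" "e > 0"
  shows "\<exists>p. \<forall>u\<in>{0..a}. \<bar>poly p u - f u\<bar> \<le> e"
proof -
  obtain g where g: "real_polynomial_function g" "\<And>x. x \<in> {0..a} \<Longrightarrow> \<bar>f x - g x\<bar> < e"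
    using Stone_Weierstrass_real_polynomial_function[OF compact_Icc assms] by blast
  then obtain c n where "g = (\<lambda>x. \<Sum>i\<le>n. c i * x ^ i)"
    unfolding real_polynomial_function_iff_sum by blast
  then have "poly (\<Sum>i\<le>n. monom (c i) i) u = g u" for u
    by (simp add: poly_sum poly_monom)
  then show ?thesis
    using g(2) by (intro exI[of _ "\<Sum>i\<le>n. monom (c i) i"]) (metis abs_minus_commute less_imp_le)
qed

locale hilbert_operator = positive_operator A "onorm A"
  for A :: "'a::{real_inner,complete_space} \<Rightarrow> 'a"
begin

text \<open>Uniform closeness on the interval is closeness in operator norm by
  \<open>poly_op_norm_le\<close>, so polynomial approximants converge. The estimate is stated for
  every q and e instead of one sequence, so that later arguments may choose their own
  approximants.\<close>

lemma poly_op_limit_exists: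
  assumes f: "continuous_on {0..onorm A} f"
  shows "\<exists>B. bounded_linear B \<and> (\<forall>q e h. (\<forall>u\<in>{0..onorm A}. \<bar>poly q u - f u\<bar> \<le> e) \<longrightarrow>
           norm (poly_op q A h - B h) \<le> e * norm h)"
proof -
  have "\<exists>p. \<forall>u\<in>{0..onorm A}. \<bar>poly p u - f u\<bar> \<le> 1 / real (Suc n)" for n
    by (rule poly_approximation[OF f]) simp
  then obtain p where p: "\<And>n u. u \<in> {0..onorm A} \<Longrightarrow> \<bar>poly (p n) u - f u\<bar> \<le> 1 / real (Suc n)"
    by metis
  have diff: "norm (poly_op q A h - poly_op (p n) A h) \<le> (e + 1 / real (Suc n)) * norm h"
    if "\<And>u. u \<in> {0..onorm A} \<Longrightarrow> \<bar>poly q u - f u\<bar> \<le> e" for q e n h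
  proof -
    have "\<bar>poly (q - p n) u\<bar> \<le> e + 1 / real (Suc n)" if "u \<in> {0..onorm A}" for u
      using \<open>\<And>u. u \<in> {0..onorm A} \<Longrightarrow> \<bar>poly q u - f u\<bar> \<le> e\<close>[OF that] p[OF that, of n]
      unfolding poly_diff by linarith
    from poly_op_norm_le[OF this, of h] show ?thesis
      by (simp add: poly_op_diff)
  qed
  have "Cauchy (\<lambda>n. poly_op (p n) A h)" for h
  proof (rule metric_CauchyI)
    fix e :: real assume "e > 0"
    obtain N where N: "2 * norm h / e < real N"
      using reals_Archimedean2 by blast
    have "dist (poly_op (p m) A h) (poly_op (p n) A h) < e" if "m \<ge> N" "n \<ge> N" for m n
    proof -
      have N0: "real N > 0"
        using N \<open>e > 0\<close> by (smt (verit) divide_nonneg_pos norm_ge_zero)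
      have "dist (poly_op (p m) A h) (poly_op (p n) A h) \<le> (1 / real (Suc m) + 1 / real (Suc n)) * norm h"
        unfolding dist_norm by (rule diff) (rule p)
      also have "\<dots> \<le> (1 / real N + 1 / real N) * norm h"
        using that N0 by (intro mult_right_mono add_mono divide_left_mono) auto
      also have "\<dots> < e"
        using N N0 \<open>e > 0\<close> by (simp add: field_simps)
      finally show ?thesis .
    qed
    then show "\<exists>M. \<forall>m\<ge>M. \<forall>n\<ge>M. dist (poly_op (p m) A h) (poly_op (p n) A h) < e"
      by blast
  qed
  then have "convergent (\<lambda>n. poly_op (p n) A h)" for h
    by (simp add: Cauchy_convergent_iff)
  then obtain B where B: "(\<lambda>n. poly_op (p n) A h) \<longlonglongrightarrow> B h" for h
    unfolding convergent_def by metis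
  have lim0: "(\<lambda>n. (e + 1 / real (Suc n)) * norm h) \<longlonglongrightarrow> (e + 0) * norm h" for e and h :: 'a
    by (intro tendsto_intros lim_1_over_n[THEN LIMSEQ_Suc])
  have approx: "norm (poly_op q A h - B h) \<le> e * norm h"
    if "\<forall>u\<in>{0..onorm A}. \<bar>poly q u - f u\<bar> \<le> e" for q e h
  proof (rule LIMSEQ_le)
    show "(\<lambda>n. norm (poly_op q A h - poly_op (p n) A h)) \<longlonglongrightarrow> norm (poly_op q A h - B h)"
      by (intro tendsto_intros B)
    show "(\<lambda>n. (e + 1 / real (Suc n)) * norm h) \<longlonglongrightarrow> e * norm h"
      using lim0[of e h] by simp
    show "\<exists>N. \<forall>n\<ge>N. norm (poly_op q A h - poly_op (p n) A h) \<le> (e + 1 / real (Suc n)) * norm h"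
      using diff that by blast
  qed
  have bl: "bounded_linear (poly_op q A)" for q
    by (rule bounded_linear_poly_op[OF bounded_linear_A])
  have "bounded_linear B"
  proof (rule bounded_linear_intro)
    show "B (x + y) = B x + B y" for x y
    proof (rule LIMSEQ_unique[OF B])
      show "(\<lambda>n. poly_op (p n) A (x + y)) \<longlonglongrightarrow> B x + B y"
        using tendsto_add[OF B[of x] B[of y]] by (simp add: bounded_linear.linear[OF bl] linear_add)
    qed
    show "B (r *\<^sub>R x) = r *\<^sub>R B x" for r x
    proof (rule LIMSEQ_unique[OF B])
      show "(\<lambda>n. poly_op (p n) A (r *\<^sub>R x)) \<longlonglongrightarrow> r *\<^sub>R B x"
        using tendsto_scaleR[OF tendsto_const B[of x], of r]
        by (simp add: bounded_linear.linear[OF bl] linear_scale)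
    qed
    show "norm (B x) \<le> norm x * (onorm (poly_op (p 0) A) + 1)" for x
    proof -
      have "norm (B x) \<le> norm (poly_op (p 0) A x) + norm (poly_op (p 0) A x - B x)"
        by (metis norm_minus_commute norm_triangle_sub)
      also have "\<dots> \<le> onorm (poly_op (p 0) A) * norm x + 1 * norm x"
        using p[of _ 0] by (intro add_mono onorm bl approx) simp
      finally show ?thesis
        by (simp add: algebra_simps)
    qed
  qed
  with approx show ?thesis
    by blast
qed

text \<open>\<open>spectral_fun\<close> is a definite description. The limit just built satisfies
  it; it is the only candidate because some polynomial sequence does converge uniformly to f and so
  determines the operator.\<close>

lemma spectral_fun_spec:
  assumes f: "continuous_on {0..onorm A} f"
  shows bounded_linear_spectral_fun: "bounded_linear (spectral_fun f A)"
    and spectral_fun_approx: "\<And>q e h. (\<And>u. u \<in> {0..onorm A} \<Longrightarrow> \<bar>poly q u - f u\<bar> \<le> e) \<Longrightarrow>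
           norm (poly_op q A h - spectral_fun f A h) \<le> e * norm h"
proof -
  obtain B where bl: "bounded_linear B" and B: "\<And>q e h. (\<And>u. u \<in> {0..onorm A} \<Longrightarrow> \<bar>poly q u - f u\<bar> \<le> e) \<Longrightarrow>
           norm (poly_op q A h - B h) \<le> e * norm h"
    using poly_op_limit_exists[OF f] by metis
  define lim where "lim C \<longleftrightarrow> (\<forall>p. uniform_limit {0..onorm A} (\<lambda>n. poly (p n)) f sequentially \<longrightarrow>
        (\<lambda>n. onorm (\<lambda>h. poly_op (p n) A h - C h)) \<longlonglongrightarrow> 0)" for C
  have blp: "bounded_linear (poly_op q A)" for q
    by (rule bounded_linear_poly_op[OF bounded_linear_A])
  have "lim B"
    unfolding lim_def
  proof (intro allI impI)
    fix p assume ul: "uniform_limit {0..onorm A} (\<lambda>n. poly (p n)) f sequentially"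
    show "(\<lambda>n. onorm (\<lambda>h. poly_op (p n) A h - B h)) \<longlonglongrightarrow> 0"
    proof (rule tendstoI)
      fix e :: real assume "e > 0"
      then have "\<forall>\<^sub>F n in sequentially. \<forall>u\<in>{0..onorm A}. dist (poly (p n) u) (f u) < e / 2"
        using ul by (intro uniform_limitD) auto
      then show "\<forall>\<^sub>F n in sequentially. dist (onorm (\<lambda>h. poly_op (p n) A h - B h)) 0 < e"
      proof eventually_elim
        case (elim n)
        have "onorm (\<lambda>h. poly_op (p n) A h - B h) \<le> e / 2"
          using elim \<open>e > 0\<close> by (intro onorm_bound B) (force simp: dist_real_def)+
        moreover have "0 \<le> onorm (\<lambda>h. poly_op (p n) A h - B h)"
          by (intro onorm_pos_le bounded_linear_sub blp bl)
        ultimately show ?case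
          using \<open>e > 0\<close> by simp
      qed
    qed
  qed
  moreover have "C = B" if C: "bounded_linear C" "lim C" for C
  proof -
    have "\<exists>p. \<forall>u\<in>{0..onorm A}. \<bar>poly p u - f u\<bar> \<le> 1 / real (Suc n)" for n
      by (rule poly_approximation[OF f]) simp
    then obtain p where p: "\<And>n u. u \<in> {0..onorm A} \<Longrightarrow> \<bar>poly (p n) u - f u\<bar> \<le> 1 / real (Suc n)"
      by metis
    have "uniform_limit {0..onorm A} (\<lambda>n. poly (p n)) f sequentially"
    proof (rule uniform_limitI)
      fix e :: real assume "e > 0"
      then obtain N where N: "inverse (real (Suc N)) < e"
        using reals_Archimedean by blast
      show "\<forall>\<^sub>F n in sequentially. \<forall>u\<in>{0..onorm A}. dist (poly (p n) u) (f u) < e"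
        unfolding eventually_sequentially
      proof (intro exI[of _ N] allI impI ballI)
        fix n u assume "N \<le> n" "u \<in> {0..onorm A}"
        then have "dist (poly (p n) u) (f u) \<le> 1 / real (Suc n)"
          using p by (simp add: dist_real_def)
        also have "\<dots> \<le> 1 / real (Suc N)"
          using \<open>N \<le> n\<close> by (intro divide_left_mono) auto
        finally show "dist (poly (p n) u) (f u) < e"
          using N by (simp add: inverse_eq_divide)
      qed
    qed
    then have lims: "(\<lambda>n. onorm (\<lambda>h. poly_op (p n) A h - B h)) \<longlonglongrightarrow> 0"
      "(\<lambda>n. onorm (\<lambda>h. poly_op (p n) A h - C h)) \<longlonglongrightarrow> 0"
      using \<open>lim B\<close> C(2) by (auto simp: lim_def)
    show "C = B"
    proof
      fix h
      have conv: "(\<lambda>n. poly_op (p n) A h - E h) \<longlonglongrightarrow> 0"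
        if "(\<lambda>n. onorm (\<lambda>h. poly_op (p n) A h - E h)) \<longlonglongrightarrow> 0" "bounded_linear E" for E
      proof (rule Lim_null_comparison)
        show "\<forall>\<^sub>F n in sequentially. norm (poly_op (p n) A h - E h)
            \<le> onorm (\<lambda>h. poly_op (p n) A h - E h) * norm h"
          by (intro always_eventually allI onorm bounded_linear_sub blp that)
        show "(\<lambda>n. onorm (\<lambda>h. poly_op (p n) A h - E h) * norm h) \<longlonglongrightarrow> 0"
          using tendsto_mult_right[OF that(1), of "norm h"] by simp
      qed
      have "(\<lambda>n. (poly_op (p n) A h - C h) - (poly_op (p n) A h - B h)) \<longlonglongrightarrow> 0 - 0"
        by (intro tendsto_diff conv lims bl C)
      then have "(\<lambda>n::nat. B h - C h) \<longlonglongrightarrow> 0"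
        by simp
      then show "C h = B h"
        by (simp add: LIMSEQ_const_iff)
    qed
  qed
  ultimately have "spectral_fun f A = B"
    unfolding spectral_fun_def lim_def using bl by (intro the_equality) blast+
  then show "bounded_linear (spectral_fun f A)"
    "\<And>q e h. (\<And>u. u \<in> {0..onorm A} \<Longrightarrow> \<bar>poly q u - f u\<bar> \<le> e) \<Longrightarrow>
           norm (poly_op q A h - spectral_fun f A h) \<le> e * norm h"
    using bl B by auto
qed

text \<open>The constants c and d allow approximants whose error is a fixed multiple of e, as
  happens for products, and e \<le> 1 keeps those approximants bounded.\<close>

lemma spectral_fun_unique:
  assumes "continuous_on {0..onorm A} f"
    and "\<And>e. 0 < e \<Longrightarrow> e \<le> 1 \<Longrightarrow>
      \<exists>q. (\<forall>u\<in>{0..onorm A}. \<bar>poly q u - f u\<bar> \<le> c * e) \<and> norm (poly_op q A h - x) \<le> d * e"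
  shows "spectral_fun f A h = x"
proof -
  define k where "k = \<bar>c\<bar> * norm h + \<bar>d\<bar> + 1"
  have "k > 0"
    by (simp add: k_def add_nonneg_pos)
  have "norm (spectral_fun f A h - x) \<le> e" if "e > 0" for e
  proof -
    define e' where "e' = min 1 (e / k)"
    have "0 < e'" "e' \<le> 1"
      using that \<open>k > 0\<close> by (auto simp: e'_def)
    from assms(2)[OF this] obtain q where q: "\<forall>u\<in>{0..onorm A}. \<bar>poly q u - f u\<bar> \<le> c * e'"
      "norm (poly_op q A h - x) \<le> d * e'"
      by blast
    have "norm (poly_op q A h - spectral_fun f A h) \<le> c * e' * norm h"
      by (rule spectral_fun_approx[OF assms(1)]) (use q in auto)
    then have "norm (spectral_fun f A h - x) \<le> c * e' * norm h + d * e'"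
      using q(2) norm_triangle_ineq[of "spectral_fun f A h - poly_op q A h" "poly_op q A h - x"]
      by (simp add: norm_minus_commute)
    also have "\<dots> = (c * norm h + d) * e'"
      by (simp add: algebra_simps)
    also have "\<dots> \<le> k * e'"
    proof (rule mult_right_mono)
      have "c * norm h \<le> \<bar>c\<bar> * norm h"
        by (intro mult_right_mono) auto
      then show "c * norm h + d \<le> k"
        by (simp add: k_def)
    qed (use \<open>0 < e'\<close> in simp)
    also have "\<dots> \<le> e"
      using \<open>k > 0\<close> by (simp add: e'_def min_def field_simps)
    finally show ?thesis .
  qed
  then have "norm (spectral_fun f A h - x) \<le> 0"
    by (rule field_le_epsilon) simp
  then show ?thesis
    by simp
qed

lemma spectral_fun_poly: "spectral_fun (poly p) A h = poly_op p A h"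
  by (rule spectral_fun_unique[where c = 0 and d = 0]) (auto intro!: continuous_intros exI[of _ p])

lemma spectral_fun_cong:
  assumes "continuous_on {0..onorm A} f" "\<And>u. u \<in> {0..onorm A} \<Longrightarrow> f u = g u"
  shows "spectral_fun f A h = spectral_fun g A h"
proof -
  have g: "continuous_on {0..onorm A} g"
    using assms continuous_on_cong by metis
  show ?thesis
  proof (rule spectral_fun_unique[OF assms(1), where c = 1 and d = "norm h"])
    fix e :: real assume "0 < e"
    then obtain q where q: "\<forall>u\<in>{0..onorm A}. \<bar>poly q u - g u\<bar> \<le> e"
      using poly_approximation[OF g] by blast
    then show "\<exists>q. (\<forall>u\<in>{0..onorm A}. \<bar>poly q u - f u\<bar> \<le> 1 * e) \<and>
        norm (poly_op q A h - spectral_fun g A h) \<le> norm h * e"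
      using spectral_fun_approx[OF g, of q e h] assms(2) by (intro exI[of _ q]) (auto simp: mult.commute)
  qed
qed

lemma spectral_fun_norm_le:
  assumes f: "continuous_on {0..onorm A} f" and D: "\<And>u. u \<in> {0..onorm A} \<Longrightarrow> \<bar>f u\<bar> \<le> D"
  shows "norm (spectral_fun f A h) \<le> D * norm h"
proof (rule field_le_epsilon)
  fix e :: real assume "e > 0"
  define e' where "e' = e / (2 * (norm h + 1))"
  have "e' > 0"
    using \<open>e > 0\<close> by (simp add: e'_def add_nonneg_pos)
  then obtain q where q: "\<forall>u\<in>{0..onorm A}. \<bar>poly q u - f u\<bar> \<le> e'"
    using poly_approximation[OF f] by blast
  have "norm (poly_op q A h) \<le> (D + e') * norm h"
    by (rule poly_op_norm_le) (use q D in fastforce)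
  moreover have "norm (poly_op q A h - spectral_fun f A h) \<le> e' * norm h"
    by (rule spectral_fun_approx[OF f]) (use q in auto)
  ultimately have "norm (spectral_fun f A h) \<le> (D + e') * norm h + e' * norm h"
    by (smt (verit) norm_minus_commute norm_triangle_sub)
  also have "\<dots> = D * norm h + 2 * e' * norm h"
    by (simp add: algebra_simps)
  also have "2 * e' * norm h \<le> e"
  proof -
    have "2 * e' * norm h \<le> 2 * e' * (norm h + 1)"
      using \<open>e' > 0\<close> by (intro mult_left_mono) auto
    also have "\<dots> = e"
      by (simp add: e'_def field_simps add_nonneg_eq_0_iff)
    finally show ?thesis .
  qed
  finally show "norm (spectral_fun f A h) \<le> D * norm h + e"
    by simp
qed

lemma spectral_fun_mult:
  assumes f: "continuous_on {0..onorm A} f" and g: "continuous_on {0..onorm A} g"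
  shows "spectral_fun (\<lambda>u. f u * g u) A h = spectral_fun f A (spectral_fun g A h)"
proof -
  have bd: "\<exists>D\<ge>0. \<forall>u\<in>{0..onorm A}. \<bar>k u\<bar> \<le> D" if "continuous_on {0..onorm A} k" for k :: "real \<Rightarrow> real"
  proof -
    have "bounded (k ` {0..onorm A})"
      using that by (intro compact_imp_bounded compact_continuous_image) auto
    then show ?thesis
      unfolding bounded_iff by (metis abs_ge_zero bound_nonneg atLeastAtMost_iff dual_order.trans image_eqI order_refl real_norm_def)
  qed
  obtain F where F: "F \<ge> 0" "\<forall>u\<in>{0..onorm A}. \<bar>f u\<bar> \<le> F"
    using bd[OF f] by blast
  obtain G where G: "G \<ge> 0" "\<forall>u\<in>{0..onorm A}. \<bar>g u\<bar> \<le> G"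
    using bd[OF g] by blast
  show ?thesis
  proof (rule spectral_fun_unique[where c = "F + 1 + G" and d = "G * norm h + (F + 1) * norm h"])
    show "continuous_on {0..onorm A} (\<lambda>u. f u * g u)"
      by (intro continuous_intros f g)
    fix e :: real assume e: "0 < e" "e \<le> 1"
    obtain p where p: "\<forall>u\<in>{0..onorm A}. \<bar>poly p u - f u\<bar> \<le> e"
      using poly_approximation[OF f e(1)] by blast
    obtain q where q: "\<forall>u\<in>{0..onorm A}. \<bar>poly q u - g u\<bar> \<le> e"
      using poly_approximation[OF g e(1)] by blast
    have p': "\<bar>poly p u\<bar> \<le> F + 1" if "u \<in> {0..onorm A}" for u
      using F(2) p that e(2) by fastforce
    have "\<bar>poly (p * q) u - f u * g u\<bar> \<le> (F + 1 + G) * e" if "u \<in> {0..onorm A}" for u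
    proof -
      have "poly (p * q) u - f u * g u = poly p u * (poly q u - g u) + (poly p u - f u) * g u"
        by (simp add: algebra_simps)
      also have "\<bar>\<dots>\<bar> \<le> \<bar>poly p u\<bar> * \<bar>poly q u - g u\<bar> + \<bar>poly p u - f u\<bar> * \<bar>g u\<bar>"
        by (metis abs_mult abs_triangle_ineq)
      also have "\<dots> \<le> (F + 1) * e + e * G"
        using p' p q G F e that by (intro add_mono mult_mono) auto
      finally show ?thesis
        by (simp add: algebra_simps)
    qed
    moreover have "norm (poly_op (p * q) A h - spectral_fun f A (spectral_fun g A h))
        \<le> (G * norm h + (F + 1) * norm h) * e"
    proof -
      have "poly_op (p * q) A h - spectral_fun f A (spectral_fun g A h)
        = poly_op p A (poly_op q A h - spectral_fun g A h)
          + (poly_op p A (spectral_fun g A h) - spectral_fun f A (spectral_fun g A h))"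
        using bounded_linear.linear[OF bounded_linear_poly_op[OF bounded_linear_A]]
        by (simp add: poly_op_mult[OF bounded_linear_A] linear_diff)
      also have "norm \<dots> \<le> (F + 1) * (e * norm h) + e * (G * norm h)"
      proof (rule norm_triangle_mono)
        have "norm (poly_op p A (poly_op q A h - spectral_fun g A h))
            \<le> (F + 1) * norm (poly_op q A h - spectral_fun g A h)"
          by (rule poly_op_norm_le) (rule p')
        also have "\<dots> \<le> (F + 1) * (e * norm h)"
          using F q by (intro mult_left_mono spectral_fun_approx[OF g]) auto
        finally show "norm (poly_op p A (poly_op q A h - spectral_fun g A h)) \<le> (F + 1) * (e * norm h)" .
        have "norm (poly_op p A (spectral_fun g A h) - spectral_fun f A (spectral_fun g A h))
            \<le> e * norm (spectral_fun g A h)"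
          using p by (intro spectral_fun_approx[OF f]) auto
        also have "\<dots> \<le> e * (G * norm h)"
          using e G by (intro mult_left_mono spectral_fun_norm_le[OF g]) auto
        finally show "norm (poly_op p A (spectral_fun g A h) - spectral_fun f A (spectral_fun g A h))
            \<le> e * (G * norm h)" .
      qed
      finally show ?thesis
        by (simp add: algebra_simps)
    qed
    ultimately show "\<exists>q. (\<forall>u\<in>{0..onorm A}. \<bar>poly q u - f u * g u\<bar> \<le> (F + 1 + G) * e) \<and>
        norm (poly_op q A h - spectral_fun f A (spectral_fun g A h))
        \<le> (G * norm h + (F + 1) * norm h) * e"
      by blast
  qed
qed

lemma spectral_fun_sym:
  assumes f: "continuous_on {0..onorm A} f"
  shows "spectral_fun f A x \<bullet> y = x \<bullet> spectral_fun f A y"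
proof -
  have "\<bar>spectral_fun f A x \<bullet> y - x \<bullet> spectral_fun f A y\<bar> \<le> 0 + e" if "e > 0" for e
  proof -
    define e' where "e' = e / (2 * (norm x * norm y + 1))"
    have "e' > 0"
      using \<open>e > 0\<close> by (simp add: e'_def add_nonneg_pos)
    then obtain q where q: "\<forall>u\<in>{0..onorm A}. \<bar>poly q u - f u\<bar> \<le> e'"
      using poly_approximation[OF f] by blast
    have "spectral_fun f A x \<bullet> y - x \<bullet> spectral_fun f A y
      = x \<bullet> (poly_op q A y - spectral_fun f A y) - (poly_op q A x - spectral_fun f A x) \<bullet> y"
      by (simp add: inner_diff poly_op_sym)
    also have "\<bar>\<dots>\<bar> \<le> norm x * norm (poly_op q A y - spectral_fun f A y)
        + norm (poly_op q A x - spectral_fun f A x) * norm y"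
      by (meson Cauchy_Schwarz_ineq2 abs_triangle_ineq4 add_mono order_trans)
    also have "\<dots> \<le> norm x * (e' * norm y) + (e' * norm x) * norm y"
      using q by (intro add_mono mult_left_mono mult_right_mono spectral_fun_approx[OF f]) auto
    also have "\<dots> = 2 * e' * (norm x * norm y)"
      by (simp add: algebra_simps)
    also have "\<dots> \<le> 2 * e' * (norm x * norm y + 1)"
      using \<open>e' > 0\<close> by (intro mult_left_mono) auto
    also have "\<dots> = e"
      by (simp add: e'_def field_simps add_nonneg_eq_0_iff)
    finally show ?thesis
      by simp
  qed
  then have "\<bar>spectral_fun f A x \<bullet> y - x \<bullet> spectral_fun f A y\<bar> \<le> 0"
    by (rule field_le_epsilon)
  then show ?thesis
    by simp
qed

end

section \<open>Hilbert space geometry\<close>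

lemma nonneg_quadratic_imp_zero:
  fixes b c :: real
  assumes "\<And>t. 0 \<le> t\<^sup>2 * c - 2 * t * b"
  shows "b = 0"
proof (rule ccontr)
  assume "b \<noteq> 0"
  define k where "k = \<bar>c\<bar> + 1"
  have "k > 0" "c < k + k"
    by (auto simp: k_def)
  have "0 \<le> (b / k)\<^sup>2 * c - 2 * (b / k) * b"
    by (rule assms)
  also have "\<dots> = b\<^sup>2 / k\<^sup>2 * (c - 2 * k)"
    using \<open>k > 0\<close> by (simp add: field_simps power2_eq_square)
  also have "\<dots> < 0"
    using \<open>b \<noteq> 0\<close> \<open>k > 0\<close> \<open>c < k + k\<close> by (intro mult_pos_neg) auto
  finally show False by simp
qed

text \<open>A sequence in M minimising the distance to x is Cauchy by the parallelogram law, since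
  midpoints stay in M. Minimality of the limit along each line through it gives orthogonality.
  Placing y in the closure of M serves kernels of functionals and spans alike.\<close>

lemma orthogonal_projection_exists:
  fixes x :: "'a::{real_inner,complete_space}"
  assumes M: "subspace M"
  shows "\<exists>y\<in>closure M. \<forall>m\<in>M. (x - y) \<bullet> m = 0"
proof -
  define d where "d = (INF m\<in>M. (norm (x - m))\<^sup>2)"
  have "0 \<in> M"
    by (rule subspace_0[OF M])
  have bdd: "bdd_below ((\<lambda>m. (norm (x - m))\<^sup>2) ` M)"
    by (intro bdd_belowI[of _ 0]) auto
  have d_le: "d \<le> (norm (x - m))\<^sup>2" if "m \<in> M" for m
    unfolding d_def by (rule cINF_lower[OF bdd that])
  have "\<exists>m\<in>M. (norm (x - m))\<^sup>2 < d + 1 / real (Suc n)" for n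
    using \<open>0 \<in> M\<close> bdd unfolding d_def
    by (subst cINF_less_iff[symmetric]) auto
  then obtain m where m: "\<And>n. m n \<in> M" "\<And>n. (norm (x - m n))\<^sup>2 < d + 1 / real (Suc n)"
    by metis
  have close: "(norm (m i - m j))\<^sup>2 \<le> 4 / real (Suc n)" if "i \<ge> n" "j \<ge> n" for i j n
  proof -
    have "(1/2) *\<^sub>R (m i + m j) \<in> M"
      by (intro subspace_scale[OF M] subspace_add[OF M] m)
    have "(norm (m i - m j))\<^sup>2 = 2 * (norm (x - m i))\<^sup>2 + 2 * (norm (x - m j))\<^sup>2
        - 4 * (norm (x - (1/2) *\<^sub>R (m i + m j)))\<^sup>2"
      unfolding power2_norm_eq_inner by (simp add: inner_diff inner_add inner_commute algebra_simps)
    also have "\<dots> \<le> 2 * (d + 1 / real (Suc i)) + 2 * (d + 1 / real (Suc j)) - 4 * d"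
      using m(2)[of i] m(2)[of j] d_le[OF \<open>(1/2) *\<^sub>R (m i + m j) \<in> M\<close>] by (smt (verit))
    also have "\<dots> \<le> 4 / real (Suc n)"
      using that frac_le[of 1 1 "real (Suc n)" "real (Suc i)"] frac_le[of 1 1 "real (Suc n)" "real (Suc j)"]
      by simp
    finally show ?thesis .
  qed
  have "Cauchy m"
  proof (rule metric_CauchyI)
    fix e :: real assume "e > 0"
    obtain n where n: "4 / e\<^sup>2 < real n"
      using reals_Archimedean2 by blast
    have "dist (m i) (m j) < e" if "i \<ge> n" "j \<ge> n" for i j
    proof (rule power2_less_imp_less)
      have "(dist (m i) (m j))\<^sup>2 \<le> 4 / real (Suc n)"
        unfolding dist_norm by (rule close[OF that])
      also have "\<dots> < e\<^sup>2"
        using n \<open>e > 0\<close> by (simp add: field_simps) (smt (verit) zero_less_power)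
      finally show "(dist (m i) (m j))\<^sup>2 < e\<^sup>2" .
    qed (use \<open>e > 0\<close> in simp)
    then show "\<exists>M. \<forall>i\<ge>M. \<forall>j\<ge>M. dist (m i) (m j) < e"
      by blast
  qed
  then obtain y where y: "m \<longlonglongrightarrow> y"
    using Cauchy_convergent_iff convergent_def by blast
  have "y \<in> closure M"
    using m(1) y closure_sequential by blast
  moreover have "(x - y) \<bullet> w = 0" if "w \<in> M" for w
  proof -
    have "(norm (x - y))\<^sup>2 \<le> d"
    proof (rule LIMSEQ_le)
      show "(\<lambda>n. (norm (x - m n))\<^sup>2) \<longlonglongrightarrow> (norm (x - y))\<^sup>2"
        by (intro tendsto_intros y)
      have "(\<lambda>n. d + 1 / real (Suc n)) \<longlonglongrightarrow> d + 0"
        by (intro tendsto_intros lim_1_over_n[THEN LIMSEQ_Suc])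
      then show "(\<lambda>n. d + 1 / real (Suc n)) \<longlonglongrightarrow> d"
        by simp
      show "\<exists>N. \<forall>n\<ge>N. (norm (x - m n))\<^sup>2 \<le> d + 1 / real (Suc n)"
        using m(2) less_imp_le by blast
    qed
    moreover have "d \<le> (norm (x - y - t *\<^sub>R w))\<^sup>2" for t
    proof (rule LIMSEQ_le_const)
      have "(\<lambda>n. (norm (x - (m n + t *\<^sub>R w)))\<^sup>2) \<longlonglongrightarrow> (norm (x - (y + t *\<^sub>R w)))\<^sup>2"
        by (intro tendsto_intros y)
      then show "(\<lambda>n. (norm (x - (m n + t *\<^sub>R w)))\<^sup>2) \<longlonglongrightarrow> (norm (x - y - t *\<^sub>R w))\<^sup>2"
        by (simp add: algebra_simps)
      show "\<exists>N. \<forall>n\<ge>N. d \<le> (norm (x - (m n + t *\<^sub>R w)))\<^sup>2"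
        using d_le[OF subspace_add[OF M m(1) subspace_scale[OF M that]]] by blast
    qed
    ultimately have "0 \<le> (norm (x - y - t *\<^sub>R w))\<^sup>2 - (norm (x - y))\<^sup>2" for t
      by (smt (verit))
    then have "0 \<le> t\<^sup>2 * (w \<bullet> w) - 2 * t * ((x - y) \<bullet> w)" for t
      unfolding power2_norm_eq_inner
      by (simp add: inner_diff inner_commute power2_eq_square algebra_simps)
    then show ?thesis
      by (rule nonneg_quadratic_imp_zero)
  qed
  ultimately show ?thesis
    by blast
qed

section \<open>Riesz representation and adjoints\<close>

lemma riesz_representation:
  fixes f :: "'a::{real_inner,complete_space} \<Rightarrow> real"
  assumes f: "bounded_linear f"
  shows "\<exists>z. \<forall>x. f x = x \<bullet> z"
proof (cases "\<forall>x. f x = 0")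
  case True
  then show ?thesis
    by (intro exI[of _ 0]) simp
next
  case False
  then obtain x where x: "f x \<noteq> 0"
    by blast
  note lin = bounded_linear.linear[OF f]
  define M where "M = {v. f v = 0}"
  have M: "subspace M"
    unfolding M_def subspace_def
    by (simp add: linear_0[OF lin] linear_add[OF lin] linear_scale[OF lin])
  have "closed M"
    unfolding M_def
    by (intro closed_Collect_eq continuous_on_const linear_continuous_on f)
  then obtain y where y: "y \<in> M" "\<And>m. m \<in> M \<Longrightarrow> (x - y) \<bullet> m = 0"
    using orthogonal_projection_exists[OF M, of x] by (auto simp: closure_closed)
  define w where "w = x - y"
  have fw: "f w = f x"
    using y(1) by (simp add: w_def M_def linear_diff[OF lin])
  then have "w \<noteq> 0"
    using x linear_0[OF lin] by auto
  have "f v = v \<bullet> ((f w / (w \<bullet> w)) *\<^sub>R w)" for v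
  proof -
    have "f (v - (f v / f w) *\<^sub>R w) = 0"
      using x fw by (simp add: linear_diff[OF lin] linear_scale[OF lin])
    then have "w \<bullet> (v - (f v / f w) *\<^sub>R w) = 0"
      using y(2) by (simp add: w_def M_def)
    then show ?thesis
      using x fw \<open>w \<noteq> 0\<close> by (simp add: inner_diff field_simps inner_commute)
  qed
  then show ?thesis
    by blast
qed

text \<open>\<open>adjoint\<close> is defined by choice and has the adjoint property only once some
  adjoint exists. Riesz vectors of the functionals that pair S x with y provide one.\<close>

lemma hilbert_adjoint:
  fixes S :: "'a::{real_inner,complete_space} \<Rightarrow> 'b::real_inner"
  assumes "bounded_linear S"
  shows "S x \<bullet> y = x \<bullet> adjoint S y"
proof -
  have "\<exists>z. \<forall>x. S x \<bullet> y = x \<bullet> z" for y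
    by (rule riesz_representation)
       (rule bounded_linear_compose[OF bounded_linear_inner_left assms])
  then have "\<exists>g. \<forall>x y. S x \<bullet> y = x \<bullet> g y"
    by metis
  then have "\<forall>x y. S x \<bullet> y = x \<bullet> adjoint S y"
    unfolding adjoint_def by (rule someI_ex)
  then show ?thesis by blast
qed

lemma hilbert_adjoint_norm_le:
  fixes S :: "'a::{real_inner,complete_space} \<Rightarrow> 'b::real_inner"
  assumes S: "bounded_linear S" and le: "\<And>x. norm (S x) \<le> k * norm x" and "0 \<le> k"
  shows "norm (adjoint S y) \<le> k * norm y"
proof -
  have "(norm (adjoint S y))\<^sup>2 = S (adjoint S y) \<bullet> y"
    by (simp add: hilbert_adjoint[OF S] power2_norm_eq_inner)
  also have "\<dots> \<le> norm (S (adjoint S y)) * norm y"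
    by (rule norm_cauchy_schwarz)
  also have "\<dots> \<le> k * norm (adjoint S y) * norm y"
    by (intro mult_right_mono le) simp
  finally have "norm (adjoint S y) * norm (adjoint S y) \<le> norm (adjoint S y) * (k * norm y)"
    by (simp add: power2_eq_square algebra_simps)
  then show ?thesis
    using \<open>0 \<le> k\<close> by (cases "adjoint S y = 0") auto
qed

section \<open>Orthonormal systems\<close>

text \<open>Expansion around the Fourier coefficients leaves a sum of squares in c. With c equal to
  these coefficients this gives Bessel's inequality; for arbitrary c it shows that they approximate
  best, which Parseval's identity needs.\<close>

lemma orthonormal_sum_norm:
  assumes "pairwise orthogonal B" "\<And>e. e \<in> B \<Longrightarrow> norm e = 1" "finite F" "F \<subseteq> B"
  shows "(norm (v - (\<Sum>e\<in>F. c e *\<^sub>R e)))\<^sup>2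
    = (norm v)\<^sup>2 - (\<Sum>e\<in>F. (v \<bullet> e)\<^sup>2) + (\<Sum>e\<in>F. (c e - v \<bullet> e)\<^sup>2)"
proof -
  have ee: "(\<Sum>e'\<in>F. c e' * (e \<bullet> e')) = c e" if "e \<in> F" for e
  proof -
    have "c e' * (e \<bullet> e') = (if e' = e then c e else 0)" if "e' \<in> F" for e'
      using assms \<open>e \<in> F\<close> that
      by (auto simp: pairwise_def orthogonal_def subset_eq simp flip: power2_norm_eq_inner)
    then have "(\<Sum>e'\<in>F. c e' * (e \<bullet> e')) = (\<Sum>e'\<in>F. if e' = e then c e else 0)"
      by (intro sum.cong) auto
    then show ?thesis
      using that assms(3) by simp
  qed
  have "(norm (v - (\<Sum>e\<in>F. c e *\<^sub>R e)))\<^sup>2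
    = (norm v)\<^sup>2 - 2 * (\<Sum>e\<in>F. c e * (v \<bullet> e)) + (\<Sum>e\<in>F. c e * (\<Sum>e'\<in>F. c e' * (e \<bullet> e')))"
  proof -
    define s where "s = (\<Sum>e\<in>F. c e *\<^sub>R e)"
    have "v \<bullet> s = (\<Sum>e\<in>F. c e * (v \<bullet> e))"
      by (simp add: s_def inner_sum_right)
    moreover have "s \<bullet> s = (\<Sum>e\<in>F. c e * (\<Sum>e'\<in>F. c e' * (e \<bullet> e')))"
      by (simp add: s_def inner_sum_right inner_sum_left inner_commute sum_distrib_left)
         (simp add: algebra_simps)
    ultimately show ?thesis
      unfolding s_def[symmetric] power2_norm_eq_inner
      by (simp add: inner_diff inner_commute[of s v])
  qed
  also have "(\<Sum>e\<in>F. c e * (\<Sum>e'\<in>F. c e' * (e \<bullet> e'))) = (\<Sum>e\<in>F. c e * c e)"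
    using ee by (intro sum.cong) auto
  finally show ?thesis
    by (simp add: power2_eq_square algebra_simps sum.distrib sum_subtractf sum_distrib_left)
qed

lemma bessel_inequality:
  assumes "pairwise orthogonal B" "\<And>e. e \<in> B \<Longrightarrow> norm e = 1" "finite F" "F \<subseteq> B"
  shows "(\<Sum>e\<in>F. (v \<bullet> e)\<^sup>2) \<le> (norm v)\<^sup>2"
  using orthonormal_sum_norm[OF assms, where v = v and c = "\<lambda>e. v \<bullet> e"]
    zero_le_power2[of "norm (v - (\<Sum>e\<in>F. (v \<bullet> e) *\<^sub>R e))"]
  by simp

lemma parseval:
  assumes "orthonormal_basis B"
  shows "((\<lambda>e. (v \<bullet> e)\<^sup>2) has_sum (norm v)\<^sup>2) B"
proof -
  have B: "pairwise orthogonal B" "\<And>e. e \<in> B \<Longrightarrow> norm e = 1" "closure (span B) = UNIV"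
    using assms by (auto simp: orthonormal_basis_def)
  show ?thesis
    unfolding has_sum_def
  proof (rule tendstoI)
    fix \<epsilon> :: real assume "\<epsilon> > 0"
    have "v \<in> closure (span B)"
      using B(3) by simp
    then obtain u where u: "u \<in> span B" "dist u v < sqrt \<epsilon>"
      unfolding closure_approachable using \<open>\<epsilon> > 0\<close> by (meson real_sqrt_gt_zero)
    obtain F0 c where F0: "finite F0" "F0 \<subseteq> B" "u = (\<Sum>e\<in>F0. c e *\<^sub>R e)"
      using u(1) unfolding span_explicit by auto
    have "dist (\<Sum>e\<in>F. (v \<bullet> e)\<^sup>2) ((norm v)\<^sup>2) < \<epsilon>" if F: "finite F" "F0 \<subseteq> F" "F \<subseteq> B" for F
    proof -
      define c' where "c' e = (if e \<in> F0 then c e else 0)" for e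
      have "u = (\<Sum>e\<in>F. c' e *\<^sub>R e)"
        unfolding F0(3) c'_def using F by (intro sum.mono_neutral_cong_left) auto
      then have "(norm v)\<^sup>2 - (\<Sum>e\<in>F. (v \<bullet> e)\<^sup>2) \<le> (norm (v - u))\<^sup>2"
        using orthonormal_sum_norm[OF B(1,2) F(1,3), where v = v and c = c']
          sum_nonneg[of F "\<lambda>e. (c' e - v \<bullet> e)\<^sup>2"] by simp
      also have "\<dots> < \<epsilon>"
        using u(2) power_strict_mono[of "norm (v - u)" "sqrt \<epsilon>" 2] \<open>\<epsilon> > 0\<close>
        by (simp add: dist_norm norm_minus_commute)
      finally show ?thesis
        using bessel_inequality[OF B(1,2) F(1,3), of v] by (simp add: dist_real_def)
    qed
    then show "\<forall>\<^sub>F F in finite_subsets_at_top B. dist (\<Sum>e\<in>F. (v \<bullet> e)\<^sup>2) ((norm v)\<^sup>2) < \<epsilon>"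
      unfolding eventually_finite_subsets_at_top using F0 by blast
  qed
qed

text \<open>Zorn's lemma. If the span of a maximal orthonormal set were not dense, the normalised
  residual of a projection onto its closure could be added to the set.\<close>

lemma orthonormal_basis_exists: "\<exists>B::'a::{real_inner,complete_space} set. orthonormal_basis B"
proof -
  define ON where "ON = {B::'a set. pairwise orthogonal B \<and> (\<forall>e\<in>B. norm e = 1)}"
  have "\<exists>B\<in>ON. \<forall>X\<in>ON. B \<subseteq> X \<longrightarrow> X = B"
  proof (rule subset_Zorn')
    fix C assume "subset.chain ON C"
    then have sub: "C \<subseteq> ON" and chain: "\<And>X Y. X \<in> C \<Longrightarrow> Y \<in> C \<Longrightarrow> X \<subseteq> Y \<or> Y \<subseteq> X"
      by (auto simp: subset_chain_def)
    have "orthogonal x y" if "X \<in> C" "x \<in> X" "Y \<in> C" "y \<in> Y" "x \<noteq> y" for X Y x y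
      using chain[OF that(1,3)] sub that by (auto simp: ON_def pairwise_def subset_eq)
    then show "\<Union>C \<in> ON"
      using sub by (auto simp: ON_def pairwise_def)
  qed
  then obtain B where B: "B \<in> ON" and max: "\<And>X. X \<in> ON \<Longrightarrow> B \<subseteq> X \<Longrightarrow> X = B"
    by blast
  have "x \<in> closure (span B)" for x
  proof (rule ccontr)
    assume x: "x \<notin> closure (span B)"
    obtain y where y: "y \<in> closure (span B)" "\<And>m. m \<in> span B \<Longrightarrow> (x - y) \<bullet> m = 0"
      using orthogonal_projection_exists[OF subspace_span] by blast
    define w where "w = (1 / norm (x - y)) *\<^sub>R (x - y)"
    have "norm w = 1"
      using x y(1) by (auto simp: w_def)
    have wB: "w \<bullet> e = 0" if "e \<in> B" for e
      using y(2)[OF span_base[OF that]] by (simp add: w_def)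
    then have "insert w B \<in> ON"
      using B \<open>norm w = 1\<close> by (auto simp: ON_def pairwise_insert orthogonal_def inner_commute)
    then have "w \<in> B"
      using max by blast
    from wB[OF this] show False
      using \<open>norm w = 1\<close> by (metis norm_eq_1 zero_neq_one)
  qed
  then show ?thesis
    using B unfolding orthonormal_basis_def ON_def by blast
qed

text \<open>Distinct unit vectors of an orthonormal set are sqrt 2 apart, so balls of radius 1/2
  around them pick different points of a countable dense set.\<close>

lemma orthonormal_countable:
  fixes B :: "'a::{real_inner,second_countable_topology} set"
  assumes "pairwise orthogonal B" "\<And>e. e \<in> B \<Longrightarrow> norm e = 1"
  shows "countable B"
proof -
  obtain D :: "'a set" where D: "countable D" "\<And>X. open X \<Longrightarrow> X \<noteq> {} \<Longrightarrow> \<exists>d\<in>D. d \<in> X"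
    using countable_dense_setE by blast
  have "\<exists>d\<in>D. d \<in> ball e (1/2)" for e
    by (rule D(2)) auto
  then obtain d where d: "\<And>e. d e \<in> D" "\<And>e. dist e (d e) < 1/2"
    by (metis mem_ball)
  have "inj_on d B"
  proof (rule inj_onI, rule ccontr)
    fix e e' assume *: "e \<in> B" "e' \<in> B" "d e = d e'" "e \<noteq> e'"
    have "e \<bullet> e' = 0" "e \<bullet> e = 1" "e' \<bullet> e' = 1"
      using assms * by (auto simp: pairwise_def orthogonal_def dot_square_norm)
    then have "(dist e e')\<^sup>2 = 2"
      unfolding dist_norm power2_norm_eq_inner by (simp add: inner_diff inner_commute)
    moreover have "dist e e' < 1"
      using d(2)[of e] d(2)[of e'] dist_triangle2[of e e' "d e"] *(3) by simp
    then have "(dist e e')\<^sup>2 < 1"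
      by (simp add: power_less_one_iff)
    ultimately show False by simp
  qed
  moreover have "countable (d ` B)"
    using d(1) by (intro countable_subset[OF _ D(1)]) auto
  ultimately show ?thesis
    using countable_image_inj_on by blast
qed

text \<open>A countable basis is enumerated and padded with zeros, which covers finite dimension.
  Only Parseval's identity is kept, because the later arguments just sum squared
  coordinates.\<close>

lemma parseval_sequence_exists:
  "\<exists>e::nat \<Rightarrow> 'a::{real_inner,complete_space,second_countable_topology}.
     \<forall>v. (\<lambda>k. (v \<bullet> e k)\<^sup>2) sums (norm v)\<^sup>2"
proof -
  obtain B :: "'a set" where B: "orthonormal_basis B"
    using orthonormal_basis_exists by blast
  then have "countable B"
    by (intro orthonormal_countable) (auto simp: orthonormal_basis_def)
  define e where "e k = (if k \<in> to_nat_on B ` B then from_nat_into B k else 0)" for k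
  have "(\<lambda>k. (v \<bullet> e k)\<^sup>2) sums (norm v)\<^sup>2" for v
  proof -
    have "((\<lambda>k. (v \<bullet> e k)\<^sup>2) has_sum (norm v)\<^sup>2) (to_nat_on B ` B)"
    proof (subst has_sum_reindex)
      show "inj_on (to_nat_on B) B"
        by (rule inj_on_to_nat_on[OF \<open>countable B\<close>])
      have "((\<lambda>k. (v \<bullet> e k)\<^sup>2) \<circ> to_nat_on B) x = (v \<bullet> x)\<^sup>2" if "x \<in> B" for x
        using that \<open>countable B\<close> by (simp add: e_def)
      then show "((\<lambda>k. (v \<bullet> e k)\<^sup>2) \<circ> to_nat_on B has_sum (norm v)\<^sup>2) B"
        using parseval[OF B, of v] has_sum_cong by (metis (no_types, lifting))
    qed
    then have "((\<lambda>k. (v \<bullet> e k)\<^sup>2) has_sum (norm v)\<^sup>2) UNIV"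
      by (subst has_sum_cong_neutral[where S = UNIV and T = "to_nat_on B ` B" and g = "\<lambda>k. (v \<bullet> e k)\<^sup>2"])
         (auto simp: e_def)
    then show ?thesis
      by (rule has_sum_imp_sums)
  qed
  then show ?thesis
    by blast
qed

section \<open>Vector-valued random variables\<close>

lemma (in finite_measure) integrable_real_bounded:
  fixes f :: "'a \<Rightarrow> real"
  assumes "f \<in> borel_measurable M" "\<And>x. x \<in> space M \<Longrightarrow> \<bar>f x\<bar> \<le> B"
  shows "integrable M f"
  by (rule integrable_const_bound[where B = B]) (use assms in auto)

text \<open>The library result \<open>integrableI_bounded\<close> is restricted to the class \<open>banach\<close>, which is
  not implied by the sort used here.  The limit of the integrals of approximating simple functions
  is the Riesz vector of the weak integral.\<close>

lemma (in finite_measure) integrable_hilbert_bounded: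
  fixes f :: "'a \<Rightarrow> 'h::{real_inner,complete_space,second_countable_topology}"
  assumes f[measurable]: "f \<in> borel_measurable M" and B: "\<And>x. x \<in> space M \<Longrightarrow> norm (f x) \<le> B"
  shows "integrable M f"
proof -
  have "0 \<le> B" if "x \<in> space M" for x
    using B[OF that] norm_ge_zero order_trans by blast
  then have B': "norm (f x) \<le> \<bar>B\<bar>" if "x \<in> space M" for x
    using B[OF that] by simp
  obtain s where s: "\<And>i. simple_function M (s i)"
    and pointwise: "\<And>x. x \<in> space M \<Longrightarrow> (\<lambda>i. s i x) \<longlonglongrightarrow> f x"
    and bound: "\<And>i x. x \<in> space M \<Longrightarrow> norm (s i x) \<le> 2 * norm (f x)"
    using borel_measurable_implies_sequence_metric[OF f, of 0] by simp metis
  have s_meas[measurable]: "s i \<in> borel_measurable M" for i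
    using s by (rule borel_measurable_simple_function)
  have s_bound: "norm (s i x) \<le> 2 * \<bar>B\<bar>" if "x \<in> space M" for i x
    using bound[OF that, of i] B'[OF that] by simp
  have si: "Bochner_Integration.simple_bochner_integrable M (s i)" for i
    by (intro simple_bochner_integrable.intros s) (simp add: emeasure_eq_measure)
  have fh: "integrable M (\<lambda>x. f x \<bullet> h)" for h
  proof (rule integrable_real_bounded)
    show "\<bar>f x \<bullet> h\<bar> \<le> \<bar>B\<bar> * norm h" if "x \<in> space M" for x
      using Cauchy_Schwarz_ineq2[of "f x" h] mult_right_mono[OF B'[OF that], of "norm h"] by simp
  qed simp
  have "bounded_linear (\<lambda>h. \<integral>x. f x \<bullet> h \<partial>M)"
  proof (rule bounded_linear_intro)
    show "(\<integral>x. f x \<bullet> (h + h') \<partial>M) = (\<integral>x. f x \<bullet> h \<partial>M) + (\<integral>x. f x \<bullet> h' \<partial>M)" for h h'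
      by (simp add: inner_add fh)
    show "(\<integral>x. f x \<bullet> (r *\<^sub>R h) \<partial>M) = r *\<^sub>R (\<integral>x. f x \<bullet> h \<partial>M)" for r h
      by simp
    show "norm (\<integral>x. f x \<bullet> h \<partial>M) \<le> norm h * (\<bar>B\<bar> * measure M (space M))" for h
    proof -
      have "norm (\<integral>x. f x \<bullet> h \<partial>M) \<le> (\<integral>x. norm (f x \<bullet> h) \<partial>M)"
        by (rule integral_norm_bound)
      also have "\<dots> \<le> (\<integral>x. \<bar>B\<bar> * norm h \<partial>M)"
      proof (intro integral_mono)
        show "norm (f x \<bullet> h) \<le> \<bar>B\<bar> * norm h" if "x \<in> space M" for x
          using Cauchy_Schwarz_ineq2[of "f x" h] mult_right_mono[OF B'[OF that], of "norm h"] by simp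
      qed (use fh in auto)
      finally show ?thesis
        by (simp add: algebra_simps)
    qed
  qed
  then obtain z where z: "\<And>h. (\<integral>x. f x \<bullet> h \<partial>M) = h \<bullet> z"
    using riesz_representation by blast
  have dom: "(\<lambda>i. \<integral>\<^sup>+x. norm (f x - s i x) \<partial>M) \<longlonglongrightarrow> 0"
  proof (rule nn_integral_dominated_convergence_norm)
    show "AE x in M. norm (s j x) \<le> 2 * \<bar>B\<bar>" for j
      using s_bound by simp
    show "(\<integral>\<^sup>+x. ennreal (2 * \<bar>B\<bar>) \<partial>M) < \<infinity>"
      by (simp add: ennreal_mult_less_top emeasure_eq_measure)
  qed (use pointwise in auto)
  have fs: "integrable M (\<lambda>x. norm (f x - s i x))" for i
  proof (rule integrable_real_bounded)
    show "\<bar>norm (f x - s i x)\<bar> \<le> 3 * \<bar>B\<bar>" if "x \<in> space M" for x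
      using norm_triangle_ineq4[of "f x" "s i x"] B'[OF that] s_bound[OF that, of i] by simp
  qed simp
  have "(\<lambda>i. Bochner_Integration.simple_bochner_integral M (s i)) \<longlonglongrightarrow> z"
  proof (rule LIM_zero_cancel, rule Lim_null_comparison)
    have "norm (Bochner_Integration.simple_bochner_integral M (s i) - z) \<le> (\<integral>x. norm (f x - s i x) \<partial>M)" for i
    proof -
      define d where "d = Bochner_Integration.simple_bochner_integral M (s i) - z"
      have int_s: "integrable M (s i)" "Bochner_Integration.simple_bochner_integral M (s i) = (\<integral>x. s i x \<partial>M)"
        using si[of i] has_bochner_integral_simple_bochner_integrable
        by (auto simp: integrable.simps simple_bochner_integrable_eq_integral)
      \<comment> \<open>Only the weak integrals of f are known, so d is tested against itself and
        one factor of its norm is cancelled afterwards.\<close>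
      have "norm d * norm d = d \<bullet> d"
        by (simp add: power2_norm_eq_inner flip: power2_eq_square)
      also have "\<dots> = (\<integral>x. s i x \<partial>M) \<bullet> d - d \<bullet> z"
        by (simp add: d_def int_s inner_diff inner_commute)
      also have "\<dots> = (\<integral>x. s i x \<bullet> d \<partial>M) - (\<integral>x. f x \<bullet> d \<partial>M)"
        using int_s(1) by (simp add: z)
      also have "\<dots> = (\<integral>x. (s i x - f x) \<bullet> d \<partial>M)"
        using int_s(1) fh by (simp add: inner_diff)
      also have "\<dots> \<le> (\<integral>x. norm (f x - s i x) * norm d \<partial>M)"
      proof (rule integral_mono)
        show "(s i x - f x) \<bullet> d \<le> norm (f x - s i x) * norm d" for x
          by (metis norm_cauchy_schwarz norm_minus_commute)
      qed (use int_s fh fs in \<open>auto simp: inner_diff\<close>)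
      also have "\<dots> = (\<integral>x. norm (f x - s i x) \<partial>M) * norm d"
        by simp
      finally have "norm d * norm d \<le> (\<integral>x. norm (f x - s i x) \<partial>M) * norm d" .
      then have "norm d \<le> (\<integral>x. norm (f x - s i x) \<partial>M)"
        by (cases "d = 0") (auto simp: mult_le_cancel_right)
      then show ?thesis
        by (simp add: d_def)
    qed
    then show "\<forall>\<^sub>F i in sequentially.
        norm (Bochner_Integration.simple_bochner_integral M (s i) - z) \<le> (\<integral>x. norm (f x - s i x) \<partial>M)"
      by simp
    have "(\<lambda>i. ennreal (\<integral>x. norm (f x - s i x) \<partial>M)) \<longlonglongrightarrow> ennreal 0"
      using dom fs by (simp add: nn_integral_eq_integral)
    then show "(\<lambda>i. \<integral>x. norm (f x - s i x) \<partial>M) \<longlonglongrightarrow> 0"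
      by (subst (asm) tendsto_ennreal_iff) auto
  qed
  then have "has_bochner_integral M f z"
    by (intro has_bochner_integral.intros[OF f si dom])
  then show ?thesis
    by (auto simp: integrable.simps)
qed

text \<open>The sequence satisfies Parseval's identity without being assumed orthonormal. The
  identity minus the n-th partial expansion is a positive operator A whose form is at most |v|^2;
  Cauchy-Schwarz for this form gives |A v|^2 \<le> A v . v, and the right-hand side is a tail of the
  Parseval series.\<close>

lemma parseval_partial_sums:
  fixes e :: "nat \<Rightarrow> 'a::real_inner"
  assumes e: "\<And>v. (\<lambda>k. (v \<bullet> e k)\<^sup>2) sums (norm v)\<^sup>2"
  shows "(\<lambda>n. \<Sum>k<n. (v \<bullet> e k) *\<^sub>R e k) \<longlonglongrightarrow> v"
proof -
  have le: "(\<Sum>k<n. (v \<bullet> e k)\<^sup>2) \<le> (norm v)\<^sup>2" for n v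
    using sum_le_suminf[OF sums_summable[OF e[of v]], of "{..<n}"] sums_unique[OF e[of v]] by simp
  have "(norm (v - (\<Sum>k<n. (v \<bullet> e k) *\<^sub>R e k)))\<^sup>2 \<le> (norm v)\<^sup>2 - (\<Sum>k<n. (v \<bullet> e k)\<^sup>2)" for n
  proof -
    define A where "A w = w - (\<Sum>k<n. (w \<bullet> e k) *\<^sub>R e k)" for w
    have AA: "A w \<bullet> w = (norm w)\<^sup>2 - (\<Sum>k<n. (w \<bullet> e k)\<^sup>2)" for w
      unfolding power2_norm_eq_inner
      by (simp add: A_def inner_diff_left inner_sum_left) (simp add: power2_eq_square inner_commute)
    have bl: "bounded_linear A"
      unfolding A_def
      by (intro bounded_linear_sub bounded_linear_ident bounded_linear_sum
          bounded_linear_scaleR_const bounded_linear_inner_left)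
    interpret A: positive_operator A "onorm A"
    proof (rule positive_operator.intro[OF bl])
      show "A x \<bullet> y = x \<bullet> A y" for x y
        by (simp add: A_def inner_diff inner_sum_left inner_sum_right mult.commute inner_commute[of y])
      show "0 \<le> A x \<bullet> x" for x
        using le[where v = x and n = n] by (simp add: AA)
    qed (auto intro: onorm bl onorm_pos_le)
    have "(norm (A v))\<^sup>2 * (norm (A v))\<^sup>2 = (A v \<bullet> A v)\<^sup>2"
      by (simp add: dot_square_norm power2_eq_square)
    also have "\<dots> \<le> (A v \<bullet> v) * (A (A v) \<bullet> A v)"
      by (rule A.cauchy_schwarz)
    also have "\<dots> \<le> (A v \<bullet> v) * (norm (A v))\<^sup>2"
      by (intro mult_left_mono A.pos) (simp add: AA sum_nonneg)
    finally have "(norm (A v))\<^sup>2 \<le> A v \<bullet> v"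
      using A.pos[of v] mult_le_cancel_right[of "(norm (A v))\<^sup>2" "(norm (A v))\<^sup>2" "A v \<bullet> v"]
      by (cases "A v = 0") (simp_all only: zero_less_power2 norm_zero inner_zero_left, auto)
    then show ?thesis
      by (simp add: AA) (simp add: A_def)
  qed
  moreover have "(\<lambda>n. (norm v)\<^sup>2 - (\<Sum>k<n. (v \<bullet> e k)\<^sup>2)) \<longlonglongrightarrow> 0"
    using tendsto_diff[OF tendsto_const e[of v, unfolded sums_def], of "(norm v)\<^sup>2"] by simp
  ultimately have "(\<lambda>n. (norm (v - (\<Sum>k<n. (v \<bullet> e k) *\<^sub>R e k)))\<^sup>2) \<longlonglongrightarrow> 0"
    by (rule_tac Lim_null_comparison) auto
  then have "(\<lambda>n. v - (\<Sum>k<n. (v \<bullet> e k) *\<^sub>R e k)) \<longlonglongrightarrow> 0"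
    by (simp add: tendsto_norm_zero_iff power_tendsto_0_iff)
  then have "(\<lambda>n. v - (v - (\<Sum>k<n. (v \<bullet> e k) *\<^sub>R e k))) \<longlonglongrightarrow> v - 0"
    by (intro tendsto_diff tendsto_const)
  then show ?thesis
    by simp
qed

text \<open>g is the pointwise limit of its finite Parseval expansions, whose coefficients are the
  given measurable functions.\<close>

lemma borel_measurable_weak:
  fixes g :: "'a \<Rightarrow> 'h::{real_inner,complete_space,second_countable_topology}"
  assumes "\<And>h. (\<lambda>x. g x \<bullet> h) \<in> borel_measurable M"
  shows "g \<in> borel_measurable M"
proof -
  obtain e :: "nat \<Rightarrow> 'h" where e: "\<And>v. (\<lambda>k. (v \<bullet> e k)\<^sup>2) sums (norm v)\<^sup>2"
    using parseval_sequence_exists by blast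
  show ?thesis
  proof (rule borel_measurable_LIMSEQ_metric)
    show "(\<lambda>x. \<Sum>k<n. (g x \<bullet> e k) *\<^sub>R e k) \<in> borel_measurable M" for n
      using assms by measurable
    show "(\<lambda>n. \<Sum>k<n. (g x \<bullet> e k) *\<^sub>R e k) \<longlonglongrightarrow> g x" for x
      by (rule parseval_partial_sums[OF e])
  qed
qed

section \<open>Concentration\<close>

text \<open>cosh is a power series in the square of its argument with nonnegative coefficients, so
  as a function of that square it is increasing and convex, term by term.\<close>

lemma cosh_mono_comb:
  fixes y a b w :: real
  assumes "0 \<le> w" "w \<le> 1" "0 \<le> y" "y\<^sup>2 \<le> w * a\<^sup>2 + (1 - w) * b\<^sup>2"
  shows "cosh y \<le> w * cosh a + (1 - w) * cosh b"
proof (rule sums_le)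
  show "(\<lambda>n. if even n then y ^ n /\<^sub>R fact n else 0) sums cosh y"
    by (rule cosh_converges)
  show "(\<lambda>n. w * (if even n then a ^ n /\<^sub>R fact n else 0) + (1 - w) * (if even n then b ^ n /\<^sub>R fact n else 0))
     sums (w * cosh a + (1 - w) * cosh b)"
    by (intro sums_add sums_mult cosh_converges)
  show "(if even n then y ^ n /\<^sub>R fact n else 0)
    \<le> w * (if even n then a ^ n /\<^sub>R fact n else 0) + (1 - w) * (if even n then b ^ n /\<^sub>R fact n else 0)" for n
  proof (cases "even n")
    case True
    then obtain k where n: "n = 2 * k" by blast
    have conv: "convex_on {0::real..} (\<lambda>x. x ^ k)"
      using convex_power_odd[of k] convex_power_even[of k] convex_on_subset by (cases "even k") auto
    have "y ^ n = (y\<^sup>2) ^ k"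
      by (simp add: n power_mult)
    also have "\<dots> \<le> (w * a\<^sup>2 + (1 - w) * b\<^sup>2) ^ k"
      by (intro power_mono assms) simp
    also have "\<dots> \<le> w * (a\<^sup>2) ^ k + (1 - w) * (b\<^sup>2) ^ k"
      using convex_onD[OF conv, of "1 - w" "a\<^sup>2" "b\<^sup>2"] assms by simp
    finally have "y ^ n \<le> w * a ^ n + (1 - w) * b ^ n"
      by (simp add: n power_mult)
    then show ?thesis
      using True by (simp add: divide_inverse flip: distrib_right) (metis (no_types, opaque_lifting) mult.commute distrib_left mult.left_commute inverse_nonnegative_iff_nonnegative fact_ge_zero mult_left_mono)
  qed simp
qed

text \<open>As a function of the cosine of the angle between \<open>x\<close> and \<open>u\<close>, the hyperbolic cosine of
  the norm of \<open>x + u\<close> is convex, hence it lies below its chord.\<close>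

lemma cosh_norm_add_le:
  fixes x u :: "'a::real_inner"
  shows "cosh (norm (x + u)) \<le> cosh (norm x) * cosh (norm u)
    + sinh (norm x) / norm x * (sinh (norm u) / norm u) * (x \<bullet> u)"
proof (cases "x = 0 \<or> u = 0")
  case False
  define a b where "a = norm x" and "b = norm u"
  have ab: "a > 0" "b > 0"
    using False by (auto simp: a_def b_def)
  define c where "c = (x \<bullet> u) / (a * b)"
  have "\<bar>x \<bullet> u\<bar> \<le> a * b"
    by (simp add: a_def b_def Cauchy_Schwarz_ineq2)
  then have c: "-1 \<le> c" "c \<le> 1"
    using ab by (auto simp: c_def field_simps abs_le_iff)
  have xu: "x \<bullet> u = c * (a * b)"
    using ab by (simp add: c_def)
  \<comment> \<open>The cosine c is the convex combination of 1 and -1 with weights (1 + c)/2 and (1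
    - c)/2; the extreme cases are parallel and antiparallel vectors, with norms a + b and |a -
    b|.\<close>
  have "cosh (norm (x + u)) \<le> (1 + c) / 2 * cosh (a + b) + (1 - (1 + c) / 2) * cosh (a - b)"
  proof (rule cosh_mono_comb)
    have "(norm (x + u))\<^sup>2 = a\<^sup>2 + b\<^sup>2 + 2 * (c * (a * b))"
      unfolding a_def b_def xu[unfolded a_def b_def, symmetric] power2_norm_eq_inner
      by (simp add: inner_add inner_commute)
    then show "(norm (x + u))\<^sup>2 \<le> (1 + c) / 2 * (a + b)\<^sup>2 + (1 - (1 + c) / 2) * (a - b)\<^sup>2"
      by (simp add: power2_eq_square field_simps)
  qed (use c in auto)
  also have "\<dots> = cosh a * cosh b + c * (sinh a * sinh b)"
    by (simp add: cosh_add cosh_diff field_simps)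
  also have "\<dots> = cosh a * cosh b + sinh a / a * (sinh b / b) * (x \<bullet> u)"
    using ab by (simp add: xu)
  finally show ?thesis
    by (simp add: a_def b_def)
qed auto

lemma sinh_ge_self:
  fixes b :: real
  assumes "0 \<le> b"
  shows "b \<le> sinh b"
proof -
  have "(\<lambda>x. sinh x - x) 0 \<le> (\<lambda>x. sinh x - x) b"
  proof (rule DERIV_nonneg_imp_nondecreasing[OF assms])
    fix x :: real
    have "((\<lambda>x. sinh x - x) has_real_derivative cosh x - 1) (at x)"
      by (auto intro!: derivative_eq_intros)
    then show "\<exists>y. ((\<lambda>x. sinh x - x) has_real_derivative y) (at x) \<and> 0 \<le> y"
      using cosh_real_ge_1[of x] by (intro exI[of _ "cosh x - 1"]) simp
  qed
  then show ?thesis by simp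
qed

text \<open>In the bound for cosh of the norm of a sum, the factor sinh b / b of the scalar product
  is replaced by 1. What remains is linear in \<xi> and integrates to 0. The replacement costs at
  most cosh a (sinh b - b), and cosh b + sinh b - b = exp b - b. Quotients at norm 0 are 0 by
  convention and fit the bound.\<close>

lemma (in prob_space) expectation_cosh_norm_add_le:
  fixes \<xi> :: "'a \<Rightarrow> 'k::{real_inner,second_countable_topology}"
  assumes \<xi>[measurable]: "\<xi> \<in> borel_measurable M"
    and B: "\<And>z. z \<in> space M \<Longrightarrow> norm (\<xi> z) \<le> B"
    and mean: "\<And>v. (\<integral>z. \<xi> z \<bullet> v \<partial>M) = 0"
  shows "(\<integral>\<^sup>+z. ennreal (cosh (norm (x + \<xi> z))) \<partial>M)
    \<le> ennreal (cosh (norm x) * (\<integral>z. exp (norm (\<xi> z)) - norm (\<xi> z) \<partial>M))"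
proof -
  define a where "a = norm x"
  define g where "g z = cosh a * cosh (norm (\<xi> z)) + sinh a / a * (sinh (norm (\<xi> z)) / norm (\<xi> z)) * (x \<bullet> \<xi> z)" for z
  define g' where "g' z = cosh a * (exp (norm (\<xi> z)) - norm (\<xi> z))" for z
  have le: "g z - g' z \<le> sinh a / a * (x \<bullet> \<xi> z)" for z
  proof -
    define b where "b = norm (\<xi> z)"
    have "sinh a / a * (x \<bullet> \<xi> z) * (sinh b / b - 1) \<le> sinh a * (sinh b - b)"
    proof (cases "x = 0 \<or> \<xi> z = 0")
      case False
      then have ab: "a > 0" "b > 0"
        by (auto simp: a_def b_def)
      have "sinh a / a * (x \<bullet> \<xi> z) * (sinh b / b - 1) \<le> sinh a / a * (a * b) * (sinh b / b - 1)"
        using ab sinh_ge_self[of b] norm_cauchy_schwarz[of x "\<xi> z"]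
        by (intro mult_right_mono mult_left_mono) (auto simp: a_def b_def)
      also have "\<dots> = sinh a * (sinh b - b)"
        using ab by (simp add: field_simps)
      finally show ?thesis .
    qed (auto simp: a_def b_def)
    also have "\<dots> \<le> cosh a * (sinh b - b)"
      using sinh_ge_self[of b] sinh_less_cosh_real[of a] by (intro mult_right_mono) (auto simp: b_def)
    finally have *: "sinh a / a * (x \<bullet> \<xi> z) * (sinh b / b - 1) \<le> cosh a * (sinh b - b)" .
    have "exp b = cosh b + sinh b"
      by (simp add: cosh_plus_sinh)
    define p q where "p = sinh a / a" and "q = sinh b / b"
    show ?thesis
      using * \<open>exp b = cosh b + sinh b\<close>
      unfolding g_def g'_def b_def[symmetric] p_def[symmetric] q_def[symmetric]
      by (simp add: algebra_simps)
  qed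
  have int': "integrable M g'"
    unfolding g'_def
  proof (rule integrable_real_bounded)
    show "\<bar>cosh a * (exp (norm (\<xi> z)) - norm (\<xi> z))\<bar> \<le> cosh a * (exp B + B)" if "z \<in> space M" for z
    proof -
      have "exp (norm (\<xi> z)) \<le> exp B" "0 \<le> exp (norm (\<xi> z))"
        using B[OF that] by auto
      then have "\<bar>exp (norm (\<xi> z)) - norm (\<xi> z)\<bar> \<le> exp B + B"
        using B[OF that] norm_ge_zero[of "\<xi> z"] by linarith
      then show ?thesis
        unfolding abs_mult by (intro mult_mono) auto
    qed
  qed simp
  have intx: "integrable M (\<lambda>z. sinh a / a * (x \<bullet> \<xi> z))"
  proof (rule integrable_real_bounded)
    show "\<bar>sinh a / a * (x \<bullet> \<xi> z)\<bar> \<le> \<bar>sinh a / a\<bar> * (a * B)" if "z \<in> space M" for z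
      unfolding abs_mult a_def
      using Cauchy_Schwarz_ineq2[of x "\<xi> z"] B[OF that]
      by (intro mult_left_mono) (auto intro: order_trans[OF _ mult_left_mono])
  qed simp
  have "(\<integral>\<^sup>+z. ennreal (cosh (norm (x + \<xi> z))) \<partial>M) \<le> (\<integral>\<^sup>+z. ennreal (g' z + sinh a / a * (x \<bullet> \<xi> z)) \<partial>M)"
  proof (intro nn_integral_mono ennreal_leI)
    fix z
    show "cosh (norm (x + \<xi> z)) \<le> g' z + sinh a / a * (x \<bullet> \<xi> z)"
      using cosh_norm_add_le[of x "\<xi> z"] le[of z] by (simp add: g_def a_def)
  qed
  also have "\<dots> = ennreal (\<integral>z. g' z + sinh a / a * (x \<bullet> \<xi> z) \<partial>M)"
  proof (rule nn_integral_eq_integral)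
    show "AE z in M. 0 \<le> g' z + sinh a / a * (x \<bullet> \<xi> z)"
    proof (rule AE_I2)
      fix z
      have "0 \<le> cosh (norm (x + \<xi> z))"
        by (simp add: cosh_real_nonneg)
      also have "\<dots> \<le> g z"
        unfolding g_def a_def by (rule cosh_norm_add_le)
      finally show "0 \<le> g' z + sinh a / a * (x \<bullet> \<xi> z)"
        using le[of z] by simp
    qed
  qed (use int' intx in auto)
  also have "(\<integral>z. g' z + sinh a / a * (x \<bullet> \<xi> z) \<partial>M) = (\<integral>z. g' z \<partial>M) + sinh a / a * (\<integral>z. x \<bullet> \<xi> z \<partial>M)"
    using int' intx by simp
  also have "(\<integral>z. x \<bullet> \<xi> z \<partial>M) = 0"
    using mean[of x] by (simp add: inner_commute)
  finally show ?thesis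
    by (simp add: g'_def a_def)
qed

text \<open>Integrating out the last coordinate with the others fixed multiplies the bound by one
  factor; cosh of the norm plays the role of the exponential in a scalar Chernoff argument.\<close>

lemma (in prob_space) nn_integral_PiM_cosh_norm_sum_le:
  fixes \<xi> :: "'a \<Rightarrow> 'k::{real_inner,second_countable_topology}"
  assumes \<xi>[measurable]: "\<xi> \<in> borel_measurable M"
    and B: "\<And>z. z \<in> space M \<Longrightarrow> norm (\<xi> z) \<le> B"
    and mean: "\<And>v. (\<integral>z. \<xi> z \<bullet> v \<partial>M) = 0"
  shows "(\<integral>\<^sup>+z. ennreal (cosh (norm (\<Sum>j<n. \<xi> (z j)))) \<partial>PiM {..<n} (\<lambda>_. M))
    \<le> ennreal ((\<integral>z. exp (norm (\<xi> z)) - norm (\<xi> z) \<partial>M) ^ n)"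
proof (induction n)
  case 0
  show ?case
    by (simp add: PiM_empty)
next
  case (Suc n)
  interpret P: product_sigma_finite "\<lambda>_::nat. M"
    by standard
  have [measurable]: "cosh \<in> borel_measurable (borel :: real measure)"
    by (intro borel_measurable_continuous_onI continuous_intros)
  have [measurable]: "(\<lambda>z. \<Sum>j\<in>I. \<xi> (z j)) \<in> borel_measurable (PiM I (\<lambda>_. M))" for I :: "nat set"
    by (rule borel_measurable_sum) (rule measurable_compose[OF _ \<xi>], rule measurable_component_singleton)
  define c where "c = (\<integral>z. exp (norm (\<xi> z)) - norm (\<xi> z) \<partial>M)"
  have "c \<ge> 0"
    unfolding c_def using exp_ge_add_one_self
    by (intro integral_nonneg_AE AE_I2) (smt (verit))
  have "(\<integral>\<^sup>+z. ennreal (cosh (norm (\<Sum>j<Suc n. \<xi> (z j)))) \<partial>PiM {..<Suc n} (\<lambda>_. M))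
    = (\<integral>\<^sup>+x. \<integral>\<^sup>+y. ennreal (cosh (norm (\<Sum>j<Suc n. \<xi> ((x(n := y)) j)))) \<partial>M \<partial>PiM {..<n} (\<lambda>_. M))"
    unfolding lessThan_Suc
    by (rule P.product_nn_integral_insert) auto
  also have "\<dots> = (\<integral>\<^sup>+x. \<integral>\<^sup>+y. ennreal (cosh (norm ((\<Sum>j<n. \<xi> (x j)) + \<xi> y))) \<partial>M \<partial>PiM {..<n} (\<lambda>_. M))"
    by simp
  also have "\<dots> \<le> (\<integral>\<^sup>+x. ennreal (cosh (norm (\<Sum>j<n. \<xi> (x j))) * c) \<partial>PiM {..<n} (\<lambda>_. M))"
    unfolding c_def by (intro nn_integral_mono expectation_cosh_norm_add_le[where B = B] assms)
  also have "\<dots> = (\<integral>\<^sup>+x. ennreal (cosh (norm (\<Sum>j<n. \<xi> (x j)))) \<partial>PiM {..<n} (\<lambda>_. M)) * ennreal c"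
    using \<open>c \<ge> 0\<close> by (simp add: ennreal_mult cosh_real_nonneg nn_integral_multc)
  also have "\<dots> \<le> ennreal (c ^ n) * ennreal c"
    using Suc unfolding c_def by (intro mult_right_mono) auto
  also have "\<dots> = ennreal (c ^ Suc n)"
    using \<open>c \<ge> 0\<close> by (simp add: ennreal_mult'' mult.commute)
  finally show ?case
    by (simp add: c_def)
qed

text \<open>The scale \<theta> makes each summand at most 1 and the total variance at most 1. Since
  exp b - b \<le> 1 + b^2 on [0, 1], the expected cosh is at most (1 + \<theta>^2 V)^n \<le> e.
  Markov's inequality with cosh s \<ge> exp s / 2 yields the constant 2.\<close>

lemma (in prob_space) measure_PiM_norm_sum_ge_le:
  fixes \<xi> :: "'a \<Rightarrow> 'k::{real_inner,second_countable_topology}"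
  assumes \<xi>[measurable]: "\<xi> \<in> borel_measurable M"
    and B: "\<And>z. z \<in> space M \<Longrightarrow> norm (\<xi> z) \<le> B"
    and mean: "\<And>v. (\<integral>z. \<xi> z \<bullet> v \<partial>M) = 0"
    and V: "(\<integral>z. (norm (\<xi> z))\<^sup>2 \<partial>M) \<le> V"
    and \<theta>: "0 \<le> \<theta>" "\<theta> * B \<le> 1" "real n * \<theta>\<^sup>2 * V \<le> 1"
  shows "measure (PiM {..<n} (\<lambda>_. M)) {z \<in> space (PiM {..<n} (\<lambda>_. M)). t \<le> \<theta> * norm (\<Sum>j<n. \<xi> (z j))}
    \<le> 2 * exp (1 - t)"
proof -
  interpret PP: prob_space "PiM {..<n} (\<lambda>_. M)"
    by (intro prob_space_PiM prob_space_axioms)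
  have [measurable]: "(\<lambda>z. \<Sum>j<n. \<xi> (z j)) \<in> borel_measurable (PiM {..<n} (\<lambda>_. M))"
    by (rule borel_measurable_sum) (rule measurable_compose[OF _ \<xi>], rule measurable_component_singleton)
  have [measurable]: "cosh \<in> borel_measurable (borel :: real measure)"
    by (intro borel_measurable_continuous_onI continuous_intros)
  define b where "b z = norm (\<theta> *\<^sub>R \<xi> z)" for z
  have b: "0 \<le> b z" "b z \<le> 1" if "z \<in> space M" for z
    using mult_left_mono[OF B[OF that] \<theta>(1)] \<theta> by (auto simp: b_def)
  have b_meas[measurable]: "b \<in> borel_measurable M"
    unfolding b_def[abs_def] by measurable
  define c where "c = (\<integral>z. exp (b z) - b z \<partial>M)"
  have "c \<le> (\<integral>z. 1 + (b z)\<^sup>2 \<partial>M)"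
    unfolding c_def
  proof (rule integral_mono)
    show "integrable M (\<lambda>z. exp (b z) - b z)"
    proof (rule integrable_real_bounded)
      show "\<bar>exp (b z) - b z\<bar> \<le> exp 1 + 1" if "z \<in> space M" for z
      proof -
        have "exp (b z) \<le> exp 1" "0 \<le> exp (b z)"
          using b[OF that] by auto
        then show ?thesis
          using b[OF that] by linarith
      qed
    qed simp
    show "integrable M (\<lambda>z. 1 + (b z)\<^sup>2)"
      by (rule integrable_real_bounded[where B = 2]) (use b in \<open>auto simp: power_le_one\<close>)
    show "exp (b z) - b z \<le> 1 + (b z)\<^sup>2" if "z \<in> space M" for z
      using exp_bound[of "b z"] b[OF that] by simp
  qed
  also have "\<dots> = 1 + \<theta>\<^sup>2 * (\<integral>z. (norm (\<xi> z))\<^sup>2 \<partial>M)"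
  proof -
    have "integrable M (\<lambda>z. (b z)\<^sup>2)"
      by (rule integrable_real_bounded[where B = 1]) (use b in \<open>auto simp: power_le_one\<close>)
    then have "(\<integral>z. 1 + (b z)\<^sup>2 \<partial>M) = 1 + (\<integral>z. (b z)\<^sup>2 \<partial>M)"
      by (simp add: prob_space)
    then show ?thesis
      by (simp add: b_def power_mult_distrib)
  qed
  also have "\<dots> \<le> 1 + \<theta>\<^sup>2 * V"
    using V by (simp add: mult_left_mono)
  also have "\<dots> \<le> exp (\<theta>\<^sup>2 * V)"
    by (rule exp_ge_add_one_self)
  finally have "c \<le> exp (\<theta>\<^sup>2 * V)" .
  moreover have "0 \<le> c"
    unfolding c_def
  proof (intro integral_nonneg_AE AE_I2)
    show "0 \<le> exp (b z) - b z" for z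
      using exp_ge_add_one_self[of "b z"] by linarith
  qed
  ultimately have "c ^ n \<le> exp (\<theta>\<^sup>2 * V) ^ n"
    by (rule power_mono)
  also have "\<dots> = exp (real n * \<theta>\<^sup>2 * V)"
    by (simp add: exp_of_nat_mult[symmetric] mult.assoc)
  also have "\<dots> \<le> exp 1"
    using \<theta>(3) by simp
  finally have cn: "c ^ n \<le> exp 1" .
  have "(\<integral>\<^sup>+z. ennreal (cosh (norm (\<Sum>j<n. \<theta> *\<^sub>R \<xi> (z j)))) \<partial>PiM {..<n} (\<lambda>_. M)) \<le> ennreal (c ^ n)"
    unfolding c_def b_def
  proof (rule nn_integral_PiM_cosh_norm_sum_le)
    show "norm (\<theta> *\<^sub>R \<xi> z) \<le> 1" if "z \<in> space M" for z
      using b[OF that] by (simp add: b_def)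
    show "(\<integral>z. (\<theta> *\<^sub>R \<xi> z) \<bullet> v \<partial>M) = 0" for v
      using mean[of v] by simp
  qed simp
  then have cosh_le: "(\<integral>\<^sup>+z. ennreal (cosh (\<theta> * norm (\<Sum>j<n. \<xi> (z j)))) \<partial>PiM {..<n} (\<lambda>_. M)) \<le> ennreal (exp 1)"
    using cn \<theta>(1) by (simp add: scaleR_sum_right[symmetric]) (meson ennreal_leI order_trans)
  have "emeasure (PiM {..<n} (\<lambda>_. M)) {z \<in> space (PiM {..<n} (\<lambda>_. M)). t \<le> \<theta> * norm (\<Sum>j<n. \<xi> (z j))}
    \<le> emeasure (PiM {..<n} (\<lambda>_. M)) {z \<in> space (PiM {..<n} (\<lambda>_. M)).
        1 \<le> ennreal (2 * exp (- t)) * ennreal (cosh (\<theta> * norm (\<Sum>j<n. \<xi> (z j))))}"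
  proof (rule emeasure_mono)
    show "{z \<in> space (PiM {..<n} (\<lambda>_. M)). t \<le> \<theta> * norm (\<Sum>j<n. \<xi> (z j))}
      \<subseteq> {z \<in> space (PiM {..<n} (\<lambda>_. M)).
        1 \<le> ennreal (2 * exp (- t)) * ennreal (cosh (\<theta> * norm (\<Sum>j<n. \<xi> (z j))))}"
    proof safe
      fix z assume t: "t \<le> \<theta> * norm (\<Sum>j<n. \<xi> (z j))"
      define s where "s = \<theta> * norm (\<Sum>j<n. \<xi> (z j))"
      have "1 \<le> exp (- t) * exp s"
        using t by (simp add: s_def flip: exp_add)
      also have "\<dots> \<le> exp (- t) * (2 * cosh s)"
        by (intro mult_left_mono) (auto simp: cosh_def)
      finally show "1 \<le> ennreal (2 * exp (- t)) * ennreal (cosh (\<theta> * norm (\<Sum>j<n. \<xi> (z j))))"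
        by (simp add: s_def cosh_real_nonneg mult.commute mult.left_commute flip: ennreal_mult ennreal_1)
    qed
  qed measurable
  also have "\<dots> \<le> ennreal (2 * exp (- t)) * (\<integral>\<^sup>+z. ennreal (cosh (\<theta> * norm (\<Sum>j<n. \<xi> (z j))))
        * indicator (space (PiM {..<n} (\<lambda>_. M))) z \<partial>PiM {..<n} (\<lambda>_. M))"
    by (rule nn_integral_Markov_inequality) measurable
  also have "(\<integral>\<^sup>+z. ennreal (cosh (\<theta> * norm (\<Sum>j<n. \<xi> (z j))))
        * indicator (space (PiM {..<n} (\<lambda>_. M))) z \<partial>PiM {..<n} (\<lambda>_. M))
      = (\<integral>\<^sup>+z. ennreal (cosh (\<theta> * norm (\<Sum>j<n. \<xi> (z j)))) \<partial>PiM {..<n} (\<lambda>_. M))"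
    by (intro nn_integral_cong) simp
  also have "ennreal (2 * exp (- t)) * \<dots> \<le> ennreal (2 * exp (- t)) * ennreal (exp 1)"
    by (intro mult_left_mono cosh_le) simp
  also have "\<dots> = ennreal (2 * exp (1 - t))"
    by (simp add: exp_diff exp_minus field_simps flip: ennreal_mult)
  finally show ?thesis
    by (simp add: PP.emeasure_eq_measure)
qed

section \<open>Second moments of averages\<close>

lemma (in prob_space) nn_integral_PiM_sum_square:
  fixes \<psi> :: "'a \<Rightarrow> real"
  assumes \<psi>[measurable]: "\<psi> \<in> borel_measurable M"
    and B: "\<And>z. z \<in> space M \<Longrightarrow> \<bar>\<psi> z\<bar> \<le> B"
    and mean: "(\<integral>z. \<psi> z \<partial>M) = 0"
  shows "(\<integral>\<^sup>+z. ennreal ((\<Sum>j<n. \<psi> (z j))\<^sup>2) \<partial>PiM {..<n} (\<lambda>_. M)) = ennreal (real n * (\<integral>z. (\<psi> z)\<^sup>2 \<partial>M))"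
proof (induction n)
  case 0
  show ?case
    by (simp add: PiM_empty)
next
  case (Suc n)
  interpret P: product_sigma_finite "\<lambda>_::nat. M"
    by standard
  interpret PP: prob_space "PiM {..<n} (\<lambda>_. M)"
    by (intro prob_space_PiM prob_space_axioms)
  have [measurable]: "(\<lambda>z. \<Sum>j\<in>I. \<psi> (z j)) \<in> borel_measurable (PiM I (\<lambda>_. M))" for I :: "nat set"
    by (rule borel_measurable_sum) (rule measurable_compose[OF _ \<psi>], rule measurable_component_singleton)
  have int1: "integrable M \<psi>"
    by (rule integrable_real_bounded[OF \<psi> B])
  have int2: "integrable M (\<lambda>z. (\<psi> z)\<^sup>2)"
  proof (rule integrable_real_bounded)
    show "\<bar>(\<psi> z)\<^sup>2\<bar> \<le> B\<^sup>2" if "z \<in> space M" for z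
      using power_mono[OF B[OF that], of 2] by simp
  qed simp
  have step: "(\<integral>\<^sup>+y. ennreal ((s + \<psi> y)\<^sup>2) \<partial>M) = ennreal (s\<^sup>2) + ennreal (\<integral>z. (\<psi> z)\<^sup>2 \<partial>M)" for s
  proof -
    have "(\<integral>\<^sup>+y. ennreal ((s + \<psi> y)\<^sup>2) \<partial>M) = ennreal (\<integral>y. (s + \<psi> y)\<^sup>2 \<partial>M)"
    proof (rule nn_integral_eq_integral)
      show "integrable M (\<lambda>y. (s + \<psi> y)\<^sup>2)"
        using int1 int2 by (simp add: power2_sum)
    qed simp
    also have "(\<integral>y. (s + \<psi> y)\<^sup>2 \<partial>M) = s\<^sup>2 + (\<integral>z. (\<psi> z)\<^sup>2 \<partial>M)"
      using int1 int2 by (simp add: power2_sum mean prob_space)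
    finally show ?thesis
      by (simp flip: ennreal_plus)
  qed
  have "(\<integral>\<^sup>+z. ennreal ((\<Sum>j<Suc n. \<psi> (z j))\<^sup>2) \<partial>PiM {..<Suc n} (\<lambda>_. M))
    = (\<integral>\<^sup>+x. \<integral>\<^sup>+y. ennreal ((\<Sum>j<Suc n. \<psi> ((x(n := y)) j))\<^sup>2) \<partial>M \<partial>PiM {..<n} (\<lambda>_. M))"
    unfolding lessThan_Suc by (rule P.product_nn_integral_insert) auto
  also have "\<dots> = (\<integral>\<^sup>+x. ennreal ((\<Sum>j<n. \<psi> (x j))\<^sup>2) + ennreal (\<integral>z. (\<psi> z)\<^sup>2 \<partial>M) \<partial>PiM {..<n} (\<lambda>_. M))"
    by (simp add: step)
  also have "\<dots> = (\<integral>\<^sup>+x. ennreal ((\<Sum>j<n. \<psi> (x j))\<^sup>2) \<partial>PiM {..<n} (\<lambda>_. M)) + ennreal (\<integral>z. (\<psi> z)\<^sup>2 \<partial>M)"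
    by (subst nn_integral_add) (auto simp: PP.emeasure_space_1)
  also have "\<dots> = ennreal (real (Suc n) * (\<integral>z. (\<psi> z)\<^sup>2 \<partial>M))"
    by (simp add: Suc algebra_simps flip: ennreal_plus)
  finally show ?case .
qed

lemma (in prob_space) nn_integral_PiM_average_variance:
  fixes \<psi> :: "'a \<Rightarrow> real"
  assumes \<psi>[measurable]: "\<psi> \<in> borel_measurable M"
    and B: "\<And>z. z \<in> space M \<Longrightarrow> \<bar>\<psi> z\<bar> \<le> B" and n: "n > 0"
  shows "(\<integral>\<^sup>+z. ennreal (((\<Sum>j<n. \<psi> (z j)) / real n - (\<integral>z. \<psi> z \<partial>M))\<^sup>2) \<partial>PiM {..<n} (\<lambda>_. M))
    \<le> ennreal ((\<integral>z. (\<psi> z)\<^sup>2 \<partial>M) / real n)"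
proof -
  define m where "m = (\<integral>z. \<psi> z \<partial>M)"
  have [measurable]: "(\<lambda>z. \<Sum>j<n. \<psi> (z j) - m) \<in> borel_measurable (PiM {..<n} (\<lambda>_. M))"
    by (intro borel_measurable_sum borel_measurable_diff borel_measurable_const)
       (rule measurable_compose[OF _ \<psi>], rule measurable_component_singleton)
  have int1: "integrable M \<psi>"
    by (rule integrable_real_bounded[OF \<psi> B])
  have int2: "integrable M (\<lambda>z. (\<psi> z)\<^sup>2)"
  proof (rule integrable_real_bounded)
    show "\<bar>(\<psi> z)\<^sup>2\<bar> \<le> B\<^sup>2" if "z \<in> space M" for z
      using power_mono[OF B[OF that], of 2] by simp
  qed simp
  have "(\<integral>\<^sup>+z. ennreal (((\<Sum>j<n. \<psi> (z j)) / real n - m)\<^sup>2) \<partial>PiM {..<n} (\<lambda>_. M))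
    = (\<integral>\<^sup>+z. ennreal (1 / (real n)\<^sup>2) * ennreal ((\<Sum>j<n. \<psi> (z j) - m)\<^sup>2) \<partial>PiM {..<n} (\<lambda>_. M))"
    using n by (intro nn_integral_cong) (simp add: sum_subtractf field_simps flip: ennreal_mult)
  also have "\<dots> = ennreal (1 / (real n)\<^sup>2) * (\<integral>\<^sup>+z. ennreal ((\<Sum>j<n. \<psi> (z j) - m)\<^sup>2) \<partial>PiM {..<n} (\<lambda>_. M))"
    by (rule nn_integral_cmult) simp
  also have "(\<integral>\<^sup>+z. ennreal ((\<Sum>j<n. \<psi> (z j) - m)\<^sup>2) \<partial>PiM {..<n} (\<lambda>_. M))
    = ennreal (real n * (\<integral>z. (\<psi> z - m)\<^sup>2 \<partial>M))"
  proof (rule nn_integral_PiM_sum_square)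
    show "\<bar>\<psi> z - m\<bar> \<le> B + \<bar>m\<bar>" if "z \<in> space M" for z
      using B[OF that] by linarith
    show "(\<integral>z. \<psi> z - m \<partial>M) = 0"
      using int1 by (simp add: m_def prob_space)
  qed simp
  also have "ennreal (1 / (real n)\<^sup>2) * \<dots> = ennreal ((\<integral>z. (\<psi> z - m)\<^sup>2 \<partial>M) / real n)"
    using n by (simp add: power2_eq_square flip: ennreal_mult)
  also have "\<dots> \<le> ennreal ((\<integral>z. (\<psi> z)\<^sup>2 \<partial>M) / real n)"
  proof (intro ennreal_leI divide_right_mono)
    show "(\<integral>z. (\<psi> z - m)\<^sup>2 \<partial>M) \<le> (\<integral>z. (\<psi> z)\<^sup>2 \<partial>M)"
      using int1 int2 by (simp add: power2_diff m_def prob_space) (simp add: power2_eq_square)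
  qed simp
  finally show ?thesis
    by (simp add: m_def)
qed

text \<open>Chebyshev's inequality for the squared Hilbert-Schmidt norm X of the deviation. Each
  matrix entry is a centred scalar average whose variance is at most its second moment over n, and
  these second moments add up to the mean of |\<phi>|^4. In extended reals all sums and integrals
  commute freely.\<close>

lemma (in prob_space) empirical_covariance_deviation:
  fixes \<phi> :: "'a \<Rightarrow> 'k::{real_inner,complete_space,second_countable_topology}"
  assumes \<phi>[measurable]: "\<phi> \<in> borel_measurable M"
    and b: "\<And>z. z \<in> space M \<Longrightarrow> norm (\<phi> z) \<le> b"
    and C: "\<And>f g. C f \<bullet> g = (\<integral>z. (\<phi> z \<bullet> f) * (\<phi> z \<bullet> g) \<partial>M)"
    and n: "n > 0" and \<epsilon>: "\<epsilon> > 0"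
  shows "\<exists>E\<in>sets (PiM {..<n} (\<lambda>_. M)).
    1 - (\<integral>z. (norm (\<phi> z)) ^ 4 \<partial>M) / (real n * \<epsilon>\<^sup>2) \<le> measure (PiM {..<n} (\<lambda>_. M)) E \<and>
    (\<forall>z\<in>E. \<forall>f. norm ((1 / real n) *\<^sub>R (\<Sum>j<n. (\<phi> (z j) \<bullet> f) *\<^sub>R \<phi> (z j)) - C f) \<le> \<epsilon> * norm f)"
proof -
  interpret PP: prob_space "PiM {..<n} (\<lambda>_. M)"
    by (intro prob_space_PiM prob_space_axioms)
  let ?P = "PiM {..<n} (\<lambda>_. M)"
  obtain e :: "nat \<Rightarrow> 'k" where e: "\<And>v. (\<lambda>k. (v \<bullet> e k)\<^sup>2) sums (norm v)\<^sup>2"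
    using parseval_sequence_exists by blast
  have e_enn: "(\<Sum>k. ennreal ((v \<bullet> e k)\<^sup>2)) = ennreal ((norm v)\<^sup>2)" for v
    by (rule suminf_ennreal_eq[OF _ e]) simp
  define Z where "Z z f = (1 / real n) *\<^sub>R (\<Sum>j<n. (\<phi> (z j) \<bullet> f) *\<^sub>R \<phi> (z j)) - C f" for z f
  have Z_inner: "Z z f \<bullet> g = (\<Sum>j<n. (\<phi> (z j) \<bullet> f) * (\<phi> (z j) \<bullet> g)) / real n
      - (\<integral>z. (\<phi> z \<bullet> f) * (\<phi> z \<bullet> g) \<partial>M)" for z f g
    by (simp add: Z_def inner_diff inner_sum_left C)
  have Z_sym: "Z z f \<bullet> g = f \<bullet> Z z g" for z f g
    unfolding inner_commute[of f] Z_inner by (simp add: mult.commute)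
  define X where "X z = (\<Sum>l. \<Sum>k. ennreal ((Z z (e l) \<bullet> e k)\<^sup>2))" for z
  have X_norm: "X z = (\<Sum>l. ennreal ((norm (Z z (e l)))\<^sup>2))" for z
    by (simp add: X_def e_enn)
  \<comment> \<open>Symmetry moves Z onto the basis vectors; Cauchy-Schwarz then bounds the operator
    norm by the Hilbert-Schmidt norm.\<close>
  have Z_le: "ennreal ((norm (Z z f))\<^sup>2) \<le> ennreal ((norm f)\<^sup>2) * X z" for z f
  proof -
    have "ennreal ((norm (Z z f))\<^sup>2) = (\<Sum>l. ennreal ((Z z f \<bullet> e l)\<^sup>2))"
      by (simp add: e_enn)
    also have "\<dots> \<le> (\<Sum>l. ennreal ((norm f)\<^sup>2) * ennreal ((norm (Z z (e l)))\<^sup>2))"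
    proof (intro suminf_le summableI)
      fix l
      have "(Z z f \<bullet> e l)\<^sup>2 = (f \<bullet> Z z (e l))\<^sup>2"
        by (simp add: Z_sym)
      also have "\<dots> \<le> (norm f)\<^sup>2 * (norm (Z z (e l)))\<^sup>2"
        using Cauchy_Schwarz_ineq[of f "Z z (e l)"] by (simp add: power2_norm_eq_inner)
      finally show "ennreal ((Z z f \<bullet> e l)\<^sup>2) \<le> ennreal ((norm f)\<^sup>2) * ennreal ((norm (Z z (e l)))\<^sup>2)"
        by (simp add: ennreal_leI flip: ennreal_mult)
    qed
    also have "\<dots> = ennreal ((norm f)\<^sup>2) * X z"
      by (simp add: X_norm)
    finally show ?thesis .
  qed
  have comp: "(\<lambda>z. \<phi> (z j)) \<in> borel_measurable ?P" if "j < n" for j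
    by (rule measurable_compose[OF _ \<phi>], rule measurable_component_singleton) (use that in simp)
  have Z_meas[measurable]: "(\<lambda>z. Z z f \<bullet> g) \<in> borel_measurable ?P" for f g
    unfolding Z_inner
    by (intro borel_measurable_diff borel_measurable_divide borel_measurable_sum borel_measurable_times
        borel_measurable_inner comp borel_measurable_const) auto
  have X_meas[measurable]: "X \<in> borel_measurable ?P"
    unfolding X_def[abs_def] by measurable
  have "(\<integral>\<^sup>+z. X z \<partial>?P) = (\<Sum>l. \<Sum>k. \<integral>\<^sup>+z. ennreal ((Z z (e l) \<bullet> e k)\<^sup>2) \<partial>?P)"
    unfolding X_def by (simp add: nn_integral_suminf)
  also have "\<dots> \<le> (\<Sum>l. \<Sum>k. \<integral>\<^sup>+z. ennreal (1 / real n) * ennreal (((\<phi> z \<bullet> e l) * (\<phi> z \<bullet> e k))\<^sup>2) \<partial>M)"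
  proof (intro suminf_le summableI)
    fix l k
    define \<psi> where "\<psi> z = (\<phi> z \<bullet> e l) * (\<phi> z \<bullet> e k)" for z
    have [measurable]: "\<psi> \<in> borel_measurable M"
      unfolding \<psi>_def[abs_def] by measurable
    have bd: "\<bar>\<psi> z\<bar> \<le> (b * norm (e l)) * (b * norm (e k))" if "z \<in> space M" for z
    proof -
      have "\<bar>\<phi> z \<bullet> v\<bar> \<le> b * norm v" for v
        using Cauchy_Schwarz_ineq2[of "\<phi> z" v] mult_right_mono[OF b[OF that], of "norm v"] by simp
      then show ?thesis
        unfolding \<psi>_def abs_mult
        by (intro mult_mono) (auto intro: order_trans[OF abs_ge_zero])
    qed
    have bd2: "\<bar>(\<psi> z)\<^sup>2\<bar> \<le> ((b * norm (e l)) * (b * norm (e k)))\<^sup>2" if "z \<in> space M" for z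
      using power_mono[OF bd[OF that], of 2] by simp
    have "(\<integral>\<^sup>+z. ennreal ((Z z (e l) \<bullet> e k)\<^sup>2) \<partial>?P)
      = (\<integral>\<^sup>+z. ennreal (((\<Sum>j<n. \<psi> (z j)) / real n - (\<integral>z. \<psi> z \<partial>M))\<^sup>2) \<partial>?P)"
      by (simp add: Z_inner \<psi>_def)
    also have "\<dots> \<le> ennreal ((\<integral>z. (\<psi> z)\<^sup>2 \<partial>M) / real n)"
      by (rule nn_integral_PiM_average_variance[OF _ bd n]) simp_all
    also have "\<dots> = ennreal (1 / real n) * (\<integral>\<^sup>+z. ennreal ((\<psi> z)\<^sup>2) \<partial>M)"
    proof -
      have "integrable M (\<lambda>z. (\<psi> z)\<^sup>2)"
        by (rule integrable_real_bounded[OF _ bd2]) simp_all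
      then have "(\<integral>\<^sup>+z. ennreal ((\<psi> z)\<^sup>2) \<partial>M) = ennreal (\<integral>z. (\<psi> z)\<^sup>2 \<partial>M)"
        by (rule nn_integral_eq_integral) simp
      then show ?thesis
        by (simp flip: ennreal_mult)
    qed
    also have "\<dots> = (\<integral>\<^sup>+z. ennreal (1 / real n) * ennreal ((\<psi> z)\<^sup>2) \<partial>M)"
      by (rule nn_integral_cmult[symmetric]) simp
    finally show "(\<integral>\<^sup>+z. ennreal ((Z z (e l) \<bullet> e k)\<^sup>2) \<partial>?P)
        \<le> (\<integral>\<^sup>+z. ennreal (1 / real n) * ennreal (((\<phi> z \<bullet> e l) * (\<phi> z \<bullet> e k))\<^sup>2) \<partial>M)"
      by (simp add: \<psi>_def)
  qed
  also have "\<dots> = (\<integral>\<^sup>+z. (\<Sum>l. \<Sum>k. ennreal (1 / real n) * ennreal (((\<phi> z \<bullet> e l) * (\<phi> z \<bullet> e k))\<^sup>2)) \<partial>M)"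
  proof (subst nn_integral_suminf)
    show "(\<Sum>l. \<Sum>k. \<integral>\<^sup>+z. ennreal (1 / real n) * ennreal (((\<phi> z \<bullet> e l) * (\<phi> z \<bullet> e k))\<^sup>2) \<partial>M)
      = (\<Sum>l. \<integral>\<^sup>+z. (\<Sum>k. ennreal (1 / real n) * ennreal (((\<phi> z \<bullet> e l) * (\<phi> z \<bullet> e k))\<^sup>2)) \<partial>M)"
      by (intro suminf_cong nn_integral_suminf[symmetric]) measurable
  qed measurable
  also have "\<dots> = (\<integral>\<^sup>+z. ennreal (1 / real n) * ennreal ((norm (\<phi> z)) ^ 4) \<partial>M)"
  proof (rule nn_integral_cong)
    fix z
    have "(\<Sum>l. \<Sum>k. ennreal (1 / real n) * ennreal (((\<phi> z \<bullet> e l) * (\<phi> z \<bullet> e k))\<^sup>2))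
      = (\<Sum>l. \<Sum>k. ennreal (1 / real n) * (ennreal ((\<phi> z \<bullet> e l)\<^sup>2) * ennreal ((\<phi> z \<bullet> e k)\<^sup>2)))"
      by (simp add: power_mult_distrib ennreal_mult)
    also have "\<dots> = ennreal (1 / real n) * (ennreal ((norm (\<phi> z))\<^sup>2) * ennreal ((norm (\<phi> z))\<^sup>2))"
      by (simp add: e_enn)
    also have "\<dots> = ennreal (1 / real n) * ennreal ((norm (\<phi> z)) ^ 4)"
      by (simp flip: ennreal_mult power_add)
    finally show "(\<Sum>l. \<Sum>k. ennreal (1 / real n) * ennreal (((\<phi> z \<bullet> e l) * (\<phi> z \<bullet> e k))\<^sup>2))
      = ennreal (1 / real n) * ennreal ((norm (\<phi> z)) ^ 4)" .
  qed
  also have "\<dots> = ennreal (1 / real n) * (\<integral>\<^sup>+z. ennreal ((norm (\<phi> z)) ^ 4) \<partial>M)"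
    by (rule nn_integral_cmult) simp
  also have "(\<integral>\<^sup>+z. ennreal ((norm (\<phi> z)) ^ 4) \<partial>M) = ennreal (\<integral>z. (norm (\<phi> z)) ^ 4 \<partial>M)"
  proof (rule nn_integral_eq_integral)
    show "integrable M (\<lambda>z. (norm (\<phi> z)) ^ 4)"
      by (rule integrable_real_bounded[where B = "b ^ 4"]) (use b in \<open>auto intro!: power_mono\<close>)
  qed simp
  finally have X_le: "(\<integral>\<^sup>+z. X z \<partial>?P) \<le> ennreal (1 / real n) * ennreal (\<integral>z. (norm (\<phi> z)) ^ 4 \<partial>M)" .
  \<comment> \<open>The exceptional event: a Hilbert-Schmidt norm of at least \<epsilon>.\<close>
  define F where "F = {z \<in> space ?P. 1 \<le> ennreal (1 / \<epsilon>\<^sup>2) * X z}"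
  have F[measurable]: "F \<in> sets ?P"
    unfolding F_def by measurable
  have "emeasure ?P F \<le> ennreal (1 / \<epsilon>\<^sup>2) * (\<integral>\<^sup>+z. X z * indicator (space ?P) z \<partial>?P)"
    unfolding F_def by (rule nn_integral_Markov_inequality) measurable
  also have "(\<integral>\<^sup>+z. X z * indicator (space ?P) z \<partial>?P) = (\<integral>\<^sup>+z. X z \<partial>?P)"
    by (intro nn_integral_cong) simp
  also have "ennreal (1 / \<epsilon>\<^sup>2) * \<dots> \<le> ennreal (1 / \<epsilon>\<^sup>2) * (ennreal (1 / real n) * ennreal (\<integral>z. (norm (\<phi> z)) ^ 4 \<partial>M))"
    by (intro mult_left_mono X_le) simp
  also have "\<dots> = ennreal ((\<integral>z. (norm (\<phi> z)) ^ 4 \<partial>M) / (real n * \<epsilon>\<^sup>2))"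
    by (simp flip: ennreal_mult)
  finally have "measure ?P F \<le> (\<integral>z. (norm (\<phi> z)) ^ 4 \<partial>M) / (real n * \<epsilon>\<^sup>2)"
    by (simp add: PP.emeasure_eq_measure)
  moreover have "measure ?P (space ?P - F) = 1 - measure ?P F"
    by (rule PP.prob_compl[OF F])
  moreover have "norm (Z z f) \<le> \<epsilon> * norm f" if "z \<in> space ?P - F" for z f
  proof -
    have X1: "ennreal (1 / \<epsilon>\<^sup>2) * X z < 1"
      using that by (auto simp: F_def not_le)
    have "ennreal (1 / \<epsilon>\<^sup>2) * ennreal ((norm (Z z f))\<^sup>2) \<le> ennreal (1 / \<epsilon>\<^sup>2) * (ennreal ((norm f)\<^sup>2) * X z)"
      by (intro mult_left_mono Z_le) simp
    also have "\<dots> = ennreal ((norm f)\<^sup>2) * (ennreal (1 / \<epsilon>\<^sup>2) * X z)"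
      by (simp add: mult.left_commute)
    also have "\<dots> \<le> ennreal ((norm f)\<^sup>2) * 1"
      using X1 by (intro mult_left_mono) auto
    finally have "(norm (Z z f))\<^sup>2 / \<epsilon>\<^sup>2 \<le> (norm f)\<^sup>2"
      by (simp flip: ennreal_mult)
    then have "(norm (Z z f))\<^sup>2 \<le> (\<epsilon> * norm f)\<^sup>2"
      using \<epsilon> by (simp add: power_mult_distrib field_simps)
    then show ?thesis
      by (rule power2_le_imp_le) (use \<epsilon> in simp)
  qed
  ultimately show ?thesis
    using F by (intro bexI[of _ "space ?P - F"]) (auto simp: Z_def)
qed

section \<open>Gradient descent as a spectral filter\<close>

primrec landweber :: "real \<Rightarrow> ('k::real_vector \<Rightarrow> 'k) \<Rightarrow> 'k \<Rightarrow> nat \<Rightarrow> 'k" where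
  "landweber \<eta> A b 0 = 0"
| "landweber \<eta> A b (Suc t) = landweber \<eta> A b t - \<eta> *\<^sub>R (A (landweber \<eta> A b t) - b)"

definition residual_poly :: "real \<Rightarrow> nat \<Rightarrow> real poly" where
  "residual_poly \<eta> t = [:1, - \<eta>:] ^ t"

text \<open>The truncated Neumann series for 1/u, that is, the filter g with 1 - u g(u) = (1 -
  \<eta> u)^t.\<close>

definition filter_poly :: "real \<Rightarrow> nat \<Rightarrow> real poly" where
  "filter_poly \<eta> t = (\<Sum>s<t. smult \<eta> (residual_poly \<eta> s))"

lemma poly_residual: "poly (residual_poly \<eta> t) u = (1 - \<eta> * u) ^ t"
  by (simp add: residual_poly_def poly_power algebra_simps)

lemma poly_filter: "poly (filter_poly \<eta> t) u = (\<Sum>s<t. \<eta> * (1 - \<eta> * u) ^ s)"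
  by (simp add: filter_poly_def poly_sum poly_residual)

lemma mult_poly_filter: "u * poly (filter_poly \<eta> t) u = 1 - (1 - \<eta> * u) ^ t"
proof -
  have "u * poly (filter_poly \<eta> t) u = (\<eta> * u) * (\<Sum>s<t. (1 - \<eta> * u) ^ s)"
    by (simp add: poly_filter sum_distrib_left algebra_simps)
  also have "\<dots> = 1 - (1 - \<eta> * u) ^ t"
    using one_diff_power_eq[of "1 - \<eta> * u" t] by simp
  finally show ?thesis .
qed

lemma filter_poly_X: "[:0, 1:] * filter_poly \<eta> t = 1 - residual_poly \<eta> t"
proof -
  have "poly ([:0, 1:] * filter_poly \<eta> t) u = poly (1 - residual_poly \<eta> t) u" for u
    using mult_poly_filter[of u \<eta> t] by (simp add: poly_residual)
  then show ?thesis
    using poly_eq_poly_eq_iff by blast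
qed

text \<open>Horner form of the recursion in \<open>landweber\<close>: multiply by 1 - \<eta> u and
  add \<eta>.\<close>

lemma filter_poly_Suc: "filter_poly \<eta> (Suc t) = [:1, - \<eta>:] * filter_poly \<eta> t + [:\<eta>:]"
proof -
  have "poly (filter_poly \<eta> (Suc t)) u = poly ([:1, - \<eta>:] * filter_poly \<eta> t + [:\<eta>:]) u" for u
  proof -
    have "poly ([:1, - \<eta>:] * filter_poly \<eta> t + [:\<eta>:]) u
      = poly (filter_poly \<eta> t) u - \<eta> * (u * poly (filter_poly \<eta> t) u) + \<eta>"
      by (simp add: algebra_simps)
    also have "\<dots> = poly (filter_poly \<eta> t) u + \<eta> * (1 - \<eta> * u) ^ t"
      unfolding mult_poly_filter by (simp add: algebra_simps)
    finally show ?thesis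
      by (simp add: poly_filter)
  qed
  then show ?thesis
    using poly_eq_poly_eq_iff by blast
qed

lemma power_one_minus_bounds:
  fixes x :: real
  assumes "0 \<le> x" "x \<le> 1"
  shows "0 \<le> (1 - x) ^ t" "(1 - x) ^ t \<le> 1"
  using assms by (auto intro: power_le_one)

text \<open>The powers decrease, so m + 1 copies of the last term are at most the geometric sum,
  which telescopes to 1 - (1 - x)^(m+1).\<close>

lemma mult_power_one_minus_le:
  fixes x :: real
  assumes "0 \<le> x" "x \<le> 1"
  shows "x * (1 - x) ^ m \<le> 1 / (real m + 1)"
proof -
  have "(real m + 1) * (x * (1 - x) ^ m) = (\<Sum>s<Suc m. x * (1 - x) ^ m)"
    by simp
  also have "\<dots> \<le> (\<Sum>s<Suc m. x * (1 - x) ^ s)"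
    using assms by (intro sum_mono mult_left_mono power_decreasing) auto
  also have "\<dots> = 1 - (1 - x) ^ Suc m"
    using one_diff_power_eq[of "1 - x" "Suc m"] by (simp only: sum_distrib_left[symmetric]) simp
  also have "\<dots> \<le> 1"
    using power_one_minus_bounds[OF assms, of "Suc m"] by simp
  finally show ?thesis
    by (simp add: field_simps)
qed

locale step_size =
  fixes \<eta> a :: real
  assumes \<eta>_pos: "0 < \<eta>" and \<eta>_le: "\<eta> * a \<le> 1"
begin

lemma eta_mult:
  assumes "u \<in> {0..a}"
  shows "0 \<le> \<eta> * u" "\<eta> * u \<le> 1"
proof -
  show "0 \<le> \<eta> * u"
    using assms \<eta>_pos by simp
  have "\<eta> * u \<le> \<eta> * a"
    using assms \<eta>_pos by (intro mult_left_mono) auto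
  then show "\<eta> * u \<le> 1"
    using \<eta>_le by simp
qed

lemma residual_bounds:
  assumes "u \<in> {0..a}"
  shows "0 \<le> poly (residual_poly \<eta> t) u" "poly (residual_poly \<eta> t) u \<le> 1"
  unfolding poly_residual using power_one_minus_bounds eta_mult[OF assms] by auto

lemma filter_bounds:
  assumes "u \<in> {0..a}"
  shows "0 \<le> poly (filter_poly \<eta> t) u" "poly (filter_poly \<eta> t) u \<le> \<eta> * real t"
    "0 \<le> u * poly (filter_poly \<eta> t) u" "u * poly (filter_poly \<eta> t) u \<le> 1"
proof -
  note b = residual_bounds[OF assms, unfolded poly_residual]
  show *: "0 \<le> poly (filter_poly \<eta> t) u"
    unfolding poly_filter using b \<eta>_pos by (intro sum_nonneg) auto
  have "(\<Sum>s<t. \<eta> * (1 - \<eta> * u) ^ s) \<le> (\<Sum>s<t. \<eta> * 1)"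
    using b \<eta>_pos by (intro sum_mono mult_left_mono) auto
  then show "poly (filter_poly \<eta> t) u \<le> \<eta> * real t"
    by (simp add: poly_filter mult.commute)
  show "0 \<le> u * poly (filter_poly \<eta> t) u"
    using * assms by simp
  show "u * poly (filter_poly \<eta> t) u \<le> 1"
    unfolding mult_poly_filter using b by simp
qed

lemma mult_residual_le:
  assumes "u \<in> {0..a}"
  shows "u * poly (residual_poly \<eta> t) u \<le> 1 / (\<eta> * (real t + 1))"
proof -
  have "(\<eta> * u) * (1 - \<eta> * u) ^ t \<le> 1 / (real t + 1)"
    using mult_power_one_minus_le eta_mult[OF assms] by blast
  then have "(u * (1 - \<eta> * u) ^ t) * \<eta> \<le> 1 / (real t + 1)"
    by (simp add: mult_ac)
  then have "u * (1 - \<eta> * u) ^ t \<le> 1 / (real t + 1) / \<eta>"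
    by (simp only: pos_le_divide_eq[OF \<eta>_pos])
  then show ?thesis
    by (simp add: poly_residual mult.commute)
qed

end

lemma landweber_eq_filter:
  assumes "bounded_linear A"
  shows "landweber \<eta> A b t = poly_op (filter_poly \<eta> t) A b"
proof (induction t)
  case (Suc t)
  note lin = bounded_linear.linear[OF assms]
  show ?case
    by (simp only: landweber.simps Suc filter_poly_Suc poly_op_add poly_op_mult[OF assms]
        poly_op_const poly_op_linear)
       (simp add: algebra_simps)
qed (simp add: filter_poly_def)

section \<open>Error decomposition and perturbation formulas\<close>

text \<open>The filter acts on the defect of f in the equation A f = b (variance), the residual
  polynomial acts on f itself (bias).\<close>

lemma landweber_error:
  assumes "bounded_linear A"
  shows "landweber \<eta> A b t - f
    = poly_op (filter_poly \<eta> t) A (b - A f) - poly_op (residual_poly \<eta> t) A f"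
proof -
  have "poly_op (filter_poly \<eta> t) A (A f) = poly_op (filter_poly \<eta> t * [:0, 1:]) A f"
    by (subst poly_op_mult[OF assms]) simp
  also have "filter_poly \<eta> t * [:0, 1:] = 1 - residual_poly \<eta> t"
    using filter_poly_X[of \<eta> t] by (simp only: mult.commute)
  finally have "poly_op (filter_poly \<eta> t) A (A f) = f - poly_op (residual_poly \<eta> t) A f"
    by (simp add: poly_op_diff)
  then show ?thesis
    by (simp add: landweber_eq_filter[OF assms] linear_diff[OF bounded_linear.linear[OF bounded_linear_poly_op[OF assms]]])
qed

lemma poly_op_residual_Suc:
  assumes "bounded_linear A"
  shows "poly_op (residual_poly \<eta> (Suc t)) A f
    = poly_op (residual_poly \<eta> t) A f - \<eta> *\<^sub>R A (poly_op (residual_poly \<eta> t) A f)"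
proof -
  have "residual_poly \<eta> (Suc t) = [:1, - \<eta>:] * residual_poly \<eta> t"
    by (simp only: residual_poly_def power_Suc)
  then show ?thesis
    by (simp only: poly_op_mult[OF assms] poly_op_linear) simp
qed

text \<open>A discrete Duhamel formula. The residual of A stands outside, where it can be smoothed
  by \<open>S\<close>; the residual of B stands inside, where the regularity of w with respect to B
  acts.\<close>

lemma residual_telescope:
  assumes A: "bounded_linear A" and B: "bounded_linear B"
  shows "poly_op (residual_poly \<eta> t) A w - poly_op (residual_poly \<eta> t) B w
    = (\<Sum>s<t. \<eta> *\<^sub>R poly_op (residual_poly \<eta> (t - Suc s)) A
        (B (poly_op (residual_poly \<eta> s) B w) - A (poly_op (residual_poly \<eta> s) B w)))"
proof (induction t)
  case 0
  then show ?case
    by (simp add: residual_poly_def)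
next
  case (Suc t)
  note lin = bounded_linear.linear[OF bounded_linear_poly_op[OF A]]
  note linA = bounded_linear.linear[OF A]
  define w' where "w' s = poly_op (residual_poly \<eta> s) B w" for s
  define D where "D s = B (w' s) - A (w' s)" for s
  have IH: "poly_op (residual_poly \<eta> t) A w - w' t
    = (\<Sum>s<t. \<eta> *\<^sub>R poly_op (residual_poly \<eta> (t - Suc s)) A (D s))"
    using Suc by (simp add: w'_def D_def)
  have R: "poly_op (residual_poly \<eta> (Suc k)) A v = poly_op (residual_poly \<eta> k) A v
      - \<eta> *\<^sub>R A (poly_op (residual_poly \<eta> k) A v)" for k v
    by (rule poly_op_residual_Suc[OF A])
  have "poly_op (residual_poly \<eta> (Suc t)) A w - w' (Suc t)
    = ((poly_op (residual_poly \<eta> t) A w - w' t) - \<eta> *\<^sub>R A (poly_op (residual_poly \<eta> t) A w - w' t))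
      + \<eta> *\<^sub>R D t"
    by (simp add: w'_def D_def R poly_op_residual_Suc[OF B] linear_diff[OF linA] algebra_simps)
  also have "(poly_op (residual_poly \<eta> t) A w - w' t) - \<eta> *\<^sub>R A (poly_op (residual_poly \<eta> t) A w - w' t)
    = (\<Sum>s<t. \<eta> *\<^sub>R poly_op (residual_poly \<eta> (Suc t - Suc s)) A (D s))"
    unfolding IH
    by (simp add: linear_sum[OF linA] linear_scale[OF linA] sum_subtractf[symmetric] scaleR_sum_right
        Suc_diff_Suc[symmetric] R algebra_simps scaleR_diff_right)
  also have "\<eta> *\<^sub>R D t = \<eta> *\<^sub>R poly_op (residual_poly \<eta> (Suc t - Suc t)) A (D t)"
    by (simp add: residual_poly_def)
  finally show ?case
    by (simp add: w'_def D_def)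
qed

text \<open>The same Duhamel principle for whole iterations. It is used in both directions: with the
  perturbed operator outside for a crude norm bound, with the unperturbed one outside for a bound
  after \<open>S\<close>.\<close>

lemma landweber_perturbation:
  assumes A: "bounded_linear A"
  shows "landweber \<eta> A' b' t - landweber \<eta> A b t
    = (\<Sum>s<t. \<eta> *\<^sub>R poly_op (residual_poly \<eta> (t - Suc s)) A
        ((b' - b) - (A' (landweber \<eta> A' b' s) - A (landweber \<eta> A' b' s))))"
proof (induction t)
  case (Suc t)
  note linA = bounded_linear.linear[OF A]
  define f' f where "f' = landweber \<eta> A' b'" and "f = landweber \<eta> A b"
  define D where "D s = (b' - b) - (A' (f' s) - A (f' s))" for s
  have IH: "f' t - f t = (\<Sum>s<t. \<eta> *\<^sub>R poly_op (residual_poly \<eta> (t - Suc s)) A (D s))"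
    using Suc by (simp add: f'_def f_def D_def)
  have R: "poly_op (residual_poly \<eta> (Suc k)) A v = poly_op (residual_poly \<eta> k) A v
      - \<eta> *\<^sub>R A (poly_op (residual_poly \<eta> k) A v)" for k v
    by (rule poly_op_residual_Suc[OF A])
  have "f' (Suc t) - f (Suc t) = ((f' t - f t) - \<eta> *\<^sub>R A (f' t - f t)) + \<eta> *\<^sub>R D t"
    by (simp add: f'_def f_def D_def linear_diff[OF linA] algebra_simps)
  also have "(f' t - f t) - \<eta> *\<^sub>R A (f' t - f t)
    = (\<Sum>s<t. \<eta> *\<^sub>R poly_op (residual_poly \<eta> (Suc t - Suc s)) A (D s))"
    unfolding IH
    by (simp add: linear_sum[OF linA] linear_scale[OF linA] sum_subtractf[symmetric] scaleR_sum_right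
        Suc_diff_Suc[symmetric] R algebra_simps scaleR_diff_right)
  also have "\<eta> *\<^sub>R D t = \<eta> *\<^sub>R poly_op (residual_poly \<eta> (Suc t - Suc t)) A (D t)"
    by (simp add: residual_poly_def)
  finally show ?case
    by (simp add: f'_def f_def D_def)
qed simp

lemma sum_inverse_sqrt_le: "(\<Sum>j<t. 1 / sqrt (real j + 1)) \<le> 2 * sqrt (real t)"
proof (induction t)
  case (Suc t)
  have "1 / sqrt (real t + 1) \<le> 2 * (sqrt (real t + 1) - sqrt (real t))"
  proof -
    have "(sqrt (real t + 1) - sqrt (real t)) * (sqrt (real t + 1) + sqrt (real t)) = 1"
      by (simp add: algebra_simps flip: power2_eq_square)
    then have "1 \<le> (sqrt (real t + 1) - sqrt (real t)) * (2 * sqrt (real t + 1))"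
      by (smt (verit) mult_left_mono real_sqrt_le_mono)
    then show ?thesis
      by (simp add: field_simps)
  qed
  then show ?case
    using Suc by (simp add: algebra_simps)
qed simp

text \<open>A discrete Beta(1/2, 1/2) integral. With x = t - s and y = s + 1 the sum x + y = t + 1
  is fixed, and sqrt (x + y) \<le> sqrt x + sqrt y separates the product into two single sums. A
  bound uniform in t keeps logarithms out of the rate for r > 1.\<close>

lemma sum_inverse_sqrt_mult_le: "(\<Sum>s<t. 1 / sqrt (real (t - s) * (real s + 1))) \<le> 4"
proof (cases "t = 0")
  case False
  have le: "1 / sqrt (real (t - s) * (real s + 1))
    \<le> 1 / sqrt (real t + 1) * (1 / sqrt (real (t - s)) + 1 / sqrt (real s + 1))" if "s < t" for s
  proof -
    define x y where "x = real (t - s)" and "y = real s + 1"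
    have xy: "x > 0" "y > 0" "real t + 1 = x + y"
      using that by (auto simp: x_def y_def)
    have "sqrt (x + y) \<le> sqrt x + sqrt y"
      using xy by (intro sqrt_add_le_add_sqrt) auto
    then have "sqrt (x + y) / (sqrt (x + y) * (sqrt x * sqrt y))
        \<le> (sqrt x + sqrt y) / (sqrt (x + y) * (sqrt x * sqrt y))"
      using xy by (intro divide_right_mono) auto
    then show ?thesis
      using xy unfolding x_def[symmetric] y_def[symmetric] xy(3) real_sqrt_mult
      by (simp add: field_simps)
  qed
  have "(\<Sum>s<t. 1 / sqrt (real (t - s) * (real s + 1)))
    \<le> (\<Sum>s<t. 1 / sqrt (real t + 1) * (1 / sqrt (real (t - s)) + 1 / sqrt (real s + 1)))"
    by (intro sum_mono le) simp
  also have "\<dots> = 1 / sqrt (real t + 1) * ((\<Sum>s<t. 1 / sqrt (real (t - s))) + (\<Sum>s<t. 1 / sqrt (real s + 1)))"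
    by (simp only: sum_distrib_left[symmetric] sum.distrib)
  also have "(\<Sum>s<t. 1 / sqrt (real (t - s))) = (\<Sum>s<t. 1 / sqrt (real s + 1))"
    by (subst sum.nat_diff_reindex[symmetric]) (auto intro!: sum.cong simp: of_nat_diff)
  also have "1 / sqrt (real t + 1) * ((\<Sum>s<t. 1 / sqrt (real s + 1)) + (\<Sum>s<t. 1 / sqrt (real s + 1)))
    \<le> 1 / sqrt (real t + 1) * (2 * sqrt (real t) + 2 * sqrt (real t))"
    by (intro mult_left_mono add_mono sum_inverse_sqrt_le) auto
  also have "\<dots> = 4 * (sqrt (real t) / sqrt (real t + 1))"
    by simp
  also have "\<dots> \<le> 4 * 1"
    by (intro mult_left_mono) (auto simp: divide_le_eq)
  finally show ?thesis by simp
qed simp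

section \<open>Filters under a comparison of quadratic forms\<close>

text \<open>\<open>A\<close> is the empirical covariance operator and \<open>S\<close> the inclusion into \<open>L\<^sup>2\<close>, so that
  \<open>comparison\<close> expresses that the regularised population covariance operator is dominated by
  the regularised empirical one.\<close>

locale comparison = positive_operator A a + step_size \<eta> a
  for A :: "'k::real_inner \<Rightarrow> 'k" and a \<eta> :: real +
  fixes S :: "'k \<Rightarrow> 'l::real_inner" and lam C :: real and T :: nat
  assumes S: "bounded_linear S"
    and lam: "lam > 0" "lam * (\<eta> * real T) = 1"
    and C: "C \<ge> 0"
    and comparison: "(norm (S f))\<^sup>2 + lam * (norm f)\<^sup>2 \<le> C * (A f \<bullet> f + lam * (norm f)\<^sup>2)"
begin

lemmas linear_S = bounded_linear.linear[OF S]

text \<open>On vectors q(A) v the regularised empirical form is again the form of a polynomial in A,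
  so operator estimates reduce to scalar inequalities on [0, a].\<close>

lemma energy_poly:
  "A (poly_op q A v) \<bullet> poly_op q A v + lam * (norm (poly_op q A v))\<^sup>2 = poly_op ([:lam, 1:] * q\<^sup>2) A v \<bullet> v"
proof -
  have "poly_op ([:lam, 1:] * q\<^sup>2) A v \<bullet> v = poly_op (q * [:lam, 1:] * q) A v \<bullet> v"
    by (simp only: power2_eq_square mult_ac)
  also have "\<dots> = (lam *\<^sub>R poly_op q A v + A (poly_op q A v)) \<bullet> poly_op q A v"
    by (simp add: poly_op_mult[OF bounded_linear_A] poly_op_sym del: mult_pCons_left mult_pCons_right)
  finally show ?thesis
    by (simp add: inner_add power2_norm_eq_inner)
qed

lemma S_poly_op_le:
  assumes "\<And>u. u \<in> {0..a} \<Longrightarrow> (u + lam) * (poly q u)\<^sup>2 \<le> D"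
  shows "norm (S (poly_op q A v)) \<le> sqrt (C * D) * norm v"
proof -
  have "(norm (S (poly_op q A v)))\<^sup>2 \<le> C * (poly_op ([:lam, 1:] * q\<^sup>2) A v \<bullet> v)"
    using comparison[of "poly_op q A v"] lam by (simp only: energy_poly) (smt (verit) zero_le_mult_iff zero_le_power2)
  also have "\<dots> \<le> C * (poly_op [:D:] A v \<bullet> v)"
    using assms by (intro mult_left_mono poly_op_mono C) (simp add: algebra_simps)
  also have "\<dots> = (C * D) * (norm v)\<^sup>2"
    by (simp add: power2_norm_eq_inner)
  finally have "norm (S (poly_op q A v)) \<le> sqrt ((C * D) * (norm v)\<^sup>2)"
    by (rule real_le_rsqrt)
  then show ?thesis
    by (simp add: real_sqrt_mult)
qed

text \<open>A bound on z in the dual of the population energy norm transfers to the dual of the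
  empirical one at the price of sqrt C.\<close>

lemma duality:
  assumes z: "\<And>y. \<bar>z \<bullet> y\<bar> \<le> \<zeta> * sqrt ((norm (S y))\<^sup>2 + lam * (norm y)\<^sup>2)" and \<zeta>: "\<zeta> \<ge> 0"
  shows "z \<bullet> y \<le> \<zeta> * sqrt (C * (A y \<bullet> y + lam * (norm y)\<^sup>2))"
proof -
  have "z \<bullet> y \<le> \<zeta> * sqrt ((norm (S y))\<^sup>2 + lam * (norm y)\<^sup>2)"
    using z[of y] by simp
  also have "\<dots> \<le> \<zeta> * sqrt (C * (A y \<bullet> y + lam * (norm y)\<^sup>2))"
    by (intro mult_left_mono real_sqrt_le_mono comparison \<zeta>)
  finally show ?thesis .
qed

lemma square_le_imp:
  fixes Q k :: real
  assumes "Q \<le> k * sqrt Q" "0 \<le> k" "0 \<le> Q"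
  shows "Q \<le> k\<^sup>2"
proof -
  have "sqrt Q * sqrt Q \<le> k * sqrt Q"
    using assms by simp
  then have "sqrt Q \<le> k"
    using assms mult_le_cancel_right[of "sqrt Q" "sqrt Q" k] by (cases "Q = 0") auto
  then have "(sqrt Q)\<^sup>2 \<le> k\<^sup>2"
    using assms by (intro power_mono) auto
  then show ?thesis
    using assms by simp
qed

text \<open>Testing z against ((A + \<lambda>) q(A)^2) z bounds the energy Q of q(A) z by a multiple
  of its own square root, so the square root cancels. The comparison is used twice, once for z and
  once for \<open>S\<close>, each time costing sqrt C.\<close>

lemma S_poly_op_dual_le:
  assumes z: "\<And>y. \<bar>z \<bullet> y\<bar> \<le> \<zeta> * sqrt ((norm (S y))\<^sup>2 + lam * (norm y)\<^sup>2)" and \<zeta>: "\<zeta> \<ge> 0"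
    and q: "\<And>u. u \<in> {0..a} \<Longrightarrow> (u + lam) * \<bar>poly q u\<bar> \<le> D" and D: "D \<ge> 0"
  shows "norm (S (poly_op q A z)) \<le> C * \<zeta> * D"
proof -
  define l where "l = [:lam, 1:]"
  define Q where "Q = poly_op (l * q\<^sup>2) A z \<bullet> z"
  have l: "poly l u = u + lam" for u
    by (simp add: l_def)
  have "0 \<le> Q"
    unfolding Q_def by (rule poly_op_nonneg) (use lam in \<open>simp add: l\<close>)
  have "Q \<le> \<zeta> * sqrt (C * (poly_op (l * (l * q\<^sup>2)\<^sup>2) A z \<bullet> z))"
    using duality[OF z \<zeta>, of "poly_op (l * q\<^sup>2) A z"] unfolding energy_poly
    by (simp add: Q_def l_def inner_commute)
  also have "\<dots> \<le> \<zeta> * sqrt (C * (poly_op (smult (D\<^sup>2) (l * q\<^sup>2)) A z \<bullet> z))"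
  proof (intro mult_left_mono real_sqrt_le_mono poly_op_mono \<zeta> C)
    fix u assume u: "u \<in> {0..a}"
    have "((u + lam) * \<bar>poly q u\<bar>)\<^sup>2 \<le> D\<^sup>2"
      using q[OF u] u lam by (intro power_mono) auto
    then have "((u + lam)\<^sup>2 * (poly q u)\<^sup>2) * ((u + lam) * (poly q u)\<^sup>2) \<le> D\<^sup>2 * ((u + lam) * (poly q u)\<^sup>2)"
      using u lam by (intro mult_right_mono) (auto simp: power_mult_distrib)
    then show "poly (l * (l * q\<^sup>2)\<^sup>2) u \<le> poly (smult (D\<^sup>2) (l * q\<^sup>2)) u"
      by (simp add: l power2_eq_square mult_ac)
  qed
  also have "\<dots> = (\<zeta> * (sqrt C * D)) * sqrt Q"
    using D by (simp add: poly_op_smult Q_def[symmetric] real_sqrt_mult)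
  finally have Q: "Q \<le> (\<zeta> * (sqrt C * D))\<^sup>2"
    using \<zeta> C D \<open>0 \<le> Q\<close> by (intro square_le_imp) auto
  have "(norm (S (poly_op q A z)))\<^sup>2 \<le> C * Q"
    using comparison[of "poly_op q A z"] lam unfolding energy_poly l_def[symmetric] Q_def[symmetric]
    by (smt (verit) zero_le_mult_iff zero_le_power2)
  also have "\<dots> \<le> C * (\<zeta> * (sqrt C * D))\<^sup>2"
    by (intro mult_left_mono Q C)
  also have "\<dots> = (C * \<zeta> * D)\<^sup>2"
    using C by (simp add: power_mult_distrib power2_eq_square)
  finally show ?thesis
    by (rule power2_le_imp_le) (use C \<zeta> D in simp)
qed

text \<open>The same self-bounding argument with test vector q(A)^2 z, for the plain norm; here the
  comparison enters only once.\<close>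

lemma poly_op_dual_le:
  assumes z: "\<And>y. \<bar>z \<bullet> y\<bar> \<le> \<zeta> * sqrt ((norm (S y))\<^sup>2 + lam * (norm y)\<^sup>2)" and \<zeta>: "\<zeta> \<ge> 0"
    and q: "\<And>u. u \<in> {0..a} \<Longrightarrow> (u + lam) * (poly q u)\<^sup>2 \<le> D" and D: "D \<ge> 0"
  shows "norm (poly_op q A z) \<le> \<zeta> * sqrt (C * D)"
proof -
  define l where "l = [:lam, 1:]"
  define Q where "Q = poly_op (q\<^sup>2) A z \<bullet> z"
  have l: "poly l u = u + lam" for u
    by (simp add: l_def)
  have Q_norm: "Q = (norm (poly_op q A z))\<^sup>2"
    unfolding Q_def power2_norm_eq_inner
    by (simp add: power2_eq_square poly_op_mult[OF bounded_linear_A] poly_op_sym)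
  have "Q \<le> \<zeta> * sqrt (C * (poly_op (l * (q\<^sup>2)\<^sup>2) A z \<bullet> z))"
    using duality[OF z \<zeta>, of "poly_op (q\<^sup>2) A z"] unfolding energy_poly
    by (simp add: Q_def l_def inner_commute)
  also have "\<dots> \<le> \<zeta> * sqrt (C * (poly_op (smult D (q\<^sup>2)) A z \<bullet> z))"
  proof (intro mult_left_mono real_sqrt_le_mono poly_op_mono \<zeta> C)
    fix u assume u: "u \<in> {0..a}"
    have "((u + lam) * (poly q u)\<^sup>2) * (poly q u)\<^sup>2 \<le> D * (poly q u)\<^sup>2"
      by (intro mult_right_mono q u) simp
    then show "poly (l * (q\<^sup>2)\<^sup>2) u \<le> poly (smult D (q\<^sup>2)) u"
      by (simp add: l power2_eq_square mult_ac)
  qed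
  also have "\<dots> = (\<zeta> * sqrt (C * D)) * sqrt Q"
    using D by (simp add: poly_op_smult Q_def[symmetric] real_sqrt_mult)
  finally have "Q \<le> (\<zeta> * sqrt (C * D))\<^sup>2"
    using \<zeta> C D by (intro square_le_imp) (auto simp: Q_norm)
  then show ?thesis
    unfolding Q_norm by (rule power2_le_imp_le) (use C \<zeta> D in simp)
qed

lemma eta_t_le:
  assumes "t \<le> T"
  shows "\<eta> * real t \<le> 1 / lam"
proof -
  have "\<eta> * real t \<le> \<eta> * real T"
    using assms \<eta>_pos by (intro mult_left_mono) auto
  also have "\<dots> = 1 / lam"
    using lam by (simp add: field_simps)
  finally show ?thesis .
qed

lemma filter_le:
  assumes "u \<in> {0..a}" "t \<le> T"
  shows "(u + lam) * \<bar>poly (filter_poly \<eta> t) u\<bar> \<le> 2"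
    "(u + lam) * (poly (filter_poly \<eta> t) u)\<^sup>2 \<le> 2 / lam"
proof -
  let ?g = "poly (filter_poly \<eta> t) u"
  note b = filter_bounds[OF assms(1), of t]
  have "?g \<le> 1 / lam"
    using b(2) eta_t_le[OF assms(2)] by simp
  then have "lam * ?g \<le> 1"
    using lam by (simp add: field_simps)
  \<comment> \<open>Both u g(u) and \<lambda> g(u) are at most 1, the latter since \<eta> t \<le>
    1/\<lambda>.\<close>
  then show *: "(u + lam) * \<bar>?g\<bar> \<le> 2"
    using b by (simp add: algebra_simps)
  have "(u + lam) * ?g\<^sup>2 = ((u + lam) * \<bar>?g\<bar>) * ?g"
    using b by (simp add: power2_eq_square)
  also have "\<dots> \<le> 2 * (1 / lam)"
    using * \<open>?g \<le> 1 / lam\<close> b by (intro mult_mono) auto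
  finally show "(u + lam) * ?g\<^sup>2 \<le> 2 / lam"
    by simp
qed

text \<open>The squared residual after j steps is the residual after 2 j steps, which handles the
  factor u. The factor \<lambda> is absorbed because \<eta> (j + 1) \<le> \<eta> T =
  1/\<lambda>.\<close>

lemma residual_energy_le:
  assumes "u \<in> {0..a}" "j < T"
  shows "(u + lam) * (poly (residual_poly \<eta> j) u)\<^sup>2 \<le> 2 / (\<eta> * (real j + 1))"
proof -
  have "u * (poly (residual_poly \<eta> j) u)\<^sup>2 = u * poly (residual_poly \<eta> (2 * j)) u"
    by (simp add: poly_residual power_mult[symmetric] mult.commute)
  also have "\<dots> \<le> 1 / (\<eta> * (real (2 * j) + 1))"
    by (rule mult_residual_le[OF assms(1)])
  also have "\<dots> \<le> 1 / (\<eta> * (real j + 1))"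
    using \<eta>_pos by (intro divide_left_mono mult_left_mono mult_pos_pos) auto
  finally have 1: "u * (poly (residual_poly \<eta> j) u)\<^sup>2 \<le> 1 / (\<eta> * (real j + 1))" .
  have "lam * (poly (residual_poly \<eta> j) u)\<^sup>2 \<le> lam * 1"
    using residual_bounds[OF assms(1), of j] lam by (intro mult_left_mono power_le_one) auto
  also have "\<dots> \<le> 1 / (\<eta> * (real j + 1))"
  proof -
    have "0 < \<eta> * (real j + 1)"
      using \<eta>_pos by (intro mult_pos_pos) auto
    moreover have "\<eta> * (real j + 1) \<le> 1 / lam"
      using eta_t_le[of "Suc j"] assms(2) by (simp add: add.commute)
    ultimately show ?thesis
      using lam by (simp add: le_divide_eq mult.commute)
  qed
  finally show ?thesis
    using 1 by (simp add: algebra_simps add_divide_distrib[symmetric])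
qed

lemma S_residual_le:
  assumes "j < T"
  shows "norm (S (poly_op (residual_poly \<eta> j) A v)) \<le> sqrt (2 * C / \<eta>) / sqrt (real j + 1) * norm v"
proof -
  have "norm (S (poly_op (residual_poly \<eta> j) A v)) \<le> sqrt (C * (2 / (\<eta> * (real j + 1)))) * norm v"
    by (rule S_poly_op_le) (rule residual_energy_le[OF _ assms])
  also have "C * (2 / (\<eta> * (real j + 1))) = (2 * C / \<eta>) / (real j + 1)"
    by simp
  finally show ?thesis
    by (simp only: real_sqrt_divide)
qed

lemma S_landweber_error_le:
  assumes z: "\<And>y. \<bar>(b - A f) \<bullet> y\<bar> \<le> \<zeta> * sqrt ((norm (S y))\<^sup>2 + lam * (norm y)\<^sup>2)" and \<zeta>: "\<zeta> \<ge> 0"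
    and t: "t \<le> T"
  shows "norm (S (landweber \<eta> A b t - f)) \<le> 2 * C * \<zeta> + norm (S (poly_op (residual_poly \<eta> t) A f))"
proof -
  have "norm (S (poly_op (filter_poly \<eta> t) A (b - A f))) \<le> C * \<zeta> * 2"
    by (rule S_poly_op_dual_le[OF z \<zeta>]) (use filter_le(1) t in auto)
  then show ?thesis
    unfolding landweber_error[OF bounded_linear_A] linear_diff[OF linear_S]
    using norm_triangle_ineq4[of "S (poly_op (filter_poly \<eta> t) A (b - A f))" "S (poly_op (residual_poly \<eta> t) A f)"]
    by (simp add: mult_ac)
qed

lemma landweber_norm_le:
  assumes z: "\<And>y. \<bar>(b - A f) \<bullet> y\<bar> \<le> \<zeta> * sqrt ((norm (S y))\<^sup>2 + lam * (norm y)\<^sup>2)" and \<zeta>: "\<zeta> \<ge> 0"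
    and t: "t \<le> T"
  shows "norm (landweber \<eta> A b t) \<le> 2 * norm f + \<zeta> * sqrt (2 * C / lam)"
proof -
  have "norm (poly_op (filter_poly \<eta> t) A (b - A f)) \<le> \<zeta> * sqrt (C * (2 / lam))"
    by (rule poly_op_dual_le[OF z \<zeta>]) (use filter_le(2) t lam in auto)
  moreover have "norm (poly_op (residual_poly \<eta> t) A f) \<le> 1 * norm f"
    by (rule poly_op_norm_le) (use residual_bounds in auto)
  moreover have "landweber \<eta> A b t = f + poly_op (filter_poly \<eta> t) A (b - A f) - poly_op (residual_poly \<eta> t) A f"
    using landweber_error[OF bounded_linear_A, of \<eta> b t f] by (simp add: algebra_simps)
  ultimately show ?thesis
    using norm_triangle_ineq4[of "f + poly_op (filter_poly \<eta> t) A (b - A f)" "poly_op (residual_poly \<eta> t) A f"]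
      norm_triangle_ineq[of f "poly_op (filter_poly \<eta> t) A (b - A f)"] by (simp add: mult.commute)
qed

lemma dual_of_adjoint:
  assumes "\<And>y. f \<bullet> y = v \<bullet> S y"
  shows "\<bar>f \<bullet> y\<bar> \<le> norm v * sqrt ((norm (S y))\<^sup>2 + lam * (norm y)\<^sup>2)"
proof -
  have "norm (S y) \<le> sqrt ((norm (S y))\<^sup>2 + lam * (norm y)\<^sup>2)"
    using lam by (intro real_le_rsqrt) simp
  then have "norm v * norm (S y) \<le> norm v * sqrt ((norm (S y))\<^sup>2 + lam * (norm y)\<^sup>2)"
    by (rule mult_left_mono) simp
  then show ?thesis
    unfolding assms using Cauchy_Schwarz_ineq2[of v "S y"] by linarith
qed

text \<open>f is the adjoint of \<open>S\<close> applied to v, hence a dual vector of size |v|. For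
  t \<ge> T/2 the product (u + \<lambda>) (1 - \<eta> u)^t is at most 2 \<lambda> + \<lambda>. The
  result saturates at order \<lambda>, so it suffices only up to r = 1.\<close>

lemma bias_low:
  assumes f: "\<And>y. f \<bullet> y = v \<bullet> S y" and t: "T \<le> 2 * t"
  shows "norm (S (poly_op (residual_poly \<eta> t) A f)) \<le> 3 * C * lam * norm v"
proof -
  have "norm (S (poly_op (residual_poly \<eta> t) A f)) \<le> C * norm v * (3 * lam)"
  proof (rule S_poly_op_dual_le[OF dual_of_adjoint[OF f]])
    fix u assume u: "u \<in> {0..a}"
    have "u * poly (residual_poly \<eta> t) u \<le> 1 / (\<eta> * (real t + 1))"
      by (rule mult_residual_le[OF u])
    also have "\<dots> \<le> 2 * lam"
    proof -
      have "\<eta> * real T \<le> \<eta> * (2 * (real t + 1))"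
        using t \<eta>_pos by (intro mult_left_mono) auto
      then have "1 \<le> lam * (\<eta> * (2 * (real t + 1)))"
        using lam mult_left_mono[of "\<eta> * real T" "\<eta> * (2 * (real t + 1))" lam] by simp
      then show ?thesis
        using \<eta>_pos by (simp add: divide_le_eq mult_ac)
    qed
    finally have "u * poly (residual_poly \<eta> t) u \<le> 2 * lam" .
    moreover have "lam * poly (residual_poly \<eta> t) u \<le> lam * 1"
      using residual_bounds[OF u, of t] lam by (intro mult_left_mono) auto
    ultimately show "(u + lam) * \<bar>poly (residual_poly \<eta> t) u\<bar> \<le> 3 * lam"
      using residual_bounds[OF u, of t] by (simp add: algebra_simps)
  qed (use lam in auto)
  then show ?thesis
    by (simp add: mult_ac)
qed

text \<open>The residual of A is compared with that of the population operator B. In the telescoping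
  sum the outer factor decays like (t - s)^(-1/2) by smoothing, the inner one like (s + 1)^(-1/2)
  because f lies in the range of the adjoint of \<open>S\<close>. The Beta sum makes the total
  independent of t and \<eta>.\<close>

lemma bias_high:
  assumes f: "\<And>y. f \<bullet> y = v \<bullet> S y"
    and B: "positive_operator B a"
    and L: "positive_operator L a" and SL: "\<And>x. S (B x) = L (S x)" and Sf: "S f = L v"
    and \<Delta>: "\<And>x. norm (B x - A x) \<le> \<Delta> * norm x" "0 \<le> \<Delta>" and t: "t \<le> T"
  shows "norm (S (poly_op (residual_poly \<eta> t) A f))
    \<le> norm (poly_op (residual_poly \<eta> t * [:0, 1:]) L v) + 4 * sqrt (2 * C) * \<Delta> * norm v"
proof -
  interpret B: positive_operator B a by (rule B)
  interpret L: positive_operator L a by (rule L)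
  have SpB: "S (poly_op p B x) = poly_op p L (S x)" for p x
    by (rule poly_op_intertwine[OF linear_S]) (rule SL)
  have SpBf: "S (poly_op p B f) = poly_op (p * [:0, 1:]) L v" for p
    by (simp add: SpB Sf poly_op_mult[OF L.bounded_linear_A] del: mult_pCons_right)
  define w where "w s = poly_op (residual_poly \<eta> s) B f" for s
  \<comment> \<open>Pairing f with a polynomial of B applied to f gives a form of L at v with one
    extra factor u, and u times a squared residual is at most 1 / (\<eta> (s + 1)).\<close>
  have w: "norm (w s) \<le> norm v / sqrt (\<eta> * (real s + 1))" for s
  proof -
    have "(norm (w s))\<^sup>2 = f \<bullet> poly_op (residual_poly \<eta> s * residual_poly \<eta> s) B f"
      by (simp add: w_def power2_norm_eq_inner poly_op_mult[OF B.bounded_linear_A] B.poly_op_sym)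
    also have "\<dots> = v \<bullet> poly_op (residual_poly \<eta> s * residual_poly \<eta> s * [:0, 1:]) L v"
      by (simp only: f SpBf)
    also have "\<dots> \<le> norm v * norm (poly_op (residual_poly \<eta> s * residual_poly \<eta> s * [:0, 1:]) L v)"
      by (rule norm_cauchy_schwarz)
    also have "\<dots> \<le> norm v * (1 / (\<eta> * (real s + 1)) * norm v)"
    proof (intro mult_left_mono L.poly_op_norm_le)
      fix u assume u: "u \<in> {0..a}"
      note rb = residual_bounds[OF u, of s]
      have "poly (residual_poly \<eta> s * residual_poly \<eta> s * [:0, 1:]) u
        = poly (residual_poly \<eta> s) u * (u * poly (residual_poly \<eta> s) u)"
        by simp
      also have "\<dots> \<le> 1 * (1 / (\<eta> * (real s + 1)))"
        using rb mult_residual_le[OF u, of s] u by (intro mult_mono) auto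
      finally show "\<bar>poly (residual_poly \<eta> s * residual_poly \<eta> s * [:0, 1:]) u\<bar> \<le> 1 / (\<eta> * (real s + 1))"
        using rb u by simp
    qed simp
    also have "\<dots> = (norm v / sqrt (\<eta> * (real s + 1)))\<^sup>2"
      using \<eta>_pos by (simp add: power_divide power2_eq_square)
    finally show ?thesis
      by (rule power2_le_imp_le) (use \<eta>_pos in simp)
  qed
  have "poly_op (residual_poly \<eta> t) A f = poly_op (residual_poly \<eta> t) B f
      + (\<Sum>s<t. \<eta> *\<^sub>R poly_op (residual_poly \<eta> (t - Suc s)) A (B (w s) - A (w s)))"
    using residual_telescope[OF bounded_linear_A B.bounded_linear_A, of \<eta> t f]
    by (simp add: w_def algebra_simps)
  then have "norm (S (poly_op (residual_poly \<eta> t) A f))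
    \<le> norm (S (poly_op (residual_poly \<eta> t) B f))
      + norm (\<Sum>s<t. S (\<eta> *\<^sub>R poly_op (residual_poly \<eta> (t - Suc s)) A (B (w s) - A (w s))))"
    by (simp add: linear_add[OF linear_S] linear_sum[OF linear_S] norm_triangle_ineq)
  also have "norm (\<Sum>s<t. S (\<eta> *\<^sub>R poly_op (residual_poly \<eta> (t - Suc s)) A (B (w s) - A (w s))))
    \<le> (\<Sum>s<t. sqrt (2 * C) * \<Delta> * norm v * (1 / sqrt (real (t - s) * (real s + 1))))"
  proof (intro order_trans[OF norm_sum] sum_mono)
    fix s assume s: "s \<in> {..<t}"
    have ts: "real (t - Suc s) + 1 = real (t - s)"
      using s by (simp add: of_nat_diff)
    have "norm (S (\<eta> *\<^sub>R poly_op (residual_poly \<eta> (t - Suc s)) A (B (w s) - A (w s))))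
      = \<eta> * norm (S (poly_op (residual_poly \<eta> (t - Suc s)) A (B (w s) - A (w s))))"
      using \<eta>_pos by (simp add: linear_scale[OF linear_S])
    also have "\<dots> \<le> \<eta> * (sqrt (2 * C / \<eta>) / sqrt (real (t - Suc s) + 1) * norm (B (w s) - A (w s)))"
      using \<eta>_pos s t by (intro mult_left_mono S_residual_le) auto
    also have "\<dots> \<le> \<eta> * (sqrt (2 * C / \<eta>) / sqrt (real (t - s)) * (\<Delta> * (norm v / sqrt (\<eta> * (real s + 1)))))"
    proof -
      have "norm (B (w s) - A (w s)) \<le> \<Delta> * (norm v / sqrt (\<eta> * (real s + 1)))"
        using \<Delta>(1)[of "w s"] mult_left_mono[OF w[of s] \<Delta>(2)] by linarith
      then show ?thesis
        using \<eta>_pos C unfolding ts by (intro mult_left_mono) auto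
    qed
    also have "\<dots> = sqrt (2 * C) * \<Delta> * norm v * (1 / sqrt (real (t - s) * (real s + 1)))"
    proof -
      define e y where "e = sqrt \<eta>" and "y = real s + 1"
      have e: "e > 0" "\<eta> = e * e"
        using \<eta>_pos by (auto simp: e_def)
      have "sqrt (2 * C / \<eta>) = sqrt (2 * C) / e" "sqrt (\<eta> * y) = e * sqrt y"
        by (simp_all add: e_def real_sqrt_mult real_sqrt_divide)
      then show ?thesis
        unfolding y_def[symmetric] real_sqrt_mult[of "real (t - s)"] using e by simp
    qed
    finally show "norm (S (\<eta> *\<^sub>R poly_op (residual_poly \<eta> (t - Suc s)) A (B (w s) - A (w s))))
      \<le> sqrt (2 * C) * \<Delta> * norm v * (1 / sqrt (real (t - s) * (real s + 1)))" .
  qed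
  also have "\<dots> = sqrt (2 * C) * \<Delta> * norm v * (\<Sum>s<t. 1 / sqrt (real (t - s) * (real s + 1)))"
    by (simp only: sum_distrib_left)
  also have "\<dots> \<le> sqrt (2 * C) * \<Delta> * norm v * 4"
    using C \<Delta>(2) by (intro mult_left_mono sum_inverse_sqrt_mult_le) auto
  finally show ?thesis
    by (simp only: SpBf) (simp add: mult_ac)
qed

end

section \<open>Stability under perturbation of operator and data\<close>

context comparison
begin

text \<open>Residuals of A' are contractions, so the defects of the unperturbed iterates, bounded
  through \<open>F\<close>, simply add up with total weight \<eta> t \<le> 1/\<lambda>.\<close>

lemma landweber_stability:
  assumes A': "positive_operator A' a"
    and \<delta>A: "\<And>x. norm (A' x - A x) \<le> \<delta>A * norm x" "0 \<le> \<delta>A"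
    and \<delta>b: "norm (b' - b) \<le> \<delta>b"
    and F: "\<And>t. t \<le> T \<Longrightarrow> norm (landweber \<eta> A b t) \<le> F"
    and t: "t \<le> T"
  shows "norm (landweber \<eta> A' b' t - landweber \<eta> A b t) \<le> (\<delta>b + \<delta>A * F) / lam"
proof -
  interpret A': positive_operator A' a by (rule A')
  have "0 \<le> \<delta>b"
    using \<delta>b norm_ge_zero order_trans by blast
  have "0 \<le> F"
    using F[of 0] by simp
  have "norm (landweber \<eta> A b t - landweber \<eta> A' b' t) \<le> (\<Sum>s<t. \<eta> * (\<delta>b + \<delta>A * F))"
    unfolding landweber_perturbation[OF A'.bounded_linear_A]
  proof (intro order_trans[OF norm_sum] sum_mono)
    fix s assume s: "s \<in> {..<t}"
    define f where "f = landweber \<eta> A b s"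
    have "norm (poly_op (residual_poly \<eta> (t - Suc s)) A' ((b - b') - (A f - A' f)))
        \<le> 1 * norm ((b - b') - (A f - A' f))"
      by (rule A'.poly_op_norm_le) (use residual_bounds in auto)
    also have "\<dots> \<le> norm (b' - b) + norm (A' f - A f)"
      using norm_triangle_ineq4[of "b - b'" "A f - A' f"] by (simp add: norm_minus_commute)
    also have "\<dots> \<le> \<delta>b + \<delta>A * F"
    proof (intro add_mono \<delta>b)
      have "norm (A' f - A f) \<le> \<delta>A * norm f"
        by (rule \<delta>A)
      also have "\<dots> \<le> \<delta>A * F"
        using s t by (intro mult_left_mono \<delta>A) (auto simp: f_def intro: F)
      finally show "norm (A' f - A f) \<le> \<delta>A * F" .
    qed
    finally show "norm (\<eta> *\<^sub>R poly_op (residual_poly \<eta> (t - Suc s)) A'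
        (b - b' - (A (landweber \<eta> A b s) - A' (landweber \<eta> A b s)))) \<le> \<eta> * (\<delta>b + \<delta>A * F)"
      using \<eta>_pos by (simp add: f_def mult_left_mono)
  qed
  also have "\<dots> = (\<eta> * real t) * (\<delta>b + \<delta>A * F)"
    by simp
  also have "\<dots> \<le> (1 / lam) * (\<delta>b + \<delta>A * F)"
    using \<open>0 \<le> \<delta>b\<close> \<open>0 \<le> F\<close> \<delta>A(2) by (intro mult_right_mono eta_t_le t) auto
  finally show ?thesis
    by (simp add: norm_minus_commute)
qed

text \<open>Smoothing of residuals of A by \<open>S\<close> replaces the factor 1/\<lambda> by
  1/sqrt \<lambda>. For this A must stand outside, which puts the perturbed iterates inside; their
  norm is controlled by the crude bound, hence the nested term.\<close>

lemma S_landweber_stability: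
  assumes A': "positive_operator A' a"
    and \<delta>A: "\<And>x. norm (A' x - A x) \<le> \<delta>A * norm x" "0 \<le> \<delta>A"
    and \<delta>b: "norm (b' - b) \<le> \<delta>b"
    and F: "\<And>t. t \<le> T \<Longrightarrow> norm (landweber \<eta> A b t) \<le> F"
    and t: "t \<le> T"
  shows "norm (S (landweber \<eta> A' b' t - landweber \<eta> A b t))
    \<le> 2 * sqrt (2 * C) / sqrt lam * (\<delta>b + \<delta>A * (F + (\<delta>b + \<delta>A * F) / lam))"
proof -
  define E where "E = \<delta>b + \<delta>A * (F + (\<delta>b + \<delta>A * F) / lam)"
  have "0 \<le> \<delta>b"
    using \<delta>b norm_ge_zero order_trans by blast
  have "0 \<le> F"
    using F[of 0] by simp
  have "0 \<le> E"
    unfolding E_def using \<open>0 \<le> \<delta>b\<close> \<open>0 \<le> F\<close> \<delta>A(2) lam by (intro add_nonneg_nonneg mult_nonneg_nonneg) auto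
  have "norm (S (landweber \<eta> A' b' t - landweber \<eta> A b t))
    \<le> (\<Sum>s<t. sqrt (2 * C) * sqrt \<eta> * E * (1 / sqrt (real (t - Suc s) + 1)))"
    unfolding landweber_perturbation[OF bounded_linear_A] linear_sum[OF linear_S]
  proof (intro order_trans[OF norm_sum] sum_mono)
    fix s assume s: "s \<in> {..<t}"
    define f where "f = landweber \<eta> A' b' s"
    define g where "g = (b' - b) - (A' f - A f)"
    have "norm f \<le> norm (landweber \<eta> A b s) + norm (f - landweber \<eta> A b s)"
      by (metis add.commute diff_add_cancel norm_triangle_ineq)
    also have "\<dots> \<le> F + (\<delta>b + \<delta>A * F) / lam"
      unfolding f_def using s t by (intro add_mono F landweber_stability[OF A' \<delta>A \<delta>b F]) auto
    finally have "norm f \<le> F + (\<delta>b + \<delta>A * F) / lam" .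
    then have "norm (A' f - A f) \<le> \<delta>A * (F + (\<delta>b + \<delta>A * F) / lam)"
      using \<delta>A order_trans mult_left_mono by metis
    then have g: "norm g \<le> E"
      using norm_triangle_ineq4[of "b' - b" "A' f - A f"] \<delta>b by (simp add: g_def E_def)
    have "norm (S (\<eta> *\<^sub>R poly_op (residual_poly \<eta> (t - Suc s)) A g))
      = \<eta> * norm (S (poly_op (residual_poly \<eta> (t - Suc s)) A g))"
      using \<eta>_pos by (simp add: linear_scale[OF linear_S])
    also have "\<dots> \<le> \<eta> * (sqrt (2 * C / \<eta>) / sqrt (real (t - Suc s) + 1) * norm g)"
      using \<eta>_pos s t by (intro mult_left_mono S_residual_le) auto
    also have "\<dots> \<le> \<eta> * (sqrt (2 * C / \<eta>) / sqrt (real (t - Suc s) + 1) * E)"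
      using \<eta>_pos C g by (intro mult_left_mono) auto
    also have "\<dots> = sqrt (2 * C) * sqrt \<eta> * E * (1 / sqrt (real (t - Suc s) + 1))"
    proof -
      define e where "e = sqrt \<eta>"
      have e: "e > 0" "\<eta> = e * e"
        using \<eta>_pos by (auto simp: e_def)
      have "sqrt (2 * C / \<eta>) = sqrt (2 * C) / e"
        by (simp add: e_def real_sqrt_divide)
      then show ?thesis
        unfolding e_def[symmetric] using e by simp
    qed
    finally show "norm (S (\<eta> *\<^sub>R poly_op (residual_poly \<eta> (t - Suc s)) A
        (b' - b - (A' (landweber \<eta> A' b' s) - A (landweber \<eta> A' b' s)))))
      \<le> sqrt (2 * C) * sqrt \<eta> * E * (1 / sqrt (real (t - Suc s) + 1))"
      by (simp add: f_def g_def)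
  qed
  also have "\<dots> = sqrt (2 * C) * sqrt \<eta> * E * (\<Sum>s<t. 1 / sqrt (real (t - Suc s) + 1))"
    by (simp only: sum_distrib_left)
  also have "(\<Sum>s<t. 1 / sqrt (real (t - Suc s) + 1)) = (\<Sum>j<t. 1 / sqrt (real j + 1))"
    by (rule sum.nat_diff_reindex[where g = "\<lambda>j. 1 / sqrt (real j + 1)"])
  also have "sqrt (2 * C) * sqrt \<eta> * E * \<dots> \<le> sqrt (2 * C) * sqrt \<eta> * E * (2 * sqrt (real t))"
    using C \<open>0 \<le> E\<close> \<eta>_pos by (intro mult_left_mono sum_inverse_sqrt_le) auto
  also have "\<dots> = 2 * sqrt (2 * C) * E * sqrt (\<eta> * real t)"
    by (simp add: real_sqrt_mult)
  also have "\<dots> \<le> 2 * sqrt (2 * C) * E * sqrt (1 / lam)"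
    using C \<open>0 \<le> E\<close> by (intro mult_left_mono real_sqrt_le_mono eta_t_le t) auto
  finally show ?thesis
    by (simp add: E_def real_sqrt_divide mult_ac)
qed

end

section \<open>Tail averages\<close>

lemma norm_tail_sum_le:
  assumes "T > 0" "\<And>t. T div 2 < t \<Longrightarrow> t \<le> T \<Longrightarrow> norm (h t) \<le> c" "0 \<le> c"
  shows "norm ((2 / real T) *\<^sub>R (\<Sum>t = T div 2 + 1..T. h t)) \<le> 2 * c"
proof -
  have "norm (\<Sum>t = T div 2 + 1..T. h t) \<le> (\<Sum>t = T div 2 + 1..T. c)"
    using assms(2) by (intro order_trans[OF norm_sum] sum_mono) auto
  also have "\<dots> = real (T - T div 2) * c"
    by simp
  also have "\<dots> \<le> real T * c"
    using assms by (intro mult_right_mono) auto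
  finally have "2 / real T * norm (\<Sum>t = T div 2 + 1..T. h t) \<le> 2 / real T * (real T * c)"
    by (rule mult_left_mono) simp
  then show ?thesis
    using assms(1) by simp
qed

lemma tail_average_diff_le:
  assumes S: "linear S" and T: "T > 0"
    and c: "\<And>t. T div 2 < t \<Longrightarrow> t \<le> T \<Longrightarrow> norm (S (f' t - f t)) \<le> c" "0 \<le> c"
  shows "norm (S (tail_average f' T) - S (tail_average f T)) \<le> 2 * c"
proof -
  have "S (tail_average f' T) - S (tail_average f T) = (2 / real T) *\<^sub>R (\<Sum>t = T div 2 + 1..T. S (f' t - f t))"
    by (simp add: tail_average_def linear_scale[OF S] linear_sum[OF S] linear_diff[OF S] sum_subtractf
        scaleR_diff_right)
  then show ?thesis
    using norm_tail_sum_le[OF T c] by simp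
qed

lemma tail_average_error_le:
  assumes S: "linear S" and T: "T > 0"
    and c: "\<And>t. T div 2 < t \<Longrightarrow> t \<le> T \<Longrightarrow> norm (S (f t - h)) \<le> c" "0 \<le> c"
    and h: "norm (S h - g) \<le> c'" and odd: "odd T \<Longrightarrow> norm (S h) / real T \<le> c''" "0 \<le> c''"
  shows "norm (S (tail_average f T) - g) \<le> 2 * c + c' + c''"
proof -
  \<comment> \<open>The total weight of the tail average: 1 for even T, 1 + 1/T for odd T. The
    excess times \<open>S h\<close> is what c'' pays for.\<close>
  define w where "w = 2 / real T * real (T - T div 2)"
  have w: "w - 1 = (if odd T then 1 / real T else 0)"
  proof (cases "odd T")
    case True
    then obtain k where "T = 2 * k + 1"
      using oddE by blast
    then show ?thesis
      by (simp add: w_def field_simps)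
  next
    case False
    then obtain k where "T = 2 * k"
      by blast
    then show ?thesis
      using T by (simp add: w_def)
  qed
  have "S (tail_average f T) - g
    = (2 / real T) *\<^sub>R (\<Sum>t = T div 2 + 1..T. S (f t - h)) + (w - 1) *\<^sub>R S h + (S h - g)"
  proof -
    have "(\<Sum>t = T div 2 + 1..T. S (f t - h)) = (\<Sum>t = T div 2 + 1..T. S (f t)) - real (T - T div 2) *\<^sub>R S h"
      by (simp add: linear_diff[OF S] sum_subtractf sum_constant_scaleR)
    then have "(2 / real T) *\<^sub>R (\<Sum>t = T div 2 + 1..T. S (f t - h)) = S (tail_average f T) - w *\<^sub>R S h"
      by (simp add: tail_average_def linear_scale[OF S] linear_sum[OF S] scaleR_diff_right w_def)
    then show ?thesis
      by (simp add: scaleR_diff_left)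
  qed
  also have "norm \<dots> \<le> 2 * c + c'' + c'"
  proof (intro norm_triangle_mono norm_tail_sum_le T c h)
    show "norm ((w - 1) *\<^sub>R S h) \<le> c''"
      using odd by (simp add: w)
  qed
  finally show ?thesis
    by simp
qed

section \<open>The population operators\<close>

lemma is_L2_inner:
  assumes "is_L2 Q cls" "square_integrable Q f" "square_integrable Q g"
  shows "cls f \<bullet> cls g = (\<integral>a. f a * g a \<partial>Q)"
  using assms unfolding is_L2_def by blast

text \<open>\<open>cls\<close> is specified only through its values and inner products on square
  integrable functions, so equality of classes is read off from a vanishing distance.\<close>

lemma is_L2_cong:
  assumes cls: "is_L2 Q cls" and f: "square_integrable Q f" and g: "square_integrable Q g"
    and eq: "\<And>a. a \<in> space Q \<Longrightarrow> f a = g a"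
  shows "cls f = cls g"
proof -
  have "(\<integral>a. f a * g a \<partial>Q) = (\<integral>a. f a * f a \<partial>Q)" "(\<integral>a. g a * g a \<partial>Q) = (\<integral>a. f a * f a \<partial>Q)"
    using eq by (auto intro!: Bochner_Integration.integral_cong)
  then have "cls g \<bullet> cls g = cls f \<bullet> cls f" "cls f \<bullet> cls g = cls f \<bullet> cls f"
    by (simp_all add: is_L2_inner[OF cls] f g)
  then have "(norm (cls f - cls g))\<^sup>2 = 0"
    unfolding power2_norm_eq_inner by (simp add: inner_diff inner_commute[of "cls g" "cls f"])
  then show ?thesis
    by simp
qed

lemma has_sum_finite_sum:
  fixes f :: "'i \<Rightarrow> 'b \<Rightarrow> real"
  assumes "finite I" "\<And>i. i \<in> I \<Longrightarrow> (f i has_sum c i) B"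
  shows "((\<lambda>e. \<Sum>i\<in>I. f i e) has_sum (\<Sum>i\<in>I. c i)) B"
  using assms by (induction I rule: finite_induct) (auto intro!: has_sum_add)

lemma sums_of_suminf_ennreal:
  fixes f :: "nat \<Rightarrow> real"
  assumes "\<And>i. 0 \<le> f i" "(\<Sum>i. ennreal (f i)) = ennreal c" "0 \<le> c"
  shows "f sums c"
proof -
  have s: "summable f"
    by (rule summable_suminf_not_top) (use assms in auto)
  then have "(\<Sum>i. ennreal (f i)) = ennreal (suminf f)"
    using assms(1) by (intro suminf_ennreal_eq summable_sums)
  then show ?thesis
    using assms(2,3) suminf_nonneg[OF s assms(1)] summable_sums[OF s] by simp
qed

text \<open>The Hilbert-Schmidt norm computed by rows is compared with its computation by columns,
  where B may be uncountable.\<close>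

lemma hilbert_schmidt_swap_le:
  fixes x :: "nat \<Rightarrow> 'l::{real_inner,complete_space}"
  assumes B: "orthonormal_basis B" and u: "\<And>e. (\<lambda>k. (x k \<bullet> e)\<^sup>2) sums u e"
    and sum: "summable (\<lambda>k. (norm (x k))\<^sup>2)"
  shows "(\<Sum>k. (norm (x k))\<^sup>2) \<le> (\<Sum>\<^sub>\<infinity>e\<in>B. u e)"
proof -
  have ortho: "pairwise orthogonal B" "\<And>e. e \<in> B \<Longrightarrow> norm e = 1"
    using B by (auto simp: orthonormal_basis_def)
  have "u e \<ge> 0" for e
    using sums_unique[OF u[of e]] sums_summable[OF u[of e]] by (simp add: suminf_nonneg)
  have fin: "(\<Sum>e\<in>F. u e) \<le> (\<Sum>k. (norm (x k))\<^sup>2)" if "finite F" "F \<subseteq> B" for F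
  proof (rule sums_le)
    show "(\<lambda>k. \<Sum>e\<in>F. (x k \<bullet> e)\<^sup>2) sums (\<Sum>e\<in>F. u e)"
      by (intro sums_sum u)
    show "(\<lambda>k. (norm (x k))\<^sup>2) sums (\<Sum>k. (norm (x k))\<^sup>2)"
      by (rule summable_sums[OF sum])
    show "(\<Sum>e\<in>F. (x k \<bullet> e)\<^sup>2) \<le> (norm (x k))\<^sup>2" for k
      by (rule bessel_inequality[OF ortho that])
  qed
  \<comment> \<open>An infinite sum over a non-summable family is 0 by convention, so summability
    must come first; finite partial sums are bounded by Bessel's inequality.\<close>
  have u_sum: "u summable_on B"
    by (rule nonneg_bdd_above_summable_on)
       (use fin \<open>\<And>e. u e \<ge> 0\<close> in \<open>auto intro!: bdd_aboveI2[where M = "\<Sum>k. (norm (x k))\<^sup>2"]\<close>)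
  have "(\<Sum>k<n. (norm (x k))\<^sup>2) \<le> (\<Sum>\<^sub>\<infinity>e\<in>B. u e)" for n
  proof (rule has_sum_mono)
    show "((\<lambda>e. \<Sum>k<n. (x k \<bullet> e)\<^sup>2) has_sum (\<Sum>k<n. (norm (x k))\<^sup>2)) B"
      by (intro has_sum_finite_sum parseval B) simp
    show "(u has_sum (\<Sum>\<^sub>\<infinity>e\<in>B. u e)) B"
      by (rule has_sum_infsum[OF u_sum])
    show "(\<Sum>k<n. (x k \<bullet> e)\<^sup>2) \<le> u e" for e
      using sum_le_suminf[OF sums_summable[OF u[of e]], of "{..<n}"] sums_unique[OF u[of e]] by simp
  qed
  then show ?thesis
    by (intro suminf_le_const sum)
qed

lemma inner_ext: "(\<And>y. x \<bullet> y = z \<bullet> y) \<Longrightarrow> x = (z::'a::real_inner)"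
  using vector_eq_rdot[of x z] by (simp add: inner_commute)

section \<open>The covariance operator and the integral operator\<close>

text \<open>\<open>k m\<close> stands for the kernel section at m. Point evaluation is then a scalar
  product, and the RKHS enters only as a Hilbert space with a bounded feature map.\<close>

locale population = prob_space Q
  for Q :: "'h measure" +
  fixes k :: "'h \<Rightarrow> 'k::{real_inner,complete_space,second_countable_topology}"
    and a :: real
    and cls :: "('h \<Rightarrow> real) \<Rightarrow> 'l::{real_inner,complete_space}"
    and S :: "'k \<Rightarrow> 'l"
  assumes k_measurable[measurable]: "k \<in> borel_measurable Q"
    and k_bound: "m \<in> space Q \<Longrightarrow> (norm (k m))\<^sup>2 \<le> a"
    and cls: "is_L2 Q cls"
    and S_def: "S f = cls (\<lambda>m. f \<bullet> k m)"
begin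

lemma a_nonneg: "0 \<le> a"
  using k_bound not_empty by (metis ex_in_conv order_trans zero_le_power2)

lemma k_norm_le: "m \<in> space Q \<Longrightarrow> norm (k m) \<le> sqrt a"
  using k_bound by (intro real_le_rsqrt)

lemma inner_k_le:
  assumes "m \<in> space Q"
  shows "\<bar>f \<bullet> k m\<bar> \<le> norm f * sqrt a"
  using Cauchy_Schwarz_ineq2[of f "k m"] mult_left_mono[OF k_norm_le[OF assms], of "norm f"] by simp

lemma square_integrable_inner_k: "square_integrable Q (\<lambda>m. f \<bullet> k m)"
  unfolding square_integrable_def
proof
  show "integrable Q (\<lambda>m. (f \<bullet> k m)\<^sup>2)"
  proof (rule integrable_real_bounded)
    show "\<bar>(f \<bullet> k m)\<^sup>2\<bar> \<le> (norm f * sqrt a)\<^sup>2" if "m \<in> space Q" for m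
      using power_mono[OF inner_k_le[OF that], of f 2] by simp
  qed simp
qed simp

lemma S_inner: "S f \<bullet> S g = (\<integral>m. (f \<bullet> k m) * (g \<bullet> k m) \<partial>Q)"
  unfolding S_def by (rule is_L2_inner[OF cls square_integrable_inner_k square_integrable_inner_k])

lemma S_norm: "(norm (S f))\<^sup>2 = (\<integral>m. (f \<bullet> k m)\<^sup>2 \<partial>Q)"
  by (simp add: power2_norm_eq_inner S_inner) (simp add: power2_eq_square)

lemma S_norm_le: "norm (S f) \<le> sqrt a * norm f"
proof (rule power2_le_imp_le)
  have "(\<integral>m. (f \<bullet> k m)\<^sup>2 \<partial>Q) \<le> (\<integral>m. (norm f * sqrt a)\<^sup>2 \<partial>Q)"
  proof (rule integral_mono)
    show "(f \<bullet> k m)\<^sup>2 \<le> (norm f * sqrt a)\<^sup>2" if "m \<in> space Q" for m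
      using power_mono[OF inner_k_le[OF that], of f 2] by simp
  qed (use square_integrable_inner_k[of f] in \<open>auto simp: square_integrable_def\<close>)
  then show "(norm (S f))\<^sup>2 \<le> (sqrt a * norm f)\<^sup>2"
    by (simp add: S_norm mult.commute prob_space)
qed (use a_nonneg in simp)

lemma bounded_linear_S: "bounded_linear S"
proof (rule bounded_linear_intro)
  show "S (x + y) = S x + S y" for x y
    using cls square_integrable_inner_k unfolding S_def is_L2_def by (simp add: inner_add_left)
  show "S (c *\<^sub>R x) = c *\<^sub>R S x" for c x
    using cls square_integrable_inner_k unfolding S_def is_L2_def by simp
  show "norm (S x) \<le> norm x * sqrt a" for x
    using S_norm_le[of x] by (simp add: mult.commute)
qed

lemmas linear_S = bounded_linear.linear[OF bounded_linear_S]
lemmas adjoint_S = hilbert_adjoint[OF bounded_linear_S]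

lemma adjoint_S': "adjoint S y \<bullet> x = y \<bullet> S x"
  by (metis adjoint_S inner_commute)

lemma adjoint_S_norm_le: "norm (adjoint S y) \<le> sqrt a * norm y"
  using a_nonneg by (intro hilbert_adjoint_norm_le[OF bounded_linear_S S_norm_le]) simp

lemma bounded_linear_adjoint_S: "bounded_linear (adjoint S)"
proof (rule bounded_linear_intro)
  show "adjoint S (x + y) = adjoint S x + adjoint S y" for x y
    by (rule inner_ext) (simp add: adjoint_S' inner_add)
  show "adjoint S (c *\<^sub>R x) = c *\<^sub>R adjoint S x" for c x
    by (rule inner_ext) (simp add: adjoint_S')
  show "norm (adjoint S x) \<le> norm x * sqrt a" for x
    using adjoint_S_norm_le[of x] by (simp add: mult.commute)
qed

definition T0 :: "'k \<Rightarrow> 'k" where "T0 = adjoint S \<circ> S"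
definition L0 :: "'l \<Rightarrow> 'l" where "L0 = S \<circ> adjoint S"

lemma T0_inner: "T0 x \<bullet> y = S x \<bullet> S y"
  by (simp add: T0_def adjoint_S')

lemma S_T0: "S (T0 x) = L0 (S x)"
  by (simp add: T0_def L0_def)

lemma adjoint_S_L0: "adjoint S (L0 x) = T0 (adjoint S x)"
  by (simp add: T0_def L0_def)

lemma compose_norm_le:
  assumes "\<And>x. norm (f x) \<le> sqrt a * norm x" "\<And>x. norm (g x) \<le> sqrt a * norm x"
  shows "norm ((f \<circ> g) x) \<le> a * norm x"
proof -
  have "norm (f (g x)) \<le> sqrt a * (sqrt a * norm x)"
    using assms(1)[of "g x"] mult_left_mono[OF assms(2)[of x], of "sqrt a"] a_nonneg by simp
  then show ?thesis
    using a_nonneg by (simp add: mult.assoc[symmetric])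
qed

lemma positive_operator_T0: "positive_operator T0 a"
proof (rule positive_operator.intro)
  show "bounded_linear T0"
    unfolding T0_def o_def by (rule bounded_linear_compose[OF bounded_linear_adjoint_S bounded_linear_S])
  show "T0 x \<bullet> y = x \<bullet> T0 y" for x y
    by (simp add: T0_def adjoint_S adjoint_S')
  show "norm (T0 x) \<le> a * norm x" for x
    unfolding T0_def by (rule compose_norm_le[OF adjoint_S_norm_le S_norm_le])
qed (auto simp: T0_inner a_nonneg)

lemma positive_operator_L0: "positive_operator L0 a"
proof (rule positive_operator.intro)
  show "bounded_linear L0"
    unfolding L0_def o_def by (rule bounded_linear_compose[OF bounded_linear_S bounded_linear_adjoint_S])
  show "L0 x \<bullet> y = x \<bullet> L0 y" for x y
    by (simp add: L0_def adjoint_S adjoint_S')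
  show "0 \<le> L0 x \<bullet> x" for x
    by (simp add: L0_def adjoint_S)
  show "norm (L0 x) \<le> a * norm x" for x
    unfolding L0_def by (rule compose_norm_le[OF S_norm_le adjoint_S_norm_le])
qed (rule a_nonneg)

end

text \<open>The functional calculus lives on the interval up to the operator norm, the estimates on
  [0, a]; this passes between the two.\<close>

lemma positive_operator_onorm:
  assumes "positive_operator A a"
  shows "positive_operator A (onorm A)" "onorm A \<le> a"
proof -
  interpret positive_operator A a by (rule assms)
  show "positive_operator A (onorm A)"
    by (rule positive_operator.intro[OF bounded_linear_A sym pos])
       (auto intro: onorm bounded_linear_A onorm_pos_le)
  show "onorm A \<le> a"
    by (rule onorm_bound[OF bound_nonneg bound])
qed

section \<open>Whitening and the effective dimension\<close>

context population
begin

sublocale T0: hilbert_operator T0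
  using positive_operator_onorm(1)[OF positive_operator_T0] by (rule hilbert_operator.intro)

sublocale L0: hilbert_operator L0
  using positive_operator_onorm(1)[OF positive_operator_L0] by (rule hilbert_operator.intro)

lemma onorm_L0_le: "onorm L0 \<le> a"
  by (rule positive_operator_onorm(2)[OF positive_operator_L0])

text \<open>The operator (T + \<lambda>)^(-1/2), which whitens the features; \<open>sqrt_op\<close>
  below is its inverse, and its norm is the population energy norm.\<close>

definition inv_sqrt :: "real \<Rightarrow> 'k \<Rightarrow> 'k" where
  "inv_sqrt lam = spectral_fun (\<lambda>u. 1 / sqrt (u + lam)) T0"

definition sqrt_op :: "real \<Rightarrow> 'k \<Rightarrow> 'k" where
  "sqrt_op lam = spectral_fun (\<lambda>u. sqrt (u + lam)) T0"

context
  fixes lam :: real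
  assumes lam: "lam > 0"
begin

lemma continuous_inv_sqrt: "continuous_on {0..b} (\<lambda>u. 1 / sqrt (u + lam))"
  using lam by (intro continuous_intros) auto

lemma continuous_sqrt: "continuous_on {0..b} (\<lambda>u. sqrt (u + lam))"
  by (intro continuous_intros)

lemma bounded_linear_inv_sqrt: "bounded_linear (inv_sqrt lam)"
  unfolding inv_sqrt_def by (rule T0.bounded_linear_spectral_fun[OF continuous_inv_sqrt])

lemma inv_sqrt_sym: "inv_sqrt lam x \<bullet> y = x \<bullet> inv_sqrt lam y"
  unfolding inv_sqrt_def by (rule T0.spectral_fun_sym[OF continuous_inv_sqrt])

lemma inv_sqrt_swap: "inv_sqrt lam x \<bullet> y = inv_sqrt lam y \<bullet> x"
  by (subst inv_sqrt_sym) (rule inner_commute)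

lemma sqrt_op_sym: "sqrt_op lam x \<bullet> y = x \<bullet> sqrt_op lam y"
  unfolding sqrt_op_def by (rule T0.spectral_fun_sym[OF continuous_sqrt])

lemma inv_sqrt_norm_le: "norm (inv_sqrt lam x) \<le> 1 / sqrt lam * norm x"
  unfolding inv_sqrt_def
proof (rule T0.spectral_fun_norm_le[OF continuous_inv_sqrt])
  fix u assume "u \<in> {0..onorm T0}"
  then show "\<bar>1 / sqrt (u + lam)\<bar> \<le> 1 / sqrt lam"
    using lam by (auto intro!: divide_left_mono)
qed

lemma sqrt_op_inv_sqrt: "sqrt_op lam (inv_sqrt lam x) = x"
  and inv_sqrt_sqrt_op: "inv_sqrt lam (sqrt_op lam x) = x"
proof -
  have one: "spectral_fun (\<lambda>u. sqrt (u + lam) * (1 / sqrt (u + lam))) T0 x = x"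
    and one': "spectral_fun (\<lambda>u. 1 / sqrt (u + lam) * sqrt (u + lam)) T0 x = x"
    using T0.spectral_fun_cong[of "poly 1" "\<lambda>u. sqrt (u + lam) * (1 / sqrt (u + lam))" x]
      T0.spectral_fun_cong[of "poly 1" "\<lambda>u. 1 / sqrt (u + lam) * sqrt (u + lam)" x] lam
    by (auto simp: T0.spectral_fun_poly continuous_intros)
  show "sqrt_op lam (inv_sqrt lam x) = x"
    using one unfolding T0.spectral_fun_mult[OF continuous_sqrt continuous_inv_sqrt]
    by (simp add: sqrt_op_def inv_sqrt_def)
  show "inv_sqrt lam (sqrt_op lam x) = x"
    using one' unfolding T0.spectral_fun_mult[OF continuous_inv_sqrt continuous_sqrt]
    by (simp add: sqrt_op_def inv_sqrt_def)
qed

lemma sqrt_op_sqrt_op: "sqrt_op lam (sqrt_op lam x) = T0 x + lam *\<^sub>R x"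
proof -
  have "spectral_fun (\<lambda>u. sqrt (u + lam) * sqrt (u + lam)) T0 x = spectral_fun (poly [:lam, 1:]) T0 x"
    using lam by (intro T0.spectral_fun_cong continuous_intros) auto
  then show ?thesis
    unfolding T0.spectral_fun_mult[OF continuous_sqrt continuous_sqrt]
    by (simp add: sqrt_op_def T0.spectral_fun_poly)
qed

lemma sqrt_op_norm: "(norm (sqrt_op lam x))\<^sup>2 = (norm (S x))\<^sup>2 + lam * (norm x)\<^sup>2"
proof -
  have "(norm (sqrt_op lam x))\<^sup>2 = sqrt_op lam (sqrt_op lam x) \<bullet> x"
    by (simp add: power2_norm_eq_inner sqrt_op_sym[of "sqrt_op lam x"])
  then show ?thesis
    by (simp add: sqrt_op_sqrt_op inner_add T0_inner power2_norm_eq_inner)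
qed

lemma inner_le_inv_sqrt:
  "\<bar>z \<bullet> y\<bar> \<le> norm (inv_sqrt lam z) * sqrt ((norm (S y))\<^sup>2 + lam * (norm y)\<^sup>2)"
proof -
  have "z \<bullet> y = inv_sqrt lam z \<bullet> sqrt_op lam y"
    by (simp add: inv_sqrt_sym inv_sqrt_sqrt_op)
  also have "\<bar>\<dots>\<bar> \<le> norm (inv_sqrt lam z) * norm (sqrt_op lam y)"
    by (rule Cauchy_Schwarz_ineq2)
  also have "norm (sqrt_op lam y) = sqrt ((norm (S y))\<^sup>2 + lam * (norm y)\<^sup>2)"
    by (simp flip: sqrt_op_norm)
  finally show ?thesis .
qed

text \<open>A whitened deviation of at most 1/2 says T - A \<le> (T + \<lambda>)/2 as forms.
  Rearranging gives T + \<lambda> \<le> 2 (A + \<lambda>).\<close>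

lemma comparison_of_whitened_deviation:
  assumes "\<And>f. norm (inv_sqrt lam (A (inv_sqrt lam f)) - inv_sqrt lam (T0 (inv_sqrt lam f))) \<le> 1 / 2 * norm f"
  shows "(norm (S y))\<^sup>2 + lam * (norm y)\<^sup>2 \<le> 2 * (A y \<bullet> y + lam * (norm y)\<^sup>2)"
proof -
  define f where "f = sqrt_op lam y"
  have "T0 y \<bullet> y - A y \<bullet> y = - ((inv_sqrt lam (A (inv_sqrt lam f)) - inv_sqrt lam (T0 (inv_sqrt lam f))) \<bullet> f)"
    by (simp add: f_def inner_diff inv_sqrt_sym inv_sqrt_sqrt_op)
  also have "\<dots> \<le> norm (inv_sqrt lam (A (inv_sqrt lam f)) - inv_sqrt lam (T0 (inv_sqrt lam f))) * norm f"
    using norm_cauchy_schwarz[of "- (inv_sqrt lam (A (inv_sqrt lam f)) - inv_sqrt lam (T0 (inv_sqrt lam f)))" f]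
    by (simp only: inner_minus_left norm_minus_cancel)
  also have "\<dots> \<le> (1 / 2 * norm f) * norm f"
    by (intro mult_right_mono assms) simp
  also have "\<dots> = 1 / 2 * ((norm (S y))\<^sup>2 + lam * (norm y)\<^sup>2)"
    unfolding sqrt_op_norm[symmetric] f_def by (simp add: power2_eq_square)
  finally show ?thesis
    by (simp add: T0_inner power2_norm_eq_inner)
qed

text \<open>\<open>effective_dim\<close> refers to \<open>inv\<close>, which is a right inverse only
  for a surjection. Preimages come from the spectral function 1/(u + \<lambda>).\<close>

lemma regularised_L0_surj: "surj (\<lambda>h. L0 h + lam *\<^sub>R h)"
proof -
  have c: "continuous_on {0..b} (\<lambda>u. 1 / (u + lam))" for b
    using lam by (intro continuous_intros) auto
  have p: "L0 h + lam *\<^sub>R h = spectral_fun (poly [:lam, 1:]) L0 h" for h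
    by (simp add: L0.spectral_fun_poly)
  have "spectral_fun (poly [:lam, 1:]) L0 (spectral_fun (\<lambda>u. 1 / (u + lam)) L0 h) = h" for h
  proof -
    have "spectral_fun (poly [:lam, 1:]) L0 (spectral_fun (\<lambda>u. 1 / (u + lam)) L0 h)
      = spectral_fun (\<lambda>u. poly [:lam, 1:] u * (1 / (u + lam))) L0 h"
      by (rule L0.spectral_fun_mult[symmetric, OF _ c]) (intro continuous_intros)
    also have "\<dots> = spectral_fun (poly 1) L0 h"
      using lam by (intro L0.spectral_fun_cong continuous_intros) (auto simp: add.commute)
    finally show ?thesis
      by (simp add: L0.spectral_fun_poly)
  qed
  then show ?thesis
    unfolding p surj_def by metis
qed

text \<open>The mean squared norm of the whitened feature is the squared Hilbert-Schmidt norm of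
  \<open>S\<close> composed with (T + \<lambda>)^(-1/2): Parseval in the feature, then exchange of
  sum and integral.\<close>

lemma inv_sqrt_sums: 
  assumes e: "\<And>v::'k. (\<lambda>j. (v \<bullet> e j)\<^sup>2) sums (norm v)\<^sup>2"
  shows "(\<lambda>j. (norm (S (inv_sqrt lam (e j))))\<^sup>2) sums (\<integral>m. (norm (inv_sqrt lam (k m)))\<^sup>2 \<partial>Q)"
proof -
  have "(\<lambda>j. \<integral>m. (inv_sqrt lam (k m) \<bullet> e j)\<^sup>2 \<partial>Q) sums (\<integral>m. (norm (inv_sqrt lam (k m)))\<^sup>2 \<partial>Q)"
  proof (rule sums_of_suminf_ennreal)
    have [measurable]: "inv_sqrt lam \<in> borel_measurable borel"
      using bounded_linear_inv_sqrt by (intro borel_measurable_continuous_onI linear_continuous_on)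
    have bd: "norm (inv_sqrt lam (k m)) \<le> 1 / sqrt lam * sqrt a" if "m \<in> space Q" for m
      using inv_sqrt_norm_le[of "k m"] mult_left_mono[OF k_norm_le[OF that], of "1 / sqrt lam"] lam by simp
    have comp: "(\<integral>\<^sup>+m. ennreal ((inv_sqrt lam (k m) \<bullet> e j)\<^sup>2) \<partial>Q) = ennreal (\<integral>m. (inv_sqrt lam (k m) \<bullet> e j)\<^sup>2 \<partial>Q)" for j
    proof (rule nn_integral_eq_integral)
      have "(\<lambda>m. (inv_sqrt lam (k m) \<bullet> e j)\<^sup>2) = (\<lambda>m. (inv_sqrt lam (e j) \<bullet> k m)\<^sup>2)"
        by (simp add: inv_sqrt_swap[of "k _"])
      then show "integrable Q (\<lambda>m. (inv_sqrt lam (k m) \<bullet> e j)\<^sup>2)"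
        using square_integrable_inner_k[of "inv_sqrt lam (e j)"] by (simp add: square_integrable_def)
    qed simp
    have "(\<Sum>j. \<integral>\<^sup>+m. ennreal ((inv_sqrt lam (k m) \<bullet> e j)\<^sup>2) \<partial>Q) = (\<integral>\<^sup>+m. (\<Sum>j. ennreal ((inv_sqrt lam (k m) \<bullet> e j)\<^sup>2)) \<partial>Q)"
      by (rule nn_integral_suminf[symmetric]) measurable
    also have "\<dots> = (\<integral>\<^sup>+m. ennreal ((norm (inv_sqrt lam (k m)))\<^sup>2) \<partial>Q)"
      by (intro nn_integral_cong suminf_ennreal_eq e) simp
    also have "\<dots> = ennreal (\<integral>m. (norm (inv_sqrt lam (k m)))\<^sup>2 \<partial>Q)"
    proof (rule nn_integral_eq_integral)
      show "integrable Q (\<lambda>m. (norm (inv_sqrt lam (k m)))\<^sup>2)"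
      proof (rule integrable_real_bounded)
        show "\<bar>(norm (inv_sqrt lam (k m)))\<^sup>2\<bar> \<le> (1 / sqrt lam * sqrt a)\<^sup>2" if "m \<in> space Q" for m
          using power_mono[OF bd[OF that], of 2] by simp
      qed measurable
    qed simp
    finally show "(\<Sum>j. ennreal (\<integral>m. (inv_sqrt lam (k m) \<bullet> e j)\<^sup>2 \<partial>Q)) = ennreal (\<integral>m. (norm (inv_sqrt lam (k m)))\<^sup>2 \<partial>Q)"
      unfolding comp .
  qed simp_all
  moreover have "(\<integral>m. (inv_sqrt lam (k m) \<bullet> e j)\<^sup>2 \<partial>Q) = (norm (S (inv_sqrt lam (e j))))\<^sup>2" for j
    by (simp add: S_norm inv_sqrt_swap[of "k _"])
  ultimately show ?thesis
    by simp
qed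

text \<open>The trace runs over an orthonormal basis of L2, the integral over coordinates in the
  RKHS; the Hilbert-Schmidt exchange connects them. One inequality is enough, since the capacity
  condition is an upper bound.\<close>

lemma integral_inv_sqrt_le_effective_dim:
  "(\<integral>m. (norm (inv_sqrt lam (k m)))\<^sup>2 \<partial>Q) \<le> effective_dim L0 lam"
proof -
  obtain e :: "nat \<Rightarrow> 'k" where e: "\<And>v. (\<lambda>j. (v \<bullet> e j)\<^sup>2) sums (norm v)\<^sup>2"
    using parseval_sequence_exists by blast
  define B where "B = (SOME B::'l set. orthonormal_basis B)"
  have B: "orthonormal_basis B"
    unfolding B_def using orthonormal_basis_exists by (rule someI_ex)
  define x where "x j = S (inv_sqrt lam (e j))" for j
  \<comment> \<open>The adjoint of \<open>S\<close> intertwines L + \<lambda> with T + \<lambda>, so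
    the diagonal entry of the trace at h is a squared norm in the RKHS.\<close>
  have eq: "(L0 \<circ> inv (\<lambda>h. L0 h + lam *\<^sub>R h)) h \<bullet> h = (norm (inv_sqrt lam (adjoint S h)))\<^sup>2" for h
  proof -
    define R where "R = inv (\<lambda>h. L0 h + lam *\<^sub>R h)"
    have R: "L0 (R h) + lam *\<^sub>R R h = h"
      unfolding R_def by (rule surj_f_inv_f[OF regularised_L0_surj])
    have "sqrt_op lam (sqrt_op lam (adjoint S (R h))) = adjoint S (L0 (R h) + lam *\<^sub>R R h)"
      using bounded_linear.linear[OF bounded_linear_adjoint_S]
      by (simp add: sqrt_op_sqrt_op linear_add linear_scale adjoint_S_L0)
    also have "\<dots> = adjoint S h"
      by (simp only: R)
    finally have "adjoint S (R h) = inv_sqrt lam (inv_sqrt lam (adjoint S h))"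
      by (metis inv_sqrt_sqrt_op)
    then have "L0 (R h) \<bullet> h = inv_sqrt lam (inv_sqrt lam (adjoint S h)) \<bullet> adjoint S h"
      by (simp add: L0_def adjoint_S)
    then show ?thesis
      by (simp add: R_def inv_sqrt_sym[of "inv_sqrt lam (adjoint S h)"] power2_norm_eq_inner)
  qed
  have "(\<Sum>j. (norm (x j))\<^sup>2) \<le> (\<Sum>\<^sub>\<infinity>h\<in>B. (norm (inv_sqrt lam (adjoint S h)))\<^sup>2)"
  proof (rule hilbert_schmidt_swap_le[OF B])
    show "(\<lambda>j. (x j \<bullet> h)\<^sup>2) sums (norm (inv_sqrt lam (adjoint S h)))\<^sup>2" for h
      using e[of "inv_sqrt lam (adjoint S h)"]
      by (simp add: x_def adjoint_S inv_sqrt_swap[of "e _" "adjoint S h"])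
    show "summable (\<lambda>j. (norm (x j))\<^sup>2)"
      unfolding x_def using inv_sqrt_sums[OF e] by (rule sums_summable)
  qed
  moreover have "(\<Sum>j. (norm (x j))\<^sup>2) = (\<integral>m. (norm (inv_sqrt lam (k m)))\<^sup>2 \<partial>Q)"
    unfolding x_def using inv_sqrt_sums[OF e] by (rule sums_unique[symmetric])
  ultimately show ?thesis
    unfolding effective_dim_def op_trace_def B_def[symmetric] by (simp only: eq)
qed

end

end

section \<open>The source condition\<close>

text \<open>The summand 1 serves y \<le> 1. For y > 1 the exponent is rounded up to an integer k,
  and y^k / k! is one term of the exponential series.\<close>

lemma powr_le_exp:
  fixes y r :: real
  assumes "0 \<le> y" "0 \<le> r"
  shows "y powr r \<le> (1 + fact (nat \<lceil>r\<rceil>)) * exp y"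
proof (cases "y \<le> 1")
  case True
  have "y powr r \<le> 1"
    using True assms by (intro powr_le1) auto
  moreover have "1 * 1 \<le> (1 + fact (nat \<lceil>r\<rceil>)) * exp y"
    using assms by (intro mult_mono) auto
  ultimately show ?thesis by simp
next
  case False
  define k where "k = nat \<lceil>r\<rceil>"
  have "r \<le> real k"
    by (simp add: k_def real_nat_ceiling_ge)
  then have "y powr r \<le> y powr real k"
    using False by (intro powr_mono) auto
  also have "\<dots> = fact k * (y ^ k / fact k)"
    using False by (simp add: powr_realpow)
  also have "\<dots> \<le> fact k * exp y"
  proof (intro mult_left_mono)
    have "y ^ k / fact k \<le> (\<Sum>i. inverse (fact i) * y ^ i)"
      using sum_le_suminf[OF summable_exp[of y], of "{k}"] assms by (simp add: divide_inverse mult.commute)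
    then show "y ^ k / fact k \<le> exp y"
      by (simp add: exp_def divide_inverse mult.commute)
  qed simp
  also have "\<dots> \<le> (1 + fact k) * exp y"
    by (intro mult_right_mono) auto
  finally show ?thesis
    by (simp add: k_def)
qed

text \<open>With y = \<eta> t u the residual is at most exp (-y), which beats every power of y.
  Hence gradient descent does not saturate, and the rate holds for all r.\<close>

lemma residual_powr_le:
  fixes \<eta> u r :: real
  assumes "0 < \<eta>" "0 \<le> u" "\<eta> * u \<le> 1" "0 < t" "0 \<le> r"
  shows "(1 - \<eta> * u) ^ t * u powr r \<le> (1 + fact (nat \<lceil>r\<rceil>)) * (1 / (\<eta> * real t)) powr r"
proof -
  define y where "y = \<eta> * real t * u"
  have pos: "\<eta> * real t > 0"
    using assms by simp
  have "1 - \<eta> * u \<le> exp (- (\<eta> * u))"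
    using exp_ge_add_one_self[of "- (\<eta> * u)"] by simp
  then have "(1 - \<eta> * u) ^ t \<le> exp (- (\<eta> * u)) ^ t"
    using assms by (intro power_mono) auto
  also have "\<dots> = exp (- y)"
    by (simp add: y_def mult_ac flip: exp_of_nat_mult)
  finally have 1: "(1 - \<eta> * u) ^ t \<le> exp (- y)" .
  have "u = y * (1 / (\<eta> * real t))"
    using assms by (simp add: y_def)
  then have "u powr r = y powr r * (1 / (\<eta> * real t)) powr r"
    using assms pos by (metis powr_mult)
  also have "\<dots> \<le> ((1 + fact (nat \<lceil>r\<rceil>)) * exp y) * (1 / (\<eta> * real t)) powr r"
    using assms pos by (intro mult_right_mono powr_le_exp) (auto simp: y_def)
  finally have "(1 - \<eta> * u) ^ t * u powr r \<le> exp (- y) * (((1 + fact (nat \<lceil>r\<rceil>)) * exp y) * (1 / (\<eta> * real t)) powr r)"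
    using 1 assms by (intro mult_mono) auto
  also have "\<dots> = (1 + fact (nat \<lceil>r\<rceil>)) * (1 / (\<eta> * real t)) powr r"
    by (simp add: exp_minus)
  finally show ?thesis .
qed

text \<open>The factor 2^r accounts for iterates in the tail having t \<ge> T/2 instead of t =
  T.\<close>

definition decay_const :: "real \<Rightarrow> real" where
  "decay_const r = (1 + fact (nat \<lceil>r\<rceil>)) * 2 powr r"

lemma decay_const_nonneg: "0 \<le> decay_const r"
  by (simp add: decay_const_def)

lemma residual_powr_tail_le:
  fixes \<eta> u r lam :: real
  assumes "0 < \<eta>" "0 \<le> u" "\<eta> * u \<le> 1" "0 \<le> r" "lam * (\<eta> * real T) = 1" "0 < lam" "T \<le> 2 * t" "0 < t"
  shows "(1 - \<eta> * u) ^ t * u powr r \<le> decay_const r * lam powr r"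
proof -
  have "lam * (\<eta> * real T) \<le> lam * (\<eta> * (2 * real t))"
    using assms by (intro mult_left_mono) auto
  then have "1 \<le> 2 * lam * (\<eta> * real t)"
    using assms(5) by (simp add: mult_ac)
  then have "1 / (\<eta> * real t) \<le> 2 * lam"
    using assms by (simp add: divide_le_eq)
  then have "(1 / (\<eta> * real t)) powr r \<le> (2 * lam) powr r"
    using assms by (intro powr_mono2) auto
  also have "\<dots> = 2 powr r * lam powr r"
    by (simp add: powr_mult)
  finally show ?thesis
    using residual_powr_le[OF assms(1-3) \<open>0 < t\<close> assms(4)]
      mult_left_mono[of "(1 / (\<eta> * real t)) powr r" "2 powr r * lam powr r" "1 + fact (nat \<lceil>r\<rceil>)"]
    by (simp add: decay_const_def mult.assoc)
qed

context population
begin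

lemma continuous_powr: "0 < r \<Longrightarrow> continuous_on {0..b} (\<lambda>u. u powr r)" for r :: real
  by (intro continuous_intros continuous_on_powr') auto

text \<open>Under the source condition every operator estimate below becomes a scalar inequality for
  q(u) u^r on [0, a].\<close>

lemma poly_op_op_powr_norm_le:
  assumes r: "0 < r" and D: "\<And>u. u \<in> {0..a} \<Longrightarrow> \<bar>poly q u * u powr r\<bar> \<le> D"
  shows "norm (poly_op q L0 (op_powr L0 r h)) \<le> D * norm h"
proof -
  have "poly_op q L0 (op_powr L0 r h) = spectral_fun (\<lambda>u. poly q u * u powr r) L0 h"
    unfolding op_powr_def L0.spectral_fun_poly[symmetric]
    by (rule L0.spectral_fun_mult[symmetric]) (intro continuous_intros continuous_powr r)+
  also have "norm \<dots> \<le> D * norm h"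
    by (intro L0.spectral_fun_norm_le continuous_intros continuous_powr r D) (use onorm_L0_le in auto)
  finally show ?thesis .
qed

text \<open>The squared norm of the adjoint of \<open>S\<close> at v is the form of L at v, which
  supplies the additional factor u.\<close>

lemma adjoint_poly_op_op_powr_norm_le:
  assumes r: "0 < r" and D: "\<And>u. u \<in> {0..a} \<Longrightarrow> u * (poly q u * u powr r)\<^sup>2 \<le> D\<^sup>2" "0 \<le> D"
  shows "norm (adjoint S (poly_op q L0 (op_powr L0 r h))) \<le> D * norm h"
proof -
  define f where "f u = poly q u * u powr r" for u
  have f: "continuous_on {0..b} f" for b
    unfolding f_def by (intro continuous_intros continuous_powr r)
  have v: "poly_op q L0 (op_powr L0 r h) = spectral_fun f L0 h"
    unfolding op_powr_def L0.spectral_fun_poly[symmetric] f_def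
    by (rule L0.spectral_fun_mult[symmetric]) (intro continuous_intros continuous_powr r)+
  have "(norm (adjoint S (spectral_fun f L0 h)))\<^sup>2 = L0 (spectral_fun f L0 h) \<bullet> spectral_fun f L0 h"
    by (simp add: L0_def power2_norm_eq_inner adjoint_S)
  also have "\<dots> = spectral_fun f L0 (spectral_fun (poly [:0, 1:]) L0 (spectral_fun f L0 h)) \<bullet> h"
    by (simp add: L0.spectral_fun_sym[OF f] L0.spectral_fun_poly)
  also have "spectral_fun (poly [:0, 1:]) L0 (spectral_fun f L0 h) = spectral_fun (\<lambda>u. poly [:0, 1:] u * f u) L0 h"
    by (rule L0.spectral_fun_mult[symmetric]) (intro continuous_intros f)+
  also have "spectral_fun f L0 \<dots> = spectral_fun (\<lambda>u. f u * (poly [:0, 1:] u * f u)) L0 h"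
    by (rule L0.spectral_fun_mult[symmetric]) (intro continuous_intros f)+
  also have "\<dots> \<bullet> h \<le> norm \<dots> * norm h"
    by (rule norm_cauchy_schwarz)
  also have "\<dots> \<le> (D\<^sup>2 * norm h) * norm h"
  proof (intro mult_right_mono L0.spectral_fun_norm_le continuous_intros f)
    fix u assume "u \<in> {0..onorm L0}"
    then have "u \<in> {0..a}"
      using onorm_L0_le by auto
    then show "\<bar>f u * (poly [:0, 1:] u * f u)\<bar> \<le> D\<^sup>2"
      using D(1)[of u] by (simp add: f_def power2_eq_square abs_mult mult_ac)
  qed simp
  also have "\<dots> = (D * norm h)\<^sup>2"
    by (simp add: power2_eq_square)
  finally show ?thesis
    unfolding v by (rule power2_le_imp_le) (use D in simp)
qed

text \<open>\<open>S\<close> is dominated by the energy norm, so \<open>S\<close> after whitening is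
  a contraction, and so is its adjoint.\<close>

lemma inv_sqrt_adjoint_norm_le:
  assumes lam: "lam > 0"
  shows "norm (inv_sqrt lam (adjoint S w)) \<le> norm w"
proof -
  define x where "x = inv_sqrt lam (adjoint S w)"
  have "(norm x)\<^sup>2 = inv_sqrt lam x \<bullet> adjoint S w"
    unfolding power2_norm_eq_inner by (subst (2) x_def) (rule inv_sqrt_sym[OF lam, symmetric])
  also have "\<dots> = S (inv_sqrt lam x) \<bullet> w"
    by (simp add: adjoint_S)
  also have "\<dots> \<le> norm (S (inv_sqrt lam x)) * norm w"
    by (rule norm_cauchy_schwarz)
  also have "\<dots> \<le> norm x * norm w"
  proof (rule mult_right_mono)
    have "(norm (S (inv_sqrt lam x)))\<^sup>2 \<le> (norm (sqrt_op lam (inv_sqrt lam x)))\<^sup>2"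
      using lam by (simp add: sqrt_op_norm[OF lam])
    then show "norm (S (inv_sqrt lam x)) \<le> norm x"
      unfolding sqrt_op_inv_sqrt[OF lam] by (rule power2_le_imp_le) simp
  qed simp
  finally have "norm x * norm x \<le> norm x * norm w"
    by (simp add: power2_eq_square)
  then show ?thesis
    unfolding x_def[symmetric] by (cases "x = 0") auto
qed

end

section \<open>The population iterate\<close>

text \<open>The population iterate \<open>reference\<close> replaces the target function, which need not belong to the
  RKHS.\<close>

locale source_condition = population +
  fixes g h :: "'c" and r R \<eta> lam :: real and T :: nat
  assumes r: "1 / 2 \<le> r" and g: "g = op_powr L0 r h" and R: "norm h \<le> R"
    and \<eta>: "0 < \<eta>" "\<eta> * a \<le> 1" and lam: "0 < lam" "lam \<le> 1" "lam * (\<eta> * real T) = 1"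
begin

sublocale step_size \<eta> a
  using \<eta> by unfold_locales

lemma T_pos: "0 < T"
  using lam by (cases "T = 0") auto

text \<open>The bias bounds need a target in the range of the adjoint of \<open>S\<close>. Since
  filters intertwine, the image of this vector is the T-th iterate of population gradient
  descent.\<close>

definition dual_reference where "dual_reference = poly_op (filter_poly \<eta> T) L0 g"
definition reference where "reference = adjoint S dual_reference"

lemma reference_inner: "reference \<bullet> y = dual_reference \<bullet> S y"
  by (simp add: reference_def adjoint_S')

lemma S_reference: "S reference = L0 dual_reference"
  by (simp add: reference_def L0_def)

lemma L0_filter: "L0 (poly_op (filter_poly \<eta> T) L0 x) = x - poly_op (residual_poly \<eta> T) L0 x"
proof -
  have "L0 (poly_op (filter_poly \<eta> T) L0 x) = poly_op ([:0, 1:] * filter_poly \<eta> T) L0 x"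
    by (subst poly_op_mult[OF L0.bounded_linear_A]) simp
  then show ?thesis
    unfolding filter_poly_X by (simp add: poly_op_diff)
qed

lemma residual_g_norm_le:
  assumes "T \<le> 2 * t" "0 < t"
  shows "norm (poly_op (residual_poly \<eta> t) L0 g) \<le> decay_const r * lam powr r * R"
proof -
  have "norm (poly_op (residual_poly \<eta> t) L0 g) \<le> (decay_const r * lam powr r) * norm h"
    unfolding g
  proof (rule poly_op_op_powr_norm_le)
    fix u assume u: "u \<in> {0..a}"
    have "(1 - \<eta> * u) ^ t * u powr r \<le> decay_const r * lam powr r"
      using u r lam \<eta> assms eta_mult[OF u] by (intro residual_powr_tail_le) auto
    then show "\<bar>poly (residual_poly \<eta> t) u * u powr r\<bar> \<le> decay_const r * lam powr r"
      using residual_bounds[OF u, of t] by (simp add: poly_residual abs_mult)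
  qed (use r in simp)
  also have "\<dots> \<le> (decay_const r * lam powr r) * R"
    using R decay_const_nonneg by (intro mult_left_mono) auto
  finally show ?thesis .
qed

lemma S_reference_error: "norm (S reference - g) \<le> decay_const r * lam powr r * R"
  using residual_g_norm_le[of T] T_pos by (simp add: S_reference dual_reference_def L0_filter)

text \<open>The factor u times the filter in \<open>dual_reference\<close> is at most 1, so the
  decay of the residual against u^r survives with the full exponent r.\<close>

lemma residual_L0_dual_reference_norm_le:
  assumes "T \<le> 2 * t" "0 < t"
  shows "norm (poly_op (residual_poly \<eta> t * [:0, 1:]) L0 dual_reference) \<le> decay_const r * lam powr r * R"
proof -
  have "norm (poly_op (residual_poly \<eta> t * [:0, 1:] * filter_poly \<eta> T) L0 g) \<le> (decay_const r * lam powr r) * norm h"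
    unfolding g
  proof (rule poly_op_op_powr_norm_le)
    fix u assume u: "u \<in> {0..a}"
    note b = residual_bounds[OF u, of t] filter_bounds[OF u, of T]
    have "poly (residual_poly \<eta> t * [:0, 1:] * filter_poly \<eta> T) u * u powr r
        = (u * poly (filter_poly \<eta> T) u) * (poly (residual_poly \<eta> t) u * u powr r)"
      by simp
    moreover have "0 \<le> (u * poly (filter_poly \<eta> T) u) * (poly (residual_poly \<eta> t) u * u powr r)"
      using b u by (intro mult_nonneg_nonneg) auto
    moreover have "(u * poly (filter_poly \<eta> T) u) * (poly (residual_poly \<eta> t) u * u powr r) \<le> 1 * (decay_const r * lam powr r)"
    proof (rule mult_mono)
      show "poly (residual_poly \<eta> t) u * u powr r \<le> decay_const r * lam powr r"
        unfolding poly_residual using u r lam \<eta> assms eta_mult[OF u] by (intro residual_powr_tail_le) auto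
    qed (use b in auto)
    ultimately show "\<bar>poly (residual_poly \<eta> t * [:0, 1:] * filter_poly \<eta> T) u * u powr r\<bar> \<le> decay_const r * lam powr r"
      by (simp only: abs_of_nonneg)
  qed (use r in simp)
  also have "\<dots> \<le> (decay_const r * lam powr r) * R"
    using R decay_const_nonneg by (intro mult_left_mono) auto
  finally show ?thesis
    unfolding dual_reference_def by (simp only: poly_op_mult[OF L0.bounded_linear_A])
qed

text \<open>Interpolation between g(u) \<le> 1/\<lambda> and u g(u) \<le> 1. For r \<le> 1 the norm
  may grow, but only like \<lambda>^(r-1); multiplied by the order \<lambda> of
  \<open>bias_low\<close> it gives \<lambda>^r.\<close>

lemma dual_reference_norm_le_low:
  assumes "r \<le> 1"
  shows "norm dual_reference \<le> lam powr (r - 1) * R"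
proof -
  have "norm (poly_op (filter_poly \<eta> T) L0 g) \<le> lam powr (r - 1) * norm h"
    unfolding g
  proof (rule poly_op_op_powr_norm_le)
    fix u assume u: "u \<in> {0..a}"
    define p where "p = poly (filter_poly \<eta> T) u"
    note b = filter_bounds[OF u, of T, folded p_def]
    have "p \<le> 1 / lam"
    proof -
      have "\<eta> * real T = 1 / lam"
        using lam by (simp add: field_simps)
      then show ?thesis
        using b(2) by simp
    qed
    have "p * u powr r \<le> (1 / lam) powr (1 - r) * 1"
    proof (cases "p = 0")
      case False
      then have "p > 0"
        using b(1) by simp
      have "p * u powr r = p powr (1 - r) * (u * p) powr r"
        using \<open>p > 0\<close> u by (simp add: powr_mult powr_diff mult_ac)
      also have "\<dots> \<le> (1 / lam) powr (1 - r) * 1"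
        using assms r b \<open>p \<le> 1 / lam\<close> \<open>p > 0\<close> by (intro mult_mono powr_mono2 powr_le1) auto
      finally show ?thesis .
    qed simp
    also have "\<dots> = lam powr (r - 1)"
      using lam by (simp add: powr_divide powr_diff)
    finally show "\<bar>poly (filter_poly \<eta> T) u * u powr r\<bar> \<le> lam powr (r - 1)"
      using b(1) by (simp add: p_def abs_mult)
  qed (use r in simp)
  also have "\<dots> \<le> lam powr (r - 1) * R"
    using R by (intro mult_left_mono) auto
  finally show ?thesis
    by (simp add: dual_reference_def)
qed

lemma filter_powr_le:
  assumes u: "u \<in> {0..a}" and s: "1 \<le> s"
  shows "poly (filter_poly \<eta> T) u * u powr s \<le> a powr (s - 1)"
proof (cases "u = 0")
  case False
  then have "u > 0"
    using u by simp
  then have "u powr s = u * u powr (s - 1)"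
    by (simp add: powr_diff)
  then have "poly (filter_poly \<eta> T) u * u powr s = (u * poly (filter_poly \<eta> T) u) * u powr (s - 1)"
    by simp
  also have "\<dots> \<le> 1 * a powr (s - 1)"
    using u s filter_bounds[OF u, of T] by (intro mult_mono powr_mono2) auto
  finally show ?thesis by simp
qed simp

text \<open>For r \<ge> 1 the source condition absorbs the singularity of the filter, so the bound
  is free of \<lambda>; \<open>bias_high\<close> relies on this.\<close>

lemma dual_reference_norm_le_high:
  assumes "1 \<le> r"
  shows "norm dual_reference \<le> a powr (r - 1) * R"
proof -
  have "norm (poly_op (filter_poly \<eta> T) L0 g) \<le> a powr (r - 1) * norm h"
    unfolding g
  proof (rule poly_op_op_powr_norm_le)
    fix u assume u: "u \<in> {0..a}"
    show "\<bar>poly (filter_poly \<eta> T) u * u powr r\<bar> \<le> a powr (r - 1)"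
      using filter_powr_le[OF u assms] filter_bounds(1)[OF u, of T] by (simp add: abs_mult)
  qed (use r in simp)
  also have "\<dots> \<le> a powr (r - 1) * R"
    using R by (intro mult_left_mono) auto
  finally show ?thesis
    by (simp add: dual_reference_def)
qed

lemma reference_norm_le: "norm reference \<le> a powr (r - 1 / 2) * R"
proof -
  have "norm (adjoint S (poly_op (filter_poly \<eta> T) L0 g)) \<le> a powr (r - 1 / 2) * norm h"
    unfolding g
  proof (rule adjoint_poly_op_op_powr_norm_le)
    fix u assume u: "u \<in> {0..a}"
    have "u * (poly (filter_poly \<eta> T) u * u powr r)\<^sup>2 = (poly (filter_poly \<eta> T) u * u powr (r + 1 / 2))\<^sup>2"
      using u by (simp add: power_mult_distrib powr_add powr_half_sqrt)
    also have "\<dots> \<le> (a powr (r + 1 / 2 - 1))\<^sup>2"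
      using filter_powr_le[OF u, of "r + 1 / 2"] filter_bounds(1)[OF u, of T] r by (intro power_mono) auto
    finally show "u * (poly (filter_poly \<eta> T) u * u powr r)\<^sup>2 \<le> (a powr (r - 1 / 2))\<^sup>2"
      by simp
  qed (use r in auto)
  also have "\<dots> \<le> a powr (r - 1 / 2) * R"
    using R by (intro mult_left_mono) auto
  finally show ?thesis
    by (simp add: reference_def dual_reference_def)
qed

lemma S_reference_norm_le: "norm (S reference) \<le> a powr r * R"
proof -
  have "norm (poly_op ([:0, 1:] * filter_poly \<eta> T) L0 g) \<le> a powr r * norm h"
    unfolding g
  proof (rule poly_op_op_powr_norm_le)
    fix u assume u: "u \<in> {0..a}"
    have "(u * poly (filter_poly \<eta> T) u) * u powr r \<le> 1 * a powr r"
      using u r filter_bounds[OF u, of T] by (intro mult_mono powr_mono2) auto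
    moreover have "0 \<le> (u * poly (filter_poly \<eta> T) u) * u powr r"
      using filter_bounds[OF u, of T] u by (intro mult_nonneg_nonneg) auto
    ultimately show "\<bar>poly ([:0, 1:] * filter_poly \<eta> T) u * u powr r\<bar> \<le> a powr r"
      by simp
  qed (use r in simp)
  also have "\<dots> \<le> a powr r * R"
    using R by (intro mult_left_mono) auto
  finally show ?thesis
    unfolding S_reference dual_reference_def by (subst (asm) poly_op_mult[OF L0.bounded_linear_A]) simp
qed

end

section \<open>The first stage sample\<close>

definition emp_cov :: "nat \<Rightarrow> (nat \<Rightarrow> 'k::real_inner) \<Rightarrow> 'k \<Rightarrow> 'k" where
  "emp_cov n x f = (1 / real n) *\<^sub>R (\<Sum>j<n. (f \<bullet> x j) *\<^sub>R x j)"

definition emp_vec :: "nat \<Rightarrow> (nat \<Rightarrow> 'k::real_inner) \<Rightarrow> (nat \<Rightarrow> real) \<Rightarrow> 'k" where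
  "emp_vec n x y = (1 / real n) *\<^sub>R (\<Sum>j<n. y j *\<^sub>R x j)"

lemma positive_operator_emp_cov:
  assumes x: "\<And>j. j < n \<Longrightarrow> (norm (x j))\<^sup>2 \<le> a" and a: "0 \<le> a"
  shows "positive_operator (emp_cov n x) a"
proof (rule positive_operator.intro)
  show "bounded_linear (emp_cov n x)"
    unfolding emp_cov_def
    by (intro bounded_linear_const_scaleR bounded_linear_sum bounded_linear_scaleR_const bounded_linear_inner_left)
  show "emp_cov n x f \<bullet> g = f \<bullet> emp_cov n x g" for f g
    by (simp add: emp_cov_def inner_sum_left inner_sum_right inner_commute[of g] mult.commute)
  show "0 \<le> emp_cov n x f \<bullet> f" for f
    by (auto simp: emp_cov_def inner_sum_left inner_commute[of f] intro!: divide_nonneg_nonneg sum_nonneg)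
  show "norm (emp_cov n x f) \<le> a * norm f" for f
  proof (cases "n = 0")
    case False
    have "norm (\<Sum>j<n. (f \<bullet> x j) *\<^sub>R x j) \<le> (\<Sum>j<n. a * norm f)"
    proof (intro order_trans[OF norm_sum] sum_mono)
      fix j assume "j \<in> {..<n}"
      have "norm ((f \<bullet> x j) *\<^sub>R x j) \<le> (norm f * norm (x j)) * norm (x j)"
        by (simp add: Cauchy_Schwarz_ineq2 mult_right_mono)
      also have "\<dots> = (norm (x j))\<^sup>2 * norm f"
        by (simp add: power2_eq_square)
      also have "\<dots> \<le> a * norm f"
        using x \<open>j \<in> {..<n}\<close> by (intro mult_right_mono) auto
      finally show "norm ((f \<bullet> x j) *\<^sub>R x j) \<le> a * norm f" .
    qed
    then show ?thesis
      using False by (simp add: emp_cov_def field_simps)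
  qed (use a in \<open>simp add: emp_cov_def\<close>)
qed (rule a)

lemma expectation_variance_le:
  assumes "prob_space M"
    and X: "X \<in> borel_measurable M" "\<And>z. z \<in> space M \<Longrightarrow> norm (X z :: 'k::{real_inner,second_countable_topology}) \<le> B"
    and mean: "\<And>v. (\<integral>z. X z \<bullet> v \<partial>M) = c \<bullet> v"
  shows "(\<integral>z. (norm (X z - c))\<^sup>2 \<partial>M) \<le> (\<integral>z. (norm (X z))\<^sup>2 \<partial>M)"
proof -
  interpret prob_space M by fact
  note [measurable] = X(1)
  have int1: "integrable M (\<lambda>z. (norm (X z))\<^sup>2)"
  proof (rule integrable_real_bounded)
    show "\<bar>(norm (X z))\<^sup>2\<bar> \<le> B\<^sup>2" if "z \<in> space M" for z
      using power_mono[OF X(2)[OF that], of 2] by simp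
  qed measurable
  have int2: "integrable M (\<lambda>z. X z \<bullet> c)"
  proof (rule integrable_real_bounded)
    show "\<bar>X z \<bullet> c\<bar> \<le> B * norm c" if "z \<in> space M" for z
      using Cauchy_Schwarz_ineq2[of "X z" c] mult_right_mono[OF X(2)[OF that], of "norm c"] by simp
  qed measurable
  have "(\<lambda>z. (norm (X z - c))\<^sup>2) = (\<lambda>z. (norm (X z))\<^sup>2 - 2 * (X z \<bullet> c) + c \<bullet> c)"
    by (simp add: fun_eq_iff power2_norm_eq_inner inner_diff inner_commute)
  then have "(\<integral>z. (norm (X z - c))\<^sup>2 \<partial>M) = (\<integral>z. (norm (X z))\<^sup>2 \<partial>M) - c \<bullet> c"
    using int1 int2 mean[of c] by (simp add: prob_space)
  then show ?thesis
    by simp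
qed

text \<open>The assumption \<open>regression\<close> is the weak form of g being the conditional
  mean of the label: it tests g against the range of \<open>S\<close>, and this determines the mean
  of the noise.\<close>

locale regression = population +
  fixes \<rho> :: "('a \<times> real) measure" and M :: real and g :: "'c"
  assumes prob_\<rho>: "prob_space \<rho>"
    and fst_measurable[measurable]: "fst \<in> measurable \<rho> Q"
    and distr_fst: "distr \<rho> Q fst = Q"
    and snd_measurable[measurable]: "snd \<in> borel_measurable \<rho>"
    and snd_bound: "z \<in> space \<rho> \<Longrightarrow> \<bar>snd z\<bar> \<le> M"
    and regression: "g \<bullet> S f = (\<integral>z. snd z * (f \<bullet> k (fst z)) \<partial>\<rho>)"
begin

sublocale R: prob_space \<rho> by (rule prob_\<rho>)

abbreviation "samples n \<equiv> PiM {..<n} (\<lambda>_::nat. \<rho>)"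
abbreviation "cov n z \<equiv> emp_cov n (\<lambda>j. k (fst (z j)))"
abbreviation "bvec n z \<equiv> emp_vec n (\<lambda>j. k (fst (z j))) (\<lambda>j. snd (z j))"

lemma fst_space: "z \<in> space \<rho> \<Longrightarrow> fst z \<in> space Q"
  using measurable_space[OF fst_measurable] .

lemma integral_fst:
  fixes f :: "'a \<Rightarrow> real"
  assumes "f \<in> borel_measurable Q"
  shows "(\<integral>z. f (fst z) \<partial>\<rho>) = (\<integral>m. f m \<partial>Q)"
  using integral_distr[OF fst_measurable assms] by (simp add: distr_fst)

text \<open>Chebyshev with fourth moment at most a^2. This plain operator norm deviation is what
  \<open>bias_high\<close> consumes for r > 1.\<close>

lemma covariance_event:
  assumes n: "n > 0" and \<Delta>: "\<Delta> > 0"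
  shows "\<exists>E\<in>sets (samples n). 1 - a\<^sup>2 / (real n * \<Delta>\<^sup>2) \<le> measure (samples n) E \<and>
    (\<forall>z\<in>E. \<forall>f. norm (T0 f - cov n z f) \<le> \<Delta> * norm f)"
proof -
  have "\<exists>E\<in>sets (samples n). 1 - (\<integral>z. (norm (k (fst z))) ^ 4 \<partial>\<rho>) / (real n * \<Delta>\<^sup>2) \<le> measure (samples n) E \<and>
    (\<forall>z\<in>E. \<forall>f. norm ((1 / real n) *\<^sub>R (\<Sum>j<n. (k (fst (z j)) \<bullet> f) *\<^sub>R k (fst (z j))) - T0 f) \<le> \<Delta> * norm f)"
  proof (rule R.empirical_covariance_deviation[OF _ _ _ n \<Delta>])
    show "norm (k (fst z)) \<le> sqrt a" if "z \<in> space \<rho>" for z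
      by (rule k_norm_le[OF fst_space[OF that]])
    show "T0 f \<bullet> f' = (\<integral>z. (k (fst z) \<bullet> f) * (k (fst z) \<bullet> f') \<partial>\<rho>)" for f f'
      using integral_fst[of "\<lambda>m. (k m \<bullet> f) * (k m \<bullet> f')"] by (simp add: T0_inner S_inner inner_commute[of "k _"])
  qed measurable
  moreover have "(\<integral>z. (norm (k (fst z))) ^ 4 \<partial>\<rho>) \<le> (\<integral>z. a\<^sup>2 \<partial>\<rho>)"
  proof (rule integral_mono)
    have le: "norm (k (fst z)) ^ 4 \<le> a\<^sup>2" if "z \<in> space \<rho>" for z
      using power_mono[OF k_bound[OF fst_space[OF that]], of 2] by (simp flip: power_mult)
    then show "norm (k (fst z)) ^ 4 \<le> a\<^sup>2" if "z \<in> space \<rho>" for z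
      using that .
    show "integrable \<rho> (\<lambda>z. norm (k (fst z)) ^ 4)"
      by (rule R.integrable_real_bounded[where B = "a\<^sup>2"]) (use le in auto)
  qed simp
  then have "(\<integral>z. (norm (k (fst z))) ^ 4 \<partial>\<rho>) / (real n * \<Delta>\<^sup>2) \<le> a\<^sup>2 / (real n * \<Delta>\<^sup>2)"
    by (intro divide_right_mono) (simp_all add: R.prob_space)
  ultimately show ?thesis
    unfolding emp_cov_def inner_commute[of _ "k _"] norm_minus_commute[of "T0 _"]
    by (meson diff_left_mono order_trans)
qed

text \<open>The deviation bound is applied to whitened features with \<epsilon> = 1/2. Of their
  fourth moment, one square is at most a/\<lambda> and the other integrates to at most N.\<close>

lemma comparison_event:
  assumes n: "n > 0" and lam: "lam > 0" and N: "(\<integral>m. (norm (inv_sqrt lam (k m)))\<^sup>2 \<partial>Q) \<le> N"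
  shows "\<exists>E\<in>sets (samples n). 1 - 4 * a * N / (real n * lam) \<le> measure (samples n) E \<and>
    (\<forall>z\<in>E. \<forall>f. (norm (S f))\<^sup>2 + lam * (norm f)\<^sup>2 \<le> 2 * (cov n z f \<bullet> f + lam * (norm f)\<^sup>2))"
proof -
  let ?B = "inv_sqrt lam"
  have B_lin: "linear ?B"
    using bounded_linear_inv_sqrt[OF lam] by (rule bounded_linear.linear)
  have B_meas[measurable]: "?B \<in> borel_measurable borel"
    using bounded_linear_inv_sqrt[OF lam] by (intro borel_measurable_continuous_onI linear_continuous_on)
  have bd: "norm (?B (k m)) \<le> 1 / sqrt lam * sqrt a" if "m \<in> space Q" for m
    using inv_sqrt_norm_le[OF lam, of "k m"] mult_left_mono[OF k_norm_le[OF that], of "1 / sqrt lam"] lam by simp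
  then have bd2: "(norm (?B (k m)))\<^sup>2 \<le> a / lam" if "m \<in> space Q" for m
    using power_mono[OF bd[OF that], of 2] that lam a_nonneg by (simp add: power_divide)
  have "\<exists>E\<in>sets (samples n). 1 - (\<integral>z. (norm (?B (k (fst z)))) ^ 4 \<partial>\<rho>) / (real n * (1 / 2)\<^sup>2) \<le> measure (samples n) E \<and>
    (\<forall>z\<in>E. \<forall>f. norm ((1 / real n) *\<^sub>R (\<Sum>j<n. (?B (k (fst (z j))) \<bullet> f) *\<^sub>R ?B (k (fst (z j)))) - ?B (T0 (?B f))) \<le> (1 / 2) * norm f)"
  proof (rule R.empirical_covariance_deviation[OF _ _ _ n])
    show "norm (?B (k (fst z))) \<le> 1 / sqrt lam * sqrt a" if "z \<in> space \<rho>" for z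
      by (rule bd[OF fst_space[OF that]])
    show "?B (T0 (?B f)) \<bullet> f' = (\<integral>z. (?B (k (fst z)) \<bullet> f) * (?B (k (fst z)) \<bullet> f') \<partial>\<rho>)" for f f'
      using integral_fst[of "\<lambda>m. (?B (k m) \<bullet> f) * (?B (k m) \<bullet> f')"]
      by (simp add: inv_sqrt_sym[OF lam, of "T0 _"] T0_inner S_inner inv_sqrt_swap[OF lam, of "k _"])
  qed auto
  then obtain E where E: "E \<in> sets (samples n)"
    "1 - (\<integral>z. (norm (?B (k (fst z)))) ^ 4 \<partial>\<rho>) / (real n * (1 / 2)\<^sup>2) \<le> measure (samples n) E"
    and dev: "\<And>z f. z \<in> E \<Longrightarrow> norm ((1 / real n) *\<^sub>R (\<Sum>j<n. (?B (k (fst (z j))) \<bullet> f) *\<^sub>R ?B (k (fst (z j)))) - ?B (T0 (?B f))) \<le> (1 / 2) * norm f"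
    by blast
  have "(\<integral>z. (norm (?B (k (fst z)))) ^ 4 \<partial>\<rho>) \<le> a / lam * N"
  proof -
    have int: "integrable Q (\<lambda>m. (norm (?B (k m)))\<^sup>2)"
      by (rule integrable_real_bounded[where B = "a / lam"]) (use bd2 in auto)
    have pw: "norm (?B (k m)) ^ 4 \<le> a / lam * (norm (?B (k m)))\<^sup>2" if "m \<in> space Q" for m
    proof -
      have "norm (?B (k m)) ^ 4 = (norm (?B (k m)))\<^sup>2 * (norm (?B (k m)))\<^sup>2"
        by (simp flip: power_add)
      also have "\<dots> \<le> a / lam * (norm (?B (k m)))\<^sup>2"
        by (intro mult_right_mono bd2 that) simp
      finally show ?thesis .
    qed
    have "(\<integral>z. (norm (?B (k (fst z)))) ^ 4 \<partial>\<rho>) = (\<integral>m. (norm (?B (k m))) ^ 4 \<partial>Q)"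
      by (rule integral_fst) measurable
    also have "\<dots> \<le> (\<integral>m. a / lam * (norm (?B (k m)))\<^sup>2 \<partial>Q)"
    proof (rule integral_mono[OF _ _ pw])
      show "integrable Q (\<lambda>m. norm (?B (k m)) ^ 4)"
      proof (rule integrable_real_bounded)
        show "\<bar>norm (?B (k m)) ^ 4\<bar> \<le> (a / lam)\<^sup>2" if "m \<in> space Q" for m
          using power_mono[OF bd2[OF that], of 2] by (simp flip: power_mult)
      qed measurable
    qed (use int in auto)
    also have "\<dots> = a / lam * (\<integral>m. (norm (?B (k m)))\<^sup>2 \<partial>Q)"
      by simp
    also have "\<dots> \<le> a / lam * N"
      using N a_nonneg lam by (intro mult_left_mono) auto
    finally show ?thesis .
  qed
  then have "(\<integral>z. (norm (?B (k (fst z)))) ^ 4 \<partial>\<rho>) / (real n * (1 / 2)\<^sup>2) \<le> (a / lam * N) / (real n * (1 / 2)\<^sup>2)"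
    by (intro divide_right_mono) auto
  also have "\<dots> = 4 * a * N / (real n * lam)"
    by (simp add: power2_eq_square mult_ac)
  finally have "1 - 4 * a * N / (real n * lam) \<le> measure (samples n) E"
    using E(2) by linarith
  moreover have "(norm (S f))\<^sup>2 + lam * (norm f)\<^sup>2 \<le> 2 * (cov n z f \<bullet> f + lam * (norm f)\<^sup>2)" if "z \<in> E" for z f
  proof (rule comparison_of_whitened_deviation[OF lam])
    fix f
    have "?B (cov n z (?B f)) = (1 / real n) *\<^sub>R (\<Sum>j<n. (?B (k (fst (z j))) \<bullet> f) *\<^sub>R ?B (k (fst (z j))))"
      by (simp add: emp_cov_def linear_scale[OF B_lin] linear_sum[OF B_lin] inv_sqrt_swap[OF lam, of f])
    then show "norm (?B (cov n z (?B f)) - ?B (T0 (?B f))) \<le> 1 / 2 * norm f"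
      using dev[OF that, of f] by simp
  qed
  ultimately show ?thesis
    using E(1) by blast
qed

text \<open>The averaged residual gradients split into their mean and a centred sum. The whitened
  mean is at most the L2 error of f, and the exponential tail bound controls the centred
  sum.\<close>

lemma noise_event:
  assumes n: "n > 0" and lam: "lam > 0" and N: "(\<integral>m. (norm (inv_sqrt lam (k m)))\<^sup>2 \<partial>Q) \<le> N"
    and N': "4 * a / (lam * real n) \<le> N" "0 < N" and D: "M + norm f * sqrt a \<le> D" "0 < D"
  shows "\<exists>E\<in>sets (samples n). 1 - 2 * exp (1 - t) \<le> measure (samples n) E \<and>
    (\<forall>z\<in>E. norm (inv_sqrt lam (bvec n z - cov n z f)) \<le> t * D * sqrt (N / real n) + norm (S f - g))"
proof -
  interpret PP: prob_space "samples n"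
    by (intro prob_space_PiM prob_\<rho>)
  let ?B = "inv_sqrt lam"
  have B_lin: "linear ?B"
    using bounded_linear_inv_sqrt[OF lam] by (rule bounded_linear.linear)
  have B_meas[measurable]: "?B \<in> borel_measurable borel"
    using bounded_linear_inv_sqrt[OF lam] by (intro borel_measurable_continuous_onI linear_continuous_on)
  \<comment> \<open>The mean of the single-sample gradients \<open>X\<close>; whitening maps it to a
    vector of norm at most |S f - g|.\<close>
  define c where "c = adjoint S (g - S f)"
  define X where "X z = (snd z - f \<bullet> k (fst z)) *\<^sub>R k (fst z)" for z
  have X_meas[measurable]: "X \<in> borel_measurable \<rho>"
    unfolding X_def[abs_def] by measurable
  have res: "\<bar>snd z - f \<bullet> k (fst z)\<bar> \<le> D" if "z \<in> space \<rho>" for z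
    using snd_bound[OF that] inner_k_le[OF fst_space[OF that], of f] D by linarith
  have X_norm: "norm (X z) \<le> D * sqrt a" if "z \<in> space \<rho>" for z
    unfolding X_def norm_scaleR
    using res[OF that] k_norm_le[OF fst_space[OF that]] D by (intro mult_mono) auto
  have bounded_int: "integrable \<rho> (\<lambda>z. h z * (v \<bullet> k (fst z)))"
    if h: "h \<in> borel_measurable \<rho>" "\<And>z. z \<in> space \<rho> \<Longrightarrow> \<bar>h z\<bar> \<le> H" for h v H
  proof (rule R.integrable_real_bounded)
    show "\<bar>h z * (v \<bullet> k (fst z))\<bar> \<le> H * (norm v * sqrt a)" if z: "z \<in> space \<rho>" for z
    proof -
      have "0 \<le> H"
        using h(2)[OF z] by linarith
      then show ?thesis
        unfolding abs_mult using h(2)[OF z] inner_k_le[OF fst_space[OF z], of v] by (intro mult_mono) auto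
    qed
  qed (use h(1) in measurable)
  have mean: "(\<integral>z. X z \<bullet> v \<partial>\<rho>) = c \<bullet> v" for v
  proof -
    have "(\<integral>z. X z \<bullet> v \<partial>\<rho>) = (\<integral>z. snd z * (v \<bullet> k (fst z)) - (f \<bullet> k (fst z)) * (v \<bullet> k (fst z)) \<partial>\<rho>)"
      by (simp add: X_def left_diff_distrib inner_commute)
    also have "\<dots> = (\<integral>z. snd z * (v \<bullet> k (fst z)) \<partial>\<rho>) - (\<integral>z. (f \<bullet> k (fst z)) * (v \<bullet> k (fst z)) \<partial>\<rho>)"
      by (intro Bochner_Integration.integral_diff bounded_int) (auto intro: snd_bound inner_k_le[OF fst_space])
    also have "(\<integral>z. (f \<bullet> k (fst z)) * (v \<bullet> k (fst z)) \<partial>\<rho>) = S f \<bullet> S v"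
      by (subst integral_fst) (auto simp: S_inner)
    finally show ?thesis
      by (simp add: c_def adjoint_S' regression[symmetric] inner_diff)
  qed
  have c_norm: "norm c \<le> D * sqrt a"
  proof -
    have "norm c * norm c = (\<integral>z. X z \<bullet> c \<partial>\<rho>)"
      by (simp add: mean power2_norm_eq_inner flip: power2_eq_square)
    also have "\<dots> \<le> (\<integral>z. D * sqrt a * norm c \<partial>\<rho>)"
    proof (rule integral_mono)
      have le: "\<bar>X z \<bullet> c\<bar> \<le> D * sqrt a * norm c" if "z \<in> space \<rho>" for z
        using Cauchy_Schwarz_ineq2[of "X z" c] mult_right_mono[OF X_norm[OF that], of "norm c"] by simp
      then show "X z \<bullet> c \<le> D * sqrt a * norm c" if "z \<in> space \<rho>" for z
        using that by fastforce
      show "integrable \<rho> (\<lambda>z. X z \<bullet> c)"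
        by (rule R.integrable_real_bounded[OF _ le]) auto
    qed simp
    finally have "norm c * norm c \<le> (D * sqrt a) * norm c"
      by (simp add: R.prob_space)
    then show ?thesis
      using D a_nonneg by (cases "c = 0") auto
  qed
  define \<xi> where "\<xi> z = ?B (X z - c)" for z
  have \<xi>_meas[measurable]: "\<xi> \<in> borel_measurable \<rho>"
    unfolding \<xi>_def[abs_def] by measurable
  have \<xi>_norm: "norm (\<xi> z) \<le> 2 * D * sqrt a / sqrt lam" if "z \<in> space \<rho>" for z
  proof -
    have "norm (\<xi> z) \<le> 1 / sqrt lam * norm (X z - c)"
      unfolding \<xi>_def by (rule inv_sqrt_norm_le[OF lam])
    also have "\<dots> \<le> 1 / sqrt lam * (2 * D * sqrt a)"
      using norm_triangle_ineq4[of "X z" c] X_norm[OF that] c_norm lam by (intro mult_left_mono) auto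
    finally show ?thesis by simp
  qed
  have \<xi>_mean: "(\<integral>z. \<xi> z \<bullet> v \<partial>\<rho>) = 0" for v
  proof -
    have "integrable \<rho> (\<lambda>z. X z \<bullet> w)" for w
    proof (rule R.integrable_real_bounded)
      show "\<bar>X z \<bullet> w\<bar> \<le> D * sqrt a * norm w" if "z \<in> space \<rho>" for z
        using Cauchy_Schwarz_ineq2[of "X z" w] mult_right_mono[OF X_norm[OF that], of "norm w"] by simp
    qed auto
    then show ?thesis
      by (simp add: \<xi>_def inv_sqrt_sym[OF lam] inner_diff_left mean R.prob_space)
  qed
  \<comment> \<open>Centring does not increase the second moment, and the residual y - f(m)
    contributes at most D^2.\<close>
  have \<xi>_var: "(\<integral>z. (norm (\<xi> z))\<^sup>2 \<partial>\<rho>) \<le> D\<^sup>2 * N"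
  proof -
    have bdk: "norm (?B (k m)) \<le> 1 / sqrt lam * sqrt a" if "m \<in> space Q" for m
      using inv_sqrt_norm_le[OF lam, of "k m"] mult_left_mono[OF k_norm_le[OF that], of "1 / sqrt lam"] lam by simp
    have BX: "norm (?B (X z)) \<le> 1 / sqrt lam * (D * sqrt a)" if "z \<in> space \<rho>" for z
      using inv_sqrt_norm_le[OF lam, of "X z"] mult_left_mono[OF X_norm[OF that], of "1 / sqrt lam"] lam by simp
    have "(\<integral>z. (norm (\<xi> z))\<^sup>2 \<partial>\<rho>) = (\<integral>z. (norm (?B (X z) - ?B c))\<^sup>2 \<partial>\<rho>)"
      by (simp add: \<xi>_def linear_diff[OF B_lin])
    also have "\<dots> \<le> (\<integral>z. (norm (?B (X z)))\<^sup>2 \<partial>\<rho>)"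
    proof (rule expectation_variance_le[OF prob_\<rho> _ BX])
      show "(\<integral>z. ?B (X z) \<bullet> v \<partial>\<rho>) = ?B c \<bullet> v" for v
        by (simp add: inv_sqrt_sym[OF lam] mean)
    qed auto
    also have "\<dots> \<le> (\<integral>z. D\<^sup>2 * (norm (?B (k (fst z))))\<^sup>2 \<partial>\<rho>)"
    proof (rule integral_mono)
      show "(norm (?B (X z)))\<^sup>2 \<le> D\<^sup>2 * (norm (?B (k (fst z))))\<^sup>2" if "z \<in> space \<rho>" for z
      proof -
        have "(snd z - f \<bullet> k (fst z))\<^sup>2 \<le> D\<^sup>2"
          using power_mono[OF res[OF that], of 2] by simp
        then show ?thesis
          unfolding X_def linear_scale[OF B_lin] norm_scaleR power_mult_distrib power2_abs
          by (rule mult_right_mono) simp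
      qed
      show "integrable \<rho> (\<lambda>z. (norm (?B (X z)))\<^sup>2)"
      proof (rule R.integrable_real_bounded)
        show "\<bar>(norm (?B (X z)))\<^sup>2\<bar> \<le> (1 / sqrt lam * (D * sqrt a))\<^sup>2" if "z \<in> space \<rho>" for z
          using power_mono[OF BX[OF that], of 2] by simp
      qed auto
      show "integrable \<rho> (\<lambda>z. D\<^sup>2 * (norm (?B (k (fst z))))\<^sup>2)"
      proof (rule R.integrable_real_bounded)
        show "\<bar>D\<^sup>2 * (norm (?B (k (fst z))))\<^sup>2\<bar> \<le> D\<^sup>2 * (1 / sqrt lam * sqrt a)\<^sup>2" if "z \<in> space \<rho>" for z
          using power_mono[OF bdk[OF fst_space[OF that]], of 2] by (simp add: mult_left_mono)
      qed auto
    qed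
    also have "\<dots> = D\<^sup>2 * (\<integral>m. (norm (?B (k m)))\<^sup>2 \<partial>Q)"
      using integral_fst[of "\<lambda>m. D\<^sup>2 * (norm (?B (k m)))\<^sup>2"] by simp
    also have "\<dots> \<le> D\<^sup>2 * N"
      using N by (intro mult_left_mono) auto
    finally show ?thesis .
  qed
  \<comment> \<open>This scale makes the total variance at most 1; that single summands are at most
    1 is exactly what the lower bound on N in terms of 4 a / (\<lambda> n) provides.\<close>
  define \<theta> where "\<theta> = 1 / (D * sqrt (N * real n))"
  have Nn: "0 < N * real n"
    using N'(2) n by simp
  have \<theta>_pos: "\<theta> > 0"
    using D Nn by (simp add: \<theta>_def)
  have \<theta>B: "\<theta> * (2 * D * sqrt a / sqrt lam) \<le> 1"
  proof -
    have "4 * a \<le> (N * real n) * lam"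
      using N'(1) lam n by (simp add: divide_le_eq mult_ac)
    then have "sqrt (4 * a) \<le> sqrt (N * real n) * sqrt lam"
      by (simp flip: real_sqrt_mult)
    then have "2 * sqrt a \<le> sqrt (N * real n) * sqrt lam"
      by (simp add: real_sqrt_mult)
    then show ?thesis
      using D Nn lam by (simp add: \<theta>_def divide_le_eq)
  qed
  have \<theta>V: "real n * \<theta>\<^sup>2 * (D\<^sup>2 * N) \<le> 1"
    using D N' n by (simp add: \<theta>_def power_divide power_mult_distrib)
  define F where "F = {z \<in> space (samples n). t \<le> \<theta> * norm (\<Sum>j<n. \<xi> (z j))}"
  have [measurable]: "(\<lambda>z. \<Sum>j<n. \<xi> (z j)) \<in> borel_measurable (samples n)"
    by (rule borel_measurable_sum) (rule measurable_compose[OF _ \<xi>_meas], rule measurable_component_singleton)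
  have F: "F \<in> sets (samples n)"
    unfolding F_def by measurable
  have "measure (samples n) F \<le> 2 * exp (1 - t)"
    unfolding F_def
    by (rule R.measure_PiM_norm_sum_ge_le[OF \<xi>_meas \<xi>_norm \<xi>_mean \<xi>_var less_imp_le[OF \<theta>_pos] \<theta>B \<theta>V])
  then have "1 - 2 * exp (1 - t) \<le> measure (samples n) (space (samples n) - F)"
    using PP.prob_compl[OF F] by simp
  moreover have "norm (?B (bvec n z - cov n z f)) \<le> t * D * sqrt (N / real n) + norm (S f - g)"
    if "z \<in> space (samples n) - F" for z
  proof -
    have "bvec n z - cov n z f = (1 / real n) *\<^sub>R (\<Sum>j<n. X (z j))"
      by (simp add: emp_vec_def emp_cov_def X_def scaleR_diff_left sum_subtractf scaleR_diff_right)
    also have "\<dots> = (1 / real n) *\<^sub>R (\<Sum>j<n. X (z j) - c) + c"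
      using n by (simp add: sum_subtractf scaleR_diff_right sum_constant_scaleR)
    finally have "?B (bvec n z - cov n z f) = (1 / real n) *\<^sub>R (\<Sum>j<n. \<xi> (z j)) + ?B c"
      by (simp add: linear_add[OF B_lin] linear_scale[OF B_lin] linear_sum[OF B_lin] \<xi>_def)
    then have "norm (?B (bvec n z - cov n z f)) \<le> norm ((1 / real n) *\<^sub>R (\<Sum>j<n. \<xi> (z j))) + norm (?B c)"
      by (simp only: norm_triangle_ineq)
    moreover have "norm (?B c) \<le> norm (S f - g)"
      unfolding c_def using inv_sqrt_adjoint_norm_le[OF lam] by (metis norm_minus_commute)
    moreover have "norm ((1 / real n) *\<^sub>R (\<Sum>j<n. \<xi> (z j))) \<le> t * D * sqrt (N / real n)"
    proof -
      have "\<theta> * norm (\<Sum>j<n. \<xi> (z j)) \<le> t"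
        using that by (auto simp: F_def)
      then have "norm (\<Sum>j<n. \<xi> (z j)) \<le> t / \<theta>"
        using \<theta>_pos by (simp add: le_divide_eq mult.commute)
      then have "norm ((1 / real n) *\<^sub>R (\<Sum>j<n. \<xi> (z j))) \<le> 1 / real n * (t / \<theta>)"
        unfolding norm_scaleR by (intro mult_mono) auto
      also have "\<dots> = t * D * (sqrt (N * real n) / real n)"
        by (simp add: \<theta>_def)
      also have "sqrt (N * real n) / real n = sqrt (N / real n)"
      proof -
        define q where "q = sqrt (real n)"
        have "q > 0" "real n = q * q"
          using n by (auto simp: q_def)
        moreover have "sqrt (N * real n) = sqrt N * q" "sqrt (N / real n) = sqrt N / q"
          by (simp_all add: q_def real_sqrt_mult real_sqrt_divide)
        ultimately show ?thesis
          by (simp only:) simp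
      qed
      finally show ?thesis .
    qed
    ultimately show ?thesis
      by linarith
  qed
  ultimately show ?thesis
    using F by (intro bexI[of _ "space (samples n) - F"]) auto
qed

end

section \<open>The good event and the first-stage error\<close>

text \<open>The capacity condition is already in terms of whitened features. The lower bound on c
  guarantees N \<ge> 4 a / (\<lambda> n) in the noise estimate; the factor A is the enlargement of
  \<lambda> in the comparison.\<close>

locale first_stage_problem = regression + source_condition +
  fixes c \<nu> A :: real
  assumes M_pos: "0 < M" and R_pos: "0 < R" and a_pos: "0 < a"
    and c_pos: "0 < c" and A_ge_1: "1 \<le> A" and \<nu>: "0 < \<nu>"
    and capacity: "0 < l \<Longrightarrow> (\<integral>m. (norm (inv_sqrt l (k m)))\<^sup>2 \<partial>Q) \<le> c * l powr (- \<nu>)"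
    and c_ge: "4 * a * R\<^sup>2 / M\<^sup>2 \<le> c"
begin

text \<open>M + a^r R bounds the residual of the reference, sqrt c / M comes from N / n at the
  chosen rate, and \<open>decay_const r\<close> from the L2 error of the reference.\<close>

definition noise_const where "noise_const = (M + a powr r * R) * sqrt c / M + decay_const r"

definition bias_const where
  "bias_const = 6 * A + decay_const r + 4 * sqrt (4 * A) * a powr (r - 1)"

definition error_const where
  "error_const = 8 * A * noise_const + 2 * bias_const + decay_const r + a powr (r - 1)"

definition bound_const where
  "bound_const = 2 * a powr (r - 1 / 2) * R + noise_const * R * sqrt (4 * A)"

text \<open>After these properties the error analysis of both stages is deterministic. Membership in
  the sample space keeps labels and features bounded.\<close>

definition good :: "nat \<Rightarrow> real \<Rightarrow> (nat \<Rightarrow> 'a \<times> real) \<Rightarrow> bool" where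
  "good n \<delta> z \<longleftrightarrow> z \<in> space (samples n) \<and> comparison (cov n z) a \<eta> S lam (2 * A) T \<and>
     (\<forall>y. \<bar>(bvec n z - cov n z reference) \<bullet> y\<bar>
        \<le> ln (24 / \<delta>) * noise_const * lam powr r * R * sqrt ((norm (S y))\<^sup>2 + lam * (norm y)\<^sup>2)) \<and>
     (\<forall>f. norm (T0 f - cov n z f) \<le> 2 * a / sqrt (real n * \<delta>) * norm f)"

lemma consts_nonneg: "0 \<le> noise_const" "0 \<le> bias_const" "0 \<le> error_const" "0 \<le> bound_const"
proof -
  show 1: "0 \<le> noise_const"
    unfolding noise_const_def using M_pos R_pos c_pos decay_const_nonneg by simp
  show 2: "0 \<le> bias_const"
    unfolding bias_const_def using A_ge_1 decay_const_nonneg by simp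
  show "0 \<le> error_const"
    unfolding error_const_def using 1 2 A_ge_1 decay_const_nonneg by simp
  show "0 \<le> bound_const"
    unfolding bound_const_def using 1 A_ge_1 R_pos by simp
qed

lemma ln_ge_1:
  fixes \<delta> :: real
  assumes "0 < \<delta>" "\<delta> \<le> 1"
  shows "1 \<le> ln (24 / \<delta>)"
proof -
  have "exp 1 \<le> (24::real)"
    using exp_le by simp
  also have "24 \<le> 24 / \<delta>"
    using assms by (simp add: field_simps)
  finally show ?thesis
    using assms by (simp add: ln_ge_iff)
qed

text \<open>The three events each fail with probability at most \<delta>/4. Conditioning on \<delta>
  is harmless for the constants because only the noise bound carries ln (24/\<delta>).\<close>

lemma good_event:
  assumes n: "0 < n" and \<delta>: "0 < \<delta>" "\<delta> \<le> 1"
    and n_lam: "real n * lam powr (2 * r + \<nu>) = M\<^sup>2 / R\<^sup>2"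
    and n_large: "16 * a * c * (A * lam) powr (- (1 + \<nu>)) \<le> \<delta> * real n"
  shows "\<exists>E\<in>sets (samples n). 1 - \<delta> \<le> measure (samples n) E \<and> (\<forall>z\<in>E. good n \<delta> z)"
proof -
  interpret PP: prob_space "samples n"
    by (intro prob_space_PiM prob_\<rho>)
  define lg where "lg = ln (24 / \<delta>)"
  have lg: "1 \<le> lg"
    unfolding lg_def by (rule ln_ge_1[OF \<delta>])
  define N where "N = c * lam powr (- \<nu>)"
  have N_pos: "0 < N"
    using c_pos lam by (simp add: N_def)
  have N_n: "N / real n = c * R\<^sup>2 / M\<^sup>2 * (lam powr r)\<^sup>2"
  proof -
    have "real n = M\<^sup>2 / R\<^sup>2 / lam powr (2 * r + \<nu>)"
      using lam by (simp add: n_lam[symmetric])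
    also have "N / \<dots> = c * R\<^sup>2 / M\<^sup>2 * (lam powr (- \<nu>) * lam powr (2 * r + \<nu>))"
      by (simp add: N_def)
    also have "lam powr (- \<nu>) * lam powr (2 * r + \<nu>) = (lam powr r)\<^sup>2"
      using lam by (simp add: powr_add[symmetric] power2_eq_square)
    finally show ?thesis .
  qed
  define D where "D = M + a powr r * R"
  have D: "0 < D" "M + norm reference * sqrt a \<le> D"
  proof -
    show "0 < D"
      using M_pos R_pos by (simp add: D_def add_pos_nonneg)
    have "norm reference * sqrt a \<le> (a powr (r - 1 / 2) * R) * sqrt a"
      using a_nonneg by (intro mult_right_mono reference_norm_le) auto
    also have "\<dots> = a powr r * R"
      using a_pos by (simp add: powr_diff powr_half_sqrt)
    finally show "M + norm reference * sqrt a \<le> D"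
      by (simp add: D_def)
  qed
  \<comment> \<open>\<lambda> \<le> 1 and 2 r + \<nu> \<ge> 1 - \<nu> allow the smaller power of
    \<lambda> to replace the one fixed by the rate.\<close>
  have "4 * a / (lam * real n) \<le> N"
  proof -
    have "4 * a \<le> c * (M\<^sup>2 / R\<^sup>2)"
      using c_ge M_pos R_pos by (simp add: field_simps)
    also have "\<dots> = c * real n * lam powr (2 * r + \<nu>)"
      by (simp flip: n_lam)
    also have "\<dots> \<le> c * real n * lam powr (1 - \<nu>)"
      using c_pos lam r \<nu> by (intro mult_left_mono powr_mono') auto
    also have "\<dots> = N * (lam * real n)"
    proof -
      have "lam powr (1 - \<nu>) = lam powr (1 + - \<nu>)"
        by simp
      also have "\<dots> = lam * lam powr (- \<nu>)"
        using lam unfolding powr_add by simp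
      finally show ?thesis
        by (simp add: N_def)
    qed
    finally show ?thesis
      using lam n by (simp add: divide_le_eq)
  qed
  then obtain E1 where E1: "E1 \<in> sets (samples n)" "1 - 2 * exp (1 - lg) \<le> measure (samples n) E1"
    and noise: "\<And>z. z \<in> E1 \<Longrightarrow> norm (inv_sqrt lam (bvec n z - cov n z reference)) \<le> lg * D * sqrt (N / real n) + norm (S reference - g)"
    using noise_event[OF n lam(1) capacity[OF lam(1)] _ _ D(2,1), folded N_def, of lg] N_pos by blast
  \<comment> \<open>The comparison is taken at A \<lambda>, where its failure probability is small
    enough; it returns to \<lambda> below with constant 2 A.\<close>
  have Al: "0 < A * lam"
    using A_ge_1 lam by simp
  obtain E2 where E2: "E2 \<in> sets (samples n)"
      "1 - 4 * a * (c * (A * lam) powr (- \<nu>)) / (real n * (A * lam)) \<le> measure (samples n) E2"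
    and comp: "\<And>z f. z \<in> E2 \<Longrightarrow> (norm (S f))\<^sup>2 + (A * lam) * (norm f)\<^sup>2 \<le> 2 * (cov n z f \<bullet> f + (A * lam) * (norm f)\<^sup>2)"
    using comparison_event[OF n Al capacity[OF Al]] by blast
  \<comment> \<open>This deviation level makes the Chebyshev bound equal to \<delta>/4.\<close>
  have \<Delta>_pos: "0 < 2 * a / sqrt (real n * \<delta>)"
    using a_pos n \<delta> by simp
  obtain E3 where E3: "E3 \<in> sets (samples n)" "1 - a\<^sup>2 / (real n * (2 * a / sqrt (real n * \<delta>))\<^sup>2) \<le> measure (samples n) E3"
    and dev: "\<And>z f. z \<in> E3 \<Longrightarrow> norm (T0 f - cov n z f) \<le> 2 * a / sqrt (real n * \<delta>) * norm f"
    using covariance_event[OF n \<Delta>_pos] by blast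
  \<comment> \<open>The 24 in the logarithm: 2 exp (1 - ln (24/\<delta>)) = e \<delta> / 12 \<le>
    \<delta> / 4.\<close>
  have p1: "1 - \<delta> / 4 \<le> measure (samples n) E1"
  proof -
    have "2 * exp (1 - lg) = exp 1 * \<delta> / 12"
      using \<delta> by (simp add: lg_def exp_diff)
    moreover have "exp 1 * \<delta> \<le> 3 * \<delta>"
      using \<delta> by (intro mult_right_mono exp_le) simp
    ultimately show ?thesis
      using E1(2) by linarith
  qed
  have p2: "1 - \<delta> / 4 \<le> measure (samples n) E2"
  proof -
    have "4 * a * (c * (A * lam) powr (- \<nu>)) / (real n * (A * lam)) = 4 * a * c * (A * lam) powr (- (1 + \<nu>)) / real n"
    proof -
      have "(A * lam) powr (- (1 + \<nu>)) = (A * lam) powr (- \<nu> - 1)"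
        by (rule arg_cong) simp
      also have "\<dots> = (A * lam) powr (- \<nu>) / (A * lam)"
        unfolding powr_diff using Al by simp
      finally show ?thesis
        by (simp add: mult_ac)
    qed
    also have "\<dots> \<le> \<delta> / 4"
      using n_large n by (simp add: field_simps)
    finally show ?thesis
      using E2(2) by linarith
  qed
  have p3: "1 - \<delta> / 4 \<le> measure (samples n) E3"
  proof -
    have "a\<^sup>2 / (real n * (2 * a / sqrt (real n * \<delta>))\<^sup>2) = \<delta> / 4"
      using a_pos n \<delta> by (simp add: power_divide power_mult_distrib)
    then show ?thesis
      using E3(2) by linarith
  qed
  define E where "E = E1 \<inter> E2 \<inter> E3"
  have E: "E \<in> sets (samples n)"
    using E1 E2 E3 by (auto simp: E_def)
  have "1 - measure (samples n) E \<le> (1 - measure (samples n) E1) + (1 - measure (samples n) E2) + (1 - measure (samples n) E3)"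
  proof -
    have "space (samples n) - E = (space (samples n) - E1) \<union> (space (samples n) - E2) \<union> (space (samples n) - E3)"
      by (auto simp: E_def)
    then have "measure (samples n) (space (samples n) - E)
      \<le> measure (samples n) (space (samples n) - E1) + measure (samples n) (space (samples n) - E2) + measure (samples n) (space (samples n) - E3)"
    proof -
      let ?C = "\<lambda>F. space (samples n) - F"
      have "measure (samples n) (?C E1 \<union> ?C E2 \<union> ?C E3) \<le> measure (samples n) (?C E1 \<union> ?C E2) + measure (samples n) (?C E3)"
        using E1(1) E2(1) E3(1) by (intro measure_Un_le sets.Un sets.compl_sets)
      moreover have "measure (samples n) (?C E1 \<union> ?C E2) \<le> measure (samples n) (?C E1) + measure (samples n) (?C E2)"
        using E1(1) E2(1) by (intro measure_Un_le sets.compl_sets)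
      ultimately show ?thesis
        unfolding \<open>?C E = ?C E1 \<union> ?C E2 \<union> ?C E3\<close> by linarith
    qed
    then show ?thesis
      using PP.prob_compl E E1(1) E2(1) E3(1) by simp
  qed
  then have "1 - \<delta> \<le> measure (samples n) E"
    using p1 p2 p3 \<delta> by linarith
  moreover have "good n \<delta> z" if z: "z \<in> E" for z
  proof -
    have zs: "z \<in> space (samples n)"
      using z E sets.sets_into_space by blast
    have kz: "(norm (k (fst (z j))))\<^sup>2 \<le> a" if "j < n" for j
      using zs that by (intro k_bound fst_space) (auto simp: space_PiM PiE_iff)
    have cov_pos: "positive_operator (cov n z) a"
      by (rule positive_operator_emp_cov[OF kz a_nonneg])
    interpret cov: positive_operator "cov n z" a
      by (rule cov_pos)
    have cmp: "(norm (S f))\<^sup>2 + lam * (norm f)\<^sup>2 \<le> (2 * A) * (cov n z f \<bullet> f + lam * (norm f)\<^sup>2)" for f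
    proof -
      have "lam * (norm f)\<^sup>2 \<le> (A * lam) * (norm f)\<^sup>2"
        using A_ge_1 lam by (intro mult_right_mono) auto
      moreover have "cov n z f \<bullet> f \<le> A * (cov n z f \<bullet> f)"
        using A_ge_1 cov.pos[of f] by (simp add: mult_le_cancel_right1)
      ultimately show ?thesis
        using comp[of z f] z by (simp add: E_def algebra_simps)
    qed
    have "comparison (cov n z) a \<eta> S lam (2 * A) T"
      using cov_pos \<eta> bounded_linear_S lam A_ge_1 cmp
      by (intro comparison.intro step_size.intro comparison_axioms.intro) auto
    moreover have "norm (inv_sqrt lam (bvec n z - cov n z reference)) \<le> lg * noise_const * lam powr r * R"
    proof -
      have "sqrt (N / real n) = sqrt c * R / M * lam powr r"
        using R_pos M_pos c_pos lam by (simp add: N_n real_sqrt_mult real_sqrt_divide)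
      then have "norm (inv_sqrt lam (bvec n z - cov n z reference)) \<le> lg * D * (sqrt c * R / M * lam powr r) + norm (S reference - g)"
        using noise[of z] z by (simp add: E_def)
      also have "norm (S reference - g) \<le> lg * (decay_const r * lam powr r * R)"
        using S_reference_error lg decay_const_nonneg R_pos
        by (smt (verit) mult_nonneg_nonneg mult_le_cancel_right1 powr_ge_zero)
      finally show ?thesis
        unfolding noise_const_def D_def[symmetric] by (simp add: algebra_simps)
    qed
    then have "\<bar>(bvec n z - cov n z reference) \<bullet> y\<bar>
        \<le> lg * noise_const * lam powr r * R * sqrt ((norm (S y))\<^sup>2 + lam * (norm y)\<^sup>2)" for y
      using inner_le_inv_sqrt[OF lam(1), of "bvec n z - cov n z reference" y] lam
      by (smt (verit) mult_right_mono real_sqrt_ge_zero zero_le_power2 mult_nonneg_nonneg)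
    moreover have "norm (T0 f - cov n z f) \<le> 2 * a / sqrt (real n * \<delta>) * norm f" for f
      using dev[of z] z by (simp add: E_def)
    ultimately show ?thesis
      using zs by (simp add: good_def lg_def)
  qed
  ultimately show ?thesis
    using E by blast
qed

context
  fixes n :: nat and \<delta> :: real and z :: "nat \<Rightarrow> 'a \<times> real"
  assumes good: "good n \<delta> z" and \<delta>: "0 < \<delta>" "\<delta> \<le> 1"
begin

interpretation C: comparison "cov n z" a \<eta> S lam "2 * A" T
  using good by (simp add: good_def)

lemma noise_bound_nonneg: "0 \<le> ln (24 / \<delta>) * noise_const * lam powr r * R"
  using ln_ge_1[OF \<delta>] consts_nonneg R_pos by (intro mult_nonneg_nonneg) auto

lemma noise_bound:
  "\<bar>(bvec n z - cov n z reference) \<bullet> y\<bar>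
    \<le> ln (24 / \<delta>) * noise_const * lam powr r * R * sqrt ((norm (S y))\<^sup>2 + lam * (norm y)\<^sup>2)"
  using good by (simp add: good_def)

text \<open>The variance part of the norm is of order \<lambda>^(r - 1/2), which stays bounded
  precisely because r \<ge> 1/2 and \<lambda> \<le> 1.\<close>

lemma first_stage_norm_le:
  assumes "t \<le> T"
  shows "norm (landweber \<eta> (cov n z) (bvec n z) t) \<le> ln (24 / \<delta>) * bound_const"
proof -
  have "norm (landweber \<eta> (cov n z) (bvec n z) t)
    \<le> 2 * norm reference + ln (24 / \<delta>) * noise_const * lam powr r * R * sqrt (2 * (2 * A) / lam)"
    by (rule C.landweber_norm_le[OF noise_bound noise_bound_nonneg assms])
  also have "ln (24 / \<delta>) * noise_const * lam powr r * R * sqrt (2 * (2 * A) / lam)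
    = ln (24 / \<delta>) * (noise_const * R * sqrt (4 * A)) * lam powr (r - 1 / 2)"
    using lam by (simp add: powr_diff powr_half_sqrt real_sqrt_divide)
  also have "\<dots> \<le> ln (24 / \<delta>) * (noise_const * R * sqrt (4 * A)) * 1"
    using ln_ge_1[OF \<delta>] consts_nonneg R_pos A_ge_1 lam r by (intro mult_left_mono powr_le1) auto
  also have "2 * norm reference \<le> ln (24 / \<delta>) * (2 * a powr (r - 1 / 2) * R)"
  proof -
    have "2 * norm reference \<le> 1 * (2 * a powr (r - 1 / 2) * R)"
      using reference_norm_le by simp
    also have "\<dots> \<le> ln (24 / \<delta>) * (2 * a powr (r - 1 / 2) * R)"
      using ln_ge_1[OF \<delta>] R_pos by (intro mult_right_mono) auto
    finally show ?thesis .
  qed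
  finally show ?thesis
    by (simp add: bound_const_def algebra_simps)
qed

text \<open>For r \<le> 1 comparison of forms suffices; for r > 1 the population residual is used
  and the operator norm deviation is assumed to be below \<lambda>^r.\<close>

lemma first_stage_bias_le:
  assumes t: "T \<le> 2 * t" "t \<le> T" and \<Delta>: "1 < r \<Longrightarrow> 2 * a / sqrt (real n * \<delta>) \<le> lam powr r"
  shows "norm (S (poly_op (residual_poly \<eta> t) (cov n z) reference)) \<le> bias_const * lam powr r * R"
proof (cases "r \<le> 1")
  case True
  have "norm (S (poly_op (residual_poly \<eta> t) (cov n z) reference)) \<le> 3 * (2 * A) * lam * norm dual_reference"
    by (rule C.bias_low[OF reference_inner t(1)])
  also have "\<dots> \<le> 3 * (2 * A) * lam * (lam powr (r - 1) * R)"
    using A_ge_1 lam by (intro mult_left_mono dual_reference_norm_le_low True) auto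
  also have "\<dots> = 6 * A * lam powr r * R"
    using lam by (simp add: powr_diff)
  also have "\<dots> \<le> bias_const * lam powr r * R"
    unfolding bias_const_def using R_pos A_ge_1 decay_const_nonneg by (intro mult_right_mono) auto
  finally show ?thesis .
next
  case False
  have "t > 0"
    using t T_pos by simp
  have "norm (S (poly_op (residual_poly \<eta> t) (cov n z) reference))
    \<le> norm (poly_op (residual_poly \<eta> t * [:0, 1:]) L0 dual_reference)
      + 4 * sqrt (2 * (2 * A)) * (2 * a / sqrt (real n * \<delta>)) * norm dual_reference"
    using good a_nonneg \<delta>
    by (intro C.bias_high[OF reference_inner positive_operator_T0 positive_operator_L0 S_T0 S_reference _ _ t(2)])
       (auto simp: good_def)
  also have "norm (poly_op (residual_poly \<eta> t * [:0, 1:]) L0 dual_reference) \<le> decay_const r * lam powr r * R"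
    by (rule residual_L0_dual_reference_norm_le[OF t(1) \<open>t > 0\<close>])
  also have "4 * sqrt (2 * (2 * A)) * (2 * a / sqrt (real n * \<delta>)) * norm dual_reference
      \<le> 4 * sqrt (2 * (2 * A)) * lam powr r * (a powr (r - 1) * R)"
    using \<Delta> False A_ge_1 dual_reference_norm_le_high a_nonneg \<delta> by (intro mult_mono) auto
  finally have "norm (S (poly_op (residual_poly \<eta> t) (cov n z) reference))
      \<le> (decay_const r + 4 * sqrt (4 * A) * a powr (r - 1)) * lam powr r * R"
    by (simp add: algebra_simps)
  also have "\<dots> \<le> bias_const * lam powr r * R"
    unfolding bias_const_def using R_pos A_ge_1 by (intro mult_right_mono) auto
  finally show ?thesis .
qed

lemma first_stage_error_le:
  assumes \<Delta>: "1 < r \<Longrightarrow> 2 * a / sqrt (real n * \<delta>) \<le> lam powr r" and even: "1 < r \<Longrightarrow> even T"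
  shows "norm (S (tail_average (landweber \<eta> (cov n z) (bvec n z)) T) - g)
    \<le> error_const * ln (24 / \<delta>) * lam powr r * R"
proof -
  define lg where "lg = ln (24 / \<delta>)"
  have lg: "1 \<le> lg"
    unfolding lg_def by (rule ln_ge_1[OF \<delta>])
  define w where "w = lam powr r * R"
  have w: "0 \<le> w"
    using R_pos by (simp add: w_def)
  have "norm (S (tail_average (landweber \<eta> (cov n z) (bvec n z)) T) - g)
    \<le> 2 * (4 * A * (lg * noise_const * w) + bias_const * w) + decay_const r * w + a powr (r - 1) * w"
  proof (rule tail_average_error_le[OF linear_S T_pos])
    show "norm (S (landweber \<eta> (cov n z) (bvec n z) t - reference)) \<le> 4 * A * (lg * noise_const * w) + bias_const * w"
      if "T div 2 < t" "t \<le> T" for t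
    proof -
      have T2: "T \<le> 2 * t"
        using that(1) by linarith
      show ?thesis
      using C.S_landweber_error_le[OF noise_bound noise_bound_nonneg that(2)] first_stage_bias_le[OF T2 that(2) \<Delta>] that
      by (simp add: lg_def w_def mult_ac)
    qed
    show "0 \<le> 4 * A * (lg * noise_const * w) + bias_const * w"
      using A_ge_1 lg consts_nonneg w by simp
    show "norm (S reference - g) \<le> decay_const r * w"
      using S_reference_error by (simp add: w_def mult.assoc)
    \<comment> \<open>Odd T occurs only for r \<le> 1, where the excess weight 1/T = \<eta>
      \<lambda> \<le> \<lambda>/a is at most \<lambda>^r / a.\<close>
    show "norm (S reference) / real T \<le> a powr (r - 1) * w" if "odd T"
    proof -
      have "r \<le> 1"
        using even that by linarith
      have "1 / real T = \<eta> * lam"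
        using lam T_pos by (simp add: field_simps)
      also have "\<dots> \<le> lam / a"
        using \<eta> a_pos lam by (simp add: field_simps)
      also have "\<dots> \<le> lam powr r / a"
      proof -
        have "lam powr 1 \<le> lam powr r"
          using lam \<open>r \<le> 1\<close> by (intro powr_mono') auto
        then show ?thesis
          using lam a_pos by (simp add: divide_right_mono)
      qed
      finally have "norm (S reference) * (1 / real T) \<le> (a powr r * R) * (lam powr r / a)"
        using S_reference_norm_le by (intro mult_mono) (use R_pos in auto)
      then show ?thesis
        using a_pos by (simp add: w_def powr_diff mult_ac)
    qed
    show "0 \<le> a powr (r - 1) * w"
      using w by simp
  qed
  also have "\<dots> = (8 * A * noise_const) * (lg * w) + (2 * bias_const + decay_const r + a powr (r - 1)) * w"
    by (simp add: algebra_simps)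
  also have "\<dots> \<le> (8 * A * noise_const) * (lg * w) + (2 * bias_const + decay_const r + a powr (r - 1)) * (lg * w)"
    using lg w consts_nonneg decay_const_nonneg mult_right_mono[OF lg w]
    by (intro add_left_mono mult_left_mono) auto
  finally show ?thesis
    by (simp add: error_const_def lg_def w_def algebra_simps)
qed

end

end

section \<open>The second stage sample\<close>

lemma floor_discretisation:
  fixes t :: real
  assumes "0 < m"
  shows "\<bar>of_int \<lfloor>real m * t\<rfloor> / real m - t\<bar> \<le> 1 / real m"
proof -
  have "\<bar>of_int \<lfloor>real m * t\<rfloor> - real m * t\<bar> \<le> 1"
    by linarith
  then have "\<bar>of_int \<lfloor>real m * t\<rfloor> - real m * t\<bar> / real m \<le> 1 / real m"
    by (rule divide_right_mono) simp
  moreover have "of_int \<lfloor>real m * t\<rfloor> / real m - t = (of_int \<lfloor>real m * t\<rfloor> - real m * t) / real m"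
    using assms by (simp add: field_simps)
  ultimately show ?thesis
    by simp
qed

lemma abs_mult_diff_le:
  fixes x y x' y' :: real
  assumes "\<bar>x - x'\<bar> \<le> e" "\<bar>y - y'\<bar> \<le> e" "\<bar>x'\<bar> \<le> B" "\<bar>y'\<bar> \<le> B" "e \<le> 1"
  shows "\<bar>x * y - x' * y'\<bar> \<le> (2 * B + 1) * e"
proof -
  have "0 \<le> e" "0 \<le> B"
    using assms by linarith+
  have "x * y - x' * y' = (x - x') * (y - y') + (x - x') * y' + x' * (y - y')"
    by (simp add: algebra_simps)
  also have "\<bar>\<dots>\<bar> \<le> \<bar>x - x'\<bar> * \<bar>y - y'\<bar> + \<bar>x - x'\<bar> * \<bar>y'\<bar> + \<bar>x'\<bar> * \<bar>y - y'\<bar>"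
    using abs_triangle_ineq[of "(x - x') * (y - y') + (x - x') * y'" "x' * (y - y')"]
      abs_triangle_ineq[of "(x - x') * (y - y')" "(x - x') * y'"]
    unfolding abs_mult[symmetric] by linarith
  also have "\<dots> \<le> 1 * e + e * B + B * e"
    using assms \<open>0 \<le> e\<close> \<open>0 \<le> B\<close> by (intro add_mono mult_mono) auto
  finally show ?thesis
    by (simp add: algebra_simps)
qed

text \<open>Variances of averages involve pairs only, so conditional independence is retained for
  two distinct sample points at a time.\<close>

locale conditional_sample = prob_space \<Omega> for \<Omega> :: "'w measure" +
  fixes F :: "'w measure" and X :: "'w \<Rightarrow> 'x::topological_space measure"
    and s :: "nat \<Rightarrow> 'w \<Rightarrow> 'x" and N :: nat
  assumes subalg: "subalgebra \<Omega> F"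
    and X: "\<omega> \<in> space \<Omega> \<Longrightarrow> X \<omega> \<in> borel_probs"
    and s_measurable: "i < N \<Longrightarrow> s i \<in> \<Omega> \<rightarrow>\<^sub>M borel"
    and conditional: "i < N \<Longrightarrow> i' < N \<Longrightarrow> i \<noteq> i' \<Longrightarrow> U \<in> sets borel \<Longrightarrow> V \<in> sets borel \<Longrightarrow>
      AE \<omega> in \<Omega>. real_cond_exp \<Omega> F (indicator {\<omega> \<in> space \<Omega>. s i \<omega> \<in> U \<and> s i' \<omega> \<in> V}) \<omega>
        = measure (X \<omega>) U * measure (X \<omega>) V"
begin

sublocale finite_measure_subalgebra \<Omega> F
  by unfold_locales (rule subalg)

lemma prob_X: "\<omega> \<in> space \<Omega> \<Longrightarrow> prob_space (X \<omega>)" and sets_X: "\<omega> \<in> space \<Omega> \<Longrightarrow> sets (X \<omega>) = sets borel"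
  using X by (auto simp: borel_probs_def)

lemma space_X: "\<omega> \<in> space \<Omega> \<Longrightarrow> space (X \<omega>) = UNIV"
  using sets_eq_imp_space_eq[OF sets_X] by simp

text \<open>The hypothesis speaks about events, the conclusion about functions. Rounding \<phi> and
  \<psi> down to multiples of 1/m turns them into finite combinations of indicators with uniform
  error 1/m; then m tends to infinity.\<close>

lemma product_expectation:
  fixes \<phi> \<psi> :: "'x \<Rightarrow> real" and w :: "'w \<Rightarrow> real"
  assumes ij: "i < N" "i' < N" "i \<noteq> i'"
    and \<phi>[measurable]: "\<phi> \<in> borel_measurable borel" and \<psi>[measurable]: "\<psi> \<in> borel_measurable borel"
    and B: "\<And>x. \<bar>\<phi> x\<bar> \<le> B" "\<And>x. \<bar>\<psi> x\<bar> \<le> B"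
    and \<phi>'[measurable]: "(\<lambda>\<omega>. \<integral>x. \<phi> x \<partial>X \<omega>) \<in> borel_measurable F"
    and \<psi>'[measurable]: "(\<lambda>\<omega>. \<integral>x. \<psi> x \<partial>X \<omega>) \<in> borel_measurable F"
    and w: "w \<in> borel_measurable F" and W: "\<And>\<omega>. \<bar>w \<omega>\<bar> \<le> W"
  shows "(\<integral>\<omega>. w \<omega> * (\<phi> (s i \<omega>) * \<psi> (s i' \<omega>)) \<partial>\<Omega>)
    = (\<integral>\<omega>. w \<omega> * ((\<integral>x. \<phi> x \<partial>X \<omega>) * (\<integral>x. \<psi> x \<partial>X \<omega>)) \<partial>\<Omega>)"
proof -
  have [measurable]: "s i \<in> \<Omega> \<rightarrow>\<^sub>M borel" "s i' \<in> \<Omega> \<rightarrow>\<^sub>M borel"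
    using ij s_measurable by auto
  note [measurable] = w measurable_from_subalg[OF subalg w]
    measurable_from_subalg[OF subalg \<phi>'] measurable_from_subalg[OF subalg \<psi>']
  have "0 \<le> B"
    using B(1)[of undefined] by linarith
  have "0 \<le> W"
    using W[of undefined] by linarith
  define P where "P = (\<integral>\<omega>. w \<omega> * (\<phi> (s i \<omega>) * \<psi> (s i' \<omega>)) \<partial>\<Omega>)"
  define P' where "P' = (\<integral>\<omega>. w \<omega> * ((\<integral>x. \<phi> x \<partial>X \<omega>) * (\<integral>x. \<psi> x \<partial>X \<omega>)) \<partial>\<Omega>)"
  have mean_le: "\<bar>\<integral>x. f x \<partial>X \<omega>\<bar> \<le> B" if "\<omega> \<in> space \<Omega>" "f \<in> borel_measurable borel" "\<And>x. \<bar>f x\<bar> \<le> B" for \<omega> f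
  proof -
    interpret X: prob_space "X \<omega>"
      by (rule prob_X[OF that(1)])
    have "f \<in> borel_measurable (X \<omega>)"
      using that(2) by (simp cong: measurable_cong_sets add: sets_X[OF that(1)])
    then have "\<bar>\<integral>x. f x \<partial>X \<omega>\<bar> \<le> (\<integral>x. B \<partial>X \<omega>)"
      using that(3) by (intro order_trans[OF integral_abs_bound] integral_mono)
        (auto intro: X.integrable_real_bounded)
    then show ?thesis
      by (simp add: X.prob_space)
  qed
  have approx: "\<bar>P - P'\<bar> \<le> 2 * W * (2 * B + 1) * (1 / real m)" if m: "0 < m" for m :: nat
  proof -
    \<comment> \<open>All values of the rounded functions, times m, lie between -K and K, so the
      index set is finite.\<close>
    define K where "K = \<lceil>real m * B\<rceil> + 1"
    define d where "d t = of_int \<lfloor>real m * t\<rfloor> / real m" for t :: real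
    define U where "U f z = {x. \<lfloor>real m * f x\<rfloor> = z}" for f :: "'x \<Rightarrow> real" and z :: int
    define I where "I = {-K..K}"
    have U_meas: "U f z \<in> sets borel" if [measurable]: "f \<in> borel_measurable borel" for f z
    proof -
      have "U f z = (\<lambda>x. \<lfloor>real m * f x\<rfloor>) -` {z} \<inter> space borel"
        by (auto simp: U_def)
      also have "\<dots> \<in> sets borel"
        by measurable
      finally show ?thesis .
    qed
    have d_sum: "d (f x) = (\<Sum>z\<in>I. of_int z / real m * indicator (U f z) x)"
      if "\<And>x. \<bar>f x\<bar> \<le> B" for f x
    proof -
      have "\<bar>real m * f x\<bar> \<le> real m * B"
        using that[of x] by (simp add: abs_mult mult_left_mono)
      then have "\<lfloor>real m * f x\<rfloor> \<in> I"
        unfolding I_def K_def by simp linarith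
      moreover have "(\<Sum>z\<in>I. of_int z / real m * indicator (U f z) x)
        = (\<Sum>z\<in>I. if z = \<lfloor>real m * f x\<rfloor> then of_int z / real m else 0)"
        by (intro sum.cong) (auto simp: U_def)
      ultimately show ?thesis
        by (simp add: d_def I_def)
    qed
    have d_le: "\<bar>d t - t\<bar> \<le> 1 / real m" for t
      unfolding d_def by (rule floor_discretisation[OF m])
    have m1: "1 / real m \<le> 1"
      using m by simp
    \<comment> \<open>The conditional probability that the two points fall into a pair of level
      cells; finitely many cells allow one common null set.\<close>
    define c where "c z z' = real_cond_exp \<Omega> F (indicator {\<omega> \<in> space \<Omega>. s i \<omega> \<in> U \<phi> z \<and> s i' \<omega> \<in> U \<psi> z'})" for z z'
    define J where "J z z' = {\<omega> \<in> space \<Omega>. s i \<omega> \<in> U \<phi> z \<and> s i' \<omega> \<in> U \<psi> z'}" for z z'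
    have [measurable]: "U \<phi> z \<in> sets borel" "U \<psi> z \<in> sets borel" for z
      by (auto intro: U_meas)
    have J[measurable]: "J z z' \<in> sets \<Omega>" for z z'
      unfolding J_def by measurable
    define q where "q z z' = (of_int z / real m) * (of_int z' / real m)" for z z' :: int
    have int_ind: "integrable \<Omega> (\<lambda>\<omega>. w \<omega> * indicator (J z z') \<omega>)" for z z'
      by (rule integrable_real_bounded[where B = W]) (use W \<open>0 \<le> W\<close> in \<open>auto simp: abs_mult indicator_def\<close>)
    have c_int: "integrable \<Omega> (\<lambda>\<omega>. w \<omega> * c z z' \<omega>)"
      "(\<integral>\<omega>. w \<omega> * c z z' \<omega> \<partial>\<Omega>) = (\<integral>\<omega>. w \<omega> * indicator (J z z') \<omega> \<partial>\<Omega>)" for z z'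
      unfolding c_def J_def[symmetric] using real_cond_exp_intg[OF int_ind w] by auto
    define Pm where "Pm = (\<integral>\<omega>. w \<omega> * (d (\<phi> (s i \<omega>)) * d (\<psi> (s i' \<omega>))) \<partial>\<Omega>)"
    have prod_sum: "d (\<phi> (s i \<omega>)) * d (\<psi> (s i' \<omega>)) = (\<Sum>z\<in>I. \<Sum>z'\<in>I. q z z' * indicator (J z z') \<omega>)"
      if "\<omega> \<in> space \<Omega>" for \<omega>
    proof -
      have "d (\<phi> (s i \<omega>)) * d (\<psi> (s i' \<omega>))
        = (\<Sum>z\<in>I. of_int z / real m * indicator (U \<phi> z) (s i \<omega>)) * (\<Sum>z\<in>I. of_int z / real m * indicator (U \<psi> z) (s i' \<omega>))"
        by (simp only: d_sum[of \<phi>, OF B(1)] d_sum[of \<psi>, OF B(2)])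
      also have "\<dots> = (\<Sum>z\<in>I. \<Sum>z'\<in>I. q z z' * indicator (J z z') \<omega>)"
        unfolding sum_product by (intro sum.cong) (auto simp: q_def J_def indicator_def that)
      finally show ?thesis .
    qed
    have "Pm = (\<integral>\<omega>. (\<Sum>z\<in>I. \<Sum>z'\<in>I. q z z' * (w \<omega> * indicator (J z z') \<omega>)) \<partial>\<Omega>)"
      unfolding Pm_def
      by (intro Bochner_Integration.integral_cong)
         (auto simp: prod_sum sum_distrib_left mult_ac)
    also have "\<dots> = (\<Sum>z\<in>I. \<Sum>z'\<in>I. q z z' * (\<integral>\<omega>. w \<omega> * indicator (J z z') \<omega> \<partial>\<Omega>))"
      using int_ind by (simp add: Bochner_Integration.integral_sum)
    also have "\<dots> = (\<integral>\<omega>. (\<Sum>z\<in>I. \<Sum>z'\<in>I. q z z' * (w \<omega> * c z z' \<omega>)) \<partial>\<Omega>)"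
      using c_int by (simp add: Bochner_Integration.integral_sum)
    finally have Pm: "Pm = (\<integral>\<omega>. (\<Sum>z\<in>I. \<Sum>z'\<in>I. q z z' * (w \<omega> * c z z' \<omega>)) \<partial>\<Omega>)" .
    have c_bound: "integrable \<Omega> (\<lambda>\<omega>. \<Sum>z\<in>I. \<Sum>z'\<in>I. q z z' * (w \<omega> * c z z' \<omega>))"
      using c_int by simp
    have bound_integral: "\<bar>(\<integral>\<omega>. f \<omega> \<partial>\<Omega>) - (\<integral>\<omega>. f' \<omega> \<partial>\<Omega>)\<bar> \<le> e"
      if f: "integrable \<Omega> f" "integrable \<Omega> f'" and ae: "AE \<omega> in \<Omega>. \<bar>f \<omega> - f' \<omega>\<bar> \<le> e"
      for f f' :: "'w \<Rightarrow> real" and e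
    proof -
      have "\<bar>(\<integral>\<omega>. f \<omega> \<partial>\<Omega>) - (\<integral>\<omega>. f' \<omega> \<partial>\<Omega>)\<bar> = \<bar>\<integral>\<omega>. f \<omega> - f' \<omega> \<partial>\<Omega>\<bar>"
        using f by simp
      also have "\<dots> \<le> (\<integral>\<omega>. \<bar>f \<omega> - f' \<omega>\<bar> \<partial>\<Omega>)"
        by (rule integral_abs_bound)
      also have "\<dots> \<le> (\<integral>\<omega>. e \<partial>\<Omega>)"
        using f ae by (intro integral_mono_AE) auto
      finally show ?thesis
        by (simp add: prob_space)
    qed
    have 1: "\<bar>Pm - P\<bar> \<le> W * ((2 * B + 1) * (1 / real m))"
      unfolding Pm_def P_def
    proof (rule bound_integral)
      have dB: "\<bar>d t\<bar> \<le> B + 1" if "\<bar>t\<bar> \<le> B" for t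
        using d_le[of t] that m1 by linarith
      have d_meas[measurable]: "d \<in> borel_measurable borel"
        unfolding d_def[abs_def] by measurable
      have "\<bar>w \<omega> * (d (\<phi> (s i \<omega>)) * d (\<psi> (s i' \<omega>)))\<bar> \<le> W * ((B + 1) * (B + 1))" for \<omega>
        unfolding abs_mult using W dB[OF B(1)] dB[OF B(2)] \<open>0 \<le> B\<close> \<open>0 \<le> W\<close> by (intro mult_mono) auto
      then show "integrable \<Omega> (\<lambda>\<omega>. w \<omega> * (d (\<phi> (s i \<omega>)) * d (\<psi> (s i' \<omega>))))"
        by (intro integrable_real_bounded) measurable
      have "\<bar>w \<omega> * (\<phi> (s i \<omega>) * \<psi> (s i' \<omega>))\<bar> \<le> W * (B * B)" for \<omega>
        unfolding abs_mult using W B \<open>0 \<le> B\<close> \<open>0 \<le> W\<close> by (intro mult_mono) auto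
      then show "integrable \<Omega> (\<lambda>\<omega>. w \<omega> * (\<phi> (s i \<omega>) * \<psi> (s i' \<omega>)))"
        by (intro integrable_real_bounded) measurable
      have "\<bar>w \<omega> * (d (\<phi> (s i \<omega>)) * d (\<psi> (s i' \<omega>))) - w \<omega> * (\<phi> (s i \<omega>) * \<psi> (s i' \<omega>))\<bar>
          \<le> W * ((2 * B + 1) * (1 / real m))" for \<omega>
        unfolding right_diff_distrib[symmetric] abs_mult
        using W abs_mult_diff_le[OF d_le d_le B(1) B(2) m1] \<open>0 \<le> W\<close> by (intro mult_mono) auto
      then show "AE \<omega> in \<Omega>. \<bar>w \<omega> * (d (\<phi> (s i \<omega>)) * d (\<psi> (s i' \<omega>))) - w \<omega> * (\<phi> (s i \<omega>) * \<psi> (s i' \<omega>))\<bar>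
          \<le> W * ((2 * B + 1) * (1 / real m))"
        by simp
    qed
    have 2: "\<bar>Pm - P'\<bar> \<le> W * ((2 * B + 1) * (1 / real m))"
      unfolding Pm P'_def
    proof (rule bound_integral[OF c_bound])
      have "\<bar>w \<omega> * ((\<integral>x. \<phi> x \<partial>X \<omega>) * (\<integral>x. \<psi> x \<partial>X \<omega>))\<bar> \<le> W * (B * B)" if "\<omega> \<in> space \<Omega>" for \<omega>
        unfolding abs_mult using W mean_le[OF that \<phi> B(1)] mean_le[OF that \<psi> B(2)] \<open>0 \<le> B\<close> \<open>0 \<le> W\<close>
        by (intro mult_mono) auto
      then show "integrable \<Omega> (\<lambda>\<omega>. w \<omega> * ((\<integral>x. \<phi> x \<partial>X \<omega>) * (\<integral>x. \<psi> x \<partial>X \<omega>)))"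
        by (intro integrable_real_bounded) measurable
      have "AE \<omega> in \<Omega>. \<forall>z\<in>I. \<forall>z'\<in>I. c z z' \<omega> = measure (X \<omega>) (U \<phi> z) * measure (X \<omega>) (U \<psi> z')"
        unfolding c_def by (intro AE_finite_allI conditional ij) (auto simp: I_def)
      then show "AE \<omega> in \<Omega>. \<bar>(\<Sum>z\<in>I. \<Sum>z'\<in>I. q z z' * (w \<omega> * c z z' \<omega>)) - w \<omega> * ((\<integral>x. \<phi> x \<partial>X \<omega>) * (\<integral>x. \<psi> x \<partial>X \<omega>))\<bar>
          \<le> W * ((2 * B + 1) * (1 / real m))"
        using AE_space
      proof eventually_elim
        case (elim \<omega>)
        interpret X: prob_space "X \<omega>"
          by (rule prob_X[OF elim(2)])
        have int_d: "(\<integral>x. d (f x) \<partial>X \<omega>) = (\<Sum>z\<in>I. of_int z / real m * measure (X \<omega>) (U f z))"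
          and close_d: "\<bar>(\<integral>x. d (f x) \<partial>X \<omega>) - (\<integral>x. f x \<partial>X \<omega>)\<bar> \<le> 1 / real m"
          if f: "f \<in> borel_measurable borel" "\<And>x. \<bar>f x\<bar> \<le> B" for f
        proof -
          have Uf: "U f z \<in> sets (X \<omega>)" for z
            using U_meas[OF f(1)] by (simp add: sets_X[OF elim(2)])
          have i1: "integrable (X \<omega>) (\<lambda>x. of_int z / real m * indicator (U f z) x :: real)" for z
            by (intro integrable_mult_right integrable_real_indicator Uf) (simp add: X.emeasure_eq_measure)
          have fd: "integrable (X \<omega>) (\<lambda>x. d (f x))"
            unfolding d_sum[of f, OF f(2)] by (intro Bochner_Integration.integrable_sum i1)
          show "(\<integral>x. d (f x) \<partial>X \<omega>) = (\<Sum>z\<in>I. of_int z / real m * measure (X \<omega>) (U f z))"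
            unfolding d_sum[of f, OF f(2)] using Uf
            by (subst Bochner_Integration.integral_sum[OF i1]) (simp add: space_X[OF elim(2)])
          have "f \<in> borel_measurable (X \<omega>)"
            using f(1) by (simp cong: measurable_cong_sets add: sets_X[OF elim(2)])
          then have fi: "integrable (X \<omega>) f"
            using f(2) by (intro X.integrable_real_bounded)
          have "\<bar>(\<integral>x. d (f x) \<partial>X \<omega>) - (\<integral>x. f x \<partial>X \<omega>)\<bar> = \<bar>\<integral>x. d (f x) - f x \<partial>X \<omega>\<bar>"
            using fd fi by simp
          also have "\<dots> \<le> (\<integral>x. \<bar>d (f x) - f x\<bar> \<partial>X \<omega>)"
            by (rule integral_abs_bound)
          also have "\<dots> \<le> (\<integral>x. 1 / real m \<partial>X \<omega>)"
            using fd fi d_le by (intro integral_mono) auto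
          finally show "\<bar>(\<integral>x. d (f x) \<partial>X \<omega>) - (\<integral>x. f x \<partial>X \<omega>)\<bar> \<le> 1 / real m"
            by (simp add: X.prob_space)
        qed
        have "(\<Sum>z\<in>I. \<Sum>z'\<in>I. q z z' * (w \<omega> * c z z' \<omega>))
          = w \<omega> * ((\<integral>x. d (\<phi> x) \<partial>X \<omega>) * (\<integral>x. d (\<psi> x) \<partial>X \<omega>))"
          unfolding int_d[of \<phi>, OF \<phi> B(1)] int_d[of \<psi>, OF \<psi> B(2)]
          unfolding sum_product
          unfolding sum_distrib_left
          using elim(1) by (intro sum.cong) (auto simp: q_def)
        then show ?case
          unfolding right_diff_distrib[symmetric] abs_mult
          using W abs_mult_diff_le[OF close_d[OF \<phi> B(1)] close_d[OF \<psi> B(2)] mean_le[OF elim(2) \<phi> B(1)] mean_le[OF elim(2) \<psi> B(2)] m1] \<open>0 \<le> W\<close>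
          by (simp only: right_diff_distrib[symmetric] abs_mult) (intro mult_mono, auto)
      qed
    qed
    have "2 * W * (2 * B + 1) * (1 / real m) = 2 * (W * ((2 * B + 1) * (1 / real m)))"
      by (simp only: mult.assoc)
    then show ?thesis
      using 1 2 by linarith
  qed
  have "\<bar>P - P'\<bar> \<le> 0"
  proof (rule LIMSEQ_le_const)
    show "(\<lambda>m. 2 * W * (2 * B + 1) * (1 / real (Suc m))) \<longlonglongrightarrow> 0"
      using tendsto_mult[OF tendsto_const lim_1_over_n[THEN LIMSEQ_Suc], of "2 * W * (2 * B + 1)"] by simp
    show "\<exists>N. \<forall>m\<ge>N. \<bar>P - P'\<bar> \<le> 2 * W * (2 * B + 1) * (1 / real (Suc m))"
      using approx by blast
  qed
  then show ?thesis
    by (simp add: P_def P'_def)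
qed

end

text \<open>The set A of points of E where the conditional expectation exceeds c is itself
  admissible; the integral bound over A forces the nonnegative excess to vanish almost
  everywhere.\<close>

lemma (in finite_measure_subalgebra) real_cond_exp_le_on:
  assumes X: "integrable M X" and E: "E \<in> sets F"
    and le: "\<And>A. A \<in> sets F \<Longrightarrow> A \<subseteq> E \<Longrightarrow> (\<integral>x. indicator A x * X x \<partial>M) \<le> c * measure M A"
  shows "AE x in M. x \<in> E \<longrightarrow> real_cond_exp M F X x \<le> c"
proof -
  define e where "e = real_cond_exp M F X"
  have e_F[measurable]: "e \<in> borel_measurable F"
    by (simp add: e_def)
  have e_int: "integrable M e"
    unfolding e_def using X by (rule real_cond_exp_int(1))
  define A where "A = {x \<in> space F. x \<in> E \<and> c < e x}"
  have A: "A \<in> sets F"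
    unfolding A_def using E by measurable
  then have A_M: "A \<in> sets M"
    using subalg by (auto simp: subalgebra_def)
  have intX: "integrable M (\<lambda>x. indicator A x * X x)"
    using integrable_mult_indicator[OF A_M X] by simp
  have inte: "integrable M (\<lambda>x. indicator A x * e x)"
    using integrable_mult_indicator[OF A_M e_int] by simp
  have intA: "integrable M (\<lambda>x. indicator A x * c)"
    using A_M by (intro integrable_mult_left integrable_real_indicator) (simp_all add: emeasure_eq_measure)
  have "(\<integral>x. indicator A x * e x \<partial>M) = (\<integral>x. indicator A x * X x \<partial>M)"
    unfolding e_def using A X intX by (intro real_cond_exp_intg(2)) auto
  also have "\<dots> \<le> c * measure M A"
    using A by (rule le) (auto simp: A_def)
  also have "\<dots> = (\<integral>x. indicator A x * c \<partial>M)"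
    using A_M sets.sets_into_space[OF A_M] by (simp add: Int_absorb1 mult.commute)
  finally have "(\<integral>x. indicator A x * e x - indicator A x * c \<partial>M) \<le> 0"
    using inte intA by simp
  moreover have nn: "0 \<le> indicator A x * e x - indicator A x * c" for x
    by (auto simp: A_def indicator_def)
  ultimately have "(\<integral>x. indicator A x * e x - indicator A x * c \<partial>M) = 0"
    by (simp add: antisym integral_nonneg_AE)
  then have "AE x in M. indicator A x * e x - indicator A x * c = 0"
    using inte intA nn by (subst (asm) integral_nonneg_eq_0_iff_AE) auto
  then show ?thesis
    using AE_space
  proof eventually_elim
    case (elim x)
    show ?case
    proof (intro impI leI notI)
      assume "x \<in> E" "c < real_cond_exp M F X x"
      then have "x \<in> A"
        using elim(2) subalg by (simp add: A_def e_def subalgebra_def)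
      then show False
        using elim(1) \<open>c < _\<close> by (simp add: e_def)
    qed
  qed
qed

section \<open>Variance of averages given the first stage\<close>

context conditional_sample
begin

lemma mean_measurable_bound:
  fixes \<phi> :: "'x \<Rightarrow> real"
  assumes "\<omega> \<in> space \<Omega>" "\<phi> \<in> borel_measurable borel" "\<And>x. \<bar>\<phi> x\<bar> \<le> B"
  shows "\<bar>\<integral>x. \<phi> x \<partial>X \<omega>\<bar> \<le> B"
proof -
  interpret X: prob_space "X \<omega>"
    by (rule prob_X[OF assms(1)])
  have "\<phi> \<in> borel_measurable (X \<omega>)"
    using assms(2) by (simp cong: measurable_cong_sets add: sets_X[OF assms(1)])
  then have "\<bar>\<integral>x. \<phi> x \<partial>X \<omega>\<bar> \<le> (\<integral>x. B \<partial>X \<omega>)"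
    using assms(3) by (intro order_trans[OF integral_abs_bound] integral_mono)
      (auto intro: X.integrable_real_bounded)
  then show ?thesis
    by (simp add: X.prob_space)
qed

text \<open>The square of the centred average expands into pairs. Off-diagonal terms vanish by the
  product formula, so one factor 1/N survives.\<close>

lemma average_variance:
  fixes \<phi> :: "'x \<Rightarrow> real"
  assumes N: "2 \<le> N" and A: "A \<in> sets F" and \<phi>[measurable]: "\<phi> \<in> borel_measurable borel"
    and B: "\<And>x. \<bar>\<phi> x\<bar> \<le> B"
    and \<phi>'[measurable]: "(\<lambda>\<omega>. \<integral>x. \<phi> x \<partial>X \<omega>) \<in> borel_measurable F"
  shows "(\<integral>\<omega>. indicator A \<omega> * ((\<Sum>i<N. \<phi> (s i \<omega>)) / real N - (\<integral>x. \<phi> x \<partial>X \<omega>))\<^sup>2 \<partial>\<Omega>)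
    \<le> (\<Sum>i<N. \<integral>\<omega>. indicator A \<omega> * (\<phi> (s i \<omega>))\<^sup>2 \<partial>\<Omega>) / (real N)\<^sup>2"
proof -
  define m where "m \<omega> = (\<integral>x. \<phi> x \<partial>X \<omega>)" for \<omega>
  have "0 \<le> B"
    using B[of undefined] by linarith
  have m_F[measurable]: "m \<in> borel_measurable F"
    unfolding m_def[abs_def] by simp
  have m_\<Omega>[measurable]: "m \<in> borel_measurable \<Omega>"
    by (rule measurable_from_subalg[OF subalg m_F])
  have m_le: "\<bar>m \<omega>\<bar> \<le> B" if "\<omega> \<in> space \<Omega>" for \<omega>
    unfolding m_def by (rule mean_measurable_bound[OF that \<phi> B])
  define w where "w \<omega> = (if \<omega> \<in> space \<Omega> then m \<omega> else 0)" for \<omega>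
  have A_\<Omega>[measurable]: "A \<in> sets \<Omega>"
    using A subalg by (auto simp: subalgebra_def)
  have ind_F: "(indicator A :: 'w \<Rightarrow> real) \<in> borel_measurable F"
    using A by simp
  have space_F: "space F = space \<Omega>"
    using subalg by (simp add: subalgebra_def)
  define v where "v \<omega> = (indicator A \<omega> * m \<omega> :: real)" for \<omega>
  have v_F: "v \<in> borel_measurable F"
    unfolding v_def[abs_def] using ind_F by measurable
  have v_le: "\<bar>v \<omega>\<bar> \<le> B" for \<omega>
    using m_le[of \<omega>] sets.sets_into_space[OF A_\<Omega>] \<open>0 \<le> B\<close> by (auto simp: v_def indicator_def)
  have s_meas: "s i \<in> \<Omega> \<rightarrow>\<^sub>M borel" if "i < N" for i
    using that by (rule s_measurable)
  have int: "integrable \<Omega> (\<lambda>\<omega>. indicator A \<omega> * (f \<omega> * g \<omega>))"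
    if "f \<in> borel_measurable \<Omega>" "g \<in> borel_measurable \<Omega>" "\<And>\<omega>. \<omega> \<in> space \<Omega> \<Longrightarrow> \<bar>f \<omega>\<bar> \<le> B" "\<And>\<omega>. \<omega> \<in> space \<Omega> \<Longrightarrow> \<bar>g \<omega>\<bar> \<le> B"
    for f g :: "'w \<Rightarrow> real"
  proof (rule integrable_real_bounded)
    show "\<bar>indicator A \<omega> * (f \<omega> * g \<omega>)\<bar> \<le> 1 * (B * B)" if "\<omega> \<in> space \<Omega>" for \<omega>
      unfolding abs_mult using \<open>0 \<le> B\<close> that \<open>\<And>\<omega>. \<omega> \<in> space \<Omega> \<Longrightarrow> \<bar>f \<omega>\<bar> \<le> B\<close> \<open>\<And>\<omega>. \<omega> \<in> space \<Omega> \<Longrightarrow> \<bar>g \<omega>\<bar> \<le> B\<close>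
      by (intro mult_mono) (auto simp: indicator_def)
  qed (use that in measurable)
  have \<phi>s: "(\<lambda>\<omega>. \<phi> (s i \<omega>)) \<in> borel_measurable \<Omega>" if "i < N" for i
    using measurable_compose[OF s_meas[OF that] \<phi>] .
  have ints: "integrable \<Omega> (\<lambda>\<omega>. indicator A \<omega> * (\<phi> (s i \<omega>) * \<phi> (s i' \<omega>)))"
    "integrable \<Omega> (\<lambda>\<omega>. indicator A \<omega> * (m \<omega> * \<phi> (s i \<omega>)))" if "i < N" "i' < N" for i i'
    using that by (intro int \<phi>s m_\<Omega> B m_le; simp)+
  have intm: "integrable \<Omega> (\<lambda>\<omega>. indicator A \<omega> * (m \<omega> * m \<omega>))"
    by (intro int m_\<Omega> m_le)
  have single: "(\<integral>\<omega>. indicator A \<omega> * (m \<omega> * \<phi> (s i \<omega>)) \<partial>\<Omega>) = (\<integral>\<omega>. indicator A \<omega> * (m \<omega> * m \<omega>) \<partial>\<Omega>)"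
    if "i < N" for i
  proof -
    \<comment> \<open>A first moment is a product expectation with the constant 1 at a second index;
      N \<ge> 2 supplies that index.\<close>
    define i' where "i' = (if i = 0 then 1 else 0::nat)"
    have i': "i' < N" "i \<noteq> i'"
      using N by (auto simp: i'_def)
    have one: "(\<integral>x. 1 \<partial>X \<omega>) = (1::real)" if "\<omega> \<in> space \<Omega>" for \<omega>
    proof -
      interpret X: prob_space "X \<omega>"
        by (rule prob_X[OF that])
      show ?thesis
        by (simp add: X.prob_space)
    qed
    have one_F: "(\<lambda>\<omega>. (\<integral>x. 1 \<partial>X \<omega>) :: real) \<in> borel_measurable F"
      by (subst measurable_cong[of F _ "\<lambda>_. 1"]) (use one space_F in auto)
    have "(\<integral>\<omega>. v \<omega> * (\<phi> (s i \<omega>) * 1) \<partial>\<Omega>) = (\<integral>\<omega>. v \<omega> * ((\<integral>x. \<phi> x \<partial>X \<omega>) * (\<integral>x. 1 \<partial>X \<omega>)) \<partial>\<Omega>)"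
      by (rule product_expectation[OF that i' \<phi> _ _ _ \<phi>' one_F v_F v_le, where B = "max B 1"])
         (use B in \<open>auto simp: le_max_iff_disj\<close>)
    also have "\<dots> = (\<integral>\<omega>. v \<omega> * m \<omega> \<partial>\<Omega>)"
      using one by (intro Bochner_Integration.integral_cong) (auto simp: m_def)
    finally show ?thesis
      by (simp add: v_def mult_ac)
  qed
  have expand: "indicator A \<omega> * ((\<phi> (s i \<omega>) - m \<omega>) * (\<phi> (s i' \<omega>) - m \<omega>))
    = indicator A \<omega> * (\<phi> (s i \<omega>) * \<phi> (s i' \<omega>)) - indicator A \<omega> * (m \<omega> * \<phi> (s i \<omega>))
      - indicator A \<omega> * (m \<omega> * \<phi> (s i' \<omega>)) + indicator A \<omega> * (m \<omega> * m \<omega>)" for i i' \<omega>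
    by (simp add: algebra_simps)
  define c where "c i i' = (\<integral>\<omega>. indicator A \<omega> * ((\<phi> (s i \<omega>) - m \<omega>) * (\<phi> (s i' \<omega>) - m \<omega>)) \<partial>\<Omega>)" for i i'
  have c_int: "integrable \<Omega> (\<lambda>\<omega>. indicator A \<omega> * ((\<phi> (s i \<omega>) - m \<omega>) * (\<phi> (s i' \<omega>) - m \<omega>)))"
    and c: "c i i' = (\<integral>\<omega>. indicator A \<omega> * (\<phi> (s i \<omega>) * \<phi> (s i' \<omega>)) \<partial>\<Omega>) - (\<integral>\<omega>. indicator A \<omega> * (m \<omega> * m \<omega>) \<partial>\<Omega>)"
    if "i < N" "i' < N" for i i'
    unfolding c_def expand using ints[OF that] ints[OF that(2,1)] intm single that by simp_all
  have c0: "c i i' = 0" if "i < N" "i' < N" "i \<noteq> i'" for i i'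
  proof -
    have "(\<integral>\<omega>. indicator A \<omega> * (\<phi> (s i \<omega>) * \<phi> (s i' \<omega>)) \<partial>\<Omega>)
      = (\<integral>\<omega>. indicator A \<omega> * ((\<integral>x. \<phi> x \<partial>X \<omega>) * (\<integral>x. \<phi> x \<partial>X \<omega>)) \<partial>\<Omega>)"
      by (rule product_expectation[OF that \<phi> \<phi> B B \<phi>' \<phi>' ind_F, where W = 1]) (auto simp: indicator_def)
    then show ?thesis
      using c[OF that(1,2)] by (simp add: m_def)
  qed
  have cc: "c i i \<le> (\<integral>\<omega>. indicator A \<omega> * (\<phi> (s i \<omega>))\<^sup>2 \<partial>\<Omega>)" if "i < N" for i
  proof -
    have "0 \<le> (\<integral>\<omega>. indicator A \<omega> * (m \<omega> * m \<omega>) \<partial>\<Omega>)"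
      by (intro integral_nonneg_AE) simp
    then show ?thesis
      using c[OF that that] by (simp add: power2_eq_square)
  qed
  have "(\<integral>\<omega>. indicator A \<omega> * ((\<Sum>i<N. \<phi> (s i \<omega>)) / real N - m \<omega>)\<^sup>2 \<partial>\<Omega>)
    = (\<integral>\<omega>. (\<Sum>i<N. \<Sum>i'<N. indicator A \<omega> * ((\<phi> (s i \<omega>) - m \<omega>) * (\<phi> (s i' \<omega>) - m \<omega>))) / (real N)\<^sup>2 \<partial>\<Omega>)"
  proof (intro Bochner_Integration.integral_cong refl)
    fix \<omega>
    have "(\<Sum>i<N. \<phi> (s i \<omega>)) / real N - m \<omega> = (\<Sum>i<N. \<phi> (s i \<omega>) - m \<omega>) / real N"
      using N by (simp add: sum_subtractf field_simps)
    then have "((\<Sum>i<N. \<phi> (s i \<omega>)) / real N - m \<omega>)\<^sup>2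
      = (\<Sum>i<N. \<Sum>i'<N. (\<phi> (s i \<omega>) - m \<omega>) * (\<phi> (s i' \<omega>) - m \<omega>)) / (real N)\<^sup>2"
      by (simp add: power_divide power2_eq_square sum_product)
    then show "indicator A \<omega> * ((\<Sum>i<N. \<phi> (s i \<omega>)) / real N - m \<omega>)\<^sup>2
      = (\<Sum>i<N. \<Sum>i'<N. indicator A \<omega> * ((\<phi> (s i \<omega>) - m \<omega>) * (\<phi> (s i' \<omega>) - m \<omega>))) / (real N)\<^sup>2"
      by (simp add: sum_distrib_left)
  qed
  also have "\<dots> = (\<Sum>i<N. \<Sum>i'<N. c i i') / (real N)\<^sup>2"
  proof -
    let ?h = "\<lambda>i i' \<omega>. indicator A \<omega> * ((\<phi> (s i \<omega>) - m \<omega>) * (\<phi> (s i' \<omega>) - m \<omega>)) :: real"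
    have "(\<integral>\<omega>. (\<Sum>i<N. \<Sum>i'<N. ?h i i' \<omega>) \<partial>\<Omega>) = (\<Sum>i<N. \<integral>\<omega>. (\<Sum>i'<N. ?h i i' \<omega>) \<partial>\<Omega>)"
      by (intro Bochner_Integration.integral_sum Bochner_Integration.integrable_sum c_int) auto
    also have "\<dots> = (\<Sum>i<N. \<Sum>i'<N. c i i')"
      unfolding c_def by (intro sum.cong refl Bochner_Integration.integral_sum c_int) auto
    finally show ?thesis
      by (simp only: integral_divide_zero)
  qed
  also have "\<dots> \<le> (\<Sum>i<N. \<integral>\<omega>. indicator A \<omega> * (\<phi> (s i \<omega>))\<^sup>2 \<partial>\<Omega>) / (real N)\<^sup>2"
  proof (intro divide_right_mono sum_mono)
    fix i assume i: "i \<in> {..<N}"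
    have "(\<Sum>i'<N. c i i') = (\<Sum>i'<N. if i' = i then c i i else 0)"
      using i c0 by (intro sum.cong) auto
    then show "(\<Sum>i'<N. c i i') \<le> (\<integral>\<omega>. indicator A \<omega> * (\<phi> (s i \<omega>))\<^sup>2 \<partial>\<Omega>)"
      using i cc by simp
  qed simp
  finally show ?thesis
    by (simp add: m_def)
qed

text \<open>The scalar estimate is summed over Parseval coordinates; the coordinate second moments
  add up to the squared norm of g, so no dimension appears.\<close>

lemma hilbert_average_variance:
  fixes g :: "'x \<Rightarrow> 'h::{real_inner,complete_space,second_countable_topology}"
  assumes N: "2 \<le> N" and A: "A \<in> sets F" and g[measurable]: "g \<in> borel_measurable borel"
    and \<gamma>: "\<And>x. (norm (g x))\<^sup>2 \<le> \<gamma>"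
    and m: "\<And>h \<omega>. \<omega> \<in> space \<Omega> \<Longrightarrow> m \<omega> \<bullet> h = (\<integral>x. g x \<bullet> h \<partial>X \<omega>)"
    and m_F: "m \<in> borel_measurable F"
  shows "(\<integral>\<omega>. indicator A \<omega> * (norm ((1 / real N) *\<^sub>R (\<Sum>i<N. g (s i \<omega>)) - m \<omega>))\<^sup>2 \<partial>\<Omega>)
    \<le> \<gamma> / real N * measure \<Omega> A"
proof -
  obtain e :: "nat \<Rightarrow> 'h" where e: "\<And>v. (\<lambda>k. (v \<bullet> e k)\<^sup>2) sums (norm v)\<^sup>2"
    using parseval_sequence_exists by blast
  have "0 \<le> \<gamma>"
    using \<gamma> order_trans zero_le_power2 by blast
  have g_norm: "norm (g x) \<le> sqrt \<gamma>" for x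
    using \<gamma> by (intro real_le_rsqrt)
  have g_inner: "\<bar>g x \<bullet> h\<bar> \<le> sqrt \<gamma> * norm h" for x h
    using Cauchy_Schwarz_ineq2[of "g x" h] mult_right_mono[OF g_norm[of x], of "norm h"] by simp
  have A_\<Omega>[measurable]: "A \<in> sets \<Omega>"
    using A subalg by (auto simp: subalgebra_def)
  have m_\<Omega>[measurable]: "m \<in> borel_measurable \<Omega>"
    by (rule measurable_from_subalg[OF subalg m_F])
  have gs: "(\<lambda>\<omega>. g (s i \<omega>)) \<in> borel_measurable \<Omega>" if "i < N" for i
    by (rule measurable_compose[OF s_measurable[OF that] g])
  have space_F: "space F = space \<Omega>"
    using subalg by (simp add: subalgebra_def)
  define D where "D \<omega> = (1 / real N) *\<^sub>R (\<Sum>i<N. g (s i \<omega>)) - m \<omega>" for \<omega>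
  have D[measurable]: "D \<in> borel_measurable \<Omega>"
    unfolding D_def[abs_def] using gs by (intro borel_measurable_diff borel_measurable_scaleR borel_measurable_sum) auto
  have D_inner: "D \<omega> \<bullet> h = (\<Sum>i<N. g (s i \<omega>) \<bullet> h) / real N - (\<integral>x. g x \<bullet> h \<partial>X \<omega>)" if "\<omega> \<in> space \<Omega>" for \<omega> h
    by (simp add: D_def inner_diff inner_sum_left m[OF that])
  have m_norm: "norm (m \<omega>) \<le> sqrt \<gamma>" if "\<omega> \<in> space \<Omega>" for \<omega>
  proof -
    have "norm (m \<omega>) * norm (m \<omega>) = (\<integral>x. g x \<bullet> m \<omega> \<partial>X \<omega>)"
      by (simp add: m[OF that, symmetric] power2_norm_eq_inner flip: power2_eq_square)
    also have "\<dots> \<le> sqrt \<gamma> * norm (m \<omega>)"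
    proof -
      have "(\<lambda>x. g x \<bullet> m \<omega>) \<in> borel_measurable borel"
        by measurable
      from mean_measurable_bound[OF that this g_inner] show ?thesis
        by linarith
    qed
    finally show ?thesis
      using \<open>0 \<le> \<gamma>\<close> by (cases "m \<omega> = 0") auto
  qed
  have D_norm: "norm (D \<omega>) \<le> 2 * sqrt \<gamma>" if "\<omega> \<in> space \<Omega>" for \<omega>
  proof -
    have "norm (\<Sum>i<N. g (s i \<omega>)) \<le> (\<Sum>i<N. sqrt \<gamma>)"
      by (intro order_trans[OF norm_sum] sum_mono g_norm)
    then have "norm ((1 / real N) *\<^sub>R (\<Sum>i<N. g (s i \<omega>))) \<le> sqrt \<gamma>"
      using N by (simp add: field_simps)
    then show ?thesis
      unfolding D_def using norm_triangle_ineq4[of "(1 / real N) *\<^sub>R (\<Sum>i<N. g (s i \<omega>))" "m \<omega>"] m_norm[OF that]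
      by linarith
  qed
  have D2: "(norm (D \<omega>))\<^sup>2 \<le> (2 * sqrt \<gamma>)\<^sup>2" if "\<omega> \<in> space \<Omega>" for \<omega>
    by (intro power_mono D_norm that) simp
  have int_ind: "integrable \<Omega> (\<lambda>\<omega>. indicator A \<omega> * f \<omega>)"
    if "f \<in> borel_measurable \<Omega>" "\<And>\<omega>. \<omega> \<in> space \<Omega> \<Longrightarrow> \<bar>f \<omega>\<bar> \<le> b" for f :: "'w \<Rightarrow> real" and b
  proof (rule integrable_real_bounded)
    show "\<bar>indicator A \<omega> * f \<omega>\<bar> \<le> \<bar>b\<bar>" if "\<omega> \<in> space \<Omega>" for \<omega>
      using \<open>\<And>\<omega>. \<omega> \<in> space \<Omega> \<Longrightarrow> \<bar>f \<omega>\<bar> \<le> b\<close>[OF that] by (auto simp: indicator_def)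
  qed (use that in measurable)
  have "ennreal (\<integral>\<omega>. indicator A \<omega> * (norm (D \<omega>))\<^sup>2 \<partial>\<Omega>) = (\<integral>\<^sup>+\<omega>. ennreal (indicator A \<omega> * (norm (D \<omega>))\<^sup>2) \<partial>\<Omega>)"
    by (rule nn_integral_eq_integral[symmetric]) (auto intro!: int_ind D2)
  also have "\<dots> = (\<integral>\<^sup>+\<omega>. (\<Sum>k. ennreal (indicator A \<omega> * (D \<omega> \<bullet> e k)\<^sup>2)) \<partial>\<Omega>)"
    by (intro nn_integral_cong suminf_ennreal_eq[symmetric] sums_mult e) simp
  also have "\<dots> = (\<Sum>k. \<integral>\<^sup>+\<omega>. ennreal (indicator A \<omega> * (D \<omega> \<bullet> e k)\<^sup>2) \<partial>\<Omega>)"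
    by (rule nn_integral_suminf) measurable
  also have "\<dots> \<le> (\<Sum>k. \<Sum>i<N. ennreal (1 / (real N)\<^sup>2) * (\<integral>\<^sup>+\<omega>. ennreal (indicator A \<omega> * (g (s i \<omega>) \<bullet> e k)\<^sup>2) \<partial>\<Omega>))"
  proof (intro suminf_le summableI)
    fix k
    have phi_F: "(\<lambda>\<omega>. \<integral>x. g x \<bullet> e k \<partial>X \<omega>) \<in> borel_measurable F"
      using m_F by (subst measurable_cong[of F _ "\<lambda>\<omega>. m \<omega> \<bullet> e k"]) (auto simp: m space_F)
    have phi: "(\<lambda>x. g x \<bullet> e k) \<in> borel_measurable borel"
      by measurable
    have gs2: "integrable \<Omega> (\<lambda>\<omega>. indicator A \<omega> * (g (s i \<omega>) \<bullet> e k)\<^sup>2)" if "i < N" for i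
    proof (rule int_ind)
      show "\<bar>(g (s i \<omega>) \<bullet> e k)\<^sup>2\<bar> \<le> (sqrt \<gamma> * norm (e k))\<^sup>2" for \<omega>
        using power_mono[OF g_inner[of "s i \<omega>" "e k"], of 2] by simp
      show "(\<lambda>\<omega>. (g (s i \<omega>) \<bullet> e k)\<^sup>2) \<in> borel_measurable \<Omega>"
        using gs[OF that] by measurable
    qed
    have "(\<integral>\<^sup>+\<omega>. ennreal (indicator A \<omega> * (D \<omega> \<bullet> e k)\<^sup>2) \<partial>\<Omega>) = ennreal (\<integral>\<omega>. indicator A \<omega> * (D \<omega> \<bullet> e k)\<^sup>2 \<partial>\<Omega>)"
    proof (rule nn_integral_eq_integral)
      show "integrable \<Omega> (\<lambda>\<omega>. indicator A \<omega> * (D \<omega> \<bullet> e k)\<^sup>2)"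
      proof (rule int_ind)
        show "\<bar>(D \<omega> \<bullet> e k)\<^sup>2\<bar> \<le> (2 * sqrt \<gamma> * norm (e k))\<^sup>2" if "\<omega> \<in> space \<Omega>" for \<omega>
        proof -
          have "\<bar>D \<omega> \<bullet> e k\<bar> \<le> 2 * sqrt \<gamma> * norm (e k)"
            using Cauchy_Schwarz_ineq2[of "D \<omega>" "e k"] mult_right_mono[OF D_norm[OF that], of "norm (e k)"] by simp
          from power_mono[OF this, of 2] show ?thesis
            by simp
        qed
      qed measurable
    qed simp
    also have "\<dots> = ennreal (\<integral>\<omega>. indicator A \<omega> * ((\<Sum>i<N. g (s i \<omega>) \<bullet> e k) / real N - (\<integral>x. g x \<bullet> e k \<partial>X \<omega>))\<^sup>2 \<partial>\<Omega>)"
      by (intro arg_cong[where f = ennreal] Bochner_Integration.integral_cong) (auto simp: D_inner)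
    also have "\<dots> \<le> ennreal ((\<Sum>i<N. \<integral>\<omega>. indicator A \<omega> * (g (s i \<omega>) \<bullet> e k)\<^sup>2 \<partial>\<Omega>) / (real N)\<^sup>2)"
      by (intro ennreal_leI average_variance[OF N A phi g_inner phi_F])
    also have "\<dots> = (\<Sum>i<N. ennreal (1 / (real N)\<^sup>2) * ennreal (\<integral>\<omega>. indicator A \<omega> * (g (s i \<omega>) \<bullet> e k)\<^sup>2 \<partial>\<Omega>))"
    proof -
      have nn: "0 \<le> (\<integral>\<omega>. indicator A \<omega> * (g (s i \<omega>) \<bullet> e k)\<^sup>2 \<partial>\<Omega>)" for i
        by (intro integral_nonneg_AE) simp
      show ?thesis
        by (simp add: nn sum_divide_distrib flip: ennreal_mult sum_ennreal)
    qed
    also have "\<dots> = (\<Sum>i<N. ennreal (1 / (real N)\<^sup>2) * (\<integral>\<^sup>+\<omega>. ennreal (indicator A \<omega> * (g (s i \<omega>) \<bullet> e k)\<^sup>2) \<partial>\<Omega>))"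
      by (intro sum.cong refl arg_cong2[where f = "(*)"] nn_integral_eq_integral[symmetric] gs2) auto
    finally show "(\<integral>\<^sup>+\<omega>. ennreal (indicator A \<omega> * (D \<omega> \<bullet> e k)\<^sup>2) \<partial>\<Omega>)
      \<le> (\<Sum>i<N. ennreal (1 / (real N)\<^sup>2) * (\<integral>\<^sup>+\<omega>. ennreal (indicator A \<omega> * (g (s i \<omega>) \<bullet> e k)\<^sup>2) \<partial>\<Omega>))" .
  qed
  also have "\<dots> = (\<Sum>i<N. ennreal (1 / (real N)\<^sup>2) * (\<Sum>k. \<integral>\<^sup>+\<omega>. ennreal (indicator A \<omega> * (g (s i \<omega>) \<bullet> e k)\<^sup>2) \<partial>\<Omega>))"
    by (subst suminf_sum) auto
  also have "\<dots> \<le> (\<Sum>i<N. ennreal (1 / (real N)\<^sup>2) * ennreal (\<gamma> * measure \<Omega> A))"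
  proof (intro sum_mono mult_left_mono)
    fix i assume "i \<in> {..<N}"
    then have i: "i < N" by simp
    note [measurable] = s_measurable[OF i]
    have "(\<Sum>k. \<integral>\<^sup>+\<omega>. ennreal (indicator A \<omega> * (g (s i \<omega>) \<bullet> e k)\<^sup>2) \<partial>\<Omega>)
      = (\<integral>\<^sup>+\<omega>. (\<Sum>k. ennreal (indicator A \<omega> * (g (s i \<omega>) \<bullet> e k)\<^sup>2)) \<partial>\<Omega>)"
      by (intro nn_integral_suminf[symmetric]) measurable
    also have "\<dots> = (\<integral>\<^sup>+\<omega>. ennreal (indicator A \<omega> * (norm (g (s i \<omega>)))\<^sup>2) \<partial>\<Omega>)"
      by (intro nn_integral_cong suminf_ennreal_eq sums_mult e) simp
    also have "\<dots> \<le> (\<integral>\<^sup>+\<omega>. ennreal (indicator A \<omega> * \<gamma>) \<partial>\<Omega>)"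
      using \<gamma> by (intro nn_integral_mono ennreal_leI mult_left_mono) auto
    also have "\<dots> = ennreal (\<integral>\<omega>. indicator A \<omega> * \<gamma> \<partial>\<Omega>)"
    proof (rule nn_integral_eq_integral)
      show "integrable \<Omega> (\<lambda>\<omega>. indicator A \<omega> * \<gamma>)"
        using \<open>0 \<le> \<gamma>\<close> by (intro int_ind) auto
    qed (use \<open>0 \<le> \<gamma>\<close> in simp)
    also have "(\<integral>\<omega>. indicator A \<omega> * \<gamma> \<partial>\<Omega>) = \<gamma> * measure \<Omega> A"
      using sets.sets_into_space[OF A_\<Omega>] by (simp add: Int_absorb1 mult.commute)
    finally show "(\<Sum>k. \<integral>\<^sup>+\<omega>. ennreal (indicator A \<omega> * (g (s i \<omega>) \<bullet> e k)\<^sup>2) \<partial>\<Omega>) \<le> ennreal (\<gamma> * measure \<Omega> A)" .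
  qed simp
  also have "\<dots> = ennreal (\<gamma> / real N * measure \<Omega> A)"
    using N \<open>0 \<le> \<gamma>\<close> by (simp add: power2_eq_square ennreal_of_nat_eq_real_of_nat flip: ennreal_mult)
  finally show ?thesis
    using \<open>0 \<le> \<gamma>\<close> by (simp add: D_def)
qed

end

section \<open>Kernel sections and mean embeddings\<close>

text \<open>The description in \<open>kernel_section\<close> names the representer of evaluation,
  because elements of the RKHS are determined by their values on A.\<close>

lemma kernel_section_unique:
  fixes val :: "'h::{real_inner,complete_space} \<Rightarrow> 'a \<Rightarrow> real"
  assumes rkhs: "is_rkhs A k val" and a: "a \<in> A"
  shows kernel_section_val: "\<And>b. b \<in> A \<Longrightarrow> val (kernel_section A k val a) b = k a b"
    and kernel_section_reproducing: "\<And>f. val f a = f \<bullet> kernel_section A k val a"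
proof -
  obtain h where h: "\<forall>b\<in>A. val h b = k a b" "\<forall>f. val f a = f \<bullet> h"
    using rkhs a unfolding is_rkhs_def by blast
  have "kernel_section A k val a = h"
    unfolding kernel_section_def
  proof (rule the_equality[where a = h])
    show "h' = h" if "\<forall>b\<in>A. val h' b = k a b" for h'
      using rkhs h(1) that unfolding is_rkhs_def by metis
  qed (rule h(1))
  then show "\<And>b. b \<in> A \<Longrightarrow> val (kernel_section A k val a) b = k a b"
    "\<And>f. val f a = f \<bullet> kernel_section A k val a"
    using h by auto
qed

lemma kernel_section_inner:
  assumes "is_rkhs A k val" "a \<in> A" "b \<in> A"
  shows "kernel_section A k val a \<bullet> kernel_section A k val b = k a b"
  using kernel_section_val[OF assms(1,2,3)] kernel_section_reproducing[OF assms(1,3)] by simp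

lemma kernel_section_norm:
  assumes "is_rkhs A k val" "a \<in> A"
  shows "(norm (kernel_section A k val a))\<^sup>2 = k a a"
  by (simp add: power2_norm_eq_inner kernel_section_inner[OF assms assms(2)])

text \<open>The squared distance of two sections is G t t - 2 G t s + G s s, which tends to 0 by
  joint continuity of the kernel.\<close>

lemma continuous_on_kernel_section:
  assumes G: "mercer_kernel G" "is_rkhs UNIV G evG"
  shows "continuous_on UNIV (kernel_section UNIV G evG)"
proof -
  let ?g = "kernel_section UNIV G evG"
  have c: "continuous_on UNIV (\<lambda>(s, t). G s t)"
    using G(1) by (simp add: mercer_kernel_def)
  have inner: "?g s \<bullet> ?g t = G s t" for s t
    by (rule kernel_section_inner[OF G(2)]) auto
  have sym: "G s t = G t s" for s t
    by (metis inner inner_commute)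
  have "((\<lambda>t. norm (?g t - ?g s)) \<longlongrightarrow> 0) (at s)" for s
  proof -
    have 1: "continuous_on UNIV (\<lambda>t. G t t)"
      using continuous_on_compose2[OF c, of UNIV "\<lambda>t. (t, t)"] by (simp add: continuous_on_Pair)
    have 2: "continuous_on UNIV (\<lambda>t. G t s)"
      using continuous_on_compose2[OF c, of UNIV "\<lambda>t. (t, s)"] by (simp add: continuous_on_Pair)
    have "continuous_on UNIV (\<lambda>t. sqrt (G t t - 2 * G t s + G s s))"
      by (intro continuous_intros 1 2)
    then have "((\<lambda>t. sqrt (G t t - 2 * G t s + G s s)) \<longlongrightarrow> sqrt (G s s - 2 * G s s + G s s)) (at s)"
      unfolding continuous_on_def by blast
    moreover have "norm (?g t - ?g s) = sqrt (G t t - 2 * G t s + G s s)" for t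
      by (simp add: norm_eq_sqrt_inner inner_diff inner sym[of s t])
    ultimately show ?thesis
      by simp
  qed
  then have "(?g \<longlongrightarrow> ?g s) (at s)" for s
    by (simp add: tendsto_norm_zero_iff LIM_zero_iff)
  then show ?thesis
    unfolding continuous_on_def by simp
qed

section \<open>Measurability for the weak topology\<close>

lemma weak_topology_subset: "{U. openin weak_topology U} \<subseteq> Pow borel_probs"
proof -
  have "topspace weak_topology \<subseteq> borel_probs"
    unfolding weak_topology_def by (auto simp: topology_generated_by_topspace)
  then show ?thesis
    using openin_subset by blast
qed

lemma weak_borel_space: "space weak_borel = borel_probs"
  using weak_topology_subset by (simp add: weak_borel_def space_measure_of_conv)

lemma weak_borel_open: "openin weak_topology U \<Longrightarrow> U \<in> sets weak_borel"
  using weak_topology_subset by (auto simp: weak_borel_def sets_measure_of)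

lemma weak_borel_integral_measurable:
  fixes f :: "'x::topological_space \<Rightarrow> real"
  assumes "continuous_on UNIV f" "bounded (range f)"
  shows "(\<lambda>x. \<integral>s. f s \<partial>x) \<in> borel_measurable weak_borel"
proof (rule borel_measurableI)
  fix U :: "real set" assume "open U"
  then have "openin weak_topology {x \<in> borel_probs. (\<integral>s. f s \<partial>x) \<in> U}"
    unfolding weak_topology_def using assms by (intro topology_generated_by_Basis) blast
  then have "{x \<in> borel_probs. (\<integral>s. f s \<partial>x) \<in> U} \<in> sets weak_borel"
    by (rule weak_borel_open)
  moreover have "(\<lambda>x. \<integral>s. f s \<partial>x) -` U \<inter> space weak_borel = {x \<in> borel_probs. (\<integral>s. f s \<partial>x) \<in> U}"
    by (auto simp: weak_borel_space)
  ultimately show "(\<lambda>x. \<integral>s. f s \<partial>x) -` U \<inter> space weak_borel \<in> sets weak_borel"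
    by simp
qed

locale bounded_mercer =
  fixes G :: "'x::topological_space \<Rightarrow> 'x \<Rightarrow> real"
    and evG :: "'h::{real_inner,complete_space,second_countable_topology} \<Rightarrow> 'x \<Rightarrow> real"
    and \<gamma> :: real
  assumes mercer: "mercer_kernel G" and rkhs: "is_rkhs UNIV G evG"
    and \<gamma>: "G s s \<le> \<gamma>"
begin

abbreviation "Gs \<equiv> kernel_section UNIV G evG"
abbreviation "P \<equiv> mean_embeddings G evG"

lemma Gs_measurable[measurable]: "Gs \<in> borel_measurable borel"
  by (intro borel_measurable_continuous_onI continuous_on_kernel_section mercer rkhs)

lemma Gs_norm: "(norm (Gs s))\<^sup>2 \<le> \<gamma>"
  using kernel_section_norm[OF rkhs, of s] \<gamma> by simp

lemma Gs_norm_le: "norm (Gs s) \<le> sqrt \<gamma>"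
  by (rule real_le_rsqrt) (rule Gs_norm)

lemma Gs_integrable:
  assumes "x \<in> borel_probs"
  shows "integrable x Gs"
proof -
  interpret prob_space x
    using assms by (simp add: borel_probs_def)
  show ?thesis
    using assms by (intro integrable_hilbert_bounded[where B = "sqrt \<gamma>"] Gs_norm_le)
      (simp cong: measurable_cong_sets add: borel_probs_def)
qed

lemma mean_embedding_inner:
  assumes "x \<in> borel_probs"
  shows "mean_embedding G evG x \<bullet> h = (\<integral>s. Gs s \<bullet> h \<partial>x)"
  unfolding mean_embedding_def using Gs_integrable[OF assms] by simp

text \<open>Each scalar product with the embedding is the integral of a bounded continuous function,
  hence measurable for the weak topology; weak measurability suffices in a separable Hilbert
  space.\<close>

lemma mean_embedding_measurable: "mean_embedding G evG \<in> borel_measurable weak_borel"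
proof (rule borel_measurable_weak)
  fix h
  have "continuous_on UNIV (\<lambda>s. Gs s \<bullet> h)"
    by (intro continuous_intros continuous_on_kernel_section mercer rkhs)
  moreover have "bounded (range (\<lambda>s. Gs s \<bullet> h))"
  proof (rule boundedI)
    fix y assume "y \<in> range (\<lambda>s. Gs s \<bullet> h)"
    then obtain s where "y = Gs s \<bullet> h"
      by blast
    then show "norm y \<le> sqrt \<gamma> * norm h"
      using Cauchy_Schwarz_ineq2[of "Gs s" h] mult_right_mono[OF Gs_norm_le[of s], of "norm h"] by simp
  qed
  ultimately have "(\<lambda>x. \<integral>s. Gs s \<bullet> h \<partial>x) \<in> borel_measurable weak_borel"
    by (rule weak_borel_integral_measurable)
  then show "(\<lambda>x. mean_embedding G evG x \<bullet> h) \<in> borel_measurable weak_borel"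
    by (subst measurable_cong[of weak_borel _ "\<lambda>x. \<integral>s. Gs s \<bullet> h \<partial>x"])
       (auto simp: weak_borel_space mean_embedding_inner)
qed

lemma mean_embedding_measurable_restrict:
  "mean_embedding G evG \<in> weak_borel \<rightarrow>\<^sub>M restrict_space borel P"
  by (intro measurable_restrict_space2 mean_embedding_measurable)
     (auto simp: weak_borel_space mean_embeddings_def)

text \<open>It is the mean embedding of the empirical measure. Hence kernel sections and the Hoelder
  condition are available at the empirical embeddings.\<close>

lemma empirical_embedding_in:
  assumes "0 < N"
  shows "empirical_embedding G evG N s \<in> P"
proof -
  define x where "x = distr (uniform_count_measure {..<N}) borel s"
  have "prob_space (uniform_count_measure {..<N})"
    using assms by (intro prob_space_uniform_count_measure) auto
  moreover have s: "s \<in> uniform_count_measure {..<N} \<rightarrow>\<^sub>M borel"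
    by simp
  ultimately have "prob_space x"
    unfolding x_def by (rule prob_space.prob_space_distr)
  then have x: "x \<in> borel_probs"
    by (simp add: borel_probs_def x_def)
  have "empirical_embedding G evG N s = mean_embedding G evG x"
  proof (rule inner_ext)
    fix h
    have "mean_embedding G evG x \<bullet> h = (\<integral>i. Gs (s i) \<bullet> h \<partial>uniform_count_measure {..<N})"
      unfolding mean_embedding_inner[OF x] unfolding x_def by (rule integral_distr[OF s]) measurable
    also have "\<dots> = (\<Sum>i<N. Gs (s i) \<bullet> h) / real N"
      by (simp add: integral_uniform_count_measure)
    finally show "empirical_embedding G evG N s \<bullet> h = mean_embedding G evG x \<bullet> h"
      by (simp add: empirical_embedding_def inner_sum_left)
  qed
  then show ?thesis
    using x by (auto simp: mean_embeddings_def)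
qed

end

section \<open>The regression function\<close>

text \<open>\<open>conditional_law\<close> prescribes the joint law on rectangles; these are stable
  under intersection and generate the product \<sigma>-algebra, so the disintegration holds for the
  whole measure.\<close>

lemma conditional_law_bind:
  assumes \<rho>: "prob_space \<rho>" "sets \<rho> = sets (A \<Otimes>\<^sub>M B)" and cond: "conditional_law A B \<rho> cond"
  shows "\<rho> = distr \<rho> A fst \<bind> (\<lambda>m. distr (cond m) (A \<Otimes>\<^sub>M B) (Pair m))"
    and "(\<lambda>m. distr (cond m) (A \<Otimes>\<^sub>M B) (Pair m)) \<in> A \<rightarrow>\<^sub>M subprob_algebra (A \<Otimes>\<^sub>M B)"
proof -
  interpret prob_space \<rho> by (rule \<rho>)
  note sets_\<rho>[measurable_cong] = \<rho>(2)
  have cond_meas: "cond \<in> A \<rightarrow>\<^sub>M prob_algebra B"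
    using cond by (simp add: conditional_law_def)
  have cond_sub[measurable]: "cond \<in> A \<rightarrow>\<^sub>M subprob_algebra B"
    by (rule measurable_prob_algebraD[OF cond_meas])
  have fst[measurable]: "fst \<in> \<rho> \<rightarrow>\<^sub>M A"
    by measurable
  define Q where "Q = distr \<rho> A fst"
  have Q: "prob_space Q" "sets Q = sets A" "space Q = space A"
    unfolding Q_def by (auto intro: prob_space_distr)
  note [measurable_cong] = Q(2)
  have kern: "(\<lambda>m. distr (cond m) (A \<Otimes>\<^sub>M B) (Pair m)) \<in> A \<rightarrow>\<^sub>M subprob_algebra (A \<Otimes>\<^sub>M B)"
    by (rule measurable_distr2[OF _ cond_sub]) measurable
  have kernQ: "(\<lambda>m. distr (cond m) (A \<Otimes>\<^sub>M B) (Pair m)) \<in> Q \<rightarrow>\<^sub>M subprob_algebra (A \<Otimes>\<^sub>M B)"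
    using kern by (simp cong: measurable_cong_sets add: Q)
  define E where "E = {S \<times> V |S V. S \<in> sets A \<and> V \<in> sets B}"
  have sets_E: "sets (A \<Otimes>\<^sub>M B) = sigma_sets (space A \<times> space B) E"
    by (simp add: sets_pair_measure E_def)
  have "Q \<noteq> count_space {}"
    using prob_space.not_empty[OF Q(1)] by auto
  have "\<rho> = Q \<bind> (\<lambda>m. distr (cond m) (A \<Otimes>\<^sub>M B) (Pair m))"
  proof (rule measure_eqI_generator_eq[where E = E and \<Omega> = "space A \<times> space B" and A = "\<lambda>_::nat. space A \<times> space B"])
    show "Int_stable E"
      unfolding E_def by (rule Int_stable_pair_measure_generator)
    show "E \<subseteq> Pow (space A \<times> space B)"
      unfolding E_def by (rule pair_measure_closed)
    show "sets \<rho> = sigma_sets (space A \<times> space B) E"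
      using \<rho>(2) sets_E by simp
    show "sets (Q \<bind> (\<lambda>m. distr (cond m) (A \<Otimes>\<^sub>M B) (Pair m))) = sigma_sets (space A \<times> space B) E"
      unfolding sets_E[symmetric] using prob_space.not_empty[OF Q(1)] by (intro sets_bind) auto
    show "range (\<lambda>_::nat. space A \<times> space B) \<subseteq> E"
      by (auto simp: E_def)
    show "emeasure \<rho> (space A \<times> space B) \<noteq> \<infinity>" for i :: nat
      by (simp add: emeasure_eq_measure)
    fix Z assume "Z \<in> E"
    then obtain S V where Z: "Z = S \<times> V" and S[measurable]: "S \<in> sets A" and V[measurable]: "V \<in> sets B"
      by (auto simp: E_def)
    have "emeasure (Q \<bind> (\<lambda>m. distr (cond m) (A \<Otimes>\<^sub>M B) (Pair m))) Z
      = (\<integral>\<^sup>+m. emeasure (distr (cond m) (A \<Otimes>\<^sub>M B) (Pair m)) Z \<partial>Q)"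
      using prob_space.not_empty[OF Q(1)] Z by (intro emeasure_bind[OF _ kernQ]) auto
    also have "\<dots> = (\<integral>\<^sup>+m\<in>S. emeasure (cond m) V \<partial>Q)"
    proof (rule nn_integral_cong)
      fix m assume "m \<in> space Q"
      then have m: "m \<in> space A"
        by (simp add: Q)
      note sp = subprob_measurableD[OF cond_sub m]
      have "Pair m \<in> cond m \<rightarrow>\<^sub>M A \<Otimes>\<^sub>M B"
        using m by (simp add: sp(3))
      then have "emeasure (distr (cond m) (A \<Otimes>\<^sub>M B) (Pair m)) Z = emeasure (cond m) (Pair m -` Z \<inter> space (cond m))"
        by (rule emeasure_distr) (simp add: Z)
      also have "Pair m -` Z \<inter> space (cond m) = (if m \<in> S then V else {})"
        using sets.sets_into_space[OF V] by (auto simp: Z sp(1))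
      finally show "emeasure (distr (cond m) (A \<Otimes>\<^sub>M B) (Pair m)) Z = emeasure (cond m) V * indicator S m"
        by simp
    qed
    also have "\<dots> = emeasure \<rho> Z"
      using cond S V by (simp add: conditional_law_def Z Q_def)
    finally show "emeasure \<rho> Z = emeasure (Q \<bind> (\<lambda>m. distr (cond m) (A \<Otimes>\<^sub>M B) (Pair m))) Z"
      by simp
  qed auto
  then show "\<rho> = distr \<rho> A fst \<bind> (\<lambda>m. distr (cond m) (A \<Otimes>\<^sub>M B) (Pair m))"
    by (simp add: Q_def)
  show "(\<lambda>m. distr (cond m) (A \<Otimes>\<^sub>M B) (Pair m)) \<in> A \<rightarrow>\<^sub>M subprob_algebra (A \<Otimes>\<^sub>M B)"
    by (rule kern)
qed

lemma regression_function:
  fixes P :: "'a::topological_space set" and Y :: "real set" and M :: real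
    and \<rho> :: "('a \<times> real) measure" and cond :: "'a \<Rightarrow> real measure"
  defines "A \<equiv> restrict_space borel P" and "B \<equiv> restrict_space (borel :: real measure) Y"
  assumes \<rho>: "prob_space \<rho>" "sets \<rho> = sets (A \<Otimes>\<^sub>M B)" and cond: "conditional_law A B \<rho> cond"
    and Y: "Y \<subseteq> {- M..M}"
  defines "Q \<equiv> distr \<rho> A fst" and "f \<equiv> (\<lambda>m. \<integral>y. y \<partial>cond m)"
  shows regression_function_measurable: "f \<in> borel_measurable Q"
    and regression_function_bound: "\<And>m. m \<in> space Q \<Longrightarrow> \<bar>f m\<bar> \<le> M"
    and regression_function_integral: "\<And>h H. h \<in> borel_measurable Q \<Longrightarrow> (\<And>m. m \<in> space Q \<Longrightarrow> \<bar>h m\<bar> \<le> H) \<Longrightarrow>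
      (\<integral>z. snd z * h (fst z) \<partial>\<rho>) = (\<integral>m. f m * h m \<partial>Q)"
proof -
  interpret prob_space \<rho> by (rule \<rho>)
  note [measurable_cong] = \<rho>(2)
  have cond_meas: "cond \<in> A \<rightarrow>\<^sub>M prob_algebra B"
    using cond by (simp add: conditional_law_def)
  have cond_sub[measurable]: "cond \<in> A \<rightarrow>\<^sub>M subprob_algebra B"
    by (rule measurable_prob_algebraD[OF cond_meas])
  have id_B[measurable]: "(\<lambda>y. y) \<in> borel_measurable B"
    unfolding B_def by (intro measurable_restrict_space1) simp
  have fst_A: "fst \<in> \<rho> \<rightarrow>\<^sub>M A"
    by measurable
  have Q: "prob_space Q" "sets Q = sets A" "space Q = space A"
    unfolding Q_def by (auto intro: prob_space_distr fst_A)
  interpret Q: prob_space Q by (rule Q)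
  have f_A: "f \<in> borel_measurable A"
    unfolding f_def by (rule measurable_compose[OF cond_sub integral_measurable_subprob_algebra[OF id_B]])
  then show f_Q: "f \<in> borel_measurable Q"
    by (simp cong: measurable_cong_sets add: Q)
  have c: "prob_space (cond m)" "sets (cond m) = sets B" "space (cond m) = Y" if "m \<in> space A" for m
  proof -
    have "cond m \<in> space (prob_algebra B)"
      using cond_meas that by (rule measurable_space)
    then show "prob_space (cond m)" "sets (cond m) = sets B"
      by (auto simp: space_prob_algebra)
    then show "space (cond m) = Y"
      by (simp add: sets_eq_imp_space_eq[of "cond m" B] B_def space_restrict_space)
  qed
  have id_c: "(\<lambda>y. y) \<in> borel_measurable (cond m)" if "m \<in> space A" for m
    using id_B by (simp cong: measurable_cong_sets add: c[OF that])
  have int_c: "integrable (cond m) (\<lambda>y. y)" if "m \<in> space A" for m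
  proof -
    interpret c: prob_space "cond m"
      by (rule c[OF that])
    show ?thesis
      using Y by (intro c.integrable_real_bounded[where B = M] id_c that) (auto simp: c(3)[OF that] subset_eq)
  qed
  show bound: "\<bar>f m\<bar> \<le> M" if "m \<in> space Q" for m
  proof -
    have m: "m \<in> space A"
      using that Q by simp
    interpret c: prob_space "cond m"
      by (rule c[OF m])
    have "\<bar>f m\<bar> \<le> (\<integral>y. \<bar>y\<bar> \<partial>cond m)"
      unfolding f_def by (rule integral_abs_bound)
    also have "\<dots> \<le> (\<integral>y. M \<partial>cond m)"
      using int_c[OF m] Y by (intro integral_mono) (auto simp: c(3)[OF m] subset_eq abs_le_iff minus_le_iff)
    finally show ?thesis
      by (simp add: c.prob_space)
  qed
  fix h :: "'a \<Rightarrow> real" and H assume h: "h \<in> borel_measurable Q" and H: "\<And>m. m \<in> space Q \<Longrightarrow> \<bar>h m\<bar> \<le> H"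
  have h_A[measurable]: "h \<in> borel_measurable A"
    using h by (simp cong: measurable_cong_sets add: Q)
  have M_nonneg: "0 \<le> M"
    using bound Q.not_empty by (metis abs_ge_zero ex_in_conv order_trans)
  \<comment> \<open>Adding K makes the integrands nonnegative, so the disintegration can be used
    with nonnegative integrals and the constant subtracted at the end.\<close>
  define K where "K = M * H"
  have space_\<rho>: "space \<rho> = space A \<times> Y"
    using sets_eq_imp_space_eq[OF \<rho>(2)] by (simp add: space_pair_measure B_def space_restrict_space)
  have yh: "\<bar>y * h m\<bar> \<le> K" if "m \<in> space A" "y \<in> Y" for m y
    unfolding K_def abs_mult using H[of m] that Y Q M_nonneg
    by (intro mult_mono) (auto simp: subset_eq abs_le_iff minus_le_iff)
  have fh: "\<bar>f m * h m\<bar> \<le> K" if "m \<in> space A" for m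
    unfolding K_def abs_mult using H[of m] bound[of m] that Q M_nonneg by (intro mult_mono) auto
  have snd_\<rho>[measurable]: "snd \<in> borel_measurable \<rho>"
  proof -
    have "snd \<in> \<rho> \<rightarrow>\<^sub>M B"
      by measurable
    from measurable_compose[OF this id_B] show ?thesis
      by simp
  qed
  have yh_meas[measurable]: "(\<lambda>z. snd z * h (fst z)) \<in> borel_measurable \<rho>"
    using measurable_compose[OF fst_A h_A] by measurable
  have yh_meas': "(\<lambda>z. ennreal (snd z * h (fst z) + K)) \<in> borel_measurable (A \<Otimes>\<^sub>M B)"
    using yh_meas by (simp cong: measurable_cong_sets add: \<rho>(2))
  note bind = conditional_law_bind[OF \<rho> cond, folded Q_def]
  have int1: "integrable \<rho> (\<lambda>z. snd z * h (fst z))"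
    by (rule integrable_real_bounded[OF yh_meas, of K]) (auto simp: space_\<rho> yh)
  have int2: "integrable Q (\<lambda>m. f m * h m)"
    by (rule Q.integrable_real_bounded[of _ K]) (use f_Q h fh Q in auto)
  have "ennreal ((\<integral>z. snd z * h (fst z) \<partial>\<rho>) + K) = ennreal (\<integral>z. snd z * h (fst z) + K \<partial>\<rho>)"
    using int1 by (simp add: prob_space)
  also have "\<dots> = (\<integral>\<^sup>+z. ennreal (snd z * h (fst z) + K) \<partial>\<rho>)"
  proof (rule nn_integral_eq_integral[symmetric])
    show "AE z in \<rho>. 0 \<le> snd z * h (fst z) + K"
      using yh by (intro AE_I2) (fastforce simp: space_\<rho> abs_le_iff)
  qed (use int1 in simp)
  also have "\<dots> = (\<integral>\<^sup>+m. \<integral>\<^sup>+z. ennreal (snd z * h (fst z) + K) \<partial>distr (cond m) (A \<Otimes>\<^sub>M B) (Pair m) \<partial>Q)"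
    using bind(2) by (subst bind(1), intro nn_integral_bind[OF yh_meas']) (simp cong: measurable_cong_sets add: Q)
  also have "\<dots> = (\<integral>\<^sup>+m. ennreal (f m * h m + K) \<partial>Q)"
  proof (rule nn_integral_cong)
    fix m assume "m \<in> space Q"
    then have m: "m \<in> space A"
      by (simp add: Q)
    interpret c: prob_space "cond m"
      by (rule c[OF m])
    have pair: "Pair m \<in> cond m \<rightarrow>\<^sub>M A \<Otimes>\<^sub>M B"
      using m by (simp add: subprob_measurableD(3)[OF cond_sub m])
    have "(\<integral>\<^sup>+z. ennreal (snd z * h (fst z) + K) \<partial>distr (cond m) (A \<Otimes>\<^sub>M B) (Pair m))
      = (\<integral>\<^sup>+y. ennreal (y * h m + K) \<partial>cond m)"
      by (subst nn_integral_distr[OF pair]) (use yh_meas' in auto)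
    also have "\<dots> = ennreal (\<integral>y. y * h m + K \<partial>cond m)"
    proof (rule nn_integral_eq_integral)
      show "AE y in cond m. 0 \<le> y * h m + K"
        using yh[OF m] by (intro AE_I2) (fastforce simp: c(3)[OF m] abs_le_iff)
    qed (use int_c[OF m] in simp)
    also have "(\<integral>y. y * h m + K \<partial>cond m) = f m * h m + K"
      using int_c[OF m] by (simp add: f_def c.prob_space)
    finally show "(\<integral>\<^sup>+z. ennreal (snd z * h (fst z) + K) \<partial>distr (cond m) (A \<Otimes>\<^sub>M B) (Pair m)) = ennreal (f m * h m + K)" .
  qed
  also have "\<dots> = ennreal (\<integral>m. f m * h m + K \<partial>Q)"
  proof (rule nn_integral_eq_integral)
    show "AE m in Q. 0 \<le> f m * h m + K"
      using fh by (intro AE_I2) (fastforce simp: Q abs_le_iff)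
  qed (use int2 in simp)
  also have "\<dots> = ennreal ((\<integral>m. f m * h m \<partial>Q) + K)"
    using int2 by (simp add: Q.prob_space)
  finally have eq: "ennreal ((\<integral>z. snd z * h (fst z) \<partial>\<rho>) + K) = ennreal ((\<integral>m. f m * h m \<partial>Q) + K)" .
  have "- K \<le> (\<integral>z. snd z * h (fst z) \<partial>\<rho>)"
  proof -
    have "(\<integral>z. - K \<partial>\<rho>) \<le> (\<integral>z. snd z * h (fst z) \<partial>\<rho>)"
      using int1 yh by (intro integral_mono) (fastforce simp: space_\<rho> abs_le_iff)+
    then show ?thesis
      by (simp add: prob_space)
  qed
  moreover have "- K \<le> (\<integral>m. f m * h m \<partial>Q)"
  proof -
    have "(\<integral>m. - K \<partial>Q) \<le> (\<integral>m. f m * h m \<partial>Q)"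
      using int2 fh by (intro integral_mono) (fastforce simp: Q abs_le_iff)+
    then show ?thesis
      by (simp add: Q.prob_space)
  qed
  ultimately show "(\<integral>z. snd z * h (fst z) \<partial>\<rho>) = (\<integral>m. f m * h m \<partial>Q)"
    using eq by (subst (asm) ennreal_inj) auto
qed

section \<open>Perturbation of the sample\<close>

text \<open>Only evaluation at the sample points enters the gradient, and there the reproducing
  property turns it into a scalar product.\<close>

lemma grad_descent_eq_landweber:
  assumes "\<And>j f. j < n \<Longrightarrow> val f (m j) = f \<bullet> Ks (m j)"
  shows "grad_descent val Ks \<eta> n m y t
    = landweber \<eta> (emp_cov n (\<lambda>j. Ks (m j))) (emp_vec n (\<lambda>j. Ks (m j)) y) t"
proof (induction t)
  case (Suc t)
  define f where "f = grad_descent val Ks \<eta> n m y t"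
  have "(\<Sum>j<n. (val f (m j) - y j) *\<^sub>R Ks (m j)) = (\<Sum>j<n. (f \<bullet> Ks (m j)) *\<^sub>R Ks (m j) - y j *\<^sub>R Ks (m j))"
    using assms by (intro sum.cong) (auto simp: scaleR_diff_left)
  then show ?case
    using Suc by (simp add: f_def[symmetric] emp_cov_def emp_vec_def sum_subtractf scaleR_diff_right)
qed simp

lemma borel_measurable_landweber:
  fixes K :: "nat \<Rightarrow> 'w \<Rightarrow> 'k::{real_inner,second_countable_topology}"
  assumes [measurable]: "\<And>j. j < n \<Longrightarrow> K j \<in> borel_measurable M" "\<And>j. j < n \<Longrightarrow> y j \<in> borel_measurable M"
  shows "(\<lambda>\<omega>. landweber \<eta> (emp_cov n (\<lambda>j. K j \<omega>)) (emp_vec n (\<lambda>j. K j \<omega>) (\<lambda>j. y j \<omega>)) t) \<in> borel_measurable M"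
proof (induction t)
  case (Suc t)
  note [measurable] = Suc
  show ?case
    unfolding landweber.simps emp_cov_def emp_vec_def
    using Suc[unfolded emp_cov_def emp_vec_def] assms
    by (intro borel_measurable_diff borel_measurable_scaleR borel_measurable_sum borel_measurable_inner
        borel_measurable_const) auto
qed simp

text \<open>A bound valid for every sample, without any good event; it serves to make the risk
  integrable.\<close>

lemma landweber_norm_le_linear:
  assumes A: "positive_operator A a" and \<eta>: "0 < \<eta>" "\<eta> * a \<le> 1" and b: "norm b \<le> c"
  shows "norm (landweber \<eta> A b t) \<le> \<eta> * real t * c"
proof -
  interpret positive_operator A a by (rule A)
  interpret step_size \<eta> a by unfold_locales (rule \<eta>)+
  have "norm (poly_op (filter_poly \<eta> t) A b) \<le> \<eta> * real t * norm b"
    by (rule poly_op_norm_le) (use filter_bounds in auto)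
  also have "\<dots> \<le> \<eta> * real t * c"
    using \<eta> b by (intro mult_left_mono) auto
  finally show ?thesis
    by (simp add: landweber_eq_filter[OF bounded_linear_A])
qed

lemma norm_average_le:
  assumes "\<And>j. j < n \<Longrightarrow> norm (x j) \<le> c j"
  shows "norm ((1 / real n) *\<^sub>R (\<Sum>j<n. x j)) \<le> (\<Sum>j<n. c j) / real n"
proof -
  have "norm (\<Sum>j<n. x j) \<le> (\<Sum>j<n. c j)"
    using assms by (intro order_trans[OF norm_sum] sum_mono) auto
  then show ?thesis
    by (simp add: divide_right_mono)
qed

lemma emp_cov_diff_le:
  assumes x: "\<And>j. j < n \<Longrightarrow> norm (x j) \<le> B" "\<And>j. j < n \<Longrightarrow> norm (x' j) \<le> B"
    and d: "\<And>j. j < n \<Longrightarrow> norm (x' j - x j) \<le> d j"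
  shows "norm (emp_cov n x' f - emp_cov n x f) \<le> 2 * B * ((\<Sum>j<n. d j) / real n) * norm f"
proof -
  have "emp_cov n x' f - emp_cov n x f = (1 / real n) *\<^sub>R (\<Sum>j<n. (f \<bullet> x' j) *\<^sub>R x' j - (f \<bullet> x j) *\<^sub>R x j)"
    by (simp add: emp_cov_def sum_subtractf scaleR_diff_right)
  also have "norm \<dots> \<le> (\<Sum>j<n. 2 * B * norm f * d j) / real n"
  proof (rule norm_average_le)
    fix j assume j: "j < n"
    have "0 \<le> B"
      using x(1)[OF j] norm_ge_zero order_trans by blast
    \<comment> \<open>The rank-one operators differ in both slots; changing them one at a time gives
      the factor 2 B.\<close>
    have "(f \<bullet> x' j) *\<^sub>R x' j - (f \<bullet> x j) *\<^sub>R x j = (f \<bullet> x' j) *\<^sub>R (x' j - x j) + (f \<bullet> (x' j - x j)) *\<^sub>R x j"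
      by (simp add: algebra_simps inner_diff)
    also have "norm \<dots> \<le> (norm f * B) * d j + (norm f * d j) * B"
    proof (rule norm_triangle_mono)
      have "\<bar>f \<bullet> x' j\<bar> \<le> norm f * B"
        using Cauchy_Schwarz_ineq2[of f "x' j"] mult_left_mono[OF x(2)[OF j], of "norm f"] by simp
      then show "norm ((f \<bullet> x' j) *\<^sub>R (x' j - x j)) \<le> (norm f * B) * d j"
        unfolding norm_scaleR using d[OF j] \<open>0 \<le> B\<close> by (intro mult_mono) auto
      have "\<bar>f \<bullet> (x' j - x j)\<bar> \<le> norm f * d j"
        using Cauchy_Schwarz_ineq2[of f "x' j - x j"] mult_left_mono[OF d[OF j], of "norm f"] by simp
      then show "norm ((f \<bullet> (x' j - x j)) *\<^sub>R x j) \<le> (norm f * d j) * B"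
        unfolding norm_scaleR using x(1)[OF j] order_trans[OF norm_ge_zero d[OF j]] by (intro mult_mono) auto
    qed
    finally show "norm ((f \<bullet> x' j) *\<^sub>R x' j - (f \<bullet> x j) *\<^sub>R x j) \<le> 2 * B * norm f * d j"
      by (simp add: mult_ac)
  qed
  also have "\<dots> = 2 * B * ((\<Sum>j<n. d j) / real n) * norm f"
    by (simp add: sum_distrib_left[symmetric])
  finally show ?thesis .
qed

lemma emp_vec_diff_le:
  assumes y: "\<And>j. j < n \<Longrightarrow> \<bar>y j\<bar> \<le> M" and d: "\<And>j. j < n \<Longrightarrow> norm (x' j - x j) \<le> d j"
  shows "norm (emp_vec n x' y - emp_vec n x y) \<le> M * ((\<Sum>j<n. d j) / real n)"
proof -
  have "emp_vec n x' y - emp_vec n x y = (1 / real n) *\<^sub>R (\<Sum>j<n. y j *\<^sub>R (x' j - x j))"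
    by (simp add: emp_vec_def sum_subtractf scaleR_diff_right)
  also have "norm \<dots> \<le> (\<Sum>j<n. M * d j) / real n"
  proof (rule norm_average_le)
    fix j assume "j < n"
    then show "norm (y j *\<^sub>R (x' j - x j)) \<le> M * d j"
      unfolding norm_scaleR using y d by (intro mult_mono) (auto intro: order_trans[OF abs_ge_zero])
  qed
  finally show ?thesis
    by (simp add: sum_distrib_left[symmetric])
qed

lemma powr_le_one_plus:
  fixes t \<beta> :: real
  assumes "0 \<le> t" "0 \<le> \<beta>" "\<beta> \<le> 1"
  shows "t powr \<beta> \<le> 1 + t"
proof (cases "t \<le> 1")
  case True
  then have "t powr \<beta> \<le> 1"
    using assms by (intro powr_le1) auto
  then show ?thesis
    using assms by simp
next
  case False
  then have "t powr \<beta> \<le> t powr 1"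
    using assms by (intro powr_mono) auto
  then show ?thesis
    using False by simp
qed

text \<open>It takes the place of Jensen's inequality: pointwise and linear in u^2, so one bound on
  a conditional second moment is enough. The scale q will be the order of that moment, and exponents
  up to 2 also cover the square of u^\<alpha>.\<close>

lemma powr_le_scaled_square:
  fixes u \<alpha> q :: real
  assumes "0 \<le> u" "0 < q" "0 \<le> \<alpha>" "\<alpha> \<le> 2"
  shows "u powr \<alpha> \<le> q powr (\<alpha> / 2) * (1 + u\<^sup>2 / q)"
proof -
  have "u powr \<alpha> = (q * (u\<^sup>2 / q)) powr (\<alpha> / 2)"
  proof (cases "u = 0")
    case False
    have "(u\<^sup>2) powr (\<alpha> / 2) = u powr \<alpha>"
      using assms False by (simp add: powr_powr flip: powr_numeral)
    then show ?thesis
      using assms by simp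
  qed (use assms in simp)
  also have "\<dots> = q powr (\<alpha> / 2) * (u\<^sup>2 / q) powr (\<alpha> / 2)"
    by (rule powr_mult)
  also have "\<dots> \<le> q powr (\<alpha> / 2) * (1 + u\<^sup>2 / q)"
    using assms by (intro mult_left_mono powr_le_one_plus) auto
  finally show ?thesis .
qed

section \<open>Two-stage samples\<close>

lemma generated_by_measurable: "Z \<in> space \<Omega> \<rightarrow> space A \<Longrightarrow> Z \<in> generated_by \<Omega> Z A \<rightarrow>\<^sub>M A"
  unfolding generated_by_def by (rule measurable_vimage_algebra1)

lemma space_generated_by: "space (generated_by \<Omega> Z A) = space \<Omega>"
  by (simp add: generated_by_def)

lemma sets_generated_by_subset:
  assumes "Z \<in> F \<rightarrow>\<^sub>M A" "space F = space \<Omega>"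
  shows "sets (generated_by \<Omega> Z A) \<subseteq> sets F"
  unfolding generated_by_def using assms by (intro sets_image_in_sets) auto

lemma prod_two_point:
  fixes g :: "nat \<Rightarrow> nat \<Rightarrow> real"
  assumes "j < n" "i < N" "i' < N" "i \<noteq> i'"
    and one: "\<And>l p. l < n \<Longrightarrow> p < N \<Longrightarrow> (l, p) \<noteq> (j, i) \<Longrightarrow> (l, p) \<noteq> (j, i') \<Longrightarrow> g l p = 1"
  shows "(\<Prod>l<n. \<Prod>p<N. g l p) = g j i * g j i'"
proof -
  have "(\<Prod>p<N. g j p) = (\<Prod>p\<in>{i, i'}. g j p)"
    using assms by (intro prod.mono_neutral_right) auto
  then have gj: "(\<Prod>p<N. g j p) = g j i * g j i'"
    using assms by simp
  have "(\<Prod>l<n. \<Prod>p<N. g l p) = (\<Prod>l\<in>{j}. \<Prod>p<N. g l p)"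
    using assms by (intro prod.mono_neutral_right) (auto intro!: prod.neutral)
  then show ?thesis
    using gj by simp
qed

locale two_stage = bounded_mercer G evG \<gamma>
  for G :: "'x::topological_space \<Rightarrow> 'x \<Rightarrow> real"
    and evG :: "'h::{real_inner,complete_space,second_countable_topology} \<Rightarrow> 'x \<Rightarrow> real"
    and \<gamma> :: real +
  fixes Y :: "real set" and \<rho> :: "('h \<times> real) measure" and n N :: nat
    and \<Omega> :: "'w measure" and x :: "nat \<Rightarrow> 'w \<Rightarrow> 'x measure" and y :: "nat \<Rightarrow> 'w \<Rightarrow> real"
    and s :: "nat \<Rightarrow> nat \<Rightarrow> 'w \<Rightarrow> 'x"
  assumes n: "0 < n" and N: "2 \<le> N"
    and sets_\<rho>: "sets \<rho> = sets (restrict_space borel P \<Otimes>\<^sub>M restrict_space borel Y)"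
    and sample: "two_stage_sample G evG Y \<rho> n N \<Omega> x y s"
begin

abbreviation "YM \<equiv> restrict_space borel Y"
abbreviation "PM \<equiv> restrict_space borel P"
abbreviation "XY \<equiv> weak_borel \<Otimes>\<^sub>M YM"
abbreviation "\<mu> j \<omega> \<equiv> mean_embedding G evG (x j \<omega>)"
abbreviation "\<mu>' j \<omega> \<equiv> empirical_embedding G evG N (\<lambda>i. s j i \<omega>)"
abbreviation "DX \<equiv> first_stage n x y"
abbreviation "DP \<equiv> first_stage n \<mu> y"
abbreviation "FX \<equiv> generated_by \<Omega> DX (PiM {..<n} (\<lambda>_. XY))"
abbreviation "FP \<equiv> generated_by \<Omega> DP (PiM {..<n} (\<lambda>_. PM \<Otimes>\<^sub>M YM))"

lemma prob_\<Omega>: "prob_space \<Omega>"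
  and indep: "prob_space.indep_vars \<Omega> (\<lambda>_. XY) (\<lambda>j \<omega>. (x j \<omega>, y j \<omega>)) {..<n}"
  and law: "j < n \<Longrightarrow> distr \<Omega> (PM \<Otimes>\<^sub>M YM) (\<lambda>\<omega>. (\<mu> j \<omega>, y j \<omega>)) = \<rho>"
  and s_measurable: "j < n \<Longrightarrow> i < N \<Longrightarrow> s j i \<in> \<Omega> \<rightarrow>\<^sub>M borel"
  and conditional: "(\<And>j i. j < n \<Longrightarrow> i < N \<Longrightarrow> B j i \<in> sets borel) \<Longrightarrow>
    AE \<omega> in \<Omega>. real_cond_exp \<Omega> FX (indicator {\<omega> \<in> space \<Omega>. \<forall>j<n. \<forall>i<N. s j i \<omega> \<in> B j i}) \<omega>
      = (\<Prod>j<n. \<Prod>i<N. measure (x j \<omega>) (B j i))"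
  using sample unfolding two_stage_sample_def Let_def by blast+

sublocale prob_space \<Omega> by (rule prob_\<Omega>)

lemma xy_measurable: "j < n \<Longrightarrow> (\<lambda>\<omega>. (x j \<omega>, y j \<omega>)) \<in> \<Omega> \<rightarrow>\<^sub>M XY"
  using indep by (simp add: indep_vars_def)

lemma x_in: "j < n \<Longrightarrow> \<omega> \<in> space \<Omega> \<Longrightarrow> x j \<omega> \<in> borel_probs"
  using measurable_space[OF xy_measurable]
  by (auto simp: space_pair_measure weak_borel_space space_restrict_space)

lemma DX_measurable: "DX \<in> \<Omega> \<rightarrow>\<^sub>M PiM {..<n} (\<lambda>_. XY)"
  unfolding first_stage_def[abs_def] using xy_measurable by (intro measurable_restrict) auto

lemma DX_FX: "DX \<in> FX \<rightarrow>\<^sub>M PiM {..<n} (\<lambda>_. XY)"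
  using measurable_space[OF DX_measurable] by (intro generated_by_measurable) auto

lemma \<mu>y_measurable:
  assumes "(\<lambda>\<omega>. (x j \<omega>, y j \<omega>)) \<in> F \<rightarrow>\<^sub>M XY"
  shows "(\<lambda>\<omega>. (\<mu> j \<omega>, y j \<omega>)) \<in> F \<rightarrow>\<^sub>M PM \<Otimes>\<^sub>M YM"
proof -
  note [measurable] = mean_embedding_measurable_restrict
  have "(\<lambda>z. (mean_embedding G evG (fst z), snd z)) \<in> XY \<rightarrow>\<^sub>M PM \<Otimes>\<^sub>M YM"
    by measurable
  from measurable_compose[OF assms this] show ?thesis
    by simp
qed

lemma xy_FX:
  assumes "j < n"
  shows "(\<lambda>\<omega>. (x j \<omega>, y j \<omega>)) \<in> FX \<rightarrow>\<^sub>M XY"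
proof -
  have "(\<lambda>\<omega>. DX \<omega> j) \<in> FX \<rightarrow>\<^sub>M XY"
    using assms by (intro measurable_compose[OF DX_FX measurable_component_singleton]) simp
  then show ?thesis
    using assms by (simp add: first_stage_def)
qed

lemma DP_FX: "DP \<in> FX \<rightarrow>\<^sub>M PiM {..<n} (\<lambda>_. PM \<Otimes>\<^sub>M YM)"
  unfolding first_stage_def[abs_def]
  using \<mu>y_measurable[OF xy_FX[unfolded first_stage_def[abs_def]]]
  by (intro measurable_restrict) auto

lemma subalgebra_FX: "subalgebra \<Omega> FX"
  using sets_generated_by_subset[OF DX_measurable]
  by (simp add: subalgebra_def space_generated_by)

lemma DP_measurable: "DP \<in> \<Omega> \<rightarrow>\<^sub>M PiM {..<n} (\<lambda>_. PM \<Otimes>\<^sub>M YM)"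
  by (rule measurable_from_subalg[OF subalgebra_FX DP_FX])

lemma DP_FP: "DP \<in> FP \<rightarrow>\<^sub>M PiM {..<n} (\<lambda>_. PM \<Otimes>\<^sub>M YM)"
  using measurable_space[OF DP_measurable] by (intro generated_by_measurable) auto

text \<open>Sampling is described given the measures, the risk given the embeddings. As the
  embeddings are functions of the measures, an estimate integrated over all sets of
  \<open>FX\<close> holds over those of \<open>FP\<close>.\<close>

lemma sets_FP_subset: "sets FP \<subseteq> sets FX"
  using DP_FX by (intro sets_generated_by_subset) (auto simp: space_generated_by)

lemma subalgebra_FP: "subalgebra \<Omega> FP"
  using sets_generated_by_subset[OF DP_measurable]
  by (simp add: subalgebra_def space_generated_by)

lemma sets_samples: "sets (PiM {..<n} (\<lambda>_. PM \<Otimes>\<^sub>M YM)) = sets (PiM {..<n} (\<lambda>_. \<rho>))"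
  by (intro sets_PiM_cong) (auto simp: sets_\<rho>)

text \<open>Independence and identical laws pass through the measurable embedding map, so the first
  stage has the product law for which the good event was estimated.\<close>

lemma distr_DP: "distr \<Omega> (PiM {..<n} (\<lambda>_. PM \<Otimes>\<^sub>M YM)) DP = PiM {..<n} (\<lambda>_. \<rho>)"
proof -
  note [measurable] = mean_embedding_measurable_restrict
  have "indep_vars (\<lambda>_. PM \<Otimes>\<^sub>M YM) (\<lambda>j \<omega>. (\<lambda>z. (mean_embedding G evG (fst z), snd z)) (x j \<omega>, y j \<omega>)) {..<n}"
    by (rule indep_vars_compose2[OF indep]) measurable
  then have "indep_vars (\<lambda>_. PM \<Otimes>\<^sub>M YM) (\<lambda>j \<omega>. (\<mu> j \<omega>, y j \<omega>)) {..<n}"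
    by simp
  then have "distr \<Omega> (PiM {..<n} (\<lambda>_. PM \<Otimes>\<^sub>M YM)) (\<lambda>\<omega>. \<lambda>j\<in>{..<n}. (\<mu> j \<omega>, y j \<omega>))
    = PiM {..<n} (\<lambda>j. distr \<Omega> (PM \<Otimes>\<^sub>M YM) (\<lambda>\<omega>. (\<mu> j \<omega>, y j \<omega>)))"
    using n by (subst (asm) indep_vars_iff_distr_eq_PiM') (auto intro: \<mu>y_measurable xy_measurable)
  also have "\<dots> = PiM {..<n} (\<lambda>_. \<rho>)"
    by (intro PiM_cong) (auto simp: law)
  finally show ?thesis
    by (simp add: first_stage_def[abs_def])
qed

lemma measure_DP:
  assumes "E \<in> sets (PiM {..<n} (\<lambda>_. \<rho>))"
  shows "measure \<Omega> (DP -` E \<inter> space \<Omega>) = measure (PiM {..<n} (\<lambda>_. \<rho>)) E"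
  using assms by (subst distr_DP[symmetric], subst measure_distr[OF DP_measurable]) (auto simp: sets_samples)

lemma conditional_sample:
  assumes j: "j < n"
  shows "conditional_sample \<Omega> FX (x j) (s j) N"
proof (rule conditional_sample.intro[OF prob_\<Omega> conditional_sample_axioms.intro])
  show "subalgebra \<Omega> FX"
    by (rule subalgebra_FX)
  show "x j \<omega> \<in> borel_probs" if "\<omega> \<in> space \<Omega>" for \<omega>
    using j that by (rule x_in)
  show "s j i \<in> \<Omega> \<rightarrow>\<^sub>M borel" if "i < N" for i
    using j that by (rule s_measurable)
  fix i i' and U V :: "'x set" assume i: "i < N" "i' < N" "i \<noteq> i'" and U: "U \<in> sets borel" "V \<in> sets borel"
  \<comment> \<open>All indices other than the chosen two get the whole space and contribute the
    factor 1.\<close>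
  define B where "B l p = (if l = j \<and> p = i then U else if l = j \<and> p = i' then V else UNIV)" for l p
  have B: "B j i = U" "B j i' = V" and B_UNIV: "(l, p) \<noteq> (j, i) \<Longrightarrow> (l, p) \<noteq> (j, i') \<Longrightarrow> B l p = UNIV" for l p
    using i by (auto simp: B_def)
  have "(\<forall>l<n. \<forall>p<N. s l p \<omega> \<in> B l p) \<longleftrightarrow> s j i \<omega> \<in> U \<and> s j i' \<omega> \<in> V" for \<omega>
    using i j B B_UNIV by (metis UNIV_I prod.inject)
  moreover have "AE \<omega> in \<Omega>. real_cond_exp \<Omega> FX (indicator {\<omega> \<in> space \<Omega>. \<forall>l<n. \<forall>p<N. s l p \<omega> \<in> B l p}) \<omega>
      = (\<Prod>l<n. \<Prod>p<N. measure (x l \<omega>) (B l p))"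
    by (rule conditional) (use U in \<open>auto simp: B_def\<close>)
  moreover have "(\<Prod>l<n. \<Prod>p<N. measure (x l \<omega>) (B l p)) = measure (x j \<omega>) U * measure (x j \<omega>) V" if \<omega>: "\<omega> \<in> space \<Omega>" for \<omega>
  proof -
    have "measure (x l \<omega>) UNIV = 1" if "l < n" for l
    proof -
      have "prob_space (x l \<omega>)" "sets (x l \<omega>) = sets borel"
        using x_in[OF that \<omega>] by (auto simp: borel_probs_def)
      then show ?thesis
        using prob_space.prob_space[of "x l \<omega>"] sets_eq_imp_space_eq[of "x l \<omega>" borel] by simp
    qed
    then show ?thesis
      using prod_two_point[OF j i, of "\<lambda>l p. measure (x l \<omega>) (B l p)"] by (simp add: B B_UNIV)
  qed
  ultimately show "AE \<omega> in \<Omega>. real_cond_exp \<Omega> FX (indicator {\<omega> \<in> space \<Omega>. s j i \<omega> \<in> U \<and> s j i' \<omega> \<in> V}) \<omega>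
      = measure (x j \<omega>) U * measure (x j \<omega>) V"
    by auto
qed

lemma \<mu>_FX: "j < n \<Longrightarrow> \<mu> j \<in> borel_measurable FX"
  using measurable_compose[OF measurable_compose[OF xy_FX measurable_fst] mean_embedding_measurable] by simp

lemma \<mu>_measurable: "j < n \<Longrightarrow> \<mu> j \<in> borel_measurable \<Omega>"
  by (rule measurable_from_subalg[OF subalgebra_FX \<mu>_FX])

lemma y_measurable: "j < n \<Longrightarrow> y j \<in> borel_measurable \<Omega>"
proof -
  assume j: "j < n"
  have "(\<lambda>y. y) \<in> borel_measurable YM"
    by (intro measurable_restrict_space1) simp
  from measurable_compose[OF measurable_compose[OF xy_measurable[OF j] measurable_snd] this]
  show ?thesis
    by simp
qed

lemma \<mu>'_measurable: "j < n \<Longrightarrow> \<mu>' j \<in> borel_measurable \<Omega>"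
  unfolding empirical_embedding_def using measurable_compose[OF s_measurable Gs_measurable]
  by (intro borel_measurable_scaleR borel_measurable_const borel_measurable_sum) auto

lemma \<mu>'_in: "\<mu>' j \<omega> \<in> P"
  using N by (intro empirical_embedding_in) auto

lemma \<mu>_in: "j < n \<Longrightarrow> \<omega> \<in> space \<Omega> \<Longrightarrow> \<mu> j \<omega> \<in> P"
  by (auto simp: mean_embeddings_def x_in)

lemma P_norm_le: "m \<in> P \<Longrightarrow> norm m \<le> sqrt \<gamma>"
proof -
  assume "m \<in> P"
  then obtain z where z: "z \<in> borel_probs" and m: "m = mean_embedding G evG z"
    by (auto simp: mean_embeddings_def)
  interpret z: prob_space z
    using z by (simp add: borel_probs_def)
  have "norm m * norm m = (\<integral>s. Gs s \<bullet> m \<partial>z)"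
    using mean_embedding_inner[OF z, of m] by (simp add: m flip: power2_norm_eq_inner power2_eq_square)
  also have "\<dots> \<le> (\<integral>s. sqrt \<gamma> * norm m \<partial>z)"
  proof (rule integral_mono)
    show "integrable z (\<lambda>s. Gs s \<bullet> m)"
      using Gs_integrable[OF z] by simp
    show "Gs s \<bullet> m \<le> sqrt \<gamma> * norm m" for s
      using norm_cauchy_schwarz[of "Gs s" m] mult_right_mono[OF Gs_norm_le[of s], of "norm m"] by simp
  qed simp
  finally have "norm m * norm m \<le> sqrt \<gamma> * norm m"
    by (simp add: z.prob_space)
  moreover have "0 \<le> sqrt \<gamma>"
    using Gs_norm_le norm_ge_zero order_trans by blast
  ultimately show "norm m \<le> sqrt \<gamma>"
    by (cases "m = 0") auto
qed

text \<open>The second stage enters the risk bound only through this average of squares, whose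
  conditional mean is at most \<gamma>/N.\<close>

definition spread :: "'w \<Rightarrow> real" where
  "spread \<omega> = (\<Sum>j<n. (norm (\<mu>' j \<omega> - \<mu> j \<omega>))\<^sup>2) / real n"

lemma spread_nonneg: "0 \<le> spread \<omega>"
  by (simp add: spread_def sum_nonneg)

lemma square_deviation_integrable:
  assumes j: "j < n"
  shows "integrable \<Omega> (\<lambda>\<omega>. (norm (\<mu>' j \<omega> - \<mu> j \<omega>))\<^sup>2)"
proof (rule integrable_real_bounded)
  show "(\<lambda>\<omega>. (norm (\<mu>' j \<omega> - \<mu> j \<omega>))\<^sup>2) \<in> borel_measurable \<Omega>"
    using \<mu>'_measurable[OF j] \<mu>_measurable[OF j] by measurable
  fix \<omega> assume "\<omega> \<in> space \<Omega>"
  then have "norm (\<mu>' j \<omega> - \<mu> j \<omega>) \<le> sqrt \<gamma> + sqrt \<gamma>"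
    using P_norm_le[OF \<mu>'_in] P_norm_le[OF \<mu>_in[OF j]] by (intro norm_triangle_le_diff add_mono) auto
  then have "(norm (\<mu>' j \<omega> - \<mu> j \<omega>))\<^sup>2 \<le> (sqrt \<gamma> + sqrt \<gamma>)\<^sup>2"
    by (rule power_mono) simp
  then show "\<bar>(norm (\<mu>' j \<omega> - \<mu> j \<omega>))\<^sup>2\<bar> \<le> (sqrt \<gamma> + sqrt \<gamma>)\<^sup>2"
    by simp
qed

lemma spread_integrable: "integrable \<Omega> spread"
  unfolding spread_def[abs_def] by (intro integrable_divide_zero Bochner_Integration.integrable_sum square_deviation_integrable) auto

lemma spread_integral_le:
  assumes A: "A \<in> sets FX"
  shows "(\<integral>\<omega>. indicator A \<omega> * spread \<omega> \<partial>\<Omega>) \<le> \<gamma> / real N * measure \<Omega> A"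
proof -
  have A_\<Omega>: "A \<in> sets \<Omega>"
    using A subalgebra_FX by (auto simp: subalgebra_def)
  have int: "integrable \<Omega> (\<lambda>\<omega>. indicator A \<omega> * (norm (\<mu>' j \<omega> - \<mu> j \<omega>))\<^sup>2)" if "j < n" for j
    using integrable_mult_indicator[OF A_\<Omega> square_deviation_integrable[OF that]] by simp
  have le: "(\<integral>\<omega>. indicator A \<omega> * (norm (\<mu>' j \<omega> - \<mu> j \<omega>))\<^sup>2 \<partial>\<Omega>) \<le> \<gamma> / real N * measure \<Omega> A" if j: "j < n" for j
  proof -
    interpret c: conditional_sample \<Omega> FX "x j" "s j" N
      by (rule conditional_sample[OF j])
    show ?thesis
      unfolding empirical_embedding_def
      by (rule c.hilbert_average_variance[OF N A Gs_measurable Gs_norm _ \<mu>_FX[OF j]])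
         (simp add: mean_embedding_inner x_in j)
  qed
  have "(\<integral>\<omega>. indicator A \<omega> * spread \<omega> \<partial>\<Omega>)
      = (\<integral>\<omega>. (\<Sum>j<n. indicator A \<omega> * (norm (\<mu>' j \<omega> - \<mu> j \<omega>))\<^sup>2) / real n \<partial>\<Omega>)"
    by (simp add: spread_def sum_distrib_left)
  also have "\<dots> = (\<Sum>j<n. \<integral>\<omega>. indicator A \<omega> * (norm (\<mu>' j \<omega> - \<mu> j \<omega>))\<^sup>2 \<partial>\<Omega>) / real n"
    by (subst integral_divide_zero, subst Bochner_Integration.integral_sum) (auto intro: int)
  also have "\<dots> \<le> (\<Sum>j<n. \<gamma> / real N * measure \<Omega> A) / real n"
    using le by (intro divide_right_mono sum_mono) auto
  finally show ?thesis
    using n by simp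
qed

end

section \<open>The second-stage error\<close>

context first_stage_problem
begin

definition perturbation_const where
  "perturbation_const = 4 * sqrt (4 * A) * (M + 2 * sqrt a * bound_const)"

lemma perturbation_const_nonneg: "0 \<le> perturbation_const"
  using consts_nonneg A_ge_1 M_pos a_pos by (simp add: perturbation_const_def)

text \<open>Operator and data move by multiples of the average displacement V of the kernel
  sections. The stability bound is then linear plus quadratic in V, the quadratic part coming from
  the norm of the perturbed iterates.\<close>

lemma second_stage_error_le:
  assumes good: "good n \<delta> z" and \<delta>: "0 < \<delta>" "\<delta> \<le> 1"
    and \<Delta>: "1 < r \<Longrightarrow> 2 * a / sqrt (real n * \<delta>) \<le> lam powr r" and even: "1 < r \<Longrightarrow> even T"
    and x: "\<And>j. j < n \<Longrightarrow> (norm (x j))\<^sup>2 \<le> a"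
    and d: "\<And>j. j < n \<Longrightarrow> norm (x j - k (fst (z j))) \<le> d j"
  defines "V \<equiv> (\<Sum>j<n. d j) / real n"
  shows "norm (S (tail_average (landweber \<eta> (emp_cov n x) (emp_vec n x (\<lambda>j. snd (z j)))) T) - g)
    \<le> ln (24 / \<delta>) * (error_const * lam powr r * R
        + perturbation_const / sqrt lam * (V + 2 * sqrt a * V\<^sup>2 / lam))"
proof -
  define lg where "lg = ln (24 / \<delta>)"
  have lg: "1 \<le> lg"
    unfolding lg_def using \<delta> by (rule ln_ge_1)
  have z: "z \<in> space (samples n)" and comp: "comparison (cov n z) a \<eta> S lam (2 * A) T"
    using good by (auto simp: good_def)
  have zj: "z j \<in> space \<rho>" if "j < n" for j
    using z that by (auto simp: space_PiM)
  interpret c: comparison "cov n z" a \<eta> S lam "2 * A" T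
    by (rule comp)
  have V: "0 \<le> V"
    unfolding V_def using d by (intro divide_nonneg_nonneg sum_nonneg) (auto intro: order_trans[OF norm_ge_zero])
  define \<delta>A where "\<delta>A = 2 * sqrt a * V"
  define F where "F = lg * bound_const"
  define f where "f = landweber \<eta> (cov n z) (bvec n z)"
  define f' where "f' = landweber \<eta> (emp_cov n x) (emp_vec n x (\<lambda>j. snd (z j)))"
  have \<delta>A: "0 \<le> \<delta>A"
    using V a_pos by (simp add: \<delta>A_def)
  have F: "0 \<le> F"
    using lg consts_nonneg by (simp add: F_def)
  have cov: "norm (emp_cov n x u - cov n z u) \<le> \<delta>A * norm u" for u
    unfolding \<delta>A_def V_def using x d zj
    by (intro emp_cov_diff_le) (auto intro!: real_le_rsqrt k_bound fst_space)
  have vec: "norm (emp_vec n x (\<lambda>j. snd (z j)) - bvec n z) \<le> M * V"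
    unfolding V_def using snd_bound zj d by (intro emp_vec_diff_le) auto
  have pos: "positive_operator (emp_cov n x) a"
    using a_pos by (intro positive_operator_emp_cov x) auto
  define b where "b = 2 * sqrt (2 * (2 * A)) / sqrt lam * (M * V + \<delta>A * (F + (M * V + \<delta>A * F) / lam))"
  have b: "0 \<le> b"
    using V \<delta>A F A_ge_1 M_pos c.lam by (auto simp: b_def intro!: mult_nonneg_nonneg add_nonneg_nonneg divide_nonneg_pos)
  have "norm (S (f' t - f t)) \<le> b" if "t \<le> T" for t
    unfolding f_def f'_def b_def
    by (rule c.S_landweber_stability[OF pos cov \<delta>A vec _ that])
       (use first_stage_norm_le[OF good \<delta>] in \<open>simp add: F_def lg_def\<close>)
  then have "norm (S (tail_average f' T) - S (tail_average f T)) \<le> 2 * b"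
    using b by (intro tail_average_diff_le linear_S T_pos)
  moreover have "2 * b \<le> lg * (perturbation_const / sqrt lam * (V + 2 * sqrt a * V\<^sup>2 / lam))"
  proof -
    define \<kappa>1 where "\<kappa>1 = M + 2 * sqrt a * bound_const"
    \<comment> \<open>Since ln (24/\<delta>) \<ge> 1, the logarithm in the norm bound of the
      iterates can be factored out of both terms.\<close>
    have MV: "M * V + \<delta>A * F \<le> lg * \<kappa>1 * V"
      using lg mult_right_mono[OF lg, of "M * V"] V M_pos
      by (simp add: \<delta>A_def F_def \<kappa>1_def algebra_simps)
    have "M * V + \<delta>A * (F + (M * V + \<delta>A * F) / lam) = (M * V + \<delta>A * F) + \<delta>A * (M * V + \<delta>A * F) / lam"
      by (simp add: algebra_simps)
    also have "\<dots> \<le> lg * \<kappa>1 * V + \<delta>A * (lg * \<kappa>1 * V) / lam"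
      using MV \<delta>A c.lam by (intro add_mono divide_right_mono mult_left_mono) auto
    also have "\<dots> = lg * \<kappa>1 * (V + 2 * sqrt a * V\<^sup>2 / lam)"
      by (simp add: \<delta>A_def algebra_simps power2_eq_square)
    finally have "2 * b \<le> 2 * (2 * sqrt (2 * (2 * A)) / sqrt lam * (lg * \<kappa>1 * (V + 2 * sqrt a * V\<^sup>2 / lam)))"
      unfolding b_def using A_ge_1 c.lam by (intro mult_left_mono) auto
    then show ?thesis
      by (simp add: perturbation_const_def \<kappa>1_def mult_ac)
  qed
  moreover have "norm (S (tail_average f T) - g) \<le> lg * (error_const * lam powr r * R)"
    using first_stage_error_le[OF good \<delta> \<Delta> even] by (simp add: f_def lg_def mult_ac)
  moreover have "norm (S (tail_average f' T) - g)
      \<le> norm (S (tail_average f' T) - S (tail_average f T)) + norm (S (tail_average f T) - g)"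
    using norm_triangle_ineq[of "S (tail_average f' T) - S (tail_average f T)" "S (tail_average f T) - g"] by simp
  ultimately show ?thesis
    unfolding f'_def[symmetric] lg_def[symmetric] by (simp add: distrib_left)
qed

lemma landweber_risk_bounded:
  assumes x: "\<And>j. j < n \<Longrightarrow> (norm (x j))\<^sup>2 \<le> a" and y: "\<And>j. j < n \<Longrightarrow> \<bar>y j\<bar> \<le> M"
  shows "norm (S (tail_average (landweber \<eta> (emp_cov n x) (emp_vec n x y)) T) - g)
    \<le> sqrt a * (2 * (\<eta> * real T * (M * sqrt a))) + norm g"
proof -
  define f where "f = landweber \<eta> (emp_cov n x) (emp_vec n x y)"
  have pos: "positive_operator (emp_cov n x) a"
    using a_pos by (intro positive_operator_emp_cov x) auto
  have "norm (emp_vec n x y) \<le> (\<Sum>j<n. M * sqrt a) / real n"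
    unfolding emp_vec_def
  proof (rule norm_average_le)
    show "norm (y j *\<^sub>R x j) \<le> M * sqrt a" if "j < n" for j
      unfolding norm_scaleR using x[OF that] y[OF that] M_pos by (intro mult_mono real_le_rsqrt) auto
  qed
  also have "\<dots> \<le> M * sqrt a"
    using M_pos a_pos by simp
  finally have b: "norm (emp_vec n x y) \<le> M * sqrt a" .
  have "norm (f t) \<le> \<eta> * real T * (M * sqrt a)" if "t \<le> T" for t
  proof -
    have "norm (f t) \<le> \<eta> * real t * (M * sqrt a)"
      unfolding f_def by (rule landweber_norm_le_linear[OF pos \<eta> b])
    also have "\<dots> \<le> \<eta> * real T * (M * sqrt a)"
      using \<eta> M_pos a_pos that by (intro mult_right_mono mult_left_mono) auto
    finally show ?thesis .
  qed
  then have "norm (id (tail_average f T) - id (tail_average (\<lambda>_. 0) T)) \<le> 2 * (\<eta> * real T * (M * sqrt a))"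
    using \<eta> M_pos a_pos by (intro tail_average_diff_le T_pos) (auto intro: linearI)
  then have "norm (tail_average f T) \<le> 2 * (\<eta> * real T * (M * sqrt a))"
    by (simp add: tail_average_def)
  then have "norm (S (tail_average f T)) \<le> sqrt a * (2 * (\<eta> * real T * (M * sqrt a)))"
    using S_norm_le[of "tail_average f T"] a_pos by (meson mult_left_mono order_trans real_sqrt_ge_zero less_imp_le)
  then show ?thesis
    unfolding f_def[symmetric] using norm_triangle_ineq4[of "S (tail_average f T)" g] by simp
qed

end

text \<open>Both the average and its square are bounded by expressions affine in the same mean
  square W; for the square, Cauchy-Schwarz comes first and the exponent is 2 \<alpha> \<le>
  2.\<close>

lemma average_powr_le:
  fixes u :: "nat \<Rightarrow> real"
  assumes n: "0 < n" and u: "\<And>j. j < n \<Longrightarrow> 0 \<le> u j" and q: "0 < q" and \<alpha>: "0 < \<alpha>" "\<alpha> \<le> 1"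
  defines "W \<equiv> (\<Sum>j<n. (u j)\<^sup>2) / real n" and "v \<equiv> q powr (\<alpha> / 2)"
  shows "(\<Sum>j<n. u j powr \<alpha>) / real n \<le> v * (1 + W / q)"
    and "((\<Sum>j<n. u j powr \<alpha>) / real n)\<^sup>2 \<le> v\<^sup>2 * (1 + W / q)"
proof -
  have avg: "(\<Sum>j<n. c * (1 + (u j)\<^sup>2 / q)) / real n = c * (1 + W / q)" for c
  proof -
    have "(\<Sum>j<n. c * (1 + (u j)\<^sup>2 / q)) = c * (real n + (\<Sum>j<n. (u j)\<^sup>2) / q)"
      by (simp add: sum_distrib_left[symmetric] sum.distrib sum_divide_distrib)
    then show ?thesis
      using n q by (simp add: W_def field_simps)
  qed
  have "(\<Sum>j<n. u j powr \<alpha>) / real n \<le> (\<Sum>j<n. v * (1 + (u j)\<^sup>2 / q)) / real n"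
    unfolding v_def using u q \<alpha> by (intro divide_right_mono sum_mono powr_le_scaled_square) auto
  then show "(\<Sum>j<n. u j powr \<alpha>) / real n \<le> v * (1 + W / q)"
    by (simp only: avg)
  have "((\<Sum>j<n. u j powr \<alpha>) / real n)\<^sup>2 \<le> (\<Sum>j<n. (u j powr \<alpha>)\<^sup>2) / real n"
    using sum_squared_le_sum_of_squares[of "\<lambda>j. u j powr \<alpha>" "{..<n}"] n
    by (simp add: power2_eq_square field_simps)
  also have "\<dots> \<le> (\<Sum>j<n. v\<^sup>2 * (1 + (u j)\<^sup>2 / q)) / real n"
  proof (intro divide_right_mono sum_mono)
    fix j assume "j \<in> {..<n}"
    then have "(u j powr \<alpha>)\<^sup>2 = u j powr (2 * \<alpha>)" "v\<^sup>2 = q powr (2 * \<alpha> / 2)"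
      using u q by (auto simp: v_def power2_eq_square simp flip: powr_add)
    then show "(u j powr \<alpha>)\<^sup>2 \<le> v\<^sup>2 * (1 + (u j)\<^sup>2 / q)"
      using powr_le_scaled_square[of "u j" q "2 * \<alpha>"] u[of j] q \<alpha> \<open>j \<in> {..<n}\<close> by simp
  qed simp
  finally show "((\<Sum>j<n. u j powr \<alpha>) / real n)\<^sup>2 \<le> v\<^sup>2 * (1 + W / q)"
    by (simp only: avg)
qed

section \<open>The risk bound\<close>

text \<open>The factor 2 bounds the conditional mean of 1 + \<open>spread\<close> /
  (\<gamma>/N).\<close>

definition (in first_stage_problem) risk_const :: "real \<Rightarrow> real \<Rightarrow> real \<Rightarrow> real" where
  "risk_const L \<alpha> \<gamma> = error_const * R
     + 2 * perturbation_const * (L * \<gamma> powr (\<alpha> / 2) + 2 * sqrt a * L\<^sup>2 * \<gamma> powr \<alpha>)"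

locale two_stage_regression = first_stage_problem Q k a cls S \<rho> M g h r R \<eta> lam T c \<nu> A
    + d: two_stage G evG \<gamma> Y \<rho> n N \<Omega> x y s
  for Q :: "'h::{real_inner,complete_space,second_countable_topology} measure"
    and k :: "'h \<Rightarrow> 'k::{real_inner,complete_space,second_countable_topology}" and a :: real
    and cls :: "('h \<Rightarrow> real) \<Rightarrow> 'l::{real_inner,complete_space}" and S :: "'k \<Rightarrow> 'l"
    and \<rho> :: "('h \<times> real) measure" and M :: real and g h :: 'l and r R \<eta> lam :: real and T :: nat
    and c \<nu> A :: real
    and G :: "'x::topological_space \<Rightarrow> 'x \<Rightarrow> real" and evG :: "'h \<Rightarrow> 'x \<Rightarrow> real" and \<gamma> :: real
    and Y :: "real set" and n N :: nat and \<Omega> :: "'w measure"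
    and x :: "nat \<Rightarrow> 'w \<Rightarrow> 'x measure" and y :: "nat \<Rightarrow> 'w \<Rightarrow> real" and s :: "nat \<Rightarrow> nat \<Rightarrow> 'w \<Rightarrow> 'x" +
  fixes L \<alpha> \<delta> :: real
  assumes sets_Q: "sets Q = sets d.PM"
    and \<gamma>_pos: "0 < \<gamma>" and L: "0 < L" and \<alpha>: "0 < \<alpha>" "\<alpha> \<le> 1"
    and hoelder: "m1 \<in> d.P \<Longrightarrow> m2 \<in> d.P \<Longrightarrow> norm (k m1 - k m2) \<le> L * norm (m1 - m2) powr \<alpha>"
    and \<delta>: "0 < \<delta>" "\<delta> \<le> 1"
    and n_lam: "real n * lam powr (2 * r + \<nu>) = M\<^sup>2 / R\<^sup>2"
    and n_large: "16 * a * c * (A * lam) powr (- (1 + \<nu>)) \<le> \<delta> * real n"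
    and \<Delta>: "1 < r \<Longrightarrow> 2 * a / sqrt (real n * \<delta>) \<le> lam powr r" and even: "1 < r \<Longrightarrow> even T"
    and N_large: "real N powr (- \<alpha> / 2) \<le> lam powr (r + 1 / 2)"
begin

definition estimate :: "'w \<Rightarrow> 'k" where
  "estimate \<omega> = tail_average (landweber \<eta> (emp_cov n (\<lambda>j. k (d.\<mu>' j \<omega>)))
     (emp_vec n (\<lambda>j. k (d.\<mu>' j \<omega>)) (\<lambda>j. y j \<omega>))) T"

definition risk :: "'w \<Rightarrow> real" where
  "risk \<omega> = norm (S (estimate \<omega>) - g)"

lemma space_Q: "space Q = d.P"
  using sets_eq_imp_space_eq[OF sets_Q] by (simp add: space_restrict_space)

lemma DP_nth: "j < n \<Longrightarrow> d.DP \<omega> j = (d.\<mu> j \<omega>, y j \<omega>)"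
  by (simp add: first_stage_def)

lemma DP_space: "\<omega> \<in> space \<Omega> \<Longrightarrow> d.DP \<omega> \<in> space (samples n)"
  using measurable_space[OF d.DP_measurable] sets_eq_imp_space_eq[OF d.sets_samples] by simp

lemma y_bound:
  assumes "\<omega> \<in> space \<Omega>" "j < n"
  shows "\<bar>y j \<omega>\<bar> \<le> M"
proof -
  have "d.DP \<omega> j \<in> space \<rho>"
    using DP_space[OF assms(1)] assms(2) by (auto simp: space_PiM)
  then show ?thesis
    using snd_bound assms(2) by (fastforce simp: DP_nth)
qed

lemma risk_le:
  assumes \<omega>: "\<omega> \<in> space \<Omega>" and good: "good n \<delta> (d.DP \<omega>)"
  defines "K \<equiv> perturbation_const * (L * \<gamma> powr (\<alpha> / 2) + 2 * sqrt a * L\<^sup>2 * \<gamma> powr \<alpha>)"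
  shows "risk \<omega> \<le> ln (24 / \<delta>) * lam powr r * (error_const * R + K * (1 + d.spread \<omega> / (\<gamma> / real N)))"
proof -
  define u where "u j = norm (d.\<mu>' j \<omega> - d.\<mu> j \<omega>)" for j
  define V where "V = (\<Sum>j<n. L * u j powr \<alpha>) / real n"
  define q where "q = \<gamma> / real N"
  define v where "v = q powr (\<alpha> / 2)"
  define W where "W = 1 + d.spread \<omega> / q"
  have q: "0 < q"
    using \<gamma>_pos d.N by (simp add: q_def)
  have W: "1 \<le> W"
    using q d.spread_nonneg by (simp add: W_def)
  have n: "0 < n"
    by (rule d.n)
  have V_eq: "V = L * ((\<Sum>j<n. u j powr \<alpha>) / real n)"
    by (simp add: V_def sum_distrib_left)
  have spread: "d.spread \<omega> = (\<Sum>j<n. (u j)\<^sup>2) / real n"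
    by (simp add: d.spread_def u_def)
  have avg: "(\<Sum>j<n. u j powr \<alpha>) / real n \<le> v * W" "((\<Sum>j<n. u j powr \<alpha>) / real n)\<^sup>2 \<le> v\<^sup>2 * W"
    unfolding W_def spread v_def by (rule average_powr_le[OF n _ q \<alpha>]; simp add: u_def)+
  \<comment> \<open>Both powers of V are bounded linearly in \<open>W\<close>, so the conditional
    expectation of \<open>spread\<close> alone controls the risk.\<close>
  have V: "V \<le> L * (v * W)" "V\<^sup>2 \<le> L\<^sup>2 * (v\<^sup>2 * W)"
    unfolding V_eq power_mult_distrib using avg L by (auto simp del: times_divide_eq_right intro: mult_left_mono)
  have v: "v \<le> \<gamma> powr (\<alpha> / 2) * lam powr (r + 1 / 2)"
  proof -
    have "v = \<gamma> powr (\<alpha> / 2) * real N powr (- \<alpha> / 2)"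
      using \<gamma>_pos d.N by (simp add: v_def q_def powr_divide powr_minus field_simps)
    then show ?thesis
      using N_large by (simp add: mult_left_mono)
  qed
  have "0 \<le> v"
    by (simp add: v_def)
  have v1: "v / sqrt lam \<le> \<gamma> powr (\<alpha> / 2) * lam powr r"
  proof -
    have "v / sqrt lam \<le> \<gamma> powr (\<alpha> / 2) * lam powr (r + 1 / 2) / sqrt lam"
      using v lam by (intro divide_right_mono) auto
    also have "\<dots> = \<gamma> powr (\<alpha> / 2) * lam powr r"
      using lam by (simp add: powr_add powr_half_sqrt)
    finally show ?thesis .
  qed
  \<comment> \<open>The quadratic term has exponent 2 r - 1/2, which is at least r since r \<ge>
    1/2; with \<lambda> \<le> 1 it is no worse than the linear term.\<close>
  have v2: "v\<^sup>2 / lam / sqrt lam \<le> \<gamma> powr \<alpha> * lam powr r"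
  proof -
    have "v\<^sup>2 / lam / sqrt lam \<le> (\<gamma> powr (\<alpha> / 2) * lam powr (r + 1 / 2))\<^sup>2 / lam / sqrt lam"
      using v lam \<open>0 \<le> v\<close> by (intro divide_right_mono power_mono) auto
    also have "\<dots> = \<gamma> powr \<alpha> * (lam powr (2 * r + 1) / lam powr 1 / lam powr (1 / 2))"
    proof -
      have "(\<gamma> powr (\<alpha> / 2))\<^sup>2 = \<gamma> powr \<alpha>" "(lam powr (r + 1 / 2))\<^sup>2 = lam powr (2 * r + 1)"
        by (simp_all add: power2_eq_square flip: powr_add)
      then show ?thesis
        using lam by (simp add: power_mult_distrib powr_half_sqrt)
    qed
    also have "lam powr (2 * r + 1) / lam powr 1 / lam powr (1 / 2) = lam powr (2 * r - 1 / 2)"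
      by (simp only: powr_diff[symmetric]) (simp add: algebra_simps)
    also have "\<gamma> powr \<alpha> * lam powr (2 * r - 1 / 2) \<le> \<gamma> powr \<alpha> * lam powr r"
      using lam r by (intro mult_left_mono powr_mono') auto
    finally show ?thesis .
  qed
  have "risk \<omega> \<le> ln (24 / \<delta>) * (error_const * lam powr r * R
        + perturbation_const / sqrt lam * (V + 2 * sqrt a * V\<^sup>2 / lam))"
  proof -
    have "emp_vec n (\<lambda>j. k (d.\<mu>' j \<omega>)) (\<lambda>j. y j \<omega>) = emp_vec n (\<lambda>j. k (d.\<mu>' j \<omega>)) (\<lambda>j. snd (d.DP \<omega> j))"
      by (simp add: emp_vec_def DP_nth)
    then show ?thesis
      unfolding risk_def estimate_def V_def
      using d.\<mu>'_in hoelder d.\<mu>_in \<omega>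
      by (simp only:) (rule second_stage_error_le[OF good \<delta> \<Delta> even];
        auto simp: DP_nth u_def space_Q intro!: k_bound)
  qed
  also have "\<dots> \<le> ln (24 / \<delta>) * (lam powr r * (error_const * R + K * W))"
  proof (rule mult_left_mono)
    have "(V + 2 * sqrt a * V\<^sup>2 / lam) / sqrt lam = V / sqrt lam + 2 * sqrt a * (V\<^sup>2 / lam / sqrt lam)"
      by (simp add: add_divide_distrib)
    also have "\<dots> \<le> L * (v * W) / sqrt lam + 2 * sqrt a * (L\<^sup>2 * (v\<^sup>2 * W) / lam / sqrt lam)"
      using V lam a_pos by (intro add_mono mult_left_mono divide_right_mono) auto
    also have "\<dots> = (L * (v / sqrt lam) + 2 * sqrt a * L\<^sup>2 * (v\<^sup>2 / lam / sqrt lam)) * W"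
      by (simp add: algebra_simps)
    also have "\<dots> \<le> (L * (\<gamma> powr (\<alpha> / 2) * lam powr r) + 2 * sqrt a * L\<^sup>2 * (\<gamma> powr \<alpha> * lam powr r)) * W"
      using v1 v2 L a_pos W by (intro mult_right_mono add_mono mult_left_mono) auto
    finally have "perturbation_const * ((V + 2 * sqrt a * V\<^sup>2 / lam) / sqrt lam)
      \<le> perturbation_const * ((L * (\<gamma> powr (\<alpha> / 2) * lam powr r) + 2 * sqrt a * L\<^sup>2 * (\<gamma> powr \<alpha> * lam powr r)) * W)"
      using perturbation_const_nonneg by (intro mult_left_mono)
    also have "\<dots> = lam powr r * (K * W)"
      by (simp add: K_def algebra_simps)
    finally show "error_const * lam powr r * R + perturbation_const / sqrt lam * (V + 2 * sqrt a * V\<^sup>2 / lam)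
      \<le> lam powr r * (error_const * R + K * W)"
      by (simp add: algebra_simps add_divide_distrib)
    show "0 \<le> ln (24 / \<delta>)"
      using ln_ge_1[OF \<delta>] by simp
  qed
  finally show ?thesis
    by (simp add: W_def q_def mult_ac)
qed

lemma k_\<mu>'_measurable:
  assumes "j < n"
  shows "(\<lambda>\<omega>. k (d.\<mu>' j \<omega>)) \<in> borel_measurable \<Omega>"
proof -
  have 1: "d.\<mu>' j \<in> \<Omega> \<rightarrow>\<^sub>M d.PM"
    using d.\<mu>'_in d.\<mu>'_measurable[OF assms] by (intro measurable_restrict_space2) auto
  have 2: "k \<in> borel_measurable d.PM"
    using k_measurable by (simp cong: measurable_cong_sets add: sets_Q)
  show ?thesis
    by (rule measurable_compose[OF 1 2])
qed

lemma risk_integrable: "integrable \<Omega> risk"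
proof (rule d.integrable_real_bounded)
  have [measurable]: "estimate \<in> borel_measurable \<Omega>"
    unfolding estimate_def[abs_def] tail_average_def
    by (intro borel_measurable_scaleR borel_measurable_const borel_measurable_sum borel_measurable_landweber
        k_\<mu>'_measurable d.y_measurable)
  have "continuous_on UNIV (\<lambda>f. norm (S f - g))"
    by (intro continuous_intros linear_continuous_on bounded_linear_S)
  then have [measurable]: "(\<lambda>f. norm (S f - g)) \<in> borel_measurable borel"
    by (rule borel_measurable_continuous_onI)
  show "risk \<in> borel_measurable \<Omega>"
    unfolding risk_def[abs_def] by measurable
  show "\<bar>risk \<omega>\<bar> \<le> sqrt a * (2 * (\<eta> * real T * (M * sqrt a))) + norm g" if "\<omega> \<in> space \<Omega>" for \<omega>
    unfolding risk_def estimate_def abs_norm_cancel using y_bound[OF that] d.\<mu>'_in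
    by (intro landweber_risk_bounded) (auto intro!: k_bound simp: space_Q)
qed

text \<open>The conditional expectation is tested on sets contained in the good event, where the
  pointwise bound applies. The good event is determined by the first-stage embeddings, so it belongs
  to the \<sigma>-algebra that is conditioned on.\<close>

lemma risk_bound:
  "1 - \<delta> \<le> measure \<Omega> {\<omega> \<in> space \<Omega>. real_cond_exp \<Omega> d.FP risk \<omega> \<le> ln (24 / \<delta>) * lam powr r * risk_const L \<alpha> \<gamma>}"
proof -
  obtain E where E: "E \<in> sets (samples n)" "1 - \<delta> \<le> measure (samples n) E" "\<And>z. z \<in> E \<Longrightarrow> good n \<delta> z"
    using good_event[OF d.n \<delta> n_lam n_large] by blast
  define E' where "E' = d.DP -` E \<inter> space \<Omega>"
  define B where "B = ln (24 / \<delta>) * lam powr r"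
  define K where "K = perturbation_const * (L * \<gamma> powr (\<alpha> / 2) + 2 * sqrt a * L\<^sup>2 * \<gamma> powr \<alpha>)"
  define q where "q = \<gamma> / real N"
  have q: "0 < q"
    using \<gamma>_pos d.N by (simp add: q_def)
  have K: "0 \<le> K"
    using perturbation_const_nonneg L a_pos by (simp add: K_def)
  have B: "0 \<le> B"
    using ln_ge_1[OF \<delta>] by (simp add: B_def)
  have E'_FP: "E' \<in> sets d.FP"
    using measurable_sets[OF d.DP_FP, of E] E(1) by (simp add: E'_def d.sets_samples space_generated_by)
  interpret fs: finite_measure_subalgebra \<Omega> d.FP
    by unfold_locales (rule d.subalgebra_FP)
  have le: "(\<integral>\<omega>. indicator Z \<omega> * risk \<omega> \<partial>\<Omega>) \<le> B * risk_const L \<alpha> \<gamma> * measure \<Omega> Z"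
    if Z: "Z \<in> sets d.FP" "Z \<subseteq> E'" for Z
  proof -
    have Z_\<Omega>: "Z \<in> sets \<Omega>"
      using Z d.subalgebra_FP by (auto simp: subalgebra_def)
    have Z_FX: "Z \<in> sets d.FX"
      using Z d.sets_FP_subset by blast
    have int1: "integrable \<Omega> (\<lambda>\<omega>. indicator Z \<omega> * risk \<omega>)"
      using integrable_mult_indicator[OF Z_\<Omega> risk_integrable] by simp
    have int2: "integrable \<Omega> (\<lambda>\<omega>. indicator Z \<omega> * d.spread \<omega>)"
      using integrable_mult_indicator[OF Z_\<Omega> d.spread_integrable] by simp
    have int3: "integrable \<Omega> (indicator Z :: 'w \<Rightarrow> real)"
      using Z_\<Omega> d.emeasure_eq_measure by (intro integrable_real_indicator) auto
    have "(\<integral>\<omega>. indicator Z \<omega> * risk \<omega> \<partial>\<Omega>)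
      \<le> (\<integral>\<omega>. B * (error_const * R + K) * indicator Z \<omega> + B * K / q * (indicator Z \<omega> * d.spread \<omega>) \<partial>\<Omega>)"
    proof (rule integral_mono[OF int1])
      show "integrable \<Omega> (\<lambda>\<omega>. B * (error_const * R + K) * indicator Z \<omega> + B * K / q * (indicator Z \<omega> * d.spread \<omega>))"
        using int2 int3 by auto
      fix \<omega> assume \<omega>: "\<omega> \<in> space \<Omega>"
      show "indicator Z \<omega> * risk \<omega>
        \<le> B * (error_const * R + K) * indicator Z \<omega> + B * K / q * (indicator Z \<omega> * d.spread \<omega>)"
      proof (cases "\<omega> \<in> Z")
        case True
        then have "good n \<delta> (d.DP \<omega>)"
          using Z(2) by (auto simp: E'_def intro: E(3))
        then have "risk \<omega> \<le> B * (error_const * R + K * (1 + d.spread \<omega> / q))"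
          unfolding B_def K_def q_def by (rule risk_le[OF \<omega>])
        then show ?thesis
          using True by (simp add: algebra_simps)
      qed simp
    qed
    also have "\<dots> = B * (error_const * R + K) * measure \<Omega> Z + B * K / q * (\<integral>\<omega>. indicator Z \<omega> * d.spread \<omega> \<partial>\<Omega>)"
      using int2 int3 sets.sets_into_space[OF Z_\<Omega>] by (simp add: Int_absorb2)
    also have "\<dots> \<le> B * (error_const * R + K) * measure \<Omega> Z + B * K / q * (q * measure \<Omega> Z)"
      using d.spread_integral_le[OF Z_FX] B K q unfolding q_def[symmetric] by (intro add_left_mono mult_left_mono) auto
    also have "\<dots> = B * risk_const L \<alpha> \<gamma> * measure \<Omega> Z"
    proof -
      have "risk_const L \<alpha> \<gamma> = error_const * R + 2 * K"
        by (simp add: risk_const_def K_def)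
      then show ?thesis
        using q by (simp add: algebra_simps)
    qed
    finally show ?thesis .
  qed
  have "AE \<omega> in \<Omega>. \<omega> \<in> E' \<longrightarrow> real_cond_exp \<Omega> d.FP risk \<omega> \<le> B * risk_const L \<alpha> \<gamma>"
    by (rule fs.real_cond_exp_le_on[OF risk_integrable E'_FP le])
  moreover have "E' \<subseteq> space \<Omega>"
    by (auto simp: E'_def)
  moreover have "{\<omega> \<in> space \<Omega>. real_cond_exp \<Omega> d.FP risk \<omega> \<le> B * risk_const L \<alpha> \<gamma>} \<in> sets \<Omega>"
    by measurable
  ultimately have "measure \<Omega> E' \<le> measure \<Omega> {\<omega> \<in> space \<Omega>. real_cond_exp \<Omega> d.FP risk \<omega> \<le> B * risk_const L \<alpha> \<gamma>}"
    by (intro d.finite_measure_mono_AE) auto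
  moreover have "measure \<Omega> E' = measure (samples n) E"
    unfolding E'_def by (rule d.measure_DP[OF E(1)])
  ultimately show ?thesis
    using E(2) by (simp add: B_def)
qed

end

section \<open>The rate\<close>

lemma eventually_powr_le_linear:
  fixes B C \<beta> \<delta> :: real
  assumes "\<beta> < 1" "0 < B" "0 < \<delta>"
  shows "\<forall>\<^sub>F n in sequentially. C * (B * real n) powr \<beta> \<le> \<delta> * real n"
proof -
  have "(\<lambda>n. real n powr (\<beta> - 1)) \<longlonglongrightarrow> 0"
    using assms by (intro tendsto_neg_powr filterlim_real_sequentially) auto
  then have "(\<lambda>n. C * B powr \<beta> * real n powr (\<beta> - 1)) \<longlonglongrightarrow> C * B powr \<beta> * 0"
    by (intro tendsto_intros)
  then have "\<forall>\<^sub>F n in sequentially. C * B powr \<beta> * real n powr (\<beta> - 1) < \<delta>"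
    using assms by (intro order_tendstoD(2)[where y = "C * B powr \<beta> * 0"]) auto
  with eventually_gt_at_top[of "0::nat"] show ?thesis
  proof eventually_elim
    case (elim n)
    then have "C * B powr \<beta> * real n powr (\<beta> - 1) * real n \<le> \<delta> * real n"
      by (intro mult_right_mono) auto
    moreover have "real n powr (\<beta> - 1) * real n = real n powr \<beta>"
      using elim by (simp add: powr_diff)
    ultimately show ?case
      using assms elim by (simp add: powr_mult mult.assoc)
  qed
qed

text \<open>n cancels from the hypothesis and leaves an upper bound for ln (24/\<delta>), which
  keeps \<delta> above a constant.\<close>

lemma confidence_lower_bound:
  fixes B q \<delta> n :: real
  assumes "0 < \<delta>" "0 < B" "0 < q" "0 < n" and n: "q * (ln (24 / \<delta>))\<^sup>2 * (B * n) \<le> n"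
  shows "24 * exp (- sqrt (1 / (q * B))) \<le> \<delta>"
proof -
  have "(ln (24 / \<delta>))\<^sup>2 \<le> 1 / (q * B)"
    using assms by (simp add: field_simps)
  then have "ln (24 / \<delta>) \<le> sqrt (1 / (q * B))"
    by (rule real_le_rsqrt)
  then have "24 / \<delta> \<le> exp (sqrt (1 / (q * B)))"
    using assms by (subst ln_le_cancel_iff[symmetric]) auto
  then show ?thesis
    using assms by (simp add: exp_minus field_simps)
qed

text \<open>Used for the map from embeddings to kernel sections: continuity provides its Borel
  measurability.\<close>

lemma continuous_on_hoelder:
  fixes f :: "'a::real_normed_vector \<Rightarrow> 'b::real_normed_vector"
  assumes \<alpha>: "0 < \<alpha>" and f: "\<And>x y. x \<in> P \<Longrightarrow> y \<in> P \<Longrightarrow> norm (f x - f y) \<le> L * norm (x - y) powr \<alpha>"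
  shows "continuous_on P f"
  unfolding continuous_on_def
proof
  fix x assume x: "x \<in> P"
  have "((\<lambda>y. norm (y - x)) \<longlongrightarrow> norm (x - x)) (at x within P)"
    by (intro tendsto_intros)
  from tendsto_powr'[OF this tendsto_const] have "((\<lambda>y. norm (y - x) powr \<alpha>) \<longlongrightarrow> norm (x - x) powr \<alpha>) (at x within P)"
    using \<alpha> by simp
  then have lim: "((\<lambda>y. L * norm (y - x) powr \<alpha>) \<longlongrightarrow> 0) (at x within P)"
    using tendsto_mult_left by fastforce
  have "\<forall>\<^sub>F y in at x within P. norm (f y - f x) \<le> L * norm (y - x) powr \<alpha>"
    unfolding eventually_at_filter using f x by (intro always_eventually) blast
  then have "((\<lambda>y. f y - f x) \<longlongrightarrow> 0) (at x within P)"
    using lim by (rule Lim_null_comparison)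
  then show "(f \<longlongrightarrow> f x) (at x within P)"
    by (simp add: LIM_zero_iff)
qed

theorem corollaryB13:
  fixes G :: "'x::topological_space \<Rightarrow> 'x \<Rightarrow> real"
    and evG :: "'h::{real_inner,complete_space,second_countable_topology} \<Rightarrow> 'x \<Rightarrow> real"
    and K :: "'h \<Rightarrow> 'h \<Rightarrow> real"
    and evK :: "'k::{real_inner,complete_space,second_countable_topology} \<Rightarrow> 'h \<Rightarrow> real"
    and P :: "'h set" and Ks :: "'h \<Rightarrow> 'k"
    and Y :: "real set" and M :: real
    and \<rho> :: "('h \<times> real) measure" and \<rho>\<^sub>\<mu> :: "'h measure"
    and cond :: "'h \<Rightarrow> real measure" and f\<rho> :: "'h \<Rightarrow> real"
    and cls :: "('h \<Rightarrow> real) \<Rightarrow> 'l::{real_inner,complete_space}"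
    and S\<^sub>K :: "'k \<Rightarrow> 'l" and T\<^sub>K :: "'k \<Rightarrow> 'k" and L\<^sub>K :: "'l \<Rightarrow> 'l" and h\<rho> :: 'l
    and \<kappa> L \<alpha> r R \<nu> c\<^sub>\<nu> :: real
  assumes compact: "compact (UNIV :: 'x set)"
    and G: "mercer_kernel G" "is_rkhs UNIV G evG"
    and P: "P = mean_embeddings G evG"
    and K: "psd_kernel_on P K" "is_rkhs P K evK"
    and Ks: "Ks = kernel_section P K evK"
    and Y: "M > 0" "Y \<subseteq> {-M..M}"
    and \<rho>: "prob_space \<rho>" "sets \<rho> = sets (restrict_space borel P \<Otimes>\<^sub>M restrict_space borel Y)"
    and \<rho>\<^sub>\<mu>: "\<rho>\<^sub>\<mu> = distr \<rho> (restrict_space borel P) fst"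
    and cond: "conditional_law (restrict_space borel P) (restrict_space borel Y) \<rho> cond"
    and f\<rho>: "f\<rho> = (\<lambda>m. \<integral>y. y \<partial>cond m)"
    and cls: "is_L2 \<rho>\<^sub>\<mu> cls"
    and S\<^sub>K: "S\<^sub>K = (\<lambda>f. cls (evK f))"
    and T\<^sub>K: "T\<^sub>K = adjoint S\<^sub>K \<circ> S\<^sub>K"
    and L\<^sub>K: "L\<^sub>K = S\<^sub>K \<circ> adjoint S\<^sub>K"
    and i: "bdd_above (range (\<lambda>s. G s s))"
           "bdd_above ((\<lambda>m. K m m) ` P)" "\<kappa>\<^sup>2 = (SUP m\<in>P. K m m)"
    and ii: "0 < \<alpha>" "\<alpha> \<le> 1" "0 < L"
            "\<forall>m1\<in>P. \<forall>m2\<in>P. norm (Ks m1 - Ks m2) \<le> L * norm (m1 - m2) powr \<alpha>"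
    and iii: "1/2 \<le> r" "0 < R" "cls f\<rho> = op_powr L\<^sub>K r h\<rho>" "norm h\<rho> \<le> R"
    and iv: "0 < \<nu>" "\<nu> \<le> 1" "\<forall>lam>0. effective_dim L\<^sub>K lam \<le> c\<^sub>\<nu> * lam powr (-\<nu>)"
  shows "\<exists>C. \<forall>\<delta>. 0 < \<delta> \<and> \<delta> \<le> 1 \<longrightarrow> (\<exists>n\<^sub>0. \<forall>n\<ge>n\<^sub>0. \<forall>N T. \<forall>\<eta> lam.
    0 < \<eta> \<longrightarrow> \<eta> < 1 / \<kappa>\<^sup>2 \<longrightarrow> (1 < r \<longrightarrow> even T) \<longrightarrow>
    lam = 1 / (\<eta> * real T) \<longrightarrow>
    real n \<ge> 32 * \<kappa>\<^sup>2 * ln (4 / \<delta>) / lam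
              * ln (exp 1 * effective_dim L\<^sub>K lam * (1 + lam / onorm T\<^sub>K)) \<longrightarrow>
    real n \<ge> 64 * exp 1 * \<kappa>\<^sup>2 * (ln (24 / \<delta>))\<^sup>2 * (\<eta> * real T) powr (1 + \<nu>) \<longrightarrow>
    \<eta> * real T = (R\<^sup>2 / M\<^sup>2 * real n) powr (1 / (2 * r + \<nu>)) \<longrightarrow>
    real N \<ge> ln (real n) powr (2 / \<alpha>)
              * (R\<^sup>2 * real n / M\<^sup>2) powr ((2 * r + 1) / (\<alpha> * (2 * r + \<nu>))) \<longrightarrow>
    (\<forall>(\<Omega> :: 'w measure) x y s. two_stage_sample G evG Y \<rho> n N \<Omega> x y s \<longrightarrow>
      (let fbar = (\<lambda>\<omega>. tail_average
             (grad_descent evK Ks \<eta> n (\<lambda>j. empirical_embedding G evG N (\<lambda>i. s j i \<omega>)) (\<lambda>j. y j \<omega>)) T);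
           D = first_stage n (\<lambda>j \<omega>. mean_embedding G evG (x j \<omega>)) y;
           \<D> = PiM {..<n} (\<lambda>_. restrict_space borel P \<Otimes>\<^sub>M restrict_space borel Y);
           err = real_cond_exp \<Omega> (generated_by \<Omega> D \<D>) (\<lambda>\<omega>. norm (S\<^sub>K (fbar \<omega>) - cls f\<rho>))
       in measure \<Omega> {\<omega> \<in> space \<Omega>.
            err \<omega> \<le> C * ln (24 / \<delta>) * R * (M\<^sup>2 / (R\<^sup>2 * real n)) powr (r / (2 * r + \<nu>))}
          \<ge> 1 - \<delta>)))"
proof (cases "\<kappa> = 0")
  \<comment> \<open>Here 1/\<kappa>^2 is 0 by convention, so no admissible step size exists.\<close>
  case True
  then show ?thesis
    by (intro exI[of _ 0] allI impI) simp
next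
  case False
  define a where "a = \<kappa>\<^sup>2"
  have a: "0 < a"
    using False by (simp add: a_def)
  obtain \<gamma>0 where \<gamma>0: "\<And>s. G s s \<le> \<gamma>0"
    using i(1) by (auto simp: bdd_above_def)
  \<comment> \<open>A strictly positive bound, since the scale \<gamma>/N appears as a
    divisor.\<close>
  define \<gamma> where "\<gamma> = \<bar>\<gamma>0\<bar> + 1"
  have \<gamma>: "0 < \<gamma>" "\<And>s. G s s \<le> \<gamma>"
    unfolding \<gamma>_def using order_trans[OF \<gamma>0, of "\<bar>\<gamma>0\<bar> + 1"] by simp_all
  \<comment> \<open>Enlarging the capacity constant makes it positive and large enough for the bound
    on single summands in the noise estimate.\<close>
  define c where "c = \<bar>c\<^sub>\<nu>\<bar> + 1 + 4 * a * R\<^sup>2 / M\<^sup>2"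
  have c: "0 < c" "c\<^sub>\<nu> \<le> c" "4 * a * R\<^sup>2 / M\<^sup>2 \<le> c"
  proof -
    have "0 \<le> 4 * a * R\<^sup>2 / M\<^sup>2"
      using a by simp
    then show "0 < c" "c\<^sub>\<nu> \<le> c" "4 * a * R\<^sup>2 / M\<^sup>2 \<le> c"
      by (auto simp: c_def)
  qed
  define B where "B = R\<^sup>2 / M\<^sup>2"
  have B: "0 < B"
    using iii Y by (simp add: B_def)
  define w where "w = 64 * exp 1 * a"
  have w: "0 < w"
    using a by (simp add: w_def)
  \<comment> \<open>For \<open>r = 1 / 2\<close> the number \<open>n \<lambda>\<^sup>1\<^sup>+\<^sup>\<nu>\<close> is a constant and does not become large with \<open>n\<close>.  There the
    second lower bound on \<open>n\<close> forces \<open>\<delta> \<ge> \<delta>\<^sub>0\<close>, and the regularisation is enlarged by the factor \<open>A\<close>.\<close>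
  define \<delta>\<^sub>0 where "\<delta>\<^sub>0 = 24 * exp (- sqrt (1 / (w * B)))"
  define A where "A = (if r = 1 / 2 then max 1 (16 * a * c * B / \<delta>\<^sub>0) else 1)"
  have A: "1 \<le> A"
    by (simp add: A_def)
  let ?C = "first_stage_problem.risk_const a M r R c A L \<alpha> \<gamma> / R"

  note PK = P[symmetric]
  define Q where "Q = distr \<rho> (restrict_space borel P) fst"
  interpret \<rho>: prob_space \<rho>
    by (rule \<rho>)
  note [measurable_cong] = \<rho>(2)
  have fst_PM: "fst \<in> \<rho> \<rightarrow>\<^sub>M restrict_space borel P"
    by measurable
  have sets_Q: "sets Q = sets (restrict_space borel P)" and space_Q: "space Q = P"
    by (simp_all add: Q_def space_restrict_space)
  have prob_Q: "prob_space Q"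
    unfolding Q_def by (rule \<rho>.prob_space_distr[OF fst_PM])
  have Q_cls: "is_L2 Q cls"
    using cls by (simp add: Q_def \<rho>\<^sub>\<mu>)
  have Ks_val: "evK f m = f \<bullet> Ks m" if "m \<in> P" for f m
    unfolding Ks using K(2) that by (rule kernel_section_reproducing)
  have Ks_norm: "(norm (Ks m))\<^sup>2 \<le> a" if "m \<in> P" for m
  proof -
    have "(norm (Ks m))\<^sup>2 = K m m"
      unfolding Ks using K(2) that by (rule kernel_section_norm)
    also have "\<dots> \<le> a"
      unfolding a_def i(3) using that i(2) by (rule cSUP_upper)
    finally show ?thesis .
  qed
  have "continuous_on P Ks"
    using ii by (intro continuous_on_hoelder) auto
  then have "Ks \<in> borel_measurable (restrict_space borel P)"
    by (rule borel_measurable_continuous_on_restrict)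
  then have Ks_Q: "Ks \<in> borel_measurable Q"
    by (simp cong: measurable_cong_sets add: sets_Q)
  have sq: "square_integrable Q (\<lambda>m. f \<bullet> Ks m)" for f
  proof -
    interpret Q: prob_space Q
      by (rule prob_Q)
    have m: "(\<lambda>m. f \<bullet> Ks m) \<in> borel_measurable Q"
      using Ks_Q by measurable
    moreover have "integrable Q (\<lambda>m. (f \<bullet> Ks m)\<^sup>2)"
    proof (rule Q.integrable_real_bounded)
      show "\<bar>(f \<bullet> Ks m)\<^sup>2\<bar> \<le> (norm f)\<^sup>2 * a" if "m \<in> space Q" for m
      proof -
        have "(f \<bullet> Ks m)\<^sup>2 \<le> (norm f * norm (Ks m))\<^sup>2"
          using Cauchy_Schwarz_ineq2[of f "Ks m"] by (rule power2_le_iff_abs_le[THEN iffD2, rotated]) simp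
        also have "\<dots> \<le> (norm f)\<^sup>2 * a"
          using Ks_norm[of m] that by (simp add: space_Q power_mult_distrib mult_left_mono)
        finally show ?thesis
          by simp
      qed
    qed (use m in measurable)
    ultimately show ?thesis
      by (simp add: square_integrable_def)
  qed
  have S_eq: "S\<^sub>K f = cls (\<lambda>m. f \<bullet> Ks m)" for f
  proof -
    have eq: "evK f m = f \<bullet> Ks m" if "m \<in> space Q" for m
      using Ks_val that by (simp add: space_Q)
    have "square_integrable Q (evK f)"
      using sq[of f] unfolding square_integrable_def
      by (simp cong: measurable_cong Bochner_Integration.integrable_cong add: eq)
    then show ?thesis
      unfolding S\<^sub>K using eq by (intro is_L2_cong[OF Q_cls _ sq])
  qed
  have pop: "population Q Ks a cls S\<^sub>K"
    by (intro population.intro population_axioms.intro prob_Q Ks_Q Ks_norm Q_cls S_eq) (simp add: space_Q)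
  interpret population Q Ks a cls S\<^sub>K
    by (rule pop)
  have L0: "L0 = L\<^sub>K"
    by (simp add: L0_def L\<^sub>K)
  have f\<rho>_meas: "f\<rho> \<in> borel_measurable Q"
    unfolding f\<rho> Q_def using \<rho> cond Y(2) by (rule regression_function_measurable)
  have f\<rho>_bound: "\<bar>f\<rho> m\<bar> \<le> M" if "m \<in> space Q" for m
    using regression_function_bound[OF \<rho> cond Y(2)] that by (simp add: f\<rho> Q_def)
  have sq_f\<rho>: "square_integrable Q f\<rho>"
    unfolding square_integrable_def
  proof
    show "integrable Q (\<lambda>m. (f\<rho> m)\<^sup>2)"
      using f\<rho>_meas power_mono[OF f\<rho>_bound, of _ 2] by (intro integrable_real_bounded[where B = "M\<^sup>2"]) auto
  qed (rule f\<rho>_meas)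
  have space_\<rho>: "space \<rho> = P \<times> Y"
    using sets_eq_imp_space_eq[OF \<rho>(2)] by (simp add: space_pair_measure space_restrict_space)
  have reg: "regression Q Ks a cls S\<^sub>K \<rho> M (cls f\<rho>)"
  proof (intro regression.intro pop regression_axioms.intro)
    show "prob_space \<rho>"
      by (rule \<rho>)
    show "fst \<in> \<rho> \<rightarrow>\<^sub>M Q"
      using fst_PM by (simp cong: measurable_cong_sets add: sets_Q)
    show "distr \<rho> Q fst = Q"
      by (subst (2) Q_def) (intro distr_cong sets_Q, auto)
    have "snd \<in> \<rho> \<rightarrow>\<^sub>M restrict_space borel Y"
      by measurable
    then show "snd \<in> borel_measurable \<rho>"
      by (simp add: measurable_restrict_space2_iff)
    show "\<bar>snd z\<bar> \<le> M" if "z \<in> space \<rho>" for z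
      using that Y by (auto simp: space_\<rho> subset_eq abs_le_iff minus_le_iff)
    fix f
    have "cls f\<rho> \<bullet> S\<^sub>K f = (\<integral>m. f\<rho> m * (f \<bullet> Ks m) \<partial>Q)"
      unfolding S_eq by (rule is_L2_inner[OF Q_cls sq_f\<rho> sq])
    also have "\<dots> = (\<integral>z. snd z * (f \<bullet> Ks (fst z)) \<partial>\<rho>)"
      unfolding f\<rho> Q_def
    proof (rule regression_function_integral[OF \<rho> cond Y(2), symmetric])
      show "(\<lambda>m. f \<bullet> Ks m) \<in> borel_measurable (distr \<rho> (restrict_space borel P) fst)"
        using sq by (simp add: square_integrable_def Q_def)
      show "\<bar>f \<bullet> Ks m\<bar> \<le> norm f * sqrt a" if "m \<in> space (distr \<rho> (restrict_space borel P) fst)" for m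
      proof -
        have "norm (Ks m) \<le> sqrt a"
          using Ks_norm[of m] that by (intro real_le_rsqrt) (simp add: space_restrict_space)
        then show ?thesis
          using Cauchy_Schwarz_ineq2[of f "Ks m"] mult_left_mono[of "norm (Ks m)" "sqrt a" "norm f"] by simp
      qed
    qed
    finally show "cls f\<rho> \<bullet> S\<^sub>K f = (\<integral>z. snd z * (f \<bullet> Ks (fst z)) \<partial>\<rho>)" .
  qed
  have capacity: "(\<integral>m. (norm (inv_sqrt l (Ks m)))\<^sup>2 \<partial>Q) \<le> c * l powr (- \<nu>)" if "0 < l" for l
  proof -
    have "(\<integral>m. (norm (inv_sqrt l (Ks m)))\<^sup>2 \<partial>Q) \<le> effective_dim L\<^sub>K l"
      using integral_inv_sqrt_le_effective_dim[OF that] by (simp add: L0)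
    also have "\<dots> \<le> c\<^sub>\<nu> * l powr (- \<nu>)"
      using iv that by blast
    also have "\<dots> \<le> c * l powr (- \<nu>)"
      using c by (intro mult_right_mono) auto
    finally show ?thesis .
  qed
  have D: "0 < 2 * r + \<nu>"
    using iii iv by simp

  \<comment> \<open>The conditions on n: \<lambda> \<le> 1, then N \<ge> 2, then the comparison
    event for r > 1/2, then the operator norm deviation below \<lambda>^r. Both powers of n in the
    last two have exponent below 1.\<close>
  define ok where "ok \<delta> n \<longleftrightarrow> 1 \<le> B * real n \<and> 2 \<le> ln (real n)
    \<and> (1 / 2 < r \<longrightarrow> 16 * a * c * (B * real n) powr ((1 + \<nu>) / (2 * r + \<nu>)) \<le> \<delta> * real n)
    \<and> 4 * a\<^sup>2 * (B * real n) powr (2 * r / (2 * r + \<nu>)) \<le> \<delta> * real n" for \<delta> n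
  show ?thesis
    unfolding eventually_sequentially[symmetric] Let_def
  proof (intro exI[of _ ?C] allI impI, elim conjE, rule eventually_mono[rotated], intro allI impI)
    fix \<delta> \<eta> lam :: real and n N T :: nat and \<Omega> :: "'w measure" and x y s
    assume \<delta>: "0 < \<delta>" "\<delta> \<le> 1" and n: "ok \<delta> n" and \<eta>: "0 < \<eta>" "\<eta> < 1 / \<kappa>\<^sup>2" and even: "1 < r \<longrightarrow> even T"
      and lam: "lam = 1 / (\<eta> * real T)"
      and n_large: "64 * exp 1 * \<kappa>\<^sup>2 * (ln (24 / \<delta>))\<^sup>2 * (\<eta> * real T) powr (1 + \<nu>) \<le> real n"
      and \<eta>T: "\<eta> * real T = (R\<^sup>2 / M\<^sup>2 * real n) powr (1 / (2 * r + \<nu>))"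
      and N: "ln (real n) powr (2 / \<alpha>) * (R\<^sup>2 * real n / M\<^sup>2) powr ((2 * r + 1) / (\<alpha> * (2 * r + \<nu>))) \<le> real N"
      and sample: "two_stage_sample G evG Y \<rho> n N \<Omega> x y s"
    define X where "X = B * real n"
    have X: "1 \<le> X" and ln_n: "2 \<le> ln (real n)"
      and X_r: "1 / 2 < r \<Longrightarrow> 16 * a * c * X powr ((1 + \<nu>) / (2 * r + \<nu>)) \<le> \<delta> * real n"
      and X_\<Delta>: "4 * a\<^sup>2 * X powr (2 * r / (2 * r + \<nu>)) \<le> \<delta> * real n"
      using n by (auto simp: ok_def X_def)
    have n_pos: "0 < n"
      using X by (cases "n = 0") (auto simp: X_def)
    have \<eta>T_X: "\<eta> * real T = X powr (1 / (2 * r + \<nu>))"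
      using \<eta>T by (simp add: X_def B_def)
    have lam_powr: "lam powr p = X powr (- p / (2 * r + \<nu>))" for p
      by (simp add: lam \<eta>T_X powr_powr powr_minus powr_divide inverse_eq_divide)
    have lam_pos: "0 < lam"
      using X by (simp add: lam \<eta>T_X)
    have lam_le: "lam \<le> 1"
      using X D by (simp add: lam \<eta>T_X ge_one_powr_ge_zero)
    have \<eta>a: "\<eta> * a \<le> 1"
      using \<eta> a by (simp add: a_def pos_less_divide_eq)
    have lam_T: "lam * (\<eta> * real T) = 1"
      using X by (simp add: lam \<eta>T_X)
    have problem: "first_stage_problem Q Ks a cls S\<^sub>K \<rho> M (cls f\<rho>) h\<rho> r R \<eta> lam T c \<nu> A"
      using iii(3) L0
      by (intro first_stage_problem.intro first_stage_problem_axioms.intro source_condition.intro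
          source_condition_axioms.intro reg pop \<eta>a lam_pos lam_le lam_T capacity Y iii iv a c A \<eta>) auto
    have n_lam: "real n * lam powr (2 * r + \<nu>) = M\<^sup>2 / R\<^sup>2"
    proof -
      have "- (2 * r + \<nu>) / (2 * r + \<nu>) = - 1"
        using D by (simp add: minus_divide_left[symmetric] del: minus_add_distrib minus_add_cancel)
      then have "lam powr (2 * r + \<nu>) = 1 / X"
        unfolding lam_powr using X by (simp only:) (simp add: powr_minus_divide)
      then show ?thesis
        using n_pos by (simp add: X_def B_def)
    qed
    have A_lam: "16 * a * c * (A * lam) powr (- (1 + \<nu>)) \<le> \<delta> * real n"
    proof (cases "r = 1 / 2")
      case True
      have "2 * r + \<nu> = 1 + \<nu>"
        using True by simp
      \<comment> \<open>At r = 1/2 the two exponents coincide, so n drops out of the condition on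
        the comparison event and it must come from the choice of A.\<close>
      then have X_eq: "X powr ((1 + \<nu>) / (2 * r + \<nu>)) = X"
        using X iv by (simp only:) simp
      have "(\<eta> * real T) powr (1 + \<nu>) = X"
        using X_eq by (simp add: \<eta>T_X powr_powr)
      then have "w * (ln (24 / \<delta>))\<^sup>2 * (B * real n) \<le> real n"
        using n_large by (simp add: w_def a_def X_def)
      then have \<delta>\<^sub>0: "\<delta>\<^sub>0 \<le> \<delta>"
        unfolding \<delta>\<^sub>0_def using \<delta> B w n_pos by (intro confidence_lower_bound) auto
      have "0 < \<delta>\<^sub>0"
        by (simp add: \<delta>\<^sub>0_def)
      have "16 * a * c * B / \<delta>\<^sub>0 \<le> A"
        using True by (simp add: A_def)
      also have "A \<le> A powr (1 + \<nu>)"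
        using powr_mono[of 1 "1 + \<nu>" A] A iv by simp
      finally have "16 * a * c * B \<le> \<delta>\<^sub>0 * A powr (1 + \<nu>)"
        using \<open>0 < \<delta>\<^sub>0\<close> by (simp add: field_simps)
      also have "\<dots> \<le> \<delta> * A powr (1 + \<nu>)"
        using \<delta>\<^sub>0 by (intro mult_right_mono) auto
      finally have "16 * a * c * B / A powr (1 + \<nu>) \<le> \<delta>"
        using A by (simp add: pos_divide_le_eq)
      then have "16 * a * c * B / A powr (1 + \<nu>) * real n \<le> \<delta> * real n"
        by (rule mult_right_mono) simp
      moreover have "(A * lam) powr (- (1 + \<nu>)) = X / A powr (1 + \<nu>)"
      proof -
        have "lam powr (- (1 + \<nu>)) = X"
          unfolding lam_powr minus_minus by (rule X_eq)
        then show ?thesis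
          by (simp only: powr_mult powr_minus_divide[of A]) simp
      qed
      ultimately show ?thesis
        by (simp add: X_def)
    next
      case False
      then have "1 / 2 < r" "A = 1"
        using iii by (auto simp: A_def)
      then show ?thesis
        using X_r unfolding \<open>A = 1\<close> mult_1 lam_powr[of "- (1 + \<nu>)"] minus_minus by blast
    qed
    have \<Delta>: "2 * a / sqrt (real n * \<delta>) \<le> lam powr r"
    proof -
      have "(2 * a * X powr (r / (2 * r + \<nu>)))\<^sup>2 = 4 * a\<^sup>2 * X powr (2 * r / (2 * r + \<nu>))"
        by (simp add: power_mult_distrib power2_eq_square flip: powr_add add_divide_distrib)
      then have "2 * a * X powr (r / (2 * r + \<nu>)) \<le> sqrt (real n * \<delta>)"
        using X_\<Delta> by (intro real_le_rsqrt) (simp add: mult.commute)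
      then have "2 * a / sqrt (real n * \<delta>) \<le> 1 / X powr (r / (2 * r + \<nu>))"
        using X n_pos \<delta> by (simp add: pos_divide_le_eq pos_le_divide_eq)
      then show ?thesis
        by (simp add: lam_powr powr_minus_divide)
    qed
    define p where "p = (2 * r + 1) / (\<alpha> * (2 * r + \<nu>))"
    have N_X: "ln (real n) powr (2 / \<alpha>) * X powr p \<le> real N"
      using N by (simp add: X_def B_def p_def)
    have X_p: "1 \<le> X powr p"
      using X iii iv ii by (intro ge_one_powr_ge_zero) (auto simp: p_def)
    \<comment> \<open>As 2/\<alpha> \<ge> 1, a logarithm of at least 2 yields N \<ge> 2, which the
      variance argument requires.\<close>
    have ln_powr: "2 \<le> ln (real n) powr (2 / \<alpha>)"
    proof -
      have "(2::real) powr 1 \<le> 2 powr (2 / \<alpha>)"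
        using ii by (intro powr_mono) (auto simp: field_simps)
      also have "\<dots> \<le> ln (real n) powr (2 / \<alpha>)"
        using ln_n ii by (intro powr_mono2) auto
      finally show ?thesis
        by simp
    qed
    have "2 * 1 \<le> ln (real n) powr (2 / \<alpha>) * X powr p"
      using ln_powr X_p by (intro mult_mono) auto
    then have N2: "2 \<le> N"
      using N_X by linarith
    have N_lam: "real N powr (- \<alpha> / 2) \<le> lam powr (r + 1 / 2)"
    proof -
      have "1 * X powr p \<le> ln (real n) powr (2 / \<alpha>) * X powr p"
        using ln_powr by (intro mult_right_mono) auto
      then have "real N powr (- \<alpha> / 2) \<le> (X powr p) powr (- \<alpha> / 2)"
        using N_X X_p ii by (intro powr_mono2') auto
      also have "\<dots> = lam powr (r + 1 / 2)"
      proof -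
        \<comment> \<open>The exponent of the sample size condition is tuned so that N^(-\<alpha>/2)
          becomes \<lambda>^(r + 1/2); the extra 1/2 pays for the factor 1/sqrt \<lambda> of the
          stability bound.\<close>
        have "(2 * r + 1) / (\<alpha> * e) * (- \<alpha> / 2) = - (r + 1 / 2) / e" if "0 < e" for e
          using ii that by (simp add: field_simps)
        from this[OF D] show ?thesis
          unfolding powr_powr lam_powr p_def by simp
      qed
      finally show ?thesis .
    qed
    have stage: "two_stage G evG \<gamma> Y \<rho> n N \<Omega> x y s"
      using G \<gamma> n_pos N2 \<rho>(2) sample
      by (intro two_stage.intro bounded_mercer.intro two_stage_axioms.intro) (auto simp: PK)
    interpret c: two_stage_regression Q Ks a cls S\<^sub>K \<rho> M "cls f\<rho>" h\<rho> r R \<eta> lam T c \<nu> A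
        G evG \<gamma> Y n N \<Omega> x y s L \<alpha> \<delta>
    proof (intro two_stage_regression.intro problem stage two_stage_regression_axioms.intro)
      show "sets Q = sets (restrict_space borel (mean_embeddings G evG))"
        using sets_Q by (simp add: P)
      show "norm (Ks m1 - Ks m2) \<le> L * norm (m1 - m2) powr \<alpha>"
        if "m1 \<in> mean_embeddings G evG" "m2 \<in> mean_embeddings G evG" for m1 m2
        using ii(4) that by (simp add: P)
    qed (use \<gamma> ii \<delta> n_lam A_lam \<Delta> even N_lam in auto)
    have "grad_descent evK Ks \<eta> n (\<lambda>j. empirical_embedding G evG N (\<lambda>i. s j i \<omega>)) (\<lambda>j. y j \<omega>)
      = landweber \<eta> (emp_cov n (\<lambda>j. Ks (c.d.\<mu>' j \<omega>))) (emp_vec n (\<lambda>j. Ks (c.d.\<mu>' j \<omega>)) (\<lambda>j. y j \<omega>))" for \<omega>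
      using Ks_val c.d.\<mu>'_in by (intro ext grad_descent_eq_landweber) (simp add: P)
    then have risk: "(\<lambda>\<omega>. norm (S\<^sub>K (tail_average (grad_descent evK Ks \<eta> n
        (\<lambda>j. empirical_embedding G evG N (\<lambda>i. s j i \<omega>)) (\<lambda>j. y j \<omega>)) T) - cls f\<rho>)) = c.risk"
      by (simp add: c.risk_def[abs_def] c.estimate_def)
    have rate: "ln (24 / \<delta>) * lam powr r * c.risk_const L \<alpha> \<gamma>
      = ?C * ln (24 / \<delta>) * R * (M\<^sup>2 / (R\<^sup>2 * real n)) powr (r / (2 * r + \<nu>))"
    proof -
      have "M\<^sup>2 / (R\<^sup>2 * real n) = 1 / X"
        by (simp add: X_def B_def)
      then have "(M\<^sup>2 / (R\<^sup>2 * real n)) powr (r / (2 * r + \<nu>)) = lam powr r"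
        by (simp add: lam_powr powr_minus powr_divide inverse_eq_divide)
      then show ?thesis
        using iii by simp
    qed
    show "1 - \<delta> \<le> measure \<Omega> {\<omega> \<in> space \<Omega>.
        real_cond_exp \<Omega> (generated_by \<Omega> (first_stage n (\<lambda>j \<omega>. mean_embedding G evG (x j \<omega>)) y)
            (PiM {..<n} (\<lambda>_. restrict_space borel P \<Otimes>\<^sub>M restrict_space borel Y)))
          (\<lambda>\<omega>. norm (S\<^sub>K (tail_average (grad_descent evK Ks \<eta> n
            (\<lambda>j. empirical_embedding G evG N (\<lambda>i. s j i \<omega>)) (\<lambda>j. y j \<omega>)) T) - cls f\<rho>)) \<omega>
        \<le> ?C * ln (24 / \<delta>) * R * (M\<^sup>2 / (R\<^sup>2 * real n)) powr (r / (2 * r + \<nu>))}"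
      unfolding risk rate[symmetric] P by (rule c.risk_bound)
  next
    fix \<delta> :: real assume \<delta>: "0 < \<delta>" "\<delta> \<le> 1"
    show "\<forall>\<^sub>F n in sequentially. ok \<delta> n"
      unfolding ok_def
    proof (intro eventually_conj)
      have "filterlim (\<lambda>n. B * real n) at_top sequentially"
        using B by (intro filterlim_tendsto_pos_mult_at_top[OF tendsto_const _ filterlim_real_sequentially])
      then show "\<forall>\<^sub>F n in sequentially. 1 \<le> B * real n"
        by (simp add: filterlim_at_top)
      have "filterlim (\<lambda>n. ln (real n)) at_top sequentially"
        by (rule filterlim_compose[OF ln_at_top filterlim_real_sequentially])
      then show "\<forall>\<^sub>F n in sequentially. 2 \<le> ln (real n)"
        by (simp add: filterlim_at_top)
      show "\<forall>\<^sub>F n in sequentially. 1 / 2 < r \<longrightarrow>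
          16 * a * c * (B * real n) powr ((1 + \<nu>) / (2 * r + \<nu>)) \<le> \<delta> * real n"
      proof (cases "1 / 2 < r")
        case True
        then show ?thesis
          using eventually_powr_le_linear[of "(1 + \<nu>) / (2 * r + \<nu>)" B \<delta> "16 * a * c"] B \<delta> D
          by (simp add: field_simps)
      qed simp
      show "\<forall>\<^sub>F n in sequentially. 4 * a\<^sup>2 * (B * real n) powr (2 * r / (2 * r + \<nu>)) \<le> \<delta> * real n"
        using B \<delta> D iv by (intro eventually_powr_le_linear) (auto simp: field_simps)
    qed
  qed
qed

end
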